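(* Let $\alpha\ge4$ and $K>0$. For any $\varepsilon\in(0,1)$ there exists a constant $C>0$ depending only on $\alpha$, $K$ and $\varepsilon$ such that, for all integers $n\ge2$ and $p\ge1$, there exists a test of the form $$\phi_{\mathcal{P},\mathrm{adaptive}}=\phi_{\mathcal{P},\mathrm{dense}}\vee\max_{s'\in\mathcal{K}}\phi_{\mathcal{P},\mathrm{sparse},s'},\qquad\mathcal{K}=\{1,2,4,\dots,2^{\lceil\log_2(p)\rceil-1}\},$$ (with component tests of the types described in the context, whose tuning parameters do not depend on the true sparsity $s$) such that for every $s\in[p]$, $$\mathcal{R}_{\mathcal{P}}(\rho,\phi_{\mathcal{P},\mathrm{adaptive}})\le\varepsilon$$ as long as $$\rho^2\ge C\Bigl(\bigl[p^{(2/\alpha)\vee(1/2)}\log\log(8n)\bigr]\wedge\bigl[s(p/s)^{2/\alpha}+\log\log(8n)\bigr]\Bigr).$$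
   Context: Notation: $[m]=\{1,\dots,m\}$; $x\wedge y=\min(x,y)$, $x\vee y=\max(x,y)$; $\log$ is the natural logarithm; $\|v\|_0$ is the number of nonzero entries of $v$; the median of finitely many reals is the usual one (average of the two middle order statistics when their number is even). A maximum of tests over an empty set is $0$. Model: $X=\theta+E\in\mathbb{R}^{p\times n}$, with deterministic $\theta$ and random $E\sim P_e$; $X_t,\theta_t,E_t\in\mathbb{R}^p$ denote the $t$-th columns and $X_t(j)$ the $j$-th entry of $X_t$. $\mathbb{E}_{\theta,P_e}$ is expectation under the law of $X$. Null space: $\Theta_0(p,n)=\{\theta:\exists\mu\in\mathbb{R}^p,\ \theta_t=\mu\ \forall t\in[n]\}$. For $t_0\in[n-1]$, $\Theta^{(t_0)}(p,n,s,\rho)$ is the set of $\theta$ for which there are $\mu_1,\mu_2\in\mathbb{R}^p$ with $\theta_t=\mu_1$ for $t\le t_0$, $\theta_t=\mu_2$ for $t>t_0$, $\|\mu_1-\mu_2\|_0\le s$ and $\frac{t_0(n-t_0)}{n}\|\mu_1-\mu_2\|_2^2\ge\rho^2$. Alternative space: $\Theta(p,n,s,\rho)=\bigcup_{t_0=1}^{n-1}\Theta^{(t_0)}(p,n,s,\rho)$. Noise class: $\mathcal{P}_{\alpha,K}$ is the class of distributions of real random variables $W$ with $\mathbb{E}W=0$, $\mathbb{E}W^2=1$, $\mathbb{E}|W/K|^\alpha\le1$. $\mathcal{P}_{\alpha,K}^{\otimes}$ is the class of joint distributions of $E$ with mutually independent entries, each entry having a (possibly different) distribution in $\mathcal{P}_{\alpha,K}$.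 Worst-case testing error (at sparsity $s$) of a measurable test $\phi:\mathbb{R}^{p\times n}\to\{0,1\}$: $$\mathcal{R}_{\mathcal{P}}(\rho,\phi)=\sup_{P_e\in\mathcal{P}_{\alpha,K}^{\otimes}}\sup_{\theta\in\Theta_0(p,n)}\mathbb{E}_{\theta,P_e}(\phi)+\sup_{P_e\in\mathcal{P}_{\alpha,K}^{\otimes}}\sup_{\theta\in\Theta(p,n,s,\rho)}\mathbb{E}_{\theta,P_e}(1-\phi).$$ Component tests. Let $\mathcal{T}=\{1,2,4,\dots,2^{\lfloor\log_2(n/2)\rfloor}\}$; $Z_i=(X_i-X_{n-i+1})/\sqrt2$ for $i\le n/2$; for $t\in\mathcal{T}\setminus\{1\}$, $Y_{t,1}=t^{-1/2}(\sum_{i=1}^{t/2}X_{2i-1}-\sum_{i=1}^{t/2}X_{n+2-2i})$, $Y_{t,2}=t^{-1/2}(\sum_{i=1}^{t/2}X_{2i}-\sum_{i=1}^{t/2}X_{n+1-2i})$. All tuning parameters below may depend on $n,p,\alpha,K,\varepsilon$ and, for the sparse components, on the index $s'$. (i) $\phi_{\mathcal{P},\mathrm{dense}}=\mathbf{1}\{\max_{t\in\mathcal{T}}A_t^{\mathrm{MoM}}/r_t>1\}$ with thresholds $r_t>0$, where $\{Z_1,\dots,Z_t\}$ is split into $G_t$ groups of equal size with sample means $\overline Z_{t,g}$ and $A_t^{\mathrm{MoM}}=t\cdot\mathrm{median}_{g\in[G_t]}\sum_{j=1}^p(\overline Z_{t,g}^2(j)-G_t/t)$. (ii) $\phi_{\mathcal{P},\mathrm{sparse},s'}=\phi^{\mathrm{RSM}}_{s'}$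 if $p<(\log\log(8n))^{\alpha-2}$ and $\phi_{\mathcal{P},\mathrm{sparse},s'}=\phi^{\mathrm{MoM}}_{s'}$ otherwise, where: $\phi^{\mathrm{MoM}}_{s'}=\mathbf{1}\{\max_{t\in\mathcal{T}}A_{t,a}^{\mathrm{MoM}}/r_{t,s'}>1\}$ with a selection threshold $a$, thresholds $r_{t,s'}$, $A_{1,a}^{\mathrm{MoM}}=\sum_{j=1}^p(Z_1^2(j)-1)\mathbf{1}\{|Z_1(j)|\ge a\}$ and, for $t\ge2$, with $\{Z_1,Z_3,\dots,Z_{t-1}\}$ split into $G_t$ groups of equal size with sample means $\overline Z_{t,g,1}$, $A_{t,a}^{\mathrm{MoM}}=\frac t2\mathrm{median}_{g\in[G_t]}\sum_{j=1}^p(\overline Z_{t,g,1}^2(j)-2G_t/t)\mathbf{1}\{|Y_{t,2}(j)|\ge a\}$; $\phi^{\mathrm{RSM}}_{s'}=\mathbf{1}\{\max_{t\in\mathcal{T},t\le\tilde\Delta_1}A_{t,a}/\tilde r_{t,s'}>1\}\vee\mathbf{1}\{\max_{t\in\mathcal{T},t>\tilde\Delta_1}t\|\hat\mu^{\mathrm{RSM}}_{t,s'}(Z_1,\dots,Z_t;\eta_t)\|_2^2/r^{\mathrm{RSM}}_{t,s'}>1\}$ with tuning parameters $\tilde\Delta_1,a,\tilde r_{t,s'},\eta_t,r^{\mathrm{RSM}}_{t,s'}$, where $A_{1,a}=A_{1,a}^{\mathrm{MoM}}$, $A_{t,a}=\sum_{j=1}^p\{Y_{t,1}^2(j)-1\}\mathbf{1}\{|Y_{t,2}(j)|\ge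 a\}$ for $t\ge2$, and $\hat\mu^{\mathrm{RSM}}$ is a robust sparse mean estimator, i.e. a family of measurable maps such that, for some $B_1,B_2\ge1$ depending only on $\alpha,K$: whenever $W_1,\dots,W_m$ are independent in $\mathbb{R}^p$, each with mean $\mu_W$ and covariance $I_p$, $\|\mu_W\|_0\le s'$, $\mathbb{E}|W_i(j)-\mu_W(j)|^\alpha\le(\sqrt2K)^\alpha$ for all $i,j$, $0<\eta<1$ and $m\ge B_1(s'\log(ep/s')+\log(1/\eta))$, then with probability at least $1-\eta$, $\|\hat\mu^{\mathrm{RSM}}_{m,s'}(W_1,\dots,W_m;\eta)-\mu_W\|_2\le\sqrt{B_2}\bigl(\sqrt{s'\log(ep/s')/m}+\sqrt{\log(1/\eta)/m}\bigr)$. *)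

theory Defs
  imports "HOL-Probability.Probability"
begin

section \<open>Model\<close>

text \<open>A real \<open>p \<times> n\<close> matrix is a function on index pairs \<open>(j, t)\<close> (row \<open>j\<close>, column \<open>t\<close>,
  both counted from 1), undefined outside the index set as usual for \<^const>\<open>PiM\<close>.\<close>

type_synonym mat = "nat \<times> nat \<Rightarrow> real"

definition entries :: "nat \<Rightarrow> nat \<Rightarrow> (nat \<times> nat) set" where
  "entries p n = {1..p} \<times> {1..n}"

definition mat_space :: "nat \<Rightarrow> nat \<Rightarrow> mat measure" where
  "mat_space p n = PiM (entries p n) (\<lambda>_. borel)"

definition vec_space :: "nat \<Rightarrow> (nat \<Rightarrow> real) measure" where
  "vec_space p = PiM {1..p} (\<lambda>_. borel)"

definition col :: "nat \<Rightarrow> mat \<Rightarrow> nat \<Rightarrow> nat \<Rightarrow> real" where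
  "col p X t = (\<lambda>j\<in>{1..p}. X (j, t))"

definition norm0 :: "nat \<Rightarrow> (nat \<Rightarrow> real) \<Rightarrow> nat" where
  "norm0 p v = card {j \<in> {1..p}. v j \<noteq> 0}"

definition sqnorm :: "nat \<Rightarrow> (nat \<Rightarrow> real) \<Rightarrow> real" where
  "sqnorm p v = (\<Sum>j = 1..p. (v j)\<^sup>2)"

definition Theta0 :: "nat \<Rightarrow> nat \<Rightarrow> mat set" where
  "Theta0 p n = {\<theta> \<in> space (mat_space p n).
     \<exists>\<mu> :: nat \<Rightarrow> real. \<forall>t\<in>{1..n}. \<forall>j\<in>{1..p}. \<theta> (j, t) = \<mu> j}"

definition Theta_at :: "nat \<Rightarrow> nat \<Rightarrow> nat \<Rightarrow> nat \<Rightarrow> real \<Rightarrow> mat set" where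
  "Theta_at t0 p n s \<rho> = {\<theta> \<in> space (mat_space p n).
     \<exists>\<mu>1 \<mu>2 :: nat \<Rightarrow> real.
       (\<forall>t\<in>{1..n}. \<forall>j\<in>{1..p}. \<theta> (j, t) = (if t \<le> t0 then \<mu>1 j else \<mu>2 j)) \<and>
       norm0 p (\<lambda>j. \<mu>1 j - \<mu>2 j) \<le> s \<and>
       real t0 * (real n - real t0) / real n * sqnorm p (\<lambda>j. \<mu>1 j - \<mu>2 j) \<ge> \<rho>\<^sup>2}"

definition Theta :: "nat \<Rightarrow> nat \<Rightarrow> nat \<Rightarrow> real \<Rightarrow> mat set" where
  "Theta p n s \<rho> = (\<Union>t0\<in>{1..n - 1}. Theta_at t0 p n s \<rho>)"

text \<open>\<^const>\<open>has_bochner_integral\<close> states integrability together with the value, so that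
  non-integrable variables are not admitted through the default value 0 of the integral.\<close>

definition noise_dist :: "real \<Rightarrow> real \<Rightarrow> real measure set" where
  "noise_dist \<alpha> K = {D. prob_space D \<and> sets D = sets borel \<and>
     has_bochner_integral D (\<lambda>w. w) 0 \<and>
     has_bochner_integral D (\<lambda>w. w\<^sup>2) 1 \<and>
     integrable D (\<lambda>w. \<bar>w / K\<bar> powr \<alpha>) \<and> (\<integral>w. \<bar>w / K\<bar> powr \<alpha> \<partial>D) \<le> 1}"

definition noise_laws :: "real \<Rightarrow> real \<Rightarrow> nat \<Rightarrow> nat \<Rightarrow> mat measure set" where
  "noise_laws \<alpha> K p n = {P. prob_space P \<and> sets P = sets (mat_space p n) \<and>
     prob_space.indep_vars P (\<lambda>_. borel) (\<lambda>i E. E i) (entries p n) \<and>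
     (\<forall>i\<in>entries p n. distr P borel (\<lambda>E. E i) \<in> noise_dist \<alpha> K)}"

definition data_law :: "nat \<Rightarrow> nat \<Rightarrow> mat \<Rightarrow> mat measure \<Rightarrow> mat measure" where
  "data_law p n \<theta> P = distr P (mat_space p n) (\<lambda>E. \<lambda>i\<in>entries p n. \<theta> i + E i)"

definition is_test :: "nat \<Rightarrow> nat \<Rightarrow> (mat \<Rightarrow> real) \<Rightarrow> bool" where
  "is_test p n \<phi> \<longleftrightarrow>
     \<phi> \<in> borel_measurable (mat_space p n) \<and> (\<forall>X\<in>space (mat_space p n). \<phi> X \<in> {0, 1})"

text \<open>Values in \<^typ>\<open>ennreal\<close> make the suprema total; the supremum over an empty noise class
  (which occurs for \<open>K < 1\<close>) is 0.\<close>

definition risk :: "real \<Rightarrow> real \<Rightarrow> nat \<Rightarrow> nat \<Rightarrow> nat \<Rightarrow> real \<Rightarrow> (mat \<Rightarrow> real) \<Rightarrow> ennreal" where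
  "risk \<alpha> K p n s \<rho> \<phi> =
     (SUP P\<in>noise_laws \<alpha> K p n. SUP \<theta>\<in>Theta0 p n.
        \<integral>\<^sup>+ X. ennreal (\<phi> X) \<partial>data_law p n \<theta> P) +
     (SUP P\<in>noise_laws \<alpha> K p n. SUP \<theta>\<in>Theta p n s \<rho>.
        \<integral>\<^sup>+ X. ennreal (1 - \<phi> X) \<partial>data_law p n \<theta> P)"

section \<open>Statistics\<close>

definition scales :: "nat \<Rightarrow> nat set" where
  "scales n = {2 ^ k | k :: nat. int k \<le> \<lfloor>log 2 (real n / 2)\<rfloor>}"

text \<open>Empty for \<open>p = 1\<close>.\<close>

definition sparsity_grid :: "nat \<Rightarrow> nat set" where
  "sparsity_grid p = {2 ^ k | k :: nat. int k \<le> \<lceil>log 2 (real p)\<rceil> - 1}"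

definition Zst :: "nat \<Rightarrow> mat \<Rightarrow> nat \<Rightarrow> nat \<Rightarrow> real" where
  "Zst n X i j = (X (j, i) - X (j, n - i + 1)) / sqrt 2"

definition Y1 :: "nat \<Rightarrow> mat \<Rightarrow> nat \<Rightarrow> nat \<Rightarrow> real" where
  "Y1 n X t j =
     ((\<Sum>i = 1..t div 2. X (j, 2 * i - 1)) - (\<Sum>i = 1..t div 2. X (j, n + 2 - 2 * i)))
       / sqrt (real t)"

definition Y2 :: "nat \<Rightarrow> mat \<Rightarrow> nat \<Rightarrow> nat \<Rightarrow> real" where
  "Y2 n X t j =
     ((\<Sum>i = 1..t div 2. X (j, 2 * i)) - (\<Sum>i = 1..t div 2. X (j, n + 1 - 2 * i)))
       / sqrt (real t)"

text \<open>\<open>median G f\<close> is the median of \<open>f 1, \<dots>, f G\<close> (for \<open>G \<ge> 1\<close>).\<close>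

definition median :: "nat \<Rightarrow> (nat \<Rightarrow> real) \<Rightarrow> real" where
  "median G f = (let xs = sort (map f [1..<Suc G]) in
     if odd G then xs ! (G div 2) else (xs ! (G div 2 - 1) + xs ! (G div 2)) / 2)"

definition equal_split :: "nat set \<Rightarrow> nat \<Rightarrow> (nat \<Rightarrow> nat set) \<Rightarrow> bool" where
  "equal_split A G B \<longleftrightarrow> G \<ge> 1 \<and> (\<Union>g\<in>{1..G}. B g) = A \<and> disjoint_family_on B {1..G} \<and>
     (\<forall>g\<in>{1..G}. G * card (B g) = card A)"

definition group_mean :: "nat \<Rightarrow> mat \<Rightarrow> nat set \<Rightarrow> nat \<Rightarrow> real" where
  "group_mean n X S j = (\<Sum>i\<in>S. Zst n X i j) / real (card S)"

definition A_dense :: "nat \<Rightarrow> nat \<Rightarrow> nat \<Rightarrow> (nat \<Rightarrow> nat set) \<Rightarrow> nat \<Rightarrow> mat \<Rightarrow> real" where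
  "A_dense p n G B t X = real t *
     median G (\<lambda>g. \<Sum>j = 1..p. ((group_mean n X (B g) j)\<^sup>2 - real G / real t))"

definition A_one :: "nat \<Rightarrow> nat \<Rightarrow> real \<Rightarrow> mat \<Rightarrow> real" where
  "A_one p n a X = (\<Sum>j = 1..p. ((Zst n X 1 j)\<^sup>2 - 1) * of_bool (\<bar>Zst n X 1 j\<bar> \<ge> a))"

definition A_mom :: "nat \<Rightarrow> nat \<Rightarrow> real \<Rightarrow> nat \<Rightarrow> (nat \<Rightarrow> nat set) \<Rightarrow> nat \<Rightarrow> mat \<Rightarrow> real" where
  "A_mom p n a G B t X = (if t = 1 then A_one p n a X else
     real t / 2 * median G (\<lambda>g. \<Sum>j = 1..p.
       ((group_mean n X (B g) j)\<^sup>2 - 2 * real G / real t) * of_bool (\<bar>Y2 n X t j\<bar> \<ge> a)))"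

definition A_split :: "nat \<Rightarrow> nat \<Rightarrow> real \<Rightarrow> nat \<Rightarrow> mat \<Rightarrow> real" where
  "A_split p n a t X = (if t = 1 then A_one p n a X else
     (\<Sum>j = 1..p. ((Y1 n X t j)\<^sup>2 - 1) * of_bool (\<bar>Y2 n X t j\<bar> \<ge> a)))"

section \<open>Robust sparse mean estimation\<close>

text \<open>\<open>\<mu>h p m s \<eta>\<close> maps a \<open>p \<times> m\<close> matrix, whose columns are the sample \<open>W\<^sub>1, \<dots>, W\<^sub>m\<close>, to a
  vector. The sample enters only through its joint law \<open>Q\<close>, so \<open>W\<^sub>i\<close> is taken to be the
  \<open>i\<close>-th column on the canonical space. The bounds \<open>B1\<close>, \<open>B2\<close> are uniform in all indices of
  the family.\<close>

definition rsm_sample ::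
    "real \<Rightarrow> real \<Rightarrow> nat \<Rightarrow> nat \<Rightarrow> nat \<Rightarrow> (nat \<Rightarrow> real) \<Rightarrow> mat measure \<Rightarrow> bool" where
  "rsm_sample \<alpha> K p m s \<mu> Q \<longleftrightarrow>
     prob_space Q \<and> sets Q = sets (mat_space p m) \<and>
     prob_space.indep_vars Q (\<lambda>_. vec_space p) (\<lambda>i W. col p W i) {1..m} \<and>
     norm0 p \<mu> \<le> s \<and>
     (\<forall>i\<in>{1..m}. \<forall>j\<in>{1..p}.
        has_bochner_integral Q (\<lambda>W. W (j, i)) (\<mu> j) \<and>
        (\<forall>k\<in>{1..p}. has_bochner_integral Q
           (\<lambda>W. (W (j, i) - \<mu> j) * (W (k, i) - \<mu> k)) (of_bool (j = k))) \<and>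
        integrable Q (\<lambda>W. \<bar>W (j, i) - \<mu> j\<bar> powr \<alpha>) \<and>
        (\<integral>W. \<bar>W (j, i) - \<mu> j\<bar> powr \<alpha> \<partial>Q) \<le> (sqrt 2 * K) powr \<alpha>)"

definition robust_sparse_mean ::
    "real \<Rightarrow> real \<Rightarrow> (nat \<Rightarrow> nat \<Rightarrow> nat \<Rightarrow> real \<Rightarrow> mat \<Rightarrow> nat \<Rightarrow> real) \<Rightarrow> bool" where
  "robust_sparse_mean \<alpha> K \<mu>h \<longleftrightarrow>
     (\<forall>p\<ge>1. \<forall>m. \<forall>s\<in>{1..p}. \<forall>\<eta>. 0 < \<eta> \<and> \<eta> < 1 \<longrightarrow>
        \<mu>h p m s \<eta> \<in> measurable (mat_space p m) (vec_space p)) \<and>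
     (\<exists>B1\<ge>1. \<exists>B2\<ge>1. \<forall>p\<ge>1. \<forall>m. \<forall>s\<in>{1..p}. \<forall>\<eta> \<mu> Q.
        0 < \<eta> \<and> \<eta> < 1 \<and> rsm_sample \<alpha> K p m s \<mu> Q \<and>
        real m \<ge> B1 * (real s * ln (exp 1 * real p / real s) + ln (1 / \<eta>)) \<longrightarrow>
        measure Q {W \<in> space Q. sqrt (sqnorm p (\<lambda>j. \<mu>h p m s \<eta> W j - \<mu> j))
            \<le> sqrt B2 * (sqrt (real s * ln (exp 1 * real p / real s) / real m)
                        + sqrt (ln (1 / \<eta>) / real m))} \<ge> 1 - \<eta>)"

section \<open>Tests\<close>

text \<open>A maximum over a finite set of scales exceeds 1 iff one of its members does; with this
  reading a maximum over an empty set of scales never rejects.\<close>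

definition scan :: "nat set \<Rightarrow> (nat \<Rightarrow> mat \<Rightarrow> real) \<Rightarrow> (nat \<Rightarrow> real) \<Rightarrow> mat \<Rightarrow> real" where
  "scan S A r X = of_bool (\<exists>t\<in>S. A t X / r t > 1)"

definition dense_tests :: "nat \<Rightarrow> nat \<Rightarrow> (mat \<Rightarrow> real) set" where
  "dense_tests p n = {scan (scales n) (\<lambda>t. A_dense p n (G t) (B t) t) r | G B r.
     \<forall>t\<in>scales n. equal_split {1..t} (G t) (B t) \<and> r t > 0}"

definition mom_tests :: "nat \<Rightarrow> nat \<Rightarrow> (mat \<Rightarrow> real) set" where
  "mom_tests p n = {scan (scales n) (\<lambda>t. A_mom p n a (G t) (B t) t) r | a G B r.
     \<forall>t\<in>scales n. (t \<noteq> 1 \<longrightarrow> equal_split {i \<in> {1..t}. odd i} (G t) (B t)) \<and> r t > 0}"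

text \<open>The estimator is applied to the \<open>p \<times> t\<close> matrix with columns \<open>Z\<^sub>1, \<dots>, Z\<^sub>t\<close>.\<close>

definition rsm_stat ::
    "(nat \<Rightarrow> nat \<Rightarrow> nat \<Rightarrow> real \<Rightarrow> mat \<Rightarrow> nat \<Rightarrow> real) \<Rightarrow> nat \<Rightarrow> nat \<Rightarrow> nat \<Rightarrow> real \<Rightarrow> nat \<Rightarrow> mat \<Rightarrow> real"
  where
  "rsm_stat \<mu>h p n s \<eta> t X =
     real t * sqnorm p (\<mu>h p t s \<eta> (\<lambda>(j, i)\<in>entries p t. Zst n X i j))"

definition rsm_tests ::
    "(nat \<Rightarrow> nat \<Rightarrow> nat \<Rightarrow> real \<Rightarrow> mat \<Rightarrow> nat \<Rightarrow> real) \<Rightarrow> nat \<Rightarrow> nat \<Rightarrow> nat \<Rightarrow> (mat \<Rightarrow> real) set" where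
  "rsm_tests \<mu>h p n s =
     {\<lambda>X. max (scan {t \<in> scales n. real t \<le> \<Delta>} (A_split p n a) r X)
              (scan {t \<in> scales n. real t > \<Delta>} (\<lambda>t. rsm_stat \<mu>h p n s (\<eta> t) t) r' X)
      | \<Delta> a r \<eta> r'. \<forall>t\<in>scales n. r t > 0 \<and> r' t > 0 \<and> 0 < \<eta> t \<and> \<eta> t < 1}"

definition sparse_tests ::
    "real \<Rightarrow> (nat \<Rightarrow> nat \<Rightarrow> nat \<Rightarrow> real \<Rightarrow> mat \<Rightarrow> nat \<Rightarrow> real) \<Rightarrow> nat \<Rightarrow> nat \<Rightarrow> nat \<Rightarrow> (mat \<Rightarrow> real) set"
  where
  "sparse_tests \<alpha> \<mu>h p n s =
     (if real p < ln (ln (8 * real n)) powr (\<alpha> - 2) then rsm_tests \<mu>h p n s else mom_tests p n)"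

definition adaptive_tests ::
    "real \<Rightarrow> (nat \<Rightarrow> nat \<Rightarrow> nat \<Rightarrow> real \<Rightarrow> mat \<Rightarrow> nat \<Rightarrow> real) \<Rightarrow> nat \<Rightarrow> nat \<Rightarrow> (mat \<Rightarrow> real) set" where
  "adaptive_tests \<alpha> \<mu>h p n =
     {\<lambda>X. max (\<phi>d X) (Max (insert 0 ((\<lambda>s'. \<phi>s s' X) ` sparsity_grid p))) | \<phi>d \<phi>s.
        \<phi>d \<in> dense_tests p n \<and> (\<forall>s'\<in>sparsity_grid p. \<phi>s s' \<in> sparse_tests \<alpha> \<mu>h p n s')}"

end

theory Submission
  imports Defs
begin

text \<open>Every statistic depends on the data only through \<open>Z\<^sub>i = d + \<xi>\<^sub>i\<close>, \<open>i \<le> n / 2\<close>, where the symmetrized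
  noise \<open>\<xi>\<^sub>i\<close> has independent standardized entries with bounded \<open>\<alpha>\<close>-th moments; at the scale \<open>t\<close> below
  the distance of the change point from the boundary, the signal energy \<open>t |d|\<^sup>2\<close> is at least \<open>\<rho>\<^sup>2 / 4\<close>.
  Group statistics are controlled by Chebyshev's inequality, and their median by counting bad groups,
  which gives failure probability \<open>4\<close> to the power minus the number of groups. With about \<open>log log n + 1 / \<epsilon>\<close>
  groups this survives a union bound over the \<open>O(log n)\<close> scales, while the few scales too short for that
  many groups are handled by Chebyshev alone.
  In the sparse tests the odd half of the sample is evaluated on coordinates selected by the even half,
  at a threshold \<open>a\<close> with \<open>a\<^sup>2\<close> of order \<open>(p / s) powr (2 / \<alpha>) + log log n / s\<close>. A Fuk--Nagaev inequality bounds the number of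
  falsely selected coordinates by \<open>s\<close>. When \<open>p\<close> is too small compared with \<open>log log n\<close> for the median to
  reach the rate, a robust sparse mean estimator replaces it at the large scales; it is obtained
  by median-of-means tests along a finite net of sparse directions.
  The errors of the sparse tests decay like \<open>1 / sqrt s\<close> and hence are summable over the dyadic sparsity grid.\<close>

section \<open>Medians and counting\<close>

text \<open>The power tail \<open>a powr - \<alpha>\<close> of a selecting average is what produces
  the rate: it keeps the expected number of false selections of order \<open>s\<close>. An
  expectation alone is too weak for a union over about \<open>ln n\<close> scales. Up to
  \<open>\<Delta>\<close> this does no harm, since the number of scales is logarithmic in
  \<open>s * u\<close> while Chebyshev's inequality fails with probability of order
  \<open>s / (s * u)^2\<close>. Beyond \<open>\<Delta>\<close> the count itself must stay below
  \<open>s\<close> with probability near one; this comes from independence across coordinates and a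
  Gaussian tail whose heavy term is inverse in the scale. With \<open>G\<close> groups the
  detectable energy is of order \<open>G * sqrt s\<close>. It stays below the sparse rate only if
  \<open>L <= sqrt s * u\<close>, which follows from \<open>p >= L powr (\<alpha> - 2)\<close> and
  \<open>\<alpha> >= 4\<close>. For smaller \<open>p\<close> the mean estimator helps because it
  pays for \<open>L\<close> additively. The grid matches the true sparsity only up to a factor two.
  Hence all bounds under the alternative are proved for \<open>2 * s\<close> nonzero entries, and
  the estimator is built to accept means of that sparsity.\<close>

lemma sort_nth_le_iff:
  fixes xs :: "'a::linorder list"
  assumes "k < length xs"
  shows "sort xs ! k \<le> x \<longleftrightarrow> k < length (filter (\<lambda>y. y \<le> x) xs)"
proof -
  define ys where "ys = sort xs"
  have len: "length (filter (\<lambda>y. y \<le> x) xs) = card {i. i < length ys \<and> ys ! i \<le> x}"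
  proof -
    have "card {i. i < length ys \<and> ys ! i \<le> x} = length (filter (\<lambda>y. y \<le> x) ys)"
      by (rule length_filter_conv_card[symmetric])
    thus ?thesis by (simp add: ys_def filter_sort)
  qed
  have sorted: "ys ! i \<le> ys ! j" if "i \<le> j" "j < length ys" for i j
    using that unfolding ys_def by (simp add: sorted_nth_mono)
  have k: "k < length ys" using assms by (simp add: ys_def)
  show ?thesis
  proof
    assume "sort xs ! k \<le> x"
    hence "{..k} \<subseteq> {i. i < length ys \<and> ys ! i \<le> x}"
      using sorted k by (fastforce simp: ys_def)
    hence "card {..k} \<le> card {i. i < length ys \<and> ys ! i \<le> x}"
      by (intro card_mono) auto
    thus "k < length (filter (\<lambda>y. y \<le> x) xs)" by (simp add: len)
  next
    assume less: "k < length (filter (\<lambda>y. y \<le> x) xs)"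
    show "sort xs ! k \<le> x"
    proof (rule ccontr)
      assume "\<not> sort xs ! k \<le> x"
      hence gt: "ys ! k > x" by (simp add: ys_def)
      have "{i. i < length ys \<and> ys ! i \<le> x} \<subseteq> {..<k}"
        using sorted gt by (force simp: not_less[symmetric])
      hence "card {i. i < length ys \<and> ys ! i \<le> x} \<le> card {..<k}"
        by (intro card_mono) auto
      thus False using less by (simp add: len)
    qed
  qed
qed

lemma sort_map_nth_le_iff:
  fixes f :: "nat \<Rightarrow> real"
  assumes "k < G"
  shows "sort (map f [1..<Suc G]) ! k \<le> x \<longleftrightarrow> k < card {g \<in> {1..G}. f g \<le> x}"
proof -
  have "length (filter (\<lambda>y. y \<le> x) (map f [1..<Suc G])) = length (filter (\<lambda>g. f g \<le> x) [1..<Suc G])"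
    by (simp add: filter_map o_def del: upt_Suc)
  also have "\<dots> = card (set (filter (\<lambda>g. f g \<le> x) [1..<Suc G]))"
    by (rule distinct_card[symmetric]) (simp del: upt_Suc)
  also have "set (filter (\<lambda>g. f g \<le> x) [1..<Suc G]) = {g \<in> {1..G}. f g \<le> x}"
    by (auto simp del: upt_Suc)
  finally show ?thesis
    using sort_nth_le_iff[of k "map f [1..<Suc G]" x] assms by (simp del: upt_Suc)
qed

text \<open>The upper of the two middle order statistics dominates the median in either parity, so
  at most \<open>G div 2\<close> of the values can be \<open>\<le> x\<close>.
  \<open>median_le_card\<close> is the mirror image with the lower one. Both give a non-strict half,
  because an even \<open>G\<close> allows a tie.\<close>

lemma median_gt_card:
  assumes G: "G \<ge> 1" and gt: "median G f > x"
  shows "G \<le> 2 * card {g \<in> {1..G}. f g > x}"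
proof -
  define ys where "ys = sort (map f [1..<Suc G])"
  have "ys ! (G div 2 - 1) \<le> ys ! (G div 2)"
    unfolding ys_def by (rule sorted_nth_mono) (use G in \<open>auto simp del: upt_Suc\<close>)
  hence "ys ! (G div 2) > x"
    using gt by (auto simp: median_def Let_def ys_def simp del: upt_Suc split: if_splits)
  hence "\<not> G div 2 < card {g \<in> {1..G}. f g \<le> x}"
    using sort_map_nth_le_iff[of "G div 2" G f x] G by (simp add: ys_def del: upt_Suc)
  moreover have "card {g \<in> {1..G}. f g \<le> x} + card {g \<in> {1..G}. f g > x} = card {1..G}"
  proof -
    have "{1..G} = {g \<in> {1..G}. f g \<le> x} \<union> {g \<in> {1..G}. f g > x}" by auto
    also have "card \<dots> = card {g \<in> {1..G}. f g \<le> x} + card {g \<in> {1..G}. f g > x}"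
      by (rule card_Un_disjoint) auto
    finally show ?thesis by simp
  qed
  ultimately show ?thesis by simp
qed

lemma median_le_card:
  assumes G: "G \<ge> 1" and le: "median G f \<le> x"
  shows "G \<le> 2 * card {g \<in> {1..G}. f g \<le> x}"
proof -
  define ys where "ys = sort (map f [1..<Suc G])"
  have mono: "ys ! (G div 2 - 1) \<le> ys ! (G div 2)"
    unfolding ys_def by (rule sorted_nth_mono) (use G in \<open>auto simp del: upt_Suc\<close>)
  show ?thesis
  proof (cases "odd G")
    case True
    hence "ys ! (G div 2) \<le> x" using le by (simp add: median_def Let_def ys_def)
    hence "G div 2 < card {g \<in> {1..G}. f g \<le> x}"
      using sort_map_nth_le_iff[of "G div 2" G f x] G by (simp add: ys_def del: upt_Suc)
    thus ?thesis by linarith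
  next
    case False
    hence G2: "G \<ge> 2" using G by (cases "G = 1") auto
    have "ys ! (G div 2 - 1) \<le> x"
      using le mono False by (simp add: median_def Let_def ys_def del: upt_Suc)
    hence "G div 2 - 1 < card {g \<in> {1..G}. f g \<le> x}"
      using sort_map_nth_le_iff[of "G div 2 - 1" G f x] G2 by (simp add: ys_def del: upt_Suc)
    with False show ?thesis by (auto elim!: evenE)
  qed
qed

lemma median_one [simp]: "median (Suc 0) f = f 1"
  by (simp add: median_def)

lemma median_cong: "(\<And>g. g \<in> {1..G} \<Longrightarrow> f g = f' g) \<Longrightarrow> median G f = median G f'"
proof -
  assume "\<And>g. g \<in> {1..G} \<Longrightarrow> f g = f' g"
  hence "map f [1..<Suc G] = map f' [1..<Suc G]" by (intro map_cong) auto
  thus ?thesis by (simp only: median_def)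
qed

text \<open>An order statistic is at most \<open>x\<close> iff sufficiently many values are, and
  this count is a finite sum of indicators; no measurability of sorting is involved.\<close>

lemma borel_measurable_median [measurable (raw)]:
  assumes [measurable]: "\<And>g. f g \<in> borel_measurable M" and G: "G \<ge> 1"
  shows "(\<lambda>\<omega>. median G (\<lambda>g. f g \<omega>)) \<in> borel_measurable M"
proof -
  have meas: "(\<lambda>\<omega>. sort (map (\<lambda>g. f g \<omega>) [1..<Suc G]) ! k) \<in> borel_measurable M" if "k < G" for k
    unfolding borel_measurable_iff_le
  proof
    fix x
    have "{\<omega> \<in> space M. sort (map (\<lambda>g. f g \<omega>) [1..<Suc G]) ! k \<le> x}
        = {\<omega> \<in> space M. k < card {g \<in> {1..G}. f g \<omega> \<le> x}}"
      using sort_map_nth_le_iff[OF that] by (simp del: upt_Suc)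
    also have "\<dots> = {\<omega> \<in> space M. real k < (\<Sum>g\<in>{1..G}. of_bool (f g \<omega> \<le> x))}"
      by (simp add: sum_of_bool_eq Int_def conj_commute)
    also have "\<dots> \<in> sets M" by measurable
    finally show "{\<omega> \<in> space M. sort (map (\<lambda>g. f g \<omega>) [1..<Suc G]) ! k \<le> x} \<in> sets M" .
  qed
  have half: "G div 2 < G" "G div 2 - 1 < G" using G by auto
  show ?thesis
  proof (cases "odd G")
    case True
    thus ?thesis using meas half by (simp add: median_def Let_def del: upt_Suc)
  next
    case False
    have "(\<lambda>\<omega>. (sort (map (\<lambda>g. f g \<omega>) [1..<Suc G]) ! (G div 2 - 1)
        + sort (map (\<lambda>g. f g \<omega>) [1..<Suc G]) ! (G div 2)) / 2) \<in> borel_measurable M"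
      using meas[OF half(1)] meas[OF half(2)] by (intro borel_measurable_divide borel_measurable_add) simp_all
    thus ?thesis using False by (simp add: median_def Let_def del: upt_Suc)
  qed
qed

text \<open>If \<open>k\<close> events occur, then all events of some \<open>k\<close>-subset occur:
  a union bound over these subsets, with independence inside each. \<open>k = 0\<close> is set apart
  because \<open>indep_events\<close> speaks of nonempty subfamilies.\<close>

lemma (in prob_space) indep_events_count:
  assumes fin: "finite J" and ind: "indep_events (\<lambda>j. {\<omega> \<in> space M. P j \<omega>}) J"
    and q: "\<And>j. j \<in> J \<Longrightarrow> prob {\<omega> \<in> space M. P j \<omega>} \<le> q"
  shows "prob {\<omega> \<in> space M. k \<le> card {j \<in> J. P j \<omega>}} \<le> real (card J choose k) * q ^ k"
proof (cases "k = 0")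
  case True
  thus ?thesis by simp
next
  case False
  define T where "T = {U. U \<subseteq> J \<and> card U = k}"
  have finT: "finite T" using fin by (simp add: T_def)
  have ev: "{\<omega> \<in> space M. P j \<omega>} \<in> events" if "j \<in> J" for j
    using ind that by (auto simp: indep_events_def)
  have bound: "prob (\<Inter>j\<in>U. {\<omega> \<in> space M. P j \<omega>}) \<le> q ^ k"
    and evU: "(\<Inter>j\<in>U. {\<omega> \<in> space M. P j \<omega>}) \<in> events" if "U \<in> T" for U
  proof -
    have U: "U \<subseteq> J" "card U = k" "finite U" "U \<noteq> {}"
      using that False fin by (auto simp: T_def intro: finite_subset)
    have "prob (\<Inter>j\<in>U. {\<omega> \<in> space M. P j \<omega>}) = (\<Prod>j\<in>U. prob {\<omega> \<in> space M. P j \<omega>})"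
      using ind U unfolding indep_events_def by blast
    also have "\<dots> \<le> (\<Prod>j\<in>U. q)" using q U by (intro prod_mono) auto
    finally show "prob (\<Inter>j\<in>U. {\<omega> \<in> space M. P j \<omega>}) \<le> q ^ k" by (simp add: U)
    show "(\<Inter>j\<in>U. {\<omega> \<in> space M. P j \<omega>}) \<in> events"
      using U ev by (intro sets.finite_INT) auto
  qed
  have "{\<omega> \<in> space M. k \<le> card {j \<in> J. P j \<omega>}} \<subseteq> (\<Union>U\<in>T. \<Inter>j\<in>U. {\<omega> \<in> space M. P j \<omega>})"
  proof
    fix \<omega> assume *: "\<omega> \<in> {\<omega> \<in> space M. k \<le> card {j \<in> J. P j \<omega>}}"
    then obtain U where "U \<subseteq> {j \<in> J. P j \<omega>}" "card U = k"
      using obtain_subset_with_card_n by (metis (no_types, lifting) mem_Collect_eq)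
    thus "\<omega> \<in> (\<Union>U\<in>T. \<Inter>j\<in>U. {\<omega> \<in> space M. P j \<omega>})"
      using * by (auto simp: T_def intro!: bexI[of _ U])
  qed
  hence "prob {\<omega> \<in> space M. k \<le> card {j \<in> J. P j \<omega>}}
      \<le> prob (\<Union>U\<in>T. \<Inter>j\<in>U. {\<omega> \<in> space M. P j \<omega>})"
    using evU finT by (intro finite_measure_mono) auto
  also have "\<dots> \<le> (\<Sum>U\<in>T. prob (\<Inter>j\<in>U. {\<omega> \<in> space M. P j \<omega>}))"
    using finT evU by (intro finite_measure_subadditive_finite) auto
  also have "\<dots> \<le> (\<Sum>U\<in>T. q ^ k)" by (intro sum_mono bound)
  also have "\<dots> = real (card J choose k) * q ^ k"
    using n_subsets[OF fin, of k] by (simp add: T_def)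
  finally show ?thesis .
qed

text \<open>With \<open>k\<close> the half of \<open>G\<close> rounded up there are at most
  \<open>2 ^ G\<close> subsets to consider, and \<open>2 * k >= G\<close> gives
  \<open>(c^2) ^ k <= c ^ G\<close>. Assuming the bound as a square keeps both parities in one
  formula.\<close>

lemma (in prob_space) indep_events_majority:
  assumes G: "G \<ge> 1" and ind: "indep_events (\<lambda>g. {\<omega> \<in> space M. P g \<omega>}) {1..G::nat}"
    and q: "\<And>g. g \<in> {1..G} \<Longrightarrow> prob {\<omega> \<in> space M. P g \<omega>} \<le> c\<^sup>2" and c: "0 \<le> c" "c \<le> 1"
  shows "prob {\<omega> \<in> space M. G \<le> 2 * card {g \<in> {1..G}. P g \<omega>}} \<le> (2 * c) ^ G"
proof -
  define k where "k = (G + 1) div 2"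
  have "{\<omega> \<in> space M. G \<le> 2 * card {g \<in> {1..G}. P g \<omega>}} = {\<omega> \<in> space M. k \<le> card {g \<in> {1..G}. P g \<omega>}}"
    by (auto simp: k_def)
  also have "prob \<dots> \<le> real (card {1..G} choose k) * (c\<^sup>2) ^ k"
    by (intro indep_events_count ind q) auto
  also have "\<dots> \<le> 2 ^ G * c ^ G"
  proof (intro mult_mono)
    show "real (card {1..G} choose k) \<le> 2 ^ G"
    proof -
      have "real (G choose k) \<le> real (2 ^ G)" by (simp only: of_nat_le_iff binomial_le_pow2)
      thus ?thesis by simp
    qed
    show "(c\<^sup>2) ^ k \<le> c ^ G"
      unfolding power_mult[symmetric] by (intro power_decreasing) (use c in \<open>auto simp: k_def\<close>)
  qed (use c in auto)
  also have "\<dots> = (2 * c) ^ G" by (simp add: power_mult_distrib)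
  finally show ?thesis .
qed

section \<open>Sums of independent standardized variables\<close>

context prob_space
begin

text \<open>Stated for a bare predicate: monotonicity of the measure only asks the larger event
  \<open>c <= u\<close> to be measurable, which spares a measurability proof for \<open>P\<close> at
  each use.\<close>

lemma prob_le_markov:
  fixes u :: "'a \<Rightarrow> real"
  assumes "integrable M u" "\<And>\<omega>. \<omega> \<in> space M \<Longrightarrow> 0 \<le> u \<omega>" "0 < c"
    and "\<And>\<omega>. \<omega> \<in> space M \<Longrightarrow> P \<omega> \<Longrightarrow> c \<le> u \<omega>"
  shows "prob {\<omega> \<in> space M. P \<omega>} \<le> expectation u / c"
proof -
  have [measurable]: "u \<in> borel_measurable M" using assms(1) by simp
  have "prob {\<omega> \<in> space M. P \<omega>} \<le> prob {\<omega> \<in> space M. c \<le> u \<omega>}"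
    by (rule finite_measure_mono) (use assms(4) in auto)
  also have "\<dots> \<le> expectation u / c"
    by (rule integral_Markov_inequality_measure[where A = "{}"]) (use assms in auto)
  finally show ?thesis .
qed

lemma prob_le_markov_square:
  fixes u :: "'a \<Rightarrow> real"
  assumes "integrable M (\<lambda>\<omega>. (u \<omega>)\<^sup>2)" "0 < c"
    and "\<And>\<omega>. \<omega> \<in> space M \<Longrightarrow> P \<omega> \<Longrightarrow> c \<le> \<bar>u \<omega>\<bar>"
  shows "prob {\<omega> \<in> space M. P \<omega>} \<le> expectation (\<lambda>\<omega>. (u \<omega>)\<^sup>2) / c\<^sup>2"
  by (rule prob_le_markov) (use assms in \<open>auto simp: abs_le_square_iff[symmetric]\<close>)

lemma integrable_lower_power:
  fixes X :: "'a \<Rightarrow> real"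
  assumes [measurable]: "random_variable borel X" and int: "integrable M (\<lambda>\<omega>. X \<omega> ^ 4)" and k: "k \<le> 4"
  shows "integrable M (\<lambda>\<omega>. X \<omega> ^ k)"
proof (rule Bochner_Integration.integrable_bound)
  show "integrable M (\<lambda>\<omega>. 1 + X \<omega> ^ 4)" using int by simp
  have "\<bar>x\<bar> ^ k \<le> 1 + \<bar>x\<bar> ^ 4" for x :: real
  proof (cases "\<bar>x\<bar> \<le> 1")
    case True
    have "\<bar>x\<bar> ^ k \<le> 1" using True by (simp add: power_le_one)
    thus ?thesis by (smt (verit) zero_le_power abs_ge_zero)
  next
    case False
    have "\<bar>x\<bar> ^ k \<le> \<bar>x\<bar> ^ 4" using False k by (intro power_increasing) auto
    thus ?thesis by simp
  qed
  thus "AE \<omega> in M. norm (X \<omega> ^ k) \<le> norm (1 + X \<omega> ^ 4)"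
    by (auto simp: power_abs)
qed simp

definition std_noise :: "real \<Rightarrow> real \<Rightarrow> ('a \<Rightarrow> real) \<Rightarrow> bool" where
  "std_noise \<alpha> H X \<longleftrightarrow> has_bochner_integral M X 0 \<and> has_bochner_integral M (\<lambda>\<omega>. (X \<omega>)\<^sup>2) 1 \<and>
     integrable M (\<lambda>\<omega>. \<bar>X \<omega>\<bar> powr \<alpha>) \<and> expectation (\<lambda>\<omega>. \<bar>X \<omega>\<bar> powr \<alpha>) \<le> H"

lemma std_noiseD:
  assumes "std_noise \<alpha> H X"
  shows "random_variable borel X" "integrable M X" "expectation X = 0"
    "integrable M (\<lambda>\<omega>. (X \<omega>)\<^sup>2)" "expectation (\<lambda>\<omega>. (X \<omega>)\<^sup>2) = 1"
    "integrable M (\<lambda>\<omega>. \<bar>X \<omega>\<bar> powr \<alpha>)" "expectation (\<lambda>\<omega>. \<bar>X \<omega>\<bar> powr \<alpha>) \<le> H"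
  using assms unfolding std_noise_def has_bochner_integral_iff by auto

lemma std_noise_uminus: "std_noise \<alpha> H X \<Longrightarrow> std_noise \<alpha> H (\<lambda>\<omega>. - X \<omega>)"
  unfolding std_noise_def by (auto dest: has_bochner_integral_minus)

text \<open>Here \<open>\<alpha> >= 4\<close> enters for the first time: fourth moments bound the
  variance of the squared averages that make up the quadratic statistics.\<close>

lemma std_noise_fourth:
  assumes X: "std_noise \<alpha> H X" and \<alpha>: "\<alpha> \<ge> 4"
  shows "integrable M (\<lambda>\<omega>. X \<omega> ^ 4)" "expectation (\<lambda>\<omega>. X \<omega> ^ 4) \<le> 1 + H"
proof -
  note [measurable] = std_noiseD(1)[OF X]
  have le: "x ^ 4 \<le> 1 + \<bar>x\<bar> powr \<alpha>" for x :: real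
  proof (cases "\<bar>x\<bar> \<le> 1")
    case True
    have "x ^ 4 = \<bar>x\<bar> ^ 4" by simp
    also have "\<dots> \<le> 1" using True by (intro power_le_one) auto
    finally show ?thesis by (smt (verit) powr_ge_zero)
  next
    case False
    have "x ^ 4 = \<bar>x\<bar> powr 4" using False by (simp add: powr_numeral)
    also have "\<dots> \<le> \<bar>x\<bar> powr \<alpha>" using False \<alpha> by (intro powr_mono) auto
    finally show ?thesis by simp
  qed
  show int: "integrable M (\<lambda>\<omega>. X \<omega> ^ 4)"
    by (rule Bochner_Integration.integrable_bound[where f = "\<lambda>\<omega>. 1 + \<bar>X \<omega>\<bar> powr \<alpha>"])
      (use le std_noiseD(6)[OF X] in \<open>auto simp: abs_of_nonneg\<close>)
  have "expectation (\<lambda>\<omega>. X \<omega> ^ 4) \<le> expectation (\<lambda>\<omega>. 1 + \<bar>X \<omega>\<bar> powr \<alpha>)"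
    by (rule integral_mono) (use le int std_noiseD(6)[OF X] in auto)
  also have "\<dots> \<le> 1 + H" using std_noiseD(6,7)[OF X] by (simp add: prob_space)
  finally show "expectation (\<lambda>\<omega>. X \<omega> ^ 4) \<le> 1 + H" .
qed

text \<open>Induction over the index set. In the expansion of \<open>(X + S) ^ 4\<close> every term
  with a first power has mean zero, so a new index adds its own fourth moment and
  \<open>6 * card I\<close>, and the latter is covered by the growth of
  \<open>3 * (card I)^2\<close>.\<close>

lemma indep_sum_moments:
  fixes X :: "'i \<Rightarrow> 'a \<Rightarrow> real"
  assumes fin: "finite I" and ind: "indep_vars (\<lambda>_. borel) X I"
    and X: "\<And>i. i \<in> I \<Longrightarrow> std_noise \<alpha> H (X i)" and \<alpha>: "\<alpha> \<ge> 4"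
  shows "integrable M (\<lambda>\<omega>. (\<Sum>i\<in>I. X i \<omega>) ^ 4) \<and> expectation (\<lambda>\<omega>. \<Sum>i\<in>I. X i \<omega>) = 0 \<and>
    expectation (\<lambda>\<omega>. (\<Sum>i\<in>I. X i \<omega>)\<^sup>2) = real (card I) \<and>
    expectation (\<lambda>\<omega>. (\<Sum>i\<in>I. X i \<omega>) ^ 4) \<le> real (card I) * (1 + H) + 3 * (real (card I))\<^sup>2"
  using fin ind X
proof (induction I rule: finite_induct)
  case empty
  show ?case by simp
next
  case (insert i I)
  define S where "S = (\<lambda>\<omega>. \<Sum>i\<in>I. X i \<omega>)"
  have Xi: "std_noise \<alpha> H (X i)" using insert.prems by simp
  have rvX: "random_variable borel (X j)" if "j \<in> I" for j
    using insert.prems that std_noiseD(1) by blast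
  have [measurable]: "random_variable borel (X i)" "random_variable borel S"
    using std_noiseD(1)[OF Xi] rvX by (auto simp: S_def)
  have IH: "integrable M (\<lambda>\<omega>. S \<omega> ^ 4)" "expectation S = 0" "expectation (\<lambda>\<omega>. (S \<omega>)\<^sup>2) = real (card I)"
    "expectation (\<lambda>\<omega>. S \<omega> ^ 4) \<le> real (card I) * (1 + H) + 3 * (real (card I))\<^sup>2"
    using insert.IH insert.prems indep_vars_subset[of "\<lambda>_. borel" X "insert i I" I]
    by (auto simp: S_def)
  note intS = integrable_lower_power[OF _ IH(1), of 1] integrable_lower_power[OF _ IH(1), of 2]
    integrable_lower_power[OF _ IH(1), of 3] IH(1)
  note X4 = std_noise_fourth[OF Xi \<alpha>]
  note intX = integrable_lower_power[OF _ X4(1), of 1] integrable_lower_power[OF _ X4(1), of 2]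
    integrable_lower_power[OF _ X4(1), of 3] X4(1)
  have indep: "indep_var borel (X i) borel S"
    unfolding S_def by (rule indep_vars_sum) (use insert in auto)
  have indep_pow: "indep_var borel (\<lambda>\<omega>. X i \<omega> ^ a) borel (\<lambda>\<omega>. S \<omega> ^ b)" for a b
    using indep_var_compose[OF indep, of "\<lambda>x. x ^ a" borel "\<lambda>x. x ^ b" borel] by (simp add: comp_def)
  have int: "integrable M (\<lambda>\<omega>. X i \<omega> ^ a * S \<omega> ^ b)"
    and prod: "expectation (\<lambda>\<omega>. X i \<omega> ^ a * S \<omega> ^ b) = expectation (\<lambda>\<omega>. X i \<omega> ^ a) * expectation (\<lambda>\<omega>. S \<omega> ^ b)"
    if "a \<le> 4" "b \<le> 4" for a b
    using that
    by (auto intro!: indep_var_integrable indep_var_lebesgue_integral indep_pow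
        integrable_lower_power[OF _ IH(1)] integrable_lower_power[OF _ X4(1)])
  have sum: "(\<Sum>j\<in>insert i I. X j \<omega>) = X i \<omega> + S \<omega>" for \<omega>
    using insert by (simp add: S_def)
  have e1: "expectation (\<lambda>\<omega>. X i \<omega> + S \<omega>) = 0"
    using intS intX IH std_noiseD[OF Xi] by simp
  have "(X i \<omega> + S \<omega>)\<^sup>2 = (X i \<omega>)\<^sup>2 + 2 * (X i \<omega> ^ 1 * S \<omega> ^ 1) + (S \<omega>)\<^sup>2" for \<omega>
    by (simp add: power2_sum)
  hence e2: "expectation (\<lambda>\<omega>. (X i \<omega> + S \<omega>)\<^sup>2) = 1 + real (card I)"
    using intS intX IH std_noiseD[OF Xi] int[of 1 1] prod[of 1 1] by simp
  have eq4: "(X i \<omega> + S \<omega>) ^ 4 = X i \<omega> ^ 4 + 4 * (X i \<omega> ^ 3 * S \<omega> ^ 1) + 6 * (X i \<omega> ^ 2 * S \<omega> ^ 2)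
      + 4 * (X i \<omega> ^ 1 * S \<omega> ^ 3) + S \<omega> ^ 4" for \<omega>
    by (simp add: power4_eq_xxxx power3_eq_cube power2_eq_square algebra_simps)
  have i4: "integrable M (\<lambda>\<omega>. (X i \<omega> + S \<omega>) ^ 4)"
    unfolding eq4 using intS intX int[of 3 1] int[of 2 2] int[of 1 3] by simp
  have "expectation (\<lambda>\<omega>. (X i \<omega> + S \<omega>) ^ 4) = expectation (\<lambda>\<omega>. X i \<omega> ^ 4) + 6 * real (card I) + expectation (\<lambda>\<omega>. S \<omega> ^ 4)"
    unfolding eq4 using intS intX int[of 3 1] int[of 2 2] int[of 1 3] prod[of 3 1] prod[of 2 2] prod[of 1 3] IH std_noiseD[OF Xi]
    by simp
  also have "\<dots> \<le> (1 + H) + 6 * real (card I) + (real (card I) * (1 + H) + 3 * (real (card I))\<^sup>2)"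
    using X4 IH by simp
  also have "\<dots> \<le> real (Suc (card I)) * (1 + H) + 3 * (real (Suc (card I)))\<^sup>2"
    by (simp add: power2_eq_square algebra_simps)
  finally show ?case using i4 e1 e2 insert.hyps by (simp add: sum)
qed

section \<open>Exponential moments and tails of independent sums\<close>

lemma exp_le_quadratic:
  fixes u b :: real
  assumes "\<bar>u\<bar> \<le> b"
  shows "exp u \<le> 1 + u + u\<^sup>2 * exp b"
proof -
  obtain t where t: "\<bar>t\<bar> \<le> \<bar>u\<bar>" "exp u = (\<Sum>m<2. (u ^ m) / fact m) + (exp t / fact 2) * u ^ 2"
    using Maclaurin_exp_le[of u 2] by blast
  have "exp t / 2 * u\<^sup>2 \<le> exp b * u\<^sup>2"
  proof (rule mult_right_mono)
    have "exp t \<le> exp b" using t assms by simp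
    thus "exp t / 2 \<le> exp b" using exp_gt_zero[of t] by linarith
  qed simp
  thus ?thesis using t by (simp add: numeral_2_eq_2 mult.commute)
qed

text \<open>Truncation destroys centering, but pointwise \<open>T <= X + X^2 / b\<close>, so the
  mean of \<open>T\<close> is at most \<open>1 / b\<close>. This bias is the term
  \<open>h / b\<close> of the exponent; the other term is the quadratic remainder, using that
  \<open>T^2 <= X^2\<close> has mean at most one.\<close>

lemma truncated_mgf:
  assumes X: "std_noise \<alpha> H X" and b: "b > 0" and h: "h > 0"
  shows "integrable M (\<lambda>\<omega>. exp (h * (if \<bar>X \<omega>\<bar> \<le> b then X \<omega> else 0)))"
    and "expectation (\<lambda>\<omega>. exp (h * (if \<bar>X \<omega>\<bar> \<le> b then X \<omega> else 0))) \<le> exp (h / b + h\<^sup>2 * exp (h * b))"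
proof -
  note [measurable] = std_noiseD(1)[OF X]
  define T where "T = (\<lambda>\<omega>. if \<bar>X \<omega>\<bar> \<le> b then X \<omega> else 0)"
  have [measurable]: "random_variable borel T" unfolding T_def by measurable
  have T: "\<bar>T \<omega>\<bar> \<le> b" "T \<omega> \<le> X \<omega> + (X \<omega>)\<^sup>2 / b" "(T \<omega>)\<^sup>2 \<le> (X \<omega>)\<^sup>2" for \<omega>
  proof -
    show "\<bar>T \<omega>\<bar> \<le> b" "(T \<omega>)\<^sup>2 \<le> (X \<omega>)\<^sup>2" using b by (auto simp: T_def)
    have "0 \<le> X \<omega> + (X \<omega>)\<^sup>2 / b" if "\<not> \<bar>X \<omega>\<bar> \<le> b"
    proof -
      have "\<bar>X \<omega>\<bar> * b \<le> \<bar>X \<omega>\<bar> * \<bar>X \<omega>\<bar>" using that by (intro mult_left_mono) auto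
      hence "\<bar>X \<omega>\<bar> \<le> (X \<omega>)\<^sup>2 / b" using b by (simp add: field_simps power2_eq_square)
      thus ?thesis by linarith
    qed
    moreover have "(X \<omega>)\<^sup>2 / b \<ge> 0" using b by simp
    ultimately show "T \<omega> \<le> X \<omega> + (X \<omega>)\<^sup>2 / b" by (auto simp: T_def)
  qed
  have hT: "\<bar>h * T \<omega>\<bar> \<le> h * b" for \<omega> using T(1)[of \<omega>] h by (simp add: abs_mult)
  show int: "integrable M (\<lambda>\<omega>. exp (h * T \<omega>))"
    by (rule integrable_const_bound[where B = "exp (h * b)"])
      (use hT in \<open>auto intro!: AE_I2 simp: abs_le_iff\<close>)
  have le: "exp (h * T \<omega>) \<le> 1 + h * X \<omega> + (h / b + h\<^sup>2 * exp (h * b)) * (X \<omega>)\<^sup>2" for \<omega>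
  proof -
    have "exp (h * T \<omega>) \<le> 1 + h * T \<omega> + (h * T \<omega>)\<^sup>2 * exp (h * b)"
      by (rule exp_le_quadratic[OF hT])
    also have "\<dots> \<le> 1 + h * (X \<omega> + (X \<omega>)\<^sup>2 / b) + h\<^sup>2 * (X \<omega>)\<^sup>2 * exp (h * b)"
      unfolding power_mult_distrib using T(2,3)[of \<omega>] h
      by (intro add_mono order_refl mult_left_mono mult_right_mono) auto
    finally show ?thesis by (simp add: algebra_simps)
  qed
  have "expectation (\<lambda>\<omega>. exp (h * T \<omega>)) \<le> expectation (\<lambda>\<omega>. 1 + h * X \<omega> + (h / b + h\<^sup>2 * exp (h * b)) * (X \<omega>)\<^sup>2)"
    by (rule integral_mono[OF int _ le]) (use std_noiseD[OF X] in auto)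
  also have "\<dots> = 1 + (h / b + h\<^sup>2 * exp (h * b))"
    using std_noiseD[OF X] by (simp add: prob_space)
  also have "\<dots> \<le> exp (h / b + h\<^sup>2 * exp (h * b))" by (rule exp_ge_add_one_self)
  finally show "expectation (\<lambda>\<omega>. exp (h * T \<omega>)) \<le> exp (h / b + h\<^sup>2 * exp (h * b))" .
qed

text \<open>Chernoff's bound. The truncation level is multiplied and the tilt divided by
  \<open>sqrt (card I)\<close>, which makes the exponent of the product of moment generating
  functions equal to \<open>l / m + l^2 * exp (l * m)\<close>, free of the number of
  summands.\<close>

lemma indep_sum_tail_truncated:
  fixes X :: "'i \<Rightarrow> 'a \<Rightarrow> real"
  assumes fin: "finite I" and ne: "I \<noteq> {}" and ind: "indep_vars (\<lambda>_. borel) X I"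
    and X: "\<And>i. i \<in> I \<Longrightarrow> std_noise \<alpha> H (X i)" and pos: "m > 0" "l > 0"
  shows "prob {\<omega> \<in> space M. a * sqrt (card I) \<le> (\<Sum>i\<in>I. X i \<omega>) \<and> (\<forall>i\<in>I. \<bar>X i \<omega>\<bar> \<le> m * sqrt (card I))}
    \<le> exp (- l * a + l / m + l\<^sup>2 * exp (l * m))"
proof -
  define N where "N = real (card I)"
  have N: "N > 0" using fin ne by (simp add: N_def card_gt_0_iff)
  define b h where "b = m * sqrt N" and "h = l / sqrt N"
  have b: "b > 0" and h: "h > 0" using pos N by (auto simp: b_def h_def)
  define T where "T = (\<lambda>x. if \<bar>x\<bar> \<le> b then x else 0 :: real)"
  have [measurable]: "T \<in> borel_measurable borel" unfolding T_def by measurable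
  have indE: "indep_vars (\<lambda>_. borel) (\<lambda>i \<omega>. exp (h * T (X i \<omega>))) I"
    by (rule indep_vars_compose2[OF ind]) simp
  have mgf: "integrable M (\<lambda>\<omega>. exp (h * T (X i \<omega>)))"
    "expectation (\<lambda>\<omega>. exp (h * T (X i \<omega>))) \<le> exp (h / b + h\<^sup>2 * exp (h * b))" if "i \<in> I" for i
    using truncated_mgf[OF X[OF that] b h] by (simp_all add: T_def)
  have int: "integrable M (\<lambda>\<omega>. \<Prod>i\<in>I. exp (h * T (X i \<omega>)))"
    by (rule indep_vars_integrable[OF fin indE]) (rule mgf(1))
  have "prob {\<omega> \<in> space M. a * sqrt N \<le> (\<Sum>i\<in>I. X i \<omega>) \<and> (\<forall>i\<in>I. \<bar>X i \<omega>\<bar> \<le> b)}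
      \<le> expectation (\<lambda>\<omega>. \<Prod>i\<in>I. exp (h * T (X i \<omega>))) / exp (l * a)"
  proof (rule prob_le_markov[OF int])
    fix \<omega> assume *: "a * sqrt N \<le> (\<Sum>i\<in>I. X i \<omega>) \<and> (\<forall>i\<in>I. \<bar>X i \<omega>\<bar> \<le> b)"
    have "l * a = h * (a * sqrt N)" using N by (simp add: h_def)
    also have "\<dots> \<le> h * (\<Sum>i\<in>I. X i \<omega>)" using * h by (intro mult_left_mono) auto
    also have "\<dots> = (\<Sum>i\<in>I. h * T (X i \<omega>))" using * by (simp add: sum_distrib_left T_def)
    finally show "exp (l * a) \<le> (\<Prod>i\<in>I. exp (h * T (X i \<omega>)))"
      by (simp add: exp_sum[OF fin, symmetric])
  qed (auto intro: prod_nonneg)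
  also have "expectation (\<lambda>\<omega>. \<Prod>i\<in>I. exp (h * T (X i \<omega>))) = (\<Prod>i\<in>I. expectation (\<lambda>\<omega>. exp (h * T (X i \<omega>))))"
    by (rule indep_vars_lebesgue_integral[OF fin indE]) (rule mgf(1))
  also have "\<dots> \<le> (\<Prod>i\<in>I. exp (h / b + h\<^sup>2 * exp (h * b)))"
    by (rule prod_mono) (use mgf(2) in auto)
  also have "\<dots> = exp (N * (h / b + h\<^sup>2 * exp (h * b)))"
    by (simp add: N_def exp_of_nat_mult)
  also have "N * (h / b + h\<^sup>2 * exp (h * b)) = l / m + l\<^sup>2 * exp (l * m)"
    using N pos by (simp add: h_def b_def field_simps power2_eq_square)
  also have "exp (l / m + l\<^sup>2 * exp (l * m)) / exp (l * a) = exp (- l * a + l / m + l\<^sup>2 * exp (l * m))"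
    by (simp add: exp_diff[symmetric])
  finally show ?thesis by (simp add: N_def b_def divide_right_mono)
qed

text \<open>A Fuk--Nagaev type inequality with free truncation level \<open>m\<close> and free exponential tilt \<open>l\<close>.\<close>

lemma indep_sum_tail:
  fixes X :: "'i \<Rightarrow> 'a \<Rightarrow> real"
  assumes fin: "finite I" and ne: "I \<noteq> {}" and ind: "indep_vars (\<lambda>_. borel) X I"
    and X: "\<And>i. i \<in> I \<Longrightarrow> std_noise \<alpha> H (X i)" and pos: "m > 0" "l > 0" and \<alpha>: "\<alpha> > 0"
  shows "prob {\<omega> \<in> space M. a * sqrt (card I) \<le> \<bar>\<Sum>i\<in>I. X i \<omega>\<bar>}
    \<le> H * real (card I) powr (1 - \<alpha> / 2) * m powr - \<alpha> + 2 * exp (- l * a + l / m + l\<^sup>2 * exp (l * m))"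
proof -
  define N where "N = real (card I)"
  have N: "N > 0" using fin ne by (simp add: N_def card_gt_0_iff)
  have rv[measurable]: "random_variable borel (X i)" if "i \<in> I" for i using std_noiseD(1)[OF X[OF that]] .
  define A where "A = (\<lambda>i. {\<omega> \<in> space M. \<bar>X i \<omega>\<bar> > m * sqrt N})"
  define B1 where "B1 = {\<omega> \<in> space M. a * sqrt N \<le> (\<Sum>i\<in>I. X i \<omega>) \<and> (\<forall>i\<in>I. \<bar>X i \<omega>\<bar> \<le> m * sqrt N)}"
  define B2 where "B2 = {\<omega> \<in> space M. a * sqrt N \<le> (\<Sum>i\<in>I. - X i \<omega>) \<and> (\<forall>i\<in>I. \<bar>- X i \<omega>\<bar> \<le> m * sqrt N)}"
  have ev: "A i \<in> events" if "i \<in> I" for i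
  proof -
    note [measurable] = rv[OF that]
    show ?thesis unfolding A_def by measurable
  qed
  have "(\<lambda>\<omega>. \<Sum>i\<in>I. X i \<omega>) \<in> borel_measurable M" by (intro borel_measurable_sum rv)
  moreover have "{\<omega> \<in> space M. \<forall>i\<in>I. \<bar>X i \<omega>\<bar> \<le> m * sqrt N} = space M - (\<Union>i\<in>I. A i)"
    by (auto simp: A_def not_less)
  moreover have "space M - (\<Union>i\<in>I. A i) \<in> events"
    by (intro sets.Diff sets.top sets.finite_UN fin ev)
  ultimately have "(\<lambda>\<omega>. \<Sum>i\<in>I. X i \<omega>) \<in> borel_measurable M"
    "{\<omega> \<in> space M. \<forall>i\<in>I. \<bar>X i \<omega>\<bar> \<le> m * sqrt N} \<in> events" by simp_all
  hence evB: "B1 \<in> events" "B2 \<in> events"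
    unfolding B1_def B2_def by (simp_all add: sets.sets_Collect_conj sum_negf)
  have pA: "prob (A i) \<le> H * (m * sqrt N) powr - \<alpha>" if "i \<in> I" for i
  proof -
    have "prob (A i) \<le> expectation (\<lambda>\<omega>. \<bar>X i \<omega>\<bar> powr \<alpha>) / (m * sqrt N) powr \<alpha>"
      unfolding A_def by (rule prob_le_markov) (use std_noiseD[OF X[OF that]] pos N \<alpha> in \<open>auto intro: powr_mono2\<close>)
    also have "\<dots> \<le> H / (m * sqrt N) powr \<alpha>"
      using std_noiseD[OF X[OF that]] by (intro divide_right_mono) auto
    finally show ?thesis by (simp add: powr_minus_divide)
  qed
  have evA: "(\<Union>i\<in>I. A i) \<in> events" by (intro sets.finite_UN fin ev)
  have "{\<omega> \<in> space M. a * sqrt N \<le> \<bar>\<Sum>i\<in>I. X i \<omega>\<bar>} \<subseteq> (\<Union>i\<in>I. A i) \<union> B1 \<union> B2"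
    by (auto simp: A_def B1_def B2_def sum_negf not_less abs_le_iff split: abs_split)
  hence "prob {\<omega> \<in> space M. a * sqrt N \<le> \<bar>\<Sum>i\<in>I. X i \<omega>\<bar>} \<le> prob ((\<Union>i\<in>I. A i) \<union> B1 \<union> B2)"
    by (intro finite_measure_mono sets.Un evA evB)
  also have "\<dots> \<le> prob (\<Union>i\<in>I. A i) + prob B1 + prob B2"
    by (intro order_trans[OF measure_Un_le] add_mono measure_Un_le order_refl sets.Un evA evB)
  also have "prob (\<Union>i\<in>I. A i) \<le> (\<Sum>i\<in>I. prob (A i))"
    using ev fin by (intro finite_measure_subadditive_finite) auto
  also have "\<dots> \<le> (\<Sum>i\<in>I. H * (m * sqrt N) powr - \<alpha>)" by (intro sum_mono pA)
  also have "\<dots> = H * N powr (1 - \<alpha> / 2) * m powr - \<alpha>"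
  proof -
    have "(m * sqrt N) powr - \<alpha> = m powr - \<alpha> * N powr (- \<alpha> / 2)"
      using pos N by (simp add: powr_mult powr_half_sqrt[symmetric] powr_powr)
    moreover have "N powr (1 - \<alpha> / 2) = N * N powr (- \<alpha> / 2)"
      using N powr_add[of N 1 "- \<alpha> / 2"] by simp
    ultimately show ?thesis by (simp add: N_def)
  qed
  also have "prob B1 \<le> exp (- l * a + l / m + l\<^sup>2 * exp (l * m))"
    unfolding B1_def N_def by (rule indep_sum_tail_truncated[OF fin ne ind X pos])
  also have "prob B2 \<le> exp (- l * a + l / m + l\<^sup>2 * exp (l * m))"
    unfolding B2_def N_def
  proof (rule indep_sum_tail_truncated[OF fin ne _ _ pos])
    show "indep_vars (\<lambda>_. borel) (\<lambda>i \<omega>. - X i \<omega>) I"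
      by (rule indep_vars_compose2[OF ind]) simp
  qed (use X std_noise_uminus in auto)
  finally show ?thesis by (simp add: N_def)
qed

lemma indep_sum_tail_power:
  fixes X :: "'i \<Rightarrow> 'a \<Rightarrow> real"
  assumes fin: "finite I" and ne: "I \<noteq> {}" and ind: "indep_vars (\<lambda>_. borel) X I"
    and X: "\<And>i. i \<in> I \<Longrightarrow> std_noise \<alpha> H (X i)" and \<alpha>: "\<alpha> \<ge> 4" and H: "H \<ge> 0" and a: "a > 1"
  shows "prob {\<omega> \<in> space M. a * sqrt (card I) \<le> \<bar>\<Sum>i\<in>I. X i \<omega>\<bar>}
    \<le> (H * \<alpha> powr \<alpha> + 2 * exp (2 * \<alpha>\<^sup>2)) * a powr - \<alpha>"
proof -
  define N where "N = real (card I)"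
  have N: "N \<ge> 1" using fin ne by (simp add: N_def Suc_le_eq card_gt_0_iff)
  \<comment> \<open>Chosen so that \<open>exp (l * m) = a\<close> and
    \<open>exp (- l * a) = a powr - \<alpha>\<close>. The two remaining terms of the exponent are at
    most \<open>\<alpha>^2\<close> each, by \<open>ln a <= a^2\<close> and
    \<open>(ln a)^2 <= a\<close>.\<close>
  define m l where "m = a / \<alpha>" and "l = \<alpha> * ln a / a"
  have pos: "m > 0" "l > 0" using a \<alpha> by (auto simp: m_def l_def)
  have "prob {\<omega> \<in> space M. a * sqrt (card I) \<le> \<bar>\<Sum>i\<in>I. X i \<omega>\<bar>}
      \<le> H * N powr (1 - \<alpha> / 2) * m powr - \<alpha> + 2 * exp (- l * a + l / m + l\<^sup>2 * exp (l * m))"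
    unfolding N_def by (rule indep_sum_tail[OF fin ne ind X pos]) (use \<alpha> in auto)
  also have "\<dots> \<le> H * 1 * (\<alpha> powr \<alpha> * a powr - \<alpha>) + 2 * (exp (2 * \<alpha>\<^sup>2) * a powr - \<alpha>)"
  proof (intro add_mono mult_mono order_refl)
    show "N powr (1 - \<alpha> / 2) \<le> 1" using N \<alpha> powr_mono[of "1 - \<alpha> / 2" 0 N] by simp
    show "m powr - \<alpha> \<le> \<alpha> powr \<alpha> * a powr - \<alpha>"
      using a \<alpha> by (simp add: m_def powr_divide powr_minus field_simps)
    have la: "ln a \<ge> 0" using a by simp
    have "ln a = 2 * ln (sqrt a)" using a by (simp add: ln_sqrt)
    moreover have "ln (sqrt a) \<le> sqrt a / exp 1" using ln_le_minus_one[of "sqrt a / exp 1"] a by (simp add: ln_div)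
    moreover have "2 / exp 1 \<le> (1 :: real)" using exp_ge_add_one_self[of 1] by simp
    hence "2 / exp 1 * sqrt a \<le> 1 * sqrt a" by (rule mult_right_mono) (use a in simp)
    ultimately have "ln a \<le> sqrt a" by simp
    hence sq: "(ln a)\<^sup>2 \<le> a" using la a by (metis abs_of_nonneg less_eq_real_def order_less_trans power2_eq_square power_mono real_sqrt_pow2 zero_less_one)
    have "l / m = \<alpha>\<^sup>2 * (ln a / a\<^sup>2)" using a \<alpha> by (simp add: l_def m_def power2_eq_square field_simps)
    also have "\<dots> \<le> \<alpha>\<^sup>2 * 1"
    proof (rule mult_left_mono)
      have "ln a \<le> a" using ln_le_minus_one[of a] a by simp
      also have "a \<le> a\<^sup>2" using a by (simp add: power2_eq_square)
      finally show "ln a / a\<^sup>2 \<le> 1" using a by simp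
    qed simp
    finally have t1: "l / m \<le> \<alpha>\<^sup>2" by simp
    have "exp (l * m) = a" using a \<alpha> by (simp add: l_def m_def)
    hence "l\<^sup>2 * exp (l * m) = \<alpha>\<^sup>2 * ((ln a)\<^sup>2 / a)" using a by (simp add: l_def power2_eq_square field_simps)
    also have "\<dots> \<le> \<alpha>\<^sup>2 * 1" using sq a by (intro mult_left_mono) auto
    finally have t2: "l\<^sup>2 * exp (l * m) \<le> \<alpha>\<^sup>2" by simp
    have "exp (- l * a + l / m + l\<^sup>2 * exp (l * m)) \<le> exp (- \<alpha> * ln a + 2 * \<alpha>\<^sup>2)"
      using t1 t2 a by (simp add: l_def)
    also have "\<dots> = exp (2 * \<alpha>\<^sup>2) * a powr - \<alpha>" using a by (simp add: powr_def exp_add[symmetric])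
    finally show "exp (- l * a + l / m + l\<^sup>2 * exp (l * m)) \<le> exp (2 * \<alpha>\<^sup>2) * a powr - \<alpha>" .
  qed (use H in auto)
  finally show ?thesis by (simp add: algebra_simps)
qed

lemma indep_sum_tail_gauss:
  fixes X :: "'i \<Rightarrow> 'a \<Rightarrow> real"
  assumes fin: "finite I" and ne: "I \<noteq> {}" and ind: "indep_vars (\<lambda>_. borel) X I"
    and X: "\<And>i. i \<in> I \<Longrightarrow> std_noise \<alpha> H (X i)" and \<alpha>: "\<alpha> \<ge> 4" and H: "H \<ge> 0" and a: "a > 0"
  shows "prob {\<omega> \<in> space M. a * sqrt (card I) \<le> \<bar>\<Sum>i\<in>I. X i \<omega>\<bar>}
    \<le> H * a powr \<alpha> / real (card I) + 2 * exp (- a\<^sup>2 / 32)"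
proof -
  define N where "N = real (card I)"
  have N: "N \<ge> 1" using fin ne by (simp add: N_def Suc_le_eq card_gt_0_iff)
  \<comment> \<open>With \<open>l * m = 1/2\<close> the exponent is at most
    \<open>- a^2/16 + a^2/128 + a^2/128\<close>, which is below \<open>- a^2/32\<close>. The factor
    \<open>1 / card I\<close> of the heavy term comes from
    \<open>1 - \<alpha>/2 <= - 1\<close>.\<close>
  define m l where "m = 8 / a" and "l = a / 16"
  have pos: "m > 0" "l > 0" using a by (auto simp: m_def l_def)
  have "prob {\<omega> \<in> space M. a * sqrt (card I) \<le> \<bar>\<Sum>i\<in>I. X i \<omega>\<bar>}
      \<le> H * N powr (1 - \<alpha> / 2) * m powr - \<alpha> + 2 * exp (- l * a + l / m + l\<^sup>2 * exp (l * m))"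
    unfolding N_def by (rule indep_sum_tail[OF fin ne ind X pos]) (use \<alpha> in auto)
  also have "\<dots> \<le> H * N powr - 1 * a powr \<alpha> + 2 * exp (- a\<^sup>2 / 32)"
  proof (intro add_mono mult_mono order_refl)
    show "N powr (1 - \<alpha> / 2) \<le> N powr - 1" using N \<alpha> by (intro powr_mono) auto
    have "m powr - \<alpha> = (a / 8) powr \<alpha>" using a by (simp add: m_def powr_minus powr_divide)
    also have "\<dots> \<le> a powr \<alpha>" using a \<alpha> by (intro powr_mono2) auto
    finally show "m powr - \<alpha> \<le> a powr \<alpha>" .
    have "exp (1 / 2 :: real) \<le> 2" by (rule exp_half_le2)
    hence "a\<^sup>2 / 256 * exp (1 / 2) \<le> a\<^sup>2 / 256 * 2" by (rule mult_left_mono) simp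
    thus "exp (- l * a + l / m + l\<^sup>2 * exp (l * m)) \<le> exp (- a\<^sup>2 / 32)"
      using a by (simp add: l_def m_def power2_eq_square field_simps)
  qed (use H in auto)
  finally show ?thesis using N by (simp add: N_def powr_minus_divide)
qed

end

section \<open>Quadratic statistics of an independent array\<close>

lemma (in prob_space) indep_sum_second_moment:
  fixes U :: "'i \<Rightarrow> 'a \<Rightarrow> real"
  assumes fin: "finite I" and ind: "indep_vars (\<lambda>_. borel) U I"
    and int: "\<And>i. i \<in> I \<Longrightarrow> integrable M (\<lambda>\<omega>. (U i \<omega>)\<^sup>2)"
    and mean: "\<And>i. i \<in> I \<Longrightarrow> has_bochner_integral M (U i) 0"
  shows "integrable M (\<lambda>\<omega>. (\<Sum>i\<in>I. U i \<omega>)\<^sup>2) \<and>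
    expectation (\<lambda>\<omega>. (\<Sum>i\<in>I. U i \<omega>)\<^sup>2) = (\<Sum>i\<in>I. expectation (\<lambda>\<omega>. (U i \<omega>)\<^sup>2))"
  using fin ind int mean
proof (induction I rule: finite_induct)
  case empty
  show ?case by simp
next
  case (insert i I)
  define S where "S = (\<lambda>\<omega>. \<Sum>i\<in>I. U i \<omega>)"
  have IH: "integrable M (\<lambda>\<omega>. (S \<omega>)\<^sup>2)"
    "expectation (\<lambda>\<omega>. (S \<omega>)\<^sup>2) = (\<Sum>i\<in>I. expectation (\<lambda>\<omega>. (U i \<omega>)\<^sup>2))"
    using insert.IH insert.prems indep_vars_subset[of "\<lambda>_. borel" U "insert i I" I]
    by (auto simp: S_def)
  have U0: "integrable M (U j)" "expectation (U j) = 0" if "j \<in> insert i I" for j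
    using insert.prems(3)[OF that] by (auto simp: has_bochner_integral_iff)
  have S0: "integrable M S" unfolding S_def using U0 by (intro Bochner_Integration.integrable_sum) auto
  have indep: "indep_var borel (U i) borel S"
    unfolding S_def by (rule indep_vars_sum) (use insert in auto)
  have prod: "integrable M (\<lambda>\<omega>. U i \<omega> * S \<omega>)" "expectation (\<lambda>\<omega>. U i \<omega> * S \<omega>) = 0"
    using indep_var_integrable[OF indep] indep_var_lebesgue_integral[OF indep] U0[of i] S0 by auto
  have sum: "(\<Sum>j\<in>insert i I. U j \<omega>) = U i \<omega> + S \<omega>" for \<omega>
    using insert by (simp add: S_def)
  have eq: "(U i \<omega> + S \<omega>)\<^sup>2 = (U i \<omega>)\<^sup>2 + 2 * (U i \<omega> * S \<omega>) + (S \<omega>)\<^sup>2" for \<omega>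
    by (simp add: power2_sum)
  show ?case
    unfolding sum eq using IH prod insert.prems(2)[of i] insert.hyps by simp
qed

lemma (in prob_space) count_event:
  assumes fin: "finite J" and ev: "\<And>j. j \<in> J \<Longrightarrow> {\<omega> \<in> space M. P j \<omega>} \<in> events"
  shows "{\<omega> \<in> space M. k \<le> card {j \<in> J. P j \<omega>}} \<in> events"
proof -
  have eq: "real (card {j \<in> J. P j \<omega>}) = (\<Sum>j\<in>J. indicator {\<omega> \<in> space M. P j \<omega>} \<omega>)" if "\<omega> \<in> space M" for \<omega>
  proof -
    have "(\<Sum>j\<in>J. indicator {\<omega> \<in> space M. P j \<omega>} \<omega> :: real) = (\<Sum>j\<in>J. if P j \<omega> then 1 else 0)"
      using that by (intro sum.cong) auto
    also have "\<dots> = real (card {j \<in> J. P j \<omega>})" by (simp add: sum.If_cases fin Int_def)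
    finally show ?thesis by simp
  qed
  have "{\<omega> \<in> space M. k \<le> card {j \<in> J. P j \<omega>}}
      = {\<omega> \<in> space M. real k \<le> (\<Sum>j\<in>J. indicator {\<omega> \<in> space M. P j \<omega>} \<omega>)}"
    using eq by (metis (mono_tags, lifting) of_nat_le_iff)
  also have "\<dots> \<in> events"
    by (intro borel_measurable_le borel_measurable_const borel_measurable_sum borel_measurable_indicator ev)
  finally show ?thesis .
qed

text \<open>Normalized so that for pure noise each summand is the square of a unit variance average
  minus one, whatever the size of \<open>B\<close>. The grouped statistics of the tests are positive
  multiples of medians of such forms.\<close>

definition qform :: "nat set \<Rightarrow> nat set \<Rightarrow> (nat \<Rightarrow> nat \<Rightarrow> real) \<Rightarrow> real" where
  "qform S B z = (\<Sum>j\<in>S. real (card B) * ((\<Sum>i\<in>B. z i j) / real (card B))\<^sup>2 - 1)"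

section \<open>A standardized noise array with a constant mean vector\<close>

locale noise_array = prob_space M for M :: "'a measure" +
  fixes \<xi> :: "nat \<times> nat \<Rightarrow> 'a \<Rightarrow> real" and p h :: nat and \<alpha> H :: real
  assumes alpha: "\<alpha> \<ge> 4" and H: "H \<ge> 1"
    and indep: "indep_vars (\<lambda>_. borel) \<xi> ({1..p} \<times> {1..h})"
    and noise: "\<And>i. i \<in> {1..p} \<times> {1..h} \<Longrightarrow> std_noise \<alpha> H (\<xi> i)"
begin

text \<open>Here every column has mean \<open>d\<close>, whereas the symmetrized data have a
  constant mean only in the columns up to the scale under consideration. \<open>Zst_eq_Z\<close>
  identifies the two on those columns.\<close>

definition Z :: "(nat \<Rightarrow> real) \<Rightarrow> 'a \<Rightarrow> nat \<Rightarrow> nat \<Rightarrow> real" where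
  "Z d \<omega> = (\<lambda>i j. d j + \<xi> (j, i) \<omega>)"

definition avg :: "nat set \<Rightarrow> nat \<Rightarrow> 'a \<Rightarrow> real" where
  "avg B j \<omega> = (\<Sum>i\<in>B. \<xi> (j, i) \<omega>) / sqrt (card B)"

text \<open>Sized for \<open>qform_deviation\<close>: in expectation the square of a centred summand
  is at most \<open>8 * card B * (d j)^2\<close>, from the cross term, plus
  \<open>2 * (H + 4 - 1)\<close>, from the squared noise.\<close>

definition V :: real where "V = 2 * H + 8"

lemma V_pos: "V > 0" using H by (simp add: V_def)

lemma rv: "j \<in> {1..p} \<Longrightarrow> i \<in> {1..h} \<Longrightarrow> random_variable borel (\<xi> (j, i))"
  by (rule std_noiseD(1)[OF noise]) simp

lemma sum_single_row: "(\<Sum>e\<in>{j} \<times> B. f e) = (\<Sum>i\<in>B. f (j, i))" for f :: "nat \<times> nat \<Rightarrow> real"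
proof -
  have "{j} \<times> B = Pair j ` B" by auto
  thus ?thesis by (simp add: sum.reindex inj_on_def)
qed

lemma indep_blocks:
  assumes K: "\<And>l. l \<in> L \<Longrightarrow> K l \<subseteq> {1..p} \<times> {1..h}" and disj: "disjoint_family_on K L"
    and g: "\<And>l. l \<in> L \<Longrightarrow> g l \<in> borel_measurable (PiM (K l) (\<lambda>_. borel))"
  shows "indep_vars (\<lambda>_. borel) (\<lambda>l \<omega>. g l (restrict (\<lambda>e. \<xi> e \<omega>) (K l)) :: real) L"
  by (rule indep_vars_compose2[OF indep_vars_restrict[OF indep K disj]]) (use g in auto)

lemma avg_moments:
  assumes B: "B \<subseteq> {1..h}" "B \<noteq> {}" and j: "j \<in> {1..p}"
  shows "random_variable borel (avg B j)" "integrable M (\<lambda>\<omega>. avg B j \<omega> ^ 4)"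
    "expectation (avg B j) = 0" "expectation (\<lambda>\<omega>. (avg B j \<omega>)\<^sup>2) = 1"
    "expectation (\<lambda>\<omega>. avg B j \<omega> ^ 4) \<le> H + 4"
proof -
  define N where "N = real (card B)"
  have fin: "finite B" using B finite_subset by blast
  hence N: "N \<ge> 1" using B by (simp add: N_def Suc_le_eq card_gt_0_iff)
  have sub: "{j} \<times> B \<subseteq> {1..p} \<times> {1..h}" using B j by auto
  have "integrable M (\<lambda>\<omega>. (\<Sum>e\<in>{j} \<times> B. \<xi> e \<omega>) ^ 4) \<and> expectation (\<lambda>\<omega>. \<Sum>e\<in>{j} \<times> B. \<xi> e \<omega>) = 0 \<and>
    expectation (\<lambda>\<omega>. (\<Sum>e\<in>{j} \<times> B. \<xi> e \<omega>)\<^sup>2) = real (card ({j} \<times> B)) \<and>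
    expectation (\<lambda>\<omega>. (\<Sum>e\<in>{j} \<times> B. \<xi> e \<omega>) ^ 4)
      \<le> real (card ({j} \<times> B)) * (1 + H) + 3 * (real (card ({j} \<times> B)))\<^sup>2"
    by (rule indep_sum_moments[OF _ indep_vars_subset[OF indep sub] noise[OF subsetD[OF sub]] alpha])
      (use fin in auto)
  hence S: "integrable M (\<lambda>\<omega>. (\<Sum>i\<in>B. \<xi> (j, i) \<omega>) ^ 4)" "expectation (\<lambda>\<omega>. \<Sum>i\<in>B. \<xi> (j, i) \<omega>) = 0"
    "expectation (\<lambda>\<omega>. (\<Sum>i\<in>B. \<xi> (j, i) \<omega>)\<^sup>2) = N"
    "expectation (\<lambda>\<omega>. (\<Sum>i\<in>B. \<xi> (j, i) \<omega>) ^ 4) \<le> N * (1 + H) + 3 * N\<^sup>2"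
    by (auto simp: sum_single_row N_def card_cartesian_product)
  have sq: "sqrt N ^ 2 = N" "sqrt N ^ 4 = N\<^sup>2"
    using N by (simp_all add: power4_eq_xxxx power2_eq_square)
  have [measurable]: "random_variable borel (\<xi> (j, i))" if "i \<in> B" for i using rv that B j by auto
  show "random_variable borel (avg B j)" unfolding avg_def by measurable
  show "integrable M (\<lambda>\<omega>. avg B j \<omega> ^ 4)"
    unfolding avg_def power_divide using S by (intro integrable_divide) auto
  show "expectation (avg B j) = 0" unfolding avg_def using S by simp
  show "expectation (\<lambda>\<omega>. (avg B j \<omega>)\<^sup>2) = 1"
    unfolding avg_def power_divide using S N sq by (simp add: N_def[symmetric])
  have "(N * (1 + H) + 3 * N\<^sup>2) / N\<^sup>2 \<le> H + 4"
  proof -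
    have "N * (1 + H) \<le> N\<^sup>2 * (1 + H)" using N H by (intro mult_right_mono) (auto simp: power2_eq_square)
    thus ?thesis using N by (simp add: divide_le_eq algebra_simps)
  qed
  moreover have "expectation (\<lambda>\<omega>. avg B j \<omega> ^ 4) \<le> (N * (1 + H) + 3 * N\<^sup>2) / N\<^sup>2"
    unfolding avg_def power_divide using S N sq by (simp add: N_def[symmetric] divide_right_mono)
  ultimately show "expectation (\<lambda>\<omega>. avg B j \<omega> ^ 4) \<le> H + 4" by linarith
qed

lemma indep_avg_compose:
  assumes B: "B \<subseteq> {1..h}" and S: "S \<subseteq> {1..p}" and f: "\<And>j. j \<in> S \<Longrightarrow> f j \<in> borel_measurable borel"
  shows "indep_vars (\<lambda>_. borel) (\<lambda>j \<omega>. f j (avg B j \<omega>) :: real) S"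
proof -
  have "indep_vars (\<lambda>_. borel) (\<lambda>j \<omega>. (\<lambda>y. f j ((\<Sum>i\<in>B. y (j, i)) / sqrt (card B))) (restrict (\<lambda>e. \<xi> e \<omega>) ({j} \<times> B))) S"
    using B S f by (intro indep_blocks) (auto simp: disjoint_family_on_def)
  thus ?thesis by (simp add: avg_def cong: sum.cong)
qed

lemma qform_eq:
  assumes "card B > 0"
  shows "qform S B (Z d \<omega>) = real (card B) * (\<Sum>j\<in>S. (d j)\<^sup>2)
    + (\<Sum>j\<in>S. 2 * sqrt (card B) * d j * avg B j \<omega> + ((avg B j \<omega>)\<^sup>2 - 1))"
proof -
  define N where "N = real (card B)"
  have N: "N > 0" using assms by (simp add: N_def)
  have "N * ((\<Sum>i\<in>B. Z d \<omega> i j) / N)\<^sup>2 = N * (d j)\<^sup>2 + 2 * sqrt N * d j * avg B j \<omega> + (avg B j \<omega>)\<^sup>2" for j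
  proof -
    define w q where "w = avg B j \<omega>" and "q = sqrt N"
    have q: "q > 0" "N = q\<^sup>2" using N by (auto simp: q_def)
    have "w = (\<Sum>i\<in>B. \<xi> (j, i) \<omega>) / q" by (simp add: w_def avg_def N_def q_def)
    hence "(\<Sum>i\<in>B. \<xi> (j, i) \<omega>) = q * w" using q(1) by simp
    hence "(\<Sum>i\<in>B. Z d \<omega> i j) = q\<^sup>2 * d j + q * w"
      by (simp add: Z_def sum.distrib N_def[symmetric] q(2)[symmetric])
    moreover have "q\<^sup>2 * ((q\<^sup>2 * d j + q * w) / q\<^sup>2)\<^sup>2 = q\<^sup>2 * (d j)\<^sup>2 + 2 * q * d j * w + w\<^sup>2"
      using q(1) by (simp add: power2_eq_square field_simps)
    ultimately show ?thesis using q by (simp add: w_def[symmetric] q_def[symmetric])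
  qed
  thus ?thesis
    by (simp add: qform_def N_def[symmetric] sum.distrib sum_subtractf sum_distrib_left)
qed

text \<open>Chebyshev's inequality around the mean \<open>m\<close>. Coordinates are independent,
  and each contributes a cross term \<open>2 * sqrt N * d j * w\<close> and a centred square
  \<open>w^2 - 1\<close> with \<open>w\<close> of unit variance. The variance is thus only linear in
  \<open>m\<close>, so a large signal dominates its own fluctuations.\<close>

lemma qform_deviation:
  assumes B: "B \<subseteq> {1..h}" "B \<noteq> {}" and S: "S \<subseteq> {1..p}" and y: "y > 0"
    and m: "m = real (card B) * (\<Sum>j\<in>S. (d j)\<^sup>2)"
    and P: "\<And>\<omega>. \<omega> \<in> space M \<Longrightarrow> P \<omega> \<Longrightarrow> y \<le> \<bar>qform S B (Z d \<omega>) - m\<bar>"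
  shows "prob {\<omega> \<in> space M. P \<omega>} \<le> V * (m + real (card S)) / y\<^sup>2"
proof -
  define N where "N = real (card B)"
  have fin: "finite S" "finite B" using S B finite_subset by blast+
  hence N: "card B > 0" using B by (simp add: card_gt_0_iff)
  define U where "U = (\<lambda>j \<omega>. 2 * sqrt N * d j * avg B j \<omega> + ((avg B j \<omega>)\<^sup>2 - 1))"
  have q: "qform S B (Z d \<omega>) - m = (\<Sum>j\<in>S. U j \<omega>)" for \<omega>
    using qform_eq[OF N] by (simp add: m U_def N_def)
  have ind: "indep_vars (\<lambda>_. borel) U S"
    unfolding U_def by (rule indep_avg_compose[OF B(1) S]) measurable
  have U: "has_bochner_integral M (U j) 0" "integrable M (\<lambda>\<omega>. (U j \<omega>)\<^sup>2)"
    "expectation (\<lambda>\<omega>. (U j \<omega>)\<^sup>2) \<le> V * (N * (d j)\<^sup>2 + 1)" if "j \<in> S" for j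
  proof -
    have j: "j \<in> {1..p}" using S that by auto
    note w = avg_moments[OF B j]
    note [measurable] = w(1)
    note i1 = integrable_lower_power[OF w(1,2), of 1] and i2 = integrable_lower_power[OF w(1,2), of 2]
    show "has_bochner_integral M (U j) 0"
      unfolding has_bochner_integral_iff U_def using i1 i2 w by (simp add: prob_space)
    define c where "c = 2 * sqrt N * d j"
    have c2: "c\<^sup>2 = 4 * (N * (d j)\<^sup>2)" by (simp add: c_def power_mult_distrib N_def)
    have le: "(U j \<omega>)\<^sup>2 \<le> 2 * c\<^sup>2 * (avg B j \<omega>)\<^sup>2 + 2 * (avg B j \<omega> ^ 4 - 2 * (avg B j \<omega>)\<^sup>2 + 1)" for \<omega>
    proof -
      have "(a + b)\<^sup>2 \<le> 2 * a\<^sup>2 + 2 * b\<^sup>2" for a b :: real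
        using sum_squares_bound[of a b] by (simp add: power2_sum)
      from this[of "c * avg B j \<omega>" "(avg B j \<omega>)\<^sup>2 - 1"] show ?thesis
        by (simp add: U_def c_def power_mult_distrib power2_diff power4_eq_xxxx power2_eq_square algebra_simps)
    qed
    have intb: "integrable M (\<lambda>\<omega>. 2 * c\<^sup>2 * (avg B j \<omega>)\<^sup>2 + 2 * (avg B j \<omega> ^ 4 - 2 * (avg B j \<omega>)\<^sup>2 + 1))"
      using i2 w by simp
    show int: "integrable M (\<lambda>\<omega>. (U j \<omega>)\<^sup>2)"
      by (rule Bochner_Integration.integrable_bound[OF intb])
        (use order_trans[OF le abs_ge_self] in \<open>auto simp: U_def[abs_def]\<close>)
    have "expectation (\<lambda>\<omega>. (U j \<omega>)\<^sup>2)
        \<le> expectation (\<lambda>\<omega>. 2 * c\<^sup>2 * (avg B j \<omega>)\<^sup>2 + 2 * (avg B j \<omega> ^ 4 - 2 * (avg B j \<omega>)\<^sup>2 + 1))"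
      by (rule integral_mono[OF int intb le])
    also have "\<dots> = 2 * c\<^sup>2 + 2 * (expectation (\<lambda>\<omega>. avg B j \<omega> ^ 4) - 1)"
      using i2 w by (simp add: prob_space)
    also have "\<dots> \<le> 8 * (N * (d j)\<^sup>2) + V" using w(5) by (simp add: c2 V_def)
    also have "\<dots> \<le> V * (N * (d j)\<^sup>2) + V"
      by (intro add_right_mono mult_right_mono) (use H in \<open>auto simp: V_def N_def\<close>)
    finally show "expectation (\<lambda>\<omega>. (U j \<omega>)\<^sup>2) \<le> V * (N * (d j)\<^sup>2 + 1)" by (simp add: algebra_simps)
  qed
  have sm: "integrable M (\<lambda>\<omega>. (\<Sum>j\<in>S. U j \<omega>)\<^sup>2)"
    "expectation (\<lambda>\<omega>. (\<Sum>j\<in>S. U j \<omega>)\<^sup>2) = (\<Sum>j\<in>S. expectation (\<lambda>\<omega>. (U j \<omega>)\<^sup>2))"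
    using indep_sum_second_moment[OF fin(1) ind U(2,1)] by blast+
  have "prob {\<omega> \<in> space M. P \<omega>} \<le> expectation (\<lambda>\<omega>. (\<Sum>j\<in>S. U j \<omega>)\<^sup>2) / y\<^sup>2"
    by (rule prob_le_markov_square[OF sm(1) y]) (use P q in auto)
  also have "\<dots> \<le> (\<Sum>j\<in>S. V * (N * (d j)\<^sup>2 + 1)) / y\<^sup>2"
    unfolding sm(2) by (intro divide_right_mono sum_mono U(3)) auto
  also have "(\<Sum>j\<in>S. V * (N * (d j)\<^sup>2 + 1)) = V * (m + real (card S))"
    by (simp add: m N_def sum.distrib sum_distrib_left[symmetric] algebra_simps)
  finally show ?thesis .
qed

lemma qform_upper:
  assumes B: "B \<subseteq> {1..h}" "B \<noteq> {}" and S: "S \<subseteq> {1..p}" and x: "x > 0" and d: "\<And>j. j \<in> S \<Longrightarrow> d j = 0"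
  shows "prob {\<omega> \<in> space M. x < qform S B (Z d \<omega>)} \<le> V * real (card S) / x\<^sup>2"
proof -
  have "prob {\<omega> \<in> space M. x < qform S B (Z d \<omega>)} \<le> V * (0 + real (card S)) / x\<^sup>2"
    by (rule qform_deviation[OF B S x, where d = d]) (use d in auto)
  thus ?thesis by simp
qed

lemma qform_lower:
  assumes B: "B \<subseteq> {1..h}" "B \<noteq> {}" and S: "S \<subseteq> {1..p}"
    and m: "m = real (card B) * (\<Sum>j\<in>S. (d j)\<^sup>2)" "m > 0"
  shows "prob {\<omega> \<in> space M. qform S B (Z d \<omega>) \<le> m / 2} \<le> 4 * V * (m + real (card S)) / m\<^sup>2"
proof -
  have "prob {\<omega> \<in> space M. qform S B (Z d \<omega>) \<le> m / 2} \<le> V * (m + real (card S)) / (m / 2)\<^sup>2"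
    by (rule qform_deviation[OF B S _ m(1)]) (use m(2) in auto)
  thus ?thesis by (simp add: power_divide mult_ac)
qed

lemma indep_qform:
  assumes B: "\<And>g. g \<in> {1..G} \<Longrightarrow> B g \<subseteq> {1..h}" and disj: "disjoint_family_on B {1..G::nat}"
    and S: "S \<subseteq> {1..p}"
  shows "indep_vars (\<lambda>_. borel) (\<lambda>g \<omega>. qform S (B g) (Z d \<omega>)) {1..G}"
proof -
  have "indep_vars (\<lambda>_. borel) (\<lambda>g \<omega>. (\<lambda>y. qform S (B g) (\<lambda>i j. d j + y (j, i))) (restrict (\<lambda>e. \<xi> e \<omega>) (S \<times> B g))) {1..G}"
  proof (intro indep_blocks)
    show "S \<times> B g \<subseteq> {1..p} \<times> {1..h}" if "g \<in> {1..G}" for g using B[OF that] S by auto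
    show "disjoint_family_on (\<lambda>g. S \<times> B g) {1..G}" using disj by (auto simp: disjoint_family_on_def)
    show "(\<lambda>y. qform S (B g) (\<lambda>i j. d j + y (j, i))) \<in> borel_measurable (Pi\<^sub>M (S \<times> B g) (\<lambda>_. borel))" for g
      unfolding qform_def by (intro borel_measurable_sum borel_measurable_diff borel_measurable_times
        borel_measurable_power borel_measurable_divide borel_measurable_add borel_measurable_const measurable_component_singleton) auto
  qed
  thus ?thesis by (simp add: qform_def Z_def cong: sum.cong)
qed

section \<open>Medians over disjoint groups\<close>

definition groups :: "nat \<Rightarrow> (nat \<Rightarrow> nat set) \<Rightarrow> nat \<Rightarrow> bool" where
  "groups G B N \<longleftrightarrow> G \<ge> 1 \<and> N \<ge> 1 \<and> disjoint_family_on B {1..G} \<and> (\<forall>g\<in>{1..G}. B g \<subseteq> {1..h} \<and> card (B g) = N)"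

lemma groupsD:
  assumes "groups G B N" "g \<in> {1..G}"
  shows "B g \<subseteq> {1..h}" "B g \<noteq> {}" "card (B g) = N"
proof -
  show *: "B g \<subseteq> {1..h}" "card (B g) = N" using assms by (auto simp: groups_def)
  have "N \<ge> 1" using assms by (simp add: groups_def)
  thus "B g \<noteq> {}" using * by auto
qed

definition mom :: "nat \<Rightarrow> (nat \<Rightarrow> nat set) \<Rightarrow> nat set \<Rightarrow> (nat \<Rightarrow> nat \<Rightarrow> real) \<Rightarrow> real" where
  "mom G B S z = median G (\<lambda>g. qform S (B g) z)"

text \<open>The factor \<open>64\<close> makes a single group fail with probability at most
  \<open>(1/8)^2\<close>, and the majority bound turns this into \<open>(2/8) ^ G\<close>. In
  \<open>mom_lower\<close> the deviation is \<open>m / 2\<close>, hence \<open>256 = 4 * 64\<close>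
  there.\<close>

lemma mom_upper:
  assumes gr: "groups G B N" and S: "S \<subseteq> {1..p}" and x: "x > 0" and d: "\<And>j. j \<in> S \<Longrightarrow> d j = 0"
    and small: "64 * V * real (card S) \<le> x\<^sup>2"
  shows "prob {\<omega> \<in> space M. x < mom G B S (Z d \<omega>)} \<le> (1 / 4) ^ G"
proof -
  have G: "G \<ge> 1" using gr by (simp add: groups_def)
  have half: "(G + 1) div 2 \<le> c \<longleftrightarrow> G \<le> 2 * c" for c by linarith
  have ind: "indep_vars (\<lambda>_. borel) (\<lambda>g \<omega>. qform S (B g) (Z d \<omega>)) {1..G}"
    using gr by (intro indep_qform[OF _ _ S]) (auto simp: groups_def)
  have rvq: "random_variable borel (\<lambda>\<omega>. qform S (B g) (Z d \<omega>))" if "g \<in> {1..G}" for g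
    using ind that by (auto simp: indep_vars_def)
  have ev: "{\<omega> \<in> space M. x < qform S (B g) (Z d \<omega>)} \<in> events" if "g \<in> {1..G}" for g
  proof -
    note [measurable] = rvq[OF that]
    show ?thesis by measurable
  qed
  have "prob {\<omega> \<in> space M. x < mom G B S (Z d \<omega>)}
      \<le> prob {\<omega> \<in> space M. G \<le> 2 * card {g \<in> {1..G}. x < qform S (B g) (Z d \<omega>)}}"
  proof (rule finite_measure_mono)
    show "{\<omega> \<in> space M. G \<le> 2 * card {g \<in> {1..G}. x < qform S (B g) (Z d \<omega>)}} \<in> events"
    proof -
      have "{\<omega> \<in> space M. (G + 1) div 2 \<le> card {g \<in> {1..G}. x < qform S (B g) (Z d \<omega>)}} \<in> events"
        by (rule count_event[OF finite_atLeastAtMost ev])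
      thus ?thesis by (simp only: half)
    qed
  qed (use median_gt_card[OF G] in \<open>unfold mom_def, blast\<close>)
  also have "\<dots> \<le> (2 * (1 / 8)) ^ G"
  proof (rule indep_events_majority[OF G])
    have "indep_events (\<lambda>i. {w \<in> space M. x < qform S (B i) (Z d w)}) {1..G}"
      by (rule indep_eventsI_indep_vars[OF ind, of "\<lambda>_ v. x < v"]) auto
    thus "indep_events (\<lambda>g. {\<omega> \<in> space M. x < qform S (B g) (Z d \<omega>)}) {1..G}" .
    fix g assume g: "g \<in> {1..G}"
    have "prob {\<omega> \<in> space M. x < qform S (B g) (Z d \<omega>)} \<le> V * real (card S) / x\<^sup>2"
      by (rule qform_upper[OF groupsD(1,2)[OF gr g] S x d])
    also have "\<dots> \<le> (1 / 8)\<^sup>2" using small x by (simp add: divide_le_eq power2_eq_square)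
    finally show "prob {\<omega> \<in> space M. x < qform S (B g) (Z d \<omega>)} \<le> (1 / 8)\<^sup>2" .
  qed auto
  finally show ?thesis by simp
qed

lemma mom_lower:
  assumes gr: "groups G B N" and S: "S \<subseteq> {1..p}"
    and m: "m = real N * (\<Sum>j\<in>S. (d j)\<^sup>2)" "m > 0"
    and small: "256 * V * (m + real (card S)) \<le> m\<^sup>2"
  shows "prob {\<omega> \<in> space M. mom G B S (Z d \<omega>) \<le> m / 2} \<le> (1 / 4) ^ G"
proof -
  have G: "G \<ge> 1" using gr by (simp add: groups_def)
  have half: "(G + 1) div 2 \<le> c \<longleftrightarrow> G \<le> 2 * c" for c by linarith
  have ind: "indep_vars (\<lambda>_. borel) (\<lambda>g \<omega>. qform S (B g) (Z d \<omega>)) {1..G}"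
    using gr by (intro indep_qform[OF _ _ S]) (auto simp: groups_def)
  have rvq: "random_variable borel (\<lambda>\<omega>. qform S (B g) (Z d \<omega>))" if "g \<in> {1..G}" for g
    using ind that by (auto simp: indep_vars_def)
  have ev: "{\<omega> \<in> space M. qform S (B g) (Z d \<omega>) \<le> m / 2} \<in> events" if "g \<in> {1..G}" for g
  proof -
    note [measurable] = rvq[OF that]
    show ?thesis by measurable
  qed
  have "prob {\<omega> \<in> space M. mom G B S (Z d \<omega>) \<le> m / 2}
      \<le> prob {\<omega> \<in> space M. G \<le> 2 * card {g \<in> {1..G}. qform S (B g) (Z d \<omega>) \<le> m / 2}}"
  proof (rule finite_measure_mono)
    show "{\<omega> \<in> space M. G \<le> 2 * card {g \<in> {1..G}. qform S (B g) (Z d \<omega>) \<le> m / 2}} \<in> events"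
    proof -
      have "{\<omega> \<in> space M. (G + 1) div 2 \<le> card {g \<in> {1..G}. qform S (B g) (Z d \<omega>) \<le> m / 2}} \<in> events"
        by (rule count_event[OF finite_atLeastAtMost ev])
      thus ?thesis by (simp only: half)
    qed
  qed (use median_le_card[OF G] in \<open>unfold mom_def, blast\<close>)
  also have "\<dots> \<le> (2 * (1 / 8)) ^ G"
  proof (rule indep_events_majority[OF G])
    have "indep_events (\<lambda>i. {w \<in> space M. qform S (B i) (Z d w) \<le> m / 2}) {1..G}"
      by (rule indep_eventsI_indep_vars[OF ind, of "\<lambda>_ v. v \<le> m / 2"]) auto
    thus "indep_events (\<lambda>g. {\<omega> \<in> space M. qform S (B g) (Z d \<omega>) \<le> m / 2}) {1..G}" .
    fix g assume g: "g \<in> {1..G}"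
    have "prob {\<omega> \<in> space M. qform S (B g) (Z d \<omega>) \<le> m / 2} \<le> 4 * V * (m + real (card S)) / m\<^sup>2"
      by (rule qform_lower[OF groupsD(1,2)[OF gr g] S]) (use m groupsD(3)[OF gr g] in auto)
    also have "\<dots> \<le> (1 / 8)\<^sup>2" using small m by (simp add: divide_le_eq power2_eq_square)
    finally show "prob {\<omega> \<in> space M. qform S (B g) (Z d \<omega>) \<le> m / 2} \<le> (1 / 8)\<^sup>2" .
  qed auto
  finally show ?thesis by simp
qed

end

section \<open>Selection by an independent half sample\<close>

lemma borel_measurable_median_on:
  assumes "\<And>g. g \<in> {1..G} \<Longrightarrow> f g \<in> borel_measurable M" and G: "G \<ge> 1"
  shows "(\<lambda>\<omega>. median G (\<lambda>g. f g \<omega>)) \<in> borel_measurable M"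
proof -
  have "(\<lambda>\<omega>. median G (\<lambda>g. (if g \<in> {1..G} then f g else (\<lambda>_. 0)) \<omega>)) \<in> borel_measurable M"
    by (rule borel_measurable_median) (use assms in auto)
  also have "(\<lambda>\<omega>. median G (\<lambda>g. (if g \<in> {1..G} then f g else (\<lambda>_. 0)) \<omega>)) = (\<lambda>\<omega>. median G (\<lambda>g. f g \<omega>))"
    by (intro ext median_cong) simp
  finally show ?thesis .
qed

lemma sum_Un_le:
  fixes f :: "'i \<Rightarrow> real"
  assumes "finite A" "finite B" "\<And>x. f x \<ge> 0"
  shows "sum f (A \<union> B) \<le> sum f A + sum f B"
  using sum_Un[OF assms(1,2), of f] sum_nonneg[of "A \<inter> B" f] assms(3) by simp

context noise_array
begin

section \<open>The selected set as a random variable\<close>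

definition sel :: "nat set \<Rightarrow> real \<Rightarrow> (nat \<Rightarrow> real) \<Rightarrow> 'a \<Rightarrow> nat set" where
  "sel T a d \<omega> = {j \<in> {1..p}. a \<le> \<bar>\<Sum>i\<in>T. Z d \<omega> i j\<bar> / sqrt (card T)}"

text \<open>The same set written as a function of the noise in the columns of \<open>T\<close>
  alone; independence of disjoint blocks applies to this factorization.\<close>

definition sel_of :: "nat set \<Rightarrow> real \<Rightarrow> (nat \<Rightarrow> real) \<Rightarrow> (nat \<times> nat \<Rightarrow> real) \<Rightarrow> nat set" where
  "sel_of T a d y = {j \<in> {1..p}. a \<le> \<bar>\<Sum>i\<in>T. d j + y (j, i)\<bar> / sqrt (card T)}"

lemma sel_subset: "sel T a d \<omega> \<subseteq> {1..p}" by (auto simp: sel_def)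

lemma sel_eq_sel_of: "sel T a d \<omega> = sel_of T a d (restrict (\<lambda>e. \<xi> e \<omega>) ({1..p} \<times> T))"
proof -
  have "(\<Sum>i\<in>T. d j + restrict (\<lambda>e. \<xi> e \<omega>) ({1..p} \<times> T) (j, i)) = (\<Sum>i\<in>T. Z d \<omega> i j)" if "j \<in> {1..p}" for j
    using that by (intro sum.cong) (auto simp: Z_def)
  thus ?thesis unfolding sel_def sel_of_def by (intro Collect_cong conj_cong refl) (simp only:)
qed

lemma measurable_sel_of:
  "sel_of T a d \<in> measurable (PiM ({1..p} \<times> T) (\<lambda>_. borel)) (count_space (Pow {1..p}))"
proof (subst measurable_count_space_eq2, simp, intro conjI ballI)
  let ?M = "PiM ({1..p} \<times> T) (\<lambda>_. borel :: real measure)"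
  show "sel_of T a d \<in> space ?M \<rightarrow> Pow {1..p}" by (auto simp: sel_of_def)
  fix S assume S: "S \<in> Pow {1..p}"
  have f: "(\<lambda>y. \<bar>\<Sum>i\<in>T. d j + y (j, i)\<bar> / sqrt (card T)) \<in> borel_measurable ?M" if "j \<in> {1..p}" for j
    using that by (intro borel_measurable_divide borel_measurable_abs borel_measurable_sum borel_measurable_add
        borel_measurable_const measurable_component_singleton) auto
  have "sel_of T a d -` {S} \<inter> space ?M
      = {y \<in> space ?M. \<forall>j\<in>{1..p}. (j \<in> S) \<longleftrightarrow> a \<le> \<bar>\<Sum>i\<in>T. d j + y (j, i)\<bar> / sqrt (card T)}"
  proof -
    have "sel_of T a d y = S \<longleftrightarrow> (\<forall>j\<in>{1..p}. (j \<in> S) \<longleftrightarrow> a \<le> \<bar>\<Sum>i\<in>T. d j + y (j, i)\<bar> / sqrt (card T))" for y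
      unfolding sel_of_def using S by blast
    thus ?thesis by blast
  qed
  also have "\<dots> \<in> sets ?M"
  proof (rule sets.sets_Collect_finite_All)
    fix j assume j: "j \<in> {1..p}"
    note [measurable] = f[OF j]
    show "{y \<in> space ?M. (j \<in> S) \<longleftrightarrow> a \<le> \<bar>\<Sum>i\<in>T. d j + y (j, i)\<bar> / sqrt (card T)} \<in> sets ?M"
    proof (cases "j \<in> S")
      case True
      have "{y \<in> space ?M. a \<le> \<bar>\<Sum>i\<in>T. d j + y (j, i)\<bar> / sqrt (card T)} \<in> sets ?M" by measurable
      thus ?thesis by (simp only: True simp_thms)
    next
      case False
      have "{y \<in> space ?M. \<not> a \<le> \<bar>\<Sum>i\<in>T. d j + y (j, i)\<bar> / sqrt (card T)} \<in> sets ?M" by measurable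
      thus ?thesis by (simp only: False simp_thms)
    qed
  qed simp
  finally show "sel_of T a d -` {S} \<inter> space ?M \<in> sets ?M" .
qed

lemma measurable_restrict_xi:
  assumes "A \<subseteq> {1..p} \<times> {1..h}"
  shows "(\<lambda>\<omega>. restrict (\<lambda>e. \<xi> e \<omega>) A) \<in> measurable M (PiM A (\<lambda>_. borel))"
proof (rule measurable_restrict)
  fix e assume "e \<in> A"
  thus "random_variable borel (\<xi> e)" using assms by (intro std_noiseD(1)[OF noise]) auto
qed

lemma measurable_sel:
  assumes T: "T \<subseteq> {1..h}"
  shows "sel T a d \<in> measurable M (count_space (Pow {1..p}))"
proof -
  have "{1..p} \<times> T \<subseteq> {1..p} \<times> {1..h}" using T by auto
  from measurable_compose[OF measurable_restrict_xi[OF this] measurable_sel_of[of T a d]]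
  show ?thesis by (simp only: sel_eq_sel_of[symmetric])
qed

lemma sel_event:
  assumes T: "T \<subseteq> {1..h}"
  shows "{\<omega> \<in> space M. P (sel T a d \<omega>)} \<in> events"
proof -
  have "sel T a d -` {S \<in> Pow {1..p}. P S} \<inter> space M \<in> events"
    by (rule measurable_sets[OF measurable_sel[OF T]]) auto
  also have "sel T a d -` {S \<in> Pow {1..p}. P S} \<inter> space M = {\<omega> \<in> space M. P (sel T a d \<omega>)}"
    using sel_subset by blast
  finally show ?thesis .
qed

lemma integrable_sel:
  assumes T: "T \<subseteq> {1..h}"
  shows "integrable M (\<lambda>\<omega>. b (sel T a d \<omega>) :: real)"
proof (rule integrable_const_bound)
  show "(\<lambda>\<omega>. b (sel T a d \<omega>)) \<in> borel_measurable M"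
    by (rule measurable_compose[OF measurable_sel[OF T]]) simp
  show "AE \<omega> in M. norm (b (sel T a d \<omega>)) \<le> Max ((\<lambda>S. \<bar>b S\<bar>) ` Pow {1..p})"
    using sel_subset by (intro AE_I2) (auto intro!: Max_ge)
qed

text \<open>Conditioning by hand: the selected set has finitely many values and depends on the
  columns in \<open>T\<close> only, so on each event \<open>sel T a d \<omega> = S\<close> the
  probability of \<open>F S\<close> factors out, and the bounds \<open>b S\<close> average to an
  expectation.\<close>

lemma sel_mixture:
  assumes T: "T \<subseteq> {1..h}" and C: "C \<subseteq> {1..h}" "T \<inter> C = {}"
    and F: "\<And>S. S \<subseteq> {1..p} \<Longrightarrow> {y \<in> space (PiM ({1..p} \<times> C) (\<lambda>_. borel)). F S y} \<in> sets (PiM ({1..p} \<times> C) (\<lambda>_. borel))"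
    and b: "\<And>S. S \<subseteq> {1..p} \<Longrightarrow> prob {\<omega> \<in> space M. F S (restrict (\<lambda>e. \<xi> e \<omega>) ({1..p} \<times> C))} \<le> b S"
  shows "prob {\<omega> \<in> space M. F (sel T a d \<omega>) (restrict (\<lambda>e. \<xi> e \<omega>) ({1..p} \<times> C))}
    \<le> expectation (\<lambda>\<omega>. b (sel T a d \<omega>))"
proof -
  define X1 where "X1 = (\<lambda>\<omega>. restrict (\<lambda>e. \<xi> e \<omega>) ({1..p} \<times> T))"
  define X2 where "X2 = (\<lambda>\<omega>. restrict (\<lambda>e. \<xi> e \<omega>) ({1..p} \<times> C))"
  let ?M1 = "PiM ({1..p} \<times> T) (\<lambda>_. borel :: real measure)" and ?M2 = "PiM ({1..p} \<times> C) (\<lambda>_. borel :: real measure)"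
  have ind: "indep_var ?M1 X1 ?M2 X2"
    unfolding X1_def X2_def by (rule indep_var_restrict[OF indep]) (use T C in auto)
  have X2: "X2 \<in> measurable M ?M2"
    unfolding X2_def by (rule measurable_restrict_xi) (use C in auto)
  have X1: "X1 \<in> measurable M ?M1"
    unfolding X1_def by (rule measurable_restrict_xi) (use T in auto)
  have selX1: "sel T a d \<omega> = sel_of T a d (X1 \<omega>)" for \<omega> by (simp add: X1_def sel_eq_sel_of)
  have evF: "{\<omega> \<in> space M. F S (X2 \<omega>)} \<in> events" if "S \<subseteq> {1..p}" for S
  proof -
    have "X2 -` {y \<in> space ?M2. F S y} \<inter> space M \<in> events" by (rule measurable_sets[OF X2 F[OF that]])
    also have "X2 -` {y \<in> space ?M2. F S y} \<inter> space M = {\<omega> \<in> space M. F S (X2 \<omega>)}"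
      using measurable_space[OF X2] by auto
    finally show ?thesis .
  qed
  have evS: "{\<omega> \<in> space M. sel T a d \<omega> = S} \<in> events" for S by (rule sel_event[OF T])
  have prod: "prob {\<omega> \<in> space M. sel T a d \<omega> = S \<and> F S (X2 \<omega>)} \<le> b S * prob {\<omega> \<in> space M. sel T a d \<omega> = S}"
    if S: "S \<subseteq> {1..p}" for S
  proof -
    let ?A = "sel_of T a d -` {S} \<inter> space ?M1" and ?B = "{y \<in> space ?M2. F S y}"
    have A: "?A \<in> sets ?M1" by (rule measurable_sets[OF measurable_sel_of]) (use S in auto)
    have "prob ((\<lambda>x. (X1 x, X2 x)) -` (?A \<times> ?B) \<inter> space M) = prob (X1 -` ?A \<inter> space M) * prob (X2 -` ?B \<inter> space M)"
      by (rule indep_varD[OF ind A F[OF S]])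
    moreover have "(\<lambda>x. (X1 x, X2 x)) -` (?A \<times> ?B) \<inter> space M = {\<omega> \<in> space M. sel T a d \<omega> = S \<and> F S (X2 \<omega>)}"
      "X1 -` ?A \<inter> space M = {\<omega> \<in> space M. sel T a d \<omega> = S}" "X2 -` ?B \<inter> space M = {\<omega> \<in> space M. F S (X2 \<omega>)}"
      using measurable_space[OF X1] measurable_space[OF X2] by (auto simp: selX1)
    ultimately have "prob {\<omega> \<in> space M. sel T a d \<omega> = S \<and> F S (X2 \<omega>)}
        = prob {\<omega> \<in> space M. sel T a d \<omega> = S} * prob {\<omega> \<in> space M. F S (X2 \<omega>)}" by simp
    also have "\<dots> \<le> prob {\<omega> \<in> space M. sel T a d \<omega> = S} * b S"
      using b[OF S] by (intro mult_left_mono) (auto simp: X2_def)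
    finally show ?thesis by (simp add: mult.commute)
  qed
  have "{\<omega> \<in> space M. F (sel T a d \<omega>) (X2 \<omega>)} = (\<Union>S\<in>Pow {1..p}. {\<omega> \<in> space M. sel T a d \<omega> = S \<and> F S (X2 \<omega>)})"
    using sel_subset by auto
  also have "prob \<dots> \<le> (\<Sum>S\<in>Pow {1..p}. prob {\<omega> \<in> space M. sel T a d \<omega> = S \<and> F S (X2 \<omega>)})"
  proof (rule finite_measure_subadditive_finite)
    show "(\<lambda>S. {\<omega> \<in> space M. sel T a d \<omega> = S \<and> F S (X2 \<omega>)}) ` Pow {1..p} \<subseteq> events"
      using evS evF by (auto intro!: sets.sets_Collect_conj)
  qed simp
  also have "\<dots> \<le> (\<Sum>S\<in>Pow {1..p}. b S * prob {\<omega> \<in> space M. sel T a d \<omega> = S})"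
    by (intro sum_mono prod) auto
  also have "\<dots> = expectation (\<lambda>\<omega>. \<Sum>S\<in>Pow {1..p}. b S * indicator {\<omega> \<in> space M. sel T a d \<omega> = S} \<omega>)"
    using evS by (subst Bochner_Integration.integral_sum) (auto simp: less_top[symmetric])
  also have "\<dots> = expectation (\<lambda>\<omega>. b (sel T a d \<omega>))"
  proof (rule Bochner_Integration.integral_cong[OF refl])
    fix \<omega> assume "\<omega> \<in> space M"
    hence "(\<Sum>S\<in>Pow {1..p}. b S * indicator {\<omega> \<in> space M. sel T a d \<omega> = S} \<omega>)
        = (\<Sum>S\<in>Pow {1..p}. if sel T a d \<omega> = S then b S else 0)"
      by (intro sum.cong) auto
    thus "(\<Sum>S\<in>Pow {1..p}. b S * indicator {\<omega> \<in> space M. sel T a d \<omega> = S} \<omega>) = b (sel T a d \<omega>)"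
      using sel_subset by (simp add: sum.delta)
  qed
  finally show ?thesis by (simp add: X2_def)
qed

lemma sel_mom_mixture:
  assumes T: "T \<subseteq> {1..h}" and gr: "groups G B N" and disj: "\<And>g. g \<in> {1..G} \<Longrightarrow> B g \<inter> T = {}"
    and P: "{x :: real. P x} \<in> sets borel"
    and b: "\<And>S. S \<subseteq> {1..p} \<Longrightarrow> prob {\<omega> \<in> space M. P (mom G B S (Z d \<omega>))} \<le> b S"
  shows "prob {\<omega> \<in> space M. P (mom G B (sel T a d \<omega>) (Z d \<omega>))} \<le> expectation (\<lambda>\<omega>. b (sel T a d \<omega>))"
proof -
  define C where "C = {1..h} - T"
  have BC: "B g \<subseteq> C" if "g \<in> {1..G}" for g using disj[OF that] groupsD(1)[OF gr that] by (auto simp: C_def)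
  define F where "F = (\<lambda>S y. P (mom G B S (\<lambda>i j. d j + y (j, i))))"
  have eq: "F S (restrict (\<lambda>e. \<xi> e \<omega>) ({1..p} \<times> C)) = P (mom G B S (Z d \<omega>))" if "S \<subseteq> {1..p}" for S \<omega>
  proof -
    have "mom G B S (\<lambda>i j. d j + restrict (\<lambda>e. \<xi> e \<omega>) ({1..p} \<times> C) (j, i)) = mom G B S (Z d \<omega>)"
      unfolding mom_def
    proof (rule median_cong)
      fix g assume "g \<in> {1..G}"
      thus "qform S (B g) (\<lambda>i j. d j + restrict (\<lambda>e. \<xi> e \<omega>) ({1..p} \<times> C) (j, i)) = qform S (B g) (Z d \<omega>)"
        unfolding qform_def Z_def using BC that by (intro sum.cong arg_cong2[where f = "(-)"] arg_cong2[where f = "(*)"]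
          arg_cong2[where f = "(/)"] arg_cong2[where f = "power"] refl) auto
    qed
    thus ?thesis by (simp add: F_def)
  qed
  have "prob {\<omega> \<in> space M. F (sel T a d \<omega>) (restrict (\<lambda>e. \<xi> e \<omega>) ({1..p} \<times> C))} \<le> expectation (\<lambda>\<omega>. b (sel T a d \<omega>))"
  proof (rule sel_mixture[OF T])
    fix S assume S: "S \<subseteq> {1..p}"
    let ?M = "PiM ({1..p} \<times> C) (\<lambda>_. borel :: real measure)"
    have "(\<lambda>y. mom G B S (\<lambda>i j. d j + y (j, i))) \<in> borel_measurable ?M"
      unfolding mom_def
    proof (rule borel_measurable_median_on)
      show "G \<ge> 1" using gr by (simp add: groups_def)
      fix g assume g: "g \<in> {1..G}"
      show "(\<lambda>y. qform S (B g) (\<lambda>i j. d j + y (j, i))) \<in> borel_measurable ?M"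
        unfolding qform_def using S BC[OF g]
        by (intro borel_measurable_sum borel_measurable_diff borel_measurable_times
            borel_measurable_power borel_measurable_divide borel_measurable_add borel_measurable_const measurable_component_singleton) auto
    qed
    from measurable_sets[OF this P]
    show "{y \<in> space ?M. F S y} \<in> sets ?M"
      by (simp add: F_def vimage_def Int_def conj_commute)
    show "prob {\<omega> \<in> space M. F S (restrict (\<lambda>e. \<xi> e \<omega>) ({1..p} \<times> C))} \<le> b S"
      using b[OF S] by (simp only: eq[OF S])
  qed (auto simp: C_def)
  thus ?thesis by (simp only: eq[OF sel_subset])
qed

section \<open>Noise in the selecting half sample\<close>

definition H1 :: real where "H1 = H * \<alpha> powr \<alpha> + 2 * exp (2 * \<alpha>\<^sup>2)"

text \<open>Two bounds for two purposes. The power tail holds uniformly in the size of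
  \<open>T\<close> and controls expected counts. The second one, Gaussian up to a term of order
  \<open>1 / card T\<close>, is sharp enough at large scales to be raised to the power
  \<open>s\<close>.\<close>

lemma avg_tail:
  assumes T: "T \<subseteq> {1..h}" "T \<noteq> {}" and j: "j \<in> {1..p}" and a: "a > 1"
  shows "prob {\<omega> \<in> space M. a \<le> \<bar>avg T j \<omega>\<bar>} \<le> H1 * a powr - \<alpha>"
    and "prob {\<omega> \<in> space M. a \<le> \<bar>avg T j \<omega>\<bar>} \<le> H * a powr \<alpha> / real (card T) + 2 * exp (- a\<^sup>2 / 32)"
proof -
  have fin: "finite T" using T finite_subset by blast
  have sub: "{j} \<times> T \<subseteq> {1..p} \<times> {1..h}" using T j by auto
  have card: "card T > 0" using fin T by (simp add: card_gt_0_iff)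
  have eq: "{\<omega> \<in> space M. a \<le> \<bar>avg T j \<omega>\<bar>}
      = {\<omega> \<in> space M. a * sqrt (card ({j} \<times> T)) \<le> \<bar>\<Sum>e\<in>{j} \<times> T. \<xi> e \<omega>\<bar>}"
    using card by (auto simp: avg_def sum_single_row card_cartesian_product le_divide_eq)
  show "prob {\<omega> \<in> space M. a \<le> \<bar>avg T j \<omega>\<bar>} \<le> H1 * a powr - \<alpha>"
    unfolding eq H1_def
    by (rule indep_sum_tail_power[OF _ _ indep_vars_subset[OF indep sub] noise[OF subsetD[OF sub]]])
      (use fin T alpha H a in auto)
  have "prob {\<omega> \<in> space M. a \<le> \<bar>avg T j \<omega>\<bar>} \<le> H * a powr \<alpha> / real (card ({j} \<times> T)) + 2 * exp (- a\<^sup>2 / 32)"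
    unfolding eq
    by (rule indep_sum_tail_gauss[OF _ _ indep_vars_subset[OF indep sub] noise[OF subsetD[OF sub]]])
      (use fin T alpha H a in auto)
  thus "prob {\<omega> \<in> space M. a \<le> \<bar>avg T j \<omega>\<bar>} \<le> H * a powr \<alpha> / real (card T) + 2 * exp (- a\<^sup>2 / 32)"
    by (simp add: card_cartesian_product)
qed

lemma avg_event:
  assumes T: "T \<subseteq> {1..h}" "T \<noteq> {}" and j: "j \<in> {1..p}"
  shows "{\<omega> \<in> space M. a \<le> \<bar>avg T j \<omega>\<bar>} \<in> events"
proof -
  note [measurable] = avg_moments(1)[OF assms]
  show ?thesis by measurable
qed

definition exceed :: "nat set \<Rightarrow> real \<Rightarrow> 'a \<Rightarrow> nat set" where
  "exceed T a \<omega> = {j \<in> {1..p}. a \<le> \<bar>avg T j \<omega>\<bar>}"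

text \<open>Two weights are used later: \<open>1\<close> counts the false selections, and
  \<open>(d j)^2\<close> measures the signal energy that may be missed because of noise.\<close>

lemma expectation_weight_exceed:
  assumes T: "T \<subseteq> {1..h}" "T \<noteq> {}" and a: "a > 1" and w: "\<And>j. w j \<ge> 0"
  shows "integrable M (\<lambda>\<omega>. \<Sum>j\<in>exceed T a \<omega>. w j)"
    and "expectation (\<lambda>\<omega>. \<Sum>j\<in>exceed T a \<omega>. w j) \<le> H1 * a powr - \<alpha> * (\<Sum>j=1..p. w j)"
proof -
  have eq: "(\<Sum>j\<in>exceed T a \<omega>. w j) = (\<Sum>j=1..p. w j * indicator {\<omega> \<in> space M. a \<le> \<bar>avg T j \<omega>\<bar>} \<omega>)"
    if "\<omega> \<in> space M" for \<omega>
  proof -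
    have "(\<Sum>j\<in>exceed T a \<omega>. w j) = (\<Sum>j=1..p. if a \<le> \<bar>avg T j \<omega>\<bar> then w j else 0)"
      unfolding exceed_def by (simp add: sum.inter_filter[symmetric])
    also have "\<dots> = (\<Sum>j=1..p. w j * indicator {\<omega> \<in> space M. a \<le> \<bar>avg T j \<omega>\<bar>} \<omega>)"
      using that by (intro sum.cong) auto
    finally show ?thesis .
  qed
  have int: "integrable M (\<lambda>\<omega>. w j * indicator {\<omega> \<in> space M. a \<le> \<bar>avg T j \<omega>\<bar>} \<omega>)" if "j \<in> {1..p}" for j
    using avg_event[OF T that] by (auto simp: less_top[symmetric])
  have "integrable M (\<lambda>\<omega>. \<Sum>j=1..p. w j * indicator {\<omega> \<in> space M. a \<le> \<bar>avg T j \<omega>\<bar>} \<omega>)"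
    by (intro Bochner_Integration.integrable_sum int) auto
  thus "integrable M (\<lambda>\<omega>. \<Sum>j\<in>exceed T a \<omega>. w j)"
    by (subst Bochner_Integration.integrable_cong[OF refl eq]) auto
  have "expectation (\<lambda>\<omega>. \<Sum>j\<in>exceed T a \<omega>. w j)
      = expectation (\<lambda>\<omega>. \<Sum>j=1..p. w j * indicator {\<omega> \<in> space M. a \<le> \<bar>avg T j \<omega>\<bar>} \<omega>)"
    by (rule Bochner_Integration.integral_cong[OF refl eq])
  also have "\<dots> = (\<Sum>j=1..p. w j * prob {\<omega> \<in> space M. a \<le> \<bar>avg T j \<omega>\<bar>})"
    using int avg_event[OF T] by (subst Bochner_Integration.integral_sum) auto
  also have "\<dots> \<le> (\<Sum>j=1..p. w j * (H1 * a powr - \<alpha>))"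
    using w by (intro sum_mono mult_left_mono avg_tail(1)[OF T _ a]) auto
  finally show "expectation (\<lambda>\<omega>. \<Sum>j\<in>exceed T a \<omega>. w j) \<le> H1 * a powr - \<alpha> * (\<Sum>j=1..p. w j)"
    by (simp add: sum_distrib_left mult_ac)
qed

lemma sum_Z_over_sqrt:
  assumes "card T > 0"
  shows "(\<Sum>i\<in>T. Z d \<omega> i j) / sqrt (card T) = sqrt (card T) * d j + avg T j \<omega>"
proof -
  have "real (card T) / sqrt (card T) = sqrt (card T)" by (simp add: real_div_sqrt)
  hence "real (card T) * d j / sqrt (card T) = sqrt (card T) * d j" by (metis times_divide_eq_left)
  thus ?thesis by (simp add: Z_def sum.distrib add_divide_distrib avg_def)
qed

lemma sel_null:
  assumes "card T > 0" "\<And>j. j \<in> {1..p} \<Longrightarrow> d j = 0"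
  shows "sel T a d \<omega> = exceed T a \<omega>"
proof -
  have "\<bar>\<Sum>i\<in>T. Z d \<omega> i j\<bar> / sqrt (card T) = \<bar>avg T j \<omega>\<bar>" if "j \<in> {1..p}" for j
    using sum_Z_over_sqrt[OF assms(1), of d \<omega> j] assms(2)[OF that] by (metis abs_divide abs_of_nonneg add_0 mult_zero_right of_nat_0_le_iff real_sqrt_ge_zero)
  thus ?thesis by (auto simp: sel_def exceed_def)
qed

text \<open>Independence across coordinates turns the single tail into an \<open>s\<close>-th power.
  This is what survives a union over all large scales, where Markov's inequality for the count would
  not.\<close>

lemma card_exceed_tail:
  assumes T: "T \<subseteq> {1..h}" "T \<noteq> {}" and a: "a > 1"
  shows "prob {\<omega> \<in> space M. s \<le> card (exceed T a \<omega>)}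
    \<le> real (p choose s) * (H * a powr \<alpha> / real (card T) + 2 * exp (- a\<^sup>2 / 32)) ^ s"
proof -
  have ind: "indep_vars (\<lambda>_. borel) (\<lambda>j \<omega>. \<bar>avg T j \<omega>\<bar>) {1..p}"
    by (rule indep_avg_compose[OF T(1)]) auto
  have "indep_events (\<lambda>j. {\<omega> \<in> space M. a \<le> \<bar>avg T j \<omega>\<bar>}) {1..p}"
    using indep_eventsI_indep_vars[OF ind, of "\<lambda>_ v. a \<le> v"] by auto
  from indep_events_count[OF _ this avg_tail(2)[OF T _ a], of s] show ?thesis
    by (simp add: exceed_def)
qed

text \<open>Coordinates whose signal is at least twice the selection threshold and whose noise in the
  selecting half sample stays below it.\<close>

definition clear :: "nat set \<Rightarrow> real \<Rightarrow> (nat \<Rightarrow> real) \<Rightarrow> 'a \<Rightarrow> nat set" where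
  "clear T a d \<omega> = {j \<in> {1..p}. 2 * a \<le> sqrt (card T) * \<bar>d j\<bar> \<and> \<bar>avg T j \<omega>\<bar> < a}"

lemma clear_subset_sel:
  assumes "card T > 0"
  shows "clear T a d \<omega> \<subseteq> sel T a d \<omega>"
proof
  fix j assume j: "j \<in> clear T a d \<omega>"
  have "\<bar>\<Sum>i\<in>T. Z d \<omega> i j\<bar> / sqrt (card T) = \<bar>sqrt (card T) * d j + avg T j \<omega>\<bar>"
    using sum_Z_over_sqrt[OF assms, of d \<omega> j] by (metis abs_divide abs_of_nonneg of_nat_0_le_iff real_sqrt_ge_zero)
  moreover have "2 * a \<le> \<bar>sqrt (card T) * d j\<bar>" "\<bar>avg T j \<omega>\<bar> < a"
    using j by (auto simp: clear_def abs_mult)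
  ultimately show "j \<in> sel T a d \<omega>" using j by (auto simp: sel_def clear_def)
qed

lemma clear_signal_event:
  assumes T: "T \<subseteq> {1..h}" "T \<noteq> {}"
  shows "{\<omega> \<in> space M. (\<Sum>j\<in>clear T a d \<omega>. (d j)\<^sup>2) < c} \<in> events"
proof -
  define J where "J = {j \<in> {1..p}. 2 * a \<le> sqrt (card T) * \<bar>d j\<bar>}"
  have eq: "(\<Sum>j\<in>clear T a d \<omega>. (d j)\<^sup>2) = (\<Sum>j\<in>J. (d j)\<^sup>2 * of_bool (\<bar>avg T j \<omega>\<bar> < a))" for \<omega>
  proof -
    have "clear T a d \<omega> = {j \<in> J. \<bar>avg T j \<omega>\<bar> < a}" by (auto simp: clear_def J_def)
    moreover have "finite J" by (simp add: J_def)
    moreover have "(\<Sum>j\<in>J. (d j)\<^sup>2 * of_bool (\<bar>avg T j \<omega>\<bar> < a))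
        = (\<Sum>j\<in>J. if \<bar>avg T j \<omega>\<bar> < a then (d j)\<^sup>2 else 0)"
      by (intro sum.cong) auto
    ultimately show ?thesis by (simp only: sum.inter_filter)
  qed
  have "(\<lambda>\<omega>. (d j)\<^sup>2 * of_bool (\<bar>avg T j \<omega>\<bar> < a)) \<in> borel_measurable M" if "j \<in> J" for j
  proof -
    note [measurable] = avg_moments(1)[OF T, of j]
    have "j \<in> {1..p}" using that by (simp add: J_def)
    thus ?thesis by measurable
  qed
  hence "(\<lambda>\<omega>. \<Sum>j\<in>clear T a d \<omega>. (d j)\<^sup>2) \<in> borel_measurable M"
    unfolding eq by (rule borel_measurable_sum)
  from borel_measurable_less[OF this borel_measurable_const[of c]] show ?thesis by simp
qed

text \<open>The energy \<open>D\<close> sits on three kinds of coordinates: clear ones, noisy ones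
  (\<open>exceed\<close>), and nonzero ones too small to be clear (\<open>L\<close>). There are at
  most \<open>s\<close> of the last kind with energy at most \<open>4 * a^2 / N\<close> each,
  together at most \<open>D / 4\<close>. If the clear part is below \<open>D / 2\<close>, the noisy
  part is therefore at least \<open>D / 4\<close>, and Markov's inequality applies to it.\<close>

lemma clear_signal:
  assumes T: "T \<subseteq> {1..h}" "T \<noteq> {}" and a: "a > 1"
    and D: "D = (\<Sum>j=1..p. (d j)\<^sup>2)" "D > 0" and s: "norm0 p d \<le> s" and large: "16 * real s * a\<^sup>2 \<le> real (card T) * D"
  shows "prob {\<omega> \<in> space M. (\<Sum>j\<in>clear T a d \<omega>. (d j)\<^sup>2) < D / 2} \<le> 4 * (H1 * a powr - \<alpha>)"
proof -
  have fin: "finite T" using T finite_subset by blast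
  define N where "N = real (card T)"
  have N: "N > 0" using fin T by (simp add: N_def card_gt_0_iff)
  have "prob {\<omega> \<in> space M. (\<Sum>j\<in>clear T a d \<omega>. (d j)\<^sup>2) < D / 2}
      \<le> expectation (\<lambda>\<omega>. \<Sum>j\<in>exceed T a \<omega>. (d j)\<^sup>2) / (D / 4)"
  proof (rule prob_le_markov)
    show "integrable M (\<lambda>\<omega>. \<Sum>j\<in>exceed T a \<omega>. (d j)\<^sup>2)"
      by (rule expectation_weight_exceed(1)[OF T a]) simp
    fix \<omega> assume less: "(\<Sum>j\<in>clear T a d \<omega>. (d j)\<^sup>2) < D / 2"
    define L where "L = {j \<in> {1..p}. d j \<noteq> 0 \<and> sqrt N * \<bar>d j\<bar> < 2 * a}"
    have "D \<le> (\<Sum>j\<in>clear T a d \<omega> \<union> exceed T a \<omega> \<union> L. (d j)\<^sup>2)"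
    proof -
      have "D = (\<Sum>j\<in>{j \<in> {1..p}. d j \<noteq> 0}. (d j)\<^sup>2)" unfolding D(1) by (rule sum.mono_neutral_right) auto
      also have "\<dots> \<le> (\<Sum>j\<in>clear T a d \<omega> \<union> exceed T a \<omega> \<union> L. (d j)\<^sup>2)"
        by (rule sum_mono2) (auto simp: clear_def exceed_def L_def N_def)
      finally show ?thesis .
    qed
    also have "\<dots> \<le> (\<Sum>j\<in>clear T a d \<omega> \<union> exceed T a \<omega>. (d j)\<^sup>2) + (\<Sum>j\<in>L. (d j)\<^sup>2)"
      by (rule sum_Un_le) (auto simp: clear_def exceed_def L_def)
    also have "\<dots> \<le> (\<Sum>j\<in>clear T a d \<omega>. (d j)\<^sup>2) + (\<Sum>j\<in>exceed T a \<omega>. (d j)\<^sup>2) + (\<Sum>j\<in>L. (d j)\<^sup>2)"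
      by (intro add_mono order_refl sum_Un_le) (auto simp: clear_def exceed_def L_def)
    also have "(\<Sum>j\<in>L. (d j)\<^sup>2) \<le> (\<Sum>j\<in>L. 4 * a\<^sup>2 / N)"
    proof (rule sum_mono)
      fix j assume j: "j \<in> L"
      have "(sqrt N * \<bar>d j\<bar>)\<^sup>2 \<le> (2 * a)\<^sup>2" using j N by (intro power_mono) (auto simp: L_def)
      thus "(d j)\<^sup>2 \<le> 4 * a\<^sup>2 / N" using N by (simp add: power_mult_distrib field_simps)
    qed
    also have "\<dots> \<le> D / 4"
    proof -
      have "card L \<le> s"
      proof -
        have "card L \<le> norm0 p d" unfolding norm0_def L_def by (intro card_mono) auto
        thus ?thesis using s by simp
      qed
      hence "real (card L) * (4 * a\<^sup>2 / N) \<le> real s * (4 * a\<^sup>2 / N)"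
        using N by (intro mult_right_mono) auto
      also have "\<dots> \<le> D / 4" using large N by (simp add: N_def[symmetric] field_simps)
      finally show ?thesis by simp
    qed
    finally show "D / 4 \<le> (\<Sum>j\<in>exceed T a \<omega>. (d j)\<^sup>2)" using less by simp
  qed (use D in \<open>auto intro: sum_nonneg\<close>)
  also have "\<dots> \<le> (H1 * a powr - \<alpha> * D) / (D / 4)"
    using expectation_weight_exceed(2)[OF T a, of "\<lambda>j. (d j)\<^sup>2"] D by (intro divide_right_mono) auto
  also have "\<dots> = 4 * (H1 * a powr - \<alpha>)" using D by simp
  finally show ?thesis .
qed

text \<open>Outside the support of \<open>d\<close> the selecting average is pure noise, so an
  excess over \<open>s\<close> is an excess of \<open>exceed\<close>, whose expected size is
  known.\<close>

lemma sel_size: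
  assumes T: "T \<subseteq> {1..h}" "T \<noteq> {}" and a: "a > 1" and s: "norm0 p d \<le> s" and k: "k > 0"
  shows "prob {\<omega> \<in> space M. real s + k < real (card (sel T a d \<omega>))} \<le> real p * (H1 * a powr - \<alpha>) / k"
proof -
  have "finite T" using T finite_subset by blast
  hence card: "card T > 0" using T by (simp add: card_gt_0_iff)
  have "prob {\<omega> \<in> space M. real s + k < real (card (sel T a d \<omega>))}
      \<le> expectation (\<lambda>\<omega>. \<Sum>j\<in>exceed T a \<omega>. 1 :: real) / k"
  proof (rule prob_le_markov)
    show "integrable M (\<lambda>\<omega>. \<Sum>j\<in>exceed T a \<omega>. 1 :: real)"
      by (rule expectation_weight_exceed(1)[OF T a]) simp
    fix \<omega> assume less: "real s + k < real (card (sel T a d \<omega>))"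
    have "sel T a d \<omega> \<subseteq> {j \<in> {1..p}. d j \<noteq> 0} \<union> exceed T a \<omega>"
    proof
      fix j assume j: "j \<in> sel T a d \<omega>"
      have "\<bar>\<Sum>i\<in>T. Z d \<omega> i j\<bar> / sqrt (card T) = \<bar>sqrt (card T) * d j + avg T j \<omega>\<bar>"
        using sum_Z_over_sqrt[OF card, of d \<omega> j] by (metis abs_divide abs_of_nonneg of_nat_0_le_iff real_sqrt_ge_zero)
      thus "j \<in> {j \<in> {1..p}. d j \<noteq> 0} \<union> exceed T a \<omega>" using j by (auto simp: sel_def exceed_def)
    qed
    hence "card (sel T a d \<omega>) \<le> card ({j \<in> {1..p}. d j \<noteq> 0} \<union> exceed T a \<omega>)"
      by (intro card_mono) (auto simp: exceed_def)
    also have "\<dots> \<le> s + card (exceed T a \<omega>)"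
      using card_Un_le[of "{j \<in> {1..p}. d j \<noteq> 0}" "exceed T a \<omega>"] s unfolding norm0_def by linarith
    finally show "k \<le> (\<Sum>j\<in>exceed T a \<omega>. 1 :: real)" using less by simp
  qed (use k in auto)
  also have "\<dots> \<le> (H1 * a powr - \<alpha> * real p) / k"
    using expectation_weight_exceed(2)[OF T a, of "\<lambda>j. 1"] k by (intro divide_right_mono) auto
  finally show ?thesis by (simp add: mult_ac)
qed

end

section \<open>Error bounds of the component statistics\<close>

text \<open>Chebyshev's bound for a lower deviation has this shape; monotonicity lets the guaranteed
  lower bound \<open>m0\<close> replace the actual mean \<open>m\<close>.\<close>

lemma ratio_antimono:
  fixes m m0 k :: real
  assumes "0 < m0" "m0 \<le> m" "0 \<le> k"
  shows "(m + k) / m\<^sup>2 \<le> (m0 + k) / m0\<^sup>2"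
proof -
  have "1 / m \<le> 1 / m0" using assms by (intro divide_left_mono) auto
  moreover have "k / m\<^sup>2 \<le> k / m0\<^sup>2" using assms by (intro divide_left_mono power_mono mult_pos_pos) auto
  moreover have "(m + k) / m\<^sup>2 = 1 / m + k / m\<^sup>2" if "m > 0" for m
    using that by (simp add: add_divide_distrib power2_eq_square)
  ultimately show ?thesis using assms by simp
qed

definition A1 :: "nat \<Rightarrow> real \<Rightarrow> (nat \<Rightarrow> nat \<Rightarrow> real) \<Rightarrow> real" where
  "A1 p a z = (\<Sum>j=1..p. ((z 1 j)\<^sup>2 - 1) * of_bool (a \<le> \<bar>z 1 j\<bar>))"

context noise_array
begin

section \<open>Statistics on independently selected coordinates\<close>

lemma mom_one: "mom (Suc 0) B S z = qform S (B 1) z"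
  by (simp add: mom_def)

lemma expectation_card_exceed:
  assumes T: "T \<subseteq> {1..h}" "T \<noteq> {}" and a: "a > 1"
  shows "expectation (\<lambda>\<omega>. real (card (exceed T a \<omega>))) \<le> real p * (H1 * a powr - \<alpha>)"
  using expectation_weight_exceed(2)[OF T a, of "\<lambda>_. 1"] by (simp add: mult_ac)

text \<open>For a single group the conditional Chebyshev bound is linear in the number of selected
  coordinates, so the expected number of false selections is all that enters.\<close>

lemma sparse_null_single:
  assumes T: "T \<subseteq> {1..h}" "T \<noteq> {}" and gr: "groups 1 B N" and disj: "B 1 \<inter> T = {}"
    and a: "a > 1" and r: "r > 0" and d: "\<And>j. j \<in> {1..p} \<Longrightarrow> d j = 0"
  shows "prob {\<omega> \<in> space M. r < mom 1 B (sel T a d \<omega>) (Z d \<omega>)} \<le> V * (real p * (H1 * a powr - \<alpha>)) / r\<^sup>2"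
proof -
  have card: "card T > 0" using T finite_subset[OF T(1)] by (simp add: card_gt_0_iff)
  have sn: "sel T a d \<omega> = exceed T a \<omega>" for \<omega> by (rule sel_null[OF card d])
  have "prob {\<omega> \<in> space M. r < mom 1 B (sel T a d \<omega>) (Z d \<omega>)}
      \<le> expectation (\<lambda>\<omega>. V * real (card (sel T a d \<omega>)) / r\<^sup>2)"
  proof (rule sel_mom_mixture[OF T(1) gr, where P = "\<lambda>x. r < x"])
    fix S assume S: "S \<subseteq> {1..p}"
    have "prob {\<omega> \<in> space M. r < qform S (B 1) (Z d \<omega>)} \<le> V * real (card S) / r\<^sup>2"
      by (rule qform_upper[OF groupsD(1,2)[OF gr] S r]) (use d S in auto)
    thus "prob {\<omega> \<in> space M. r < mom 1 B S (Z d \<omega>)} \<le> V * real (card S) / r\<^sup>2"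
      by (simp add: mom_one)
  qed (use disj in auto)
  also have "\<dots> = V * expectation (\<lambda>\<omega>. real (card (exceed T a \<omega>))) / r\<^sup>2"
    by (simp add: sn)
  also have "\<dots> \<le> V * (real p * (H1 * a powr - \<alpha>)) / r\<^sup>2"
    by (intro divide_right_mono mult_left_mono expectation_card_exceed[OF T a]) (use V_pos in auto)
  finally show ?thesis .
qed

lemma expectation_sel_split:
  assumes T: "T \<subseteq> {1..h}" and q: "0 \<le> q"
  shows "expectation (\<lambda>\<omega>. if good (sel T a d \<omega>) then q else 1) \<le> q + prob {\<omega> \<in> space M. \<not> good (sel T a d \<omega>)}"
proof -
  have ev: "{\<omega> \<in> space M. \<not> good (sel T a d \<omega>)} \<in> events" by (rule sel_event[OF T])
  have "expectation (\<lambda>\<omega>. if good (sel T a d \<omega>) then q else 1)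
      \<le> expectation (\<lambda>\<omega>. q + indicator {\<omega> \<in> space M. \<not> good (sel T a d \<omega>)} \<omega>)"
  proof (rule integral_mono)
    show "integrable M (\<lambda>\<omega>. if good (sel T a d \<omega>) then q else 1)"
      by (rule integrable_sel[OF T, of "\<lambda>S. if good S then q else 1"])
    show "integrable M (\<lambda>\<omega>. q + indicator {\<omega> \<in> space M. \<not> good (sel T a d \<omega>)} \<omega>)"
      using ev by (auto simp: less_top[symmetric])
  qed (use q in auto)
  also have "\<dots> = q + prob {\<omega> \<in> space M. \<not> good (sel T a d \<omega>)}"
    using ev by (subst Bochner_Integration.integral_add) (auto simp: prob_space less_top[symmetric])
  finally show ?thesis .
qed

text \<open>The exponentially small error of the median requires fewer than \<open>s\<close>
  selected coordinates; the other case is absorbed by \<open>card_exceed_tail\<close>.\<close>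

lemma sparse_null_groups:
  assumes T: "T \<subseteq> {1..h}" "T \<noteq> {}" and gr: "groups G B N" and disj: "\<And>g. g \<in> {1..G} \<Longrightarrow> B g \<inter> T = {}"
    and a: "a > 1" and r: "r > 0" "64 * V * real s \<le> r\<^sup>2" and d: "\<And>j. j \<in> {1..p} \<Longrightarrow> d j = 0"
  shows "prob {\<omega> \<in> space M. r < mom G B (sel T a d \<omega>) (Z d \<omega>)}
    \<le> (1 / 4) ^ G + real (p choose s) * (H * a powr \<alpha> / real (card T) + 2 * exp (- a\<^sup>2 / 32)) ^ s"
proof -
  have card: "card T > 0" using T finite_subset[OF T(1)] by (simp add: card_gt_0_iff)
  have sn: "sel T a d \<omega> = exceed T a \<omega>" for \<omega> by (rule sel_null[OF card d])
  have "prob {\<omega> \<in> space M. r < mom G B (sel T a d \<omega>) (Z d \<omega>)}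
      \<le> expectation (\<lambda>\<omega>. if card (sel T a d \<omega>) < s then (1 / 4) ^ G else 1)"
  proof (rule sel_mom_mixture[OF T(1) gr disj, where P = "\<lambda>x. r < x"])
    fix S assume S: "S \<subseteq> {1..p}"
    show "prob {\<omega> \<in> space M. r < mom G B S (Z d \<omega>)} \<le> (if card S < s then (1 / 4) ^ G else 1)"
    proof (cases "card S < s")
      case True
      have "64 * V * real (card S) \<le> 64 * V * real s" using True V_pos by (intro mult_left_mono) auto
      hence "prob {\<omega> \<in> space M. r < mom G B S (Z d \<omega>)} \<le> (1 / 4) ^ G"
        by (intro mom_upper[OF gr S r(1)]) (use d S r in auto)
      thus ?thesis using True by simp
    qed simp
  qed auto
  also have "\<dots> \<le> (1 / 4) ^ G + prob {\<omega> \<in> space M. \<not> card (sel T a d \<omega>) < s}"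
    by (rule expectation_sel_split[OF T(1)]) simp
  also have "{\<omega> \<in> space M. \<not> card (sel T a d \<omega>) < s} = {\<omega> \<in> space M. s \<le> card (exceed T a \<omega>)}"
    by (simp add: sn not_less)
  finally show ?thesis using card_exceed_tail[OF T a, of s] by linarith
qed

text \<open>A selection is good if it retains half of the energy and has at most \<open>k\<close>
  coordinates beyond \<open>s\<close>. The hypothesis on \<open>q\<close> treats good selections;
  the two added terms bound the probability that energy is lost or that too much is
  selected.\<close>

lemma sparse_alternative:
  assumes T: "T \<subseteq> {1..h}" "T \<noteq> {}" and gr: "groups G B N" and disj: "\<And>g. g \<in> {1..G} \<Longrightarrow> B g \<inter> T = {}"
    and a: "a > 1" and D: "D = (\<Sum>j=1..p. (d j)\<^sup>2)" "D > 0" and s: "norm0 p d \<le> s"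
    and large: "16 * real s * a\<^sup>2 \<le> real (card T) * D" and k: "k > 0"
    and q: "0 \<le> q" "\<And>S. S \<subseteq> {1..p} \<Longrightarrow> D / 2 \<le> (\<Sum>j\<in>S. (d j)\<^sup>2) \<Longrightarrow> real (card S) \<le> real s + k \<Longrightarrow>
      prob {\<omega> \<in> space M. mom G B S (Z d \<omega>) \<le> r} \<le> q"
  shows "prob {\<omega> \<in> space M. mom G B (sel T a d \<omega>) (Z d \<omega>) \<le> r}
    \<le> q + 4 * (H1 * a powr - \<alpha>) + real p * (H1 * a powr - \<alpha>) / k"
proof -
  have card: "card T > 0" using T finite_subset[OF T(1)] by (simp add: card_gt_0_iff)
  define good where "good = (\<lambda>S. D / 2 \<le> (\<Sum>j\<in>S. (d j)\<^sup>2) \<and> real (card S) \<le> real s + k)"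
  have "prob {\<omega> \<in> space M. mom G B (sel T a d \<omega>) (Z d \<omega>) \<le> r}
      \<le> expectation (\<lambda>\<omega>. if good (sel T a d \<omega>) then q else 1)"
    by (rule sel_mom_mixture[OF T(1) gr disj, where P = "\<lambda>x. x \<le> r"]) (use q in \<open>auto simp: good_def\<close>)
  also have "\<dots> \<le> q + prob {\<omega> \<in> space M. \<not> good (sel T a d \<omega>)}"
    by (rule expectation_sel_split[OF T(1) q(1)])
  also have "prob {\<omega> \<in> space M. \<not> good (sel T a d \<omega>)}
      \<le> prob ({\<omega> \<in> space M. (\<Sum>j\<in>clear T a d \<omega>. (d j)\<^sup>2) < D / 2} \<union> {\<omega> \<in> space M. real s + k < real (card (sel T a d \<omega>))})"
  proof (rule finite_measure_mono)
    have cs: "(\<Sum>j\<in>clear T a d \<omega>. (d j)\<^sup>2) \<le> (\<Sum>j\<in>sel T a d \<omega>. (d j)\<^sup>2)" for \<omega>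
      by (rule sum_mono2[OF finite_subset[OF sel_subset] clear_subset_sel[OF card]]) auto
    have "(\<Sum>j\<in>clear T a d \<omega>. (d j)\<^sup>2) < D / 2 \<or> real s + k < real (card (sel T a d \<omega>))"
      if "\<not> good (sel T a d \<omega>)" for \<omega>
      using that cs[of \<omega>] unfolding good_def by linarith
    thus "{\<omega> \<in> space M. \<not> good (sel T a d \<omega>)} \<subseteq>
        {\<omega> \<in> space M. (\<Sum>j\<in>clear T a d \<omega>. (d j)\<^sup>2) < D / 2} \<union> {\<omega> \<in> space M. real s + k < real (card (sel T a d \<omega>))}"
      by blast
    show "{\<omega> \<in> space M. (\<Sum>j\<in>clear T a d \<omega>. (d j)\<^sup>2) < D / 2} \<union> {\<omega> \<in> space M. real s + k < real (card (sel T a d \<omega>))} \<in> events"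
      by (intro sets.Un clear_signal_event[OF T] sel_event[OF T(1)])
  qed
  also have "\<dots> \<le> prob {\<omega> \<in> space M. (\<Sum>j\<in>clear T a d \<omega>. (d j)\<^sup>2) < D / 2} + prob {\<omega> \<in> space M. real s + k < real (card (sel T a d \<omega>))}"
    by (intro measure_Un_le clear_signal_event[OF T] sel_event[OF T(1)])
  also have "\<dots> \<le> 4 * (H1 * a powr - \<alpha>) + real p * (H1 * a powr - \<alpha>) / k"
    by (intro add_mono clear_signal[OF T a D s large] sel_size[OF T a s k])
  finally show ?thesis by simp
qed

text \<open>On \<open>a <= |x|\<close> the summand and its square are at most
  \<open>a powr (2 - \<alpha>)\<close> and \<open>a powr (4 - \<alpha>)\<close> times
  \<open>|x| powr \<alpha>\<close>, so the moment bound \<open>H\<close> controls mean and variance.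
  One half of \<open>r\<close> absorbs the mean and Chebyshev's inequality uses the other
  half.\<close>

lemma A1_null:
  assumes h: "h \<ge> 1" and a: "a > 1" and r: "r > 0" "2 * (real p * (H * a powr (2 - \<alpha>))) \<le> r"
    and d: "\<And>j. j \<in> {1..p} \<Longrightarrow> d j = 0"
  shows "prob {\<omega> \<in> space M. r < A1 p a (Z d \<omega>)} \<le> 4 * (real p * (H * a powr (4 - \<alpha>))) / r\<^sup>2"
proof -
  define f where "f = (\<lambda>x. (x\<^sup>2 - 1) * of_bool (a \<le> \<bar>x\<bar>) :: real)"
  have [measurable]: "f \<in> borel_measurable borel" unfolding f_def by measurable
  have f: "0 \<le> f x" "f x \<le> a powr (2 - \<alpha>) * \<bar>x\<bar> powr \<alpha>" "(f x)\<^sup>2 \<le> a powr (4 - \<alpha>) * \<bar>x\<bar> powr \<alpha>" for x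
  proof -
    have "1 \<le> x\<^sup>2" if "a \<le> \<bar>x\<bar>"
      using one_le_power[of "\<bar>x\<bar>" 2] that a by simp
    thus f0: "0 \<le> f x" by (simp add: f_def)
    have pw: "\<bar>x\<bar> powr c \<le> a powr (c - \<alpha>) * \<bar>x\<bar> powr \<alpha>" if "a \<le> \<bar>x\<bar>" "c \<le> 4" for c
    proof -
      have "\<bar>x\<bar> powr c = \<bar>x\<bar> powr (c - \<alpha>) * \<bar>x\<bar> powr \<alpha>" by (simp add: powr_add[symmetric])
      also have "\<dots> \<le> a powr (c - \<alpha>) * \<bar>x\<bar> powr \<alpha>"
        using that a alpha by (intro mult_right_mono powr_mono2') auto
      finally show ?thesis .
    qed
    have x2: "x\<^sup>2 = \<bar>x\<bar> powr 2" if "a \<le> \<bar>x\<bar>" using that a by (simp add: powr_numeral)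
    have x4: "x ^ 4 = \<bar>x\<bar> powr 4" if "a \<le> \<bar>x\<bar>" using that a by (simp add: powr_numeral)
    show "f x \<le> a powr (2 - \<alpha>) * \<bar>x\<bar> powr \<alpha>"
    proof (cases "a \<le> \<bar>x\<bar>")
      case True
      have "f x \<le> x\<^sup>2" using True by (simp add: f_def)
      also have "\<dots> \<le> a powr (2 - \<alpha>) * \<bar>x\<bar> powr \<alpha>" unfolding x2[OF True] by (rule pw[OF True]) simp
      finally show ?thesis .
    qed (use a in \<open>simp add: f_def\<close>)
    show "(f x)\<^sup>2 \<le> a powr (4 - \<alpha>) * \<bar>x\<bar> powr \<alpha>"
    proof (cases "a \<le> \<bar>x\<bar>")
      case True
      have "(f x)\<^sup>2 \<le> (x\<^sup>2)\<^sup>2" using f0 by (intro power_mono) (auto simp: f_def)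
      also have "\<dots> = x ^ 4" by simp
      also have "\<dots> \<le> a powr (4 - \<alpha>) * \<bar>x\<bar> powr \<alpha>" unfolding x4[OF True] by (rule pw[OF True]) simp
      finally show ?thesis .
    qed (use a in \<open>simp add: f_def\<close>)
  qed
  have nz: "std_noise \<alpha> H (\<xi> (j, 1))" if "j \<in> {1..p}" for j using noise that h by auto
  define W where "W = (\<lambda>j \<omega>. f (\<xi> (j, 1) \<omega>))"
  have W: "integrable M (W j)" "expectation (W j) \<le> H * a powr (2 - \<alpha>)"
    "integrable M (\<lambda>\<omega>. (W j \<omega>)\<^sup>2)" "expectation (\<lambda>\<omega>. (W j \<omega>)\<^sup>2) \<le> H * a powr (4 - \<alpha>)" if j: "j \<in> {1..p}" for j
  proof -
    note n = std_noiseD[OF nz[OF j]]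
    note [measurable] = n(1)
    have mW: "(\<lambda>\<omega>. f (\<xi> (j, Suc 0) \<omega>)) \<in> borel_measurable M" "(\<lambda>\<omega>. (f (\<xi> (j, Suc 0) \<omega>))\<^sup>2) \<in> borel_measurable M"
      by (simp_all only: One_nat_def[symmetric]) measurable
    show i1: "integrable M (W j)"
      by (rule Bochner_Integration.integrable_bound[where f = "\<lambda>\<omega>. a powr (2 - \<alpha>) * \<bar>\<xi> (j, 1) \<omega>\<bar> powr \<alpha>"])
        (use n(6) f mW in \<open>auto simp: W_def abs_of_nonneg\<close>)
    show i2: "integrable M (\<lambda>\<omega>. (W j \<omega>)\<^sup>2)"
      by (rule Bochner_Integration.integrable_bound[where f = "\<lambda>\<omega>. a powr (4 - \<alpha>) * \<bar>\<xi> (j, 1) \<omega>\<bar> powr \<alpha>"])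
        (use n(6) f mW in \<open>auto simp: W_def abs_of_nonneg\<close>)
    have "expectation (W j) \<le> expectation (\<lambda>\<omega>. a powr (2 - \<alpha>) * \<bar>\<xi> (j, 1) \<omega>\<bar> powr \<alpha>)"
      by (rule integral_mono[OF i1]) (use n(6) f in \<open>auto simp: W_def\<close>)
    also have "\<dots> \<le> a powr (2 - \<alpha>) * H" using n(7) by (simp add: mult_left_mono)
    finally show "expectation (W j) \<le> H * a powr (2 - \<alpha>)" by (simp add: mult.commute)
    have "expectation (\<lambda>\<omega>. (W j \<omega>)\<^sup>2) \<le> expectation (\<lambda>\<omega>. a powr (4 - \<alpha>) * \<bar>\<xi> (j, 1) \<omega>\<bar> powr \<alpha>)"
      by (rule integral_mono[OF i2]) (use n(6) f in \<open>auto simp: W_def\<close>)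
    also have "\<dots> \<le> a powr (4 - \<alpha>) * H" using n(7) by (simp add: mult_left_mono)
    finally show "expectation (\<lambda>\<omega>. (W j \<omega>)\<^sup>2) \<le> H * a powr (4 - \<alpha>)" by (simp add: mult.commute)
  qed
  define U where "U = (\<lambda>j \<omega>. W j \<omega> - expectation (W j))"
  have indU: "indep_vars (\<lambda>_. borel) U {1..p}"
  proof -
    have "indep_vars (\<lambda>_. borel) (\<lambda>j \<omega>. (\<lambda>y. f (y (j, 1)) - expectation (W j)) (restrict (\<lambda>e. \<xi> e \<omega>) {(j, 1)})) {1..p}"
      using h by (intro indep_blocks) (auto simp: disjoint_family_on_def)
    thus ?thesis by (simp add: U_def W_def)
  qed
  have U: "integrable M (\<lambda>\<omega>. (U j \<omega>)\<^sup>2)" "has_bochner_integral M (U j) 0"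
    "expectation (\<lambda>\<omega>. (U j \<omega>)\<^sup>2) \<le> H * a powr (4 - \<alpha>)" if j: "j \<in> {1..p}" for j
  proof -
    have eq: "(U j \<omega>)\<^sup>2 = (W j \<omega>)\<^sup>2 - 2 * expectation (W j) * W j \<omega> + (expectation (W j))\<^sup>2" for \<omega>
      by (simp add: U_def power2_diff algebra_simps)
    show "integrable M (\<lambda>\<omega>. (U j \<omega>)\<^sup>2)" unfolding eq using W[OF j] by simp
    show "has_bochner_integral M (U j) 0"
      unfolding has_bochner_integral_iff U_def using W[OF j] by (simp add: prob_space)
    have "expectation (\<lambda>\<omega>. (U j \<omega>)\<^sup>2) = expectation (\<lambda>\<omega>. (W j \<omega>)\<^sup>2) - (expectation (W j))\<^sup>2"
      unfolding eq using W[OF j] by (simp add: prob_space power2_eq_square)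
    also have "\<dots> \<le> expectation (\<lambda>\<omega>. (W j \<omega>)\<^sup>2)" by simp
    finally show "expectation (\<lambda>\<omega>. (U j \<omega>)\<^sup>2) \<le> H * a powr (4 - \<alpha>)" using W(4)[OF j] by linarith
  qed
  have sm: "integrable M (\<lambda>\<omega>. (\<Sum>j=1..p. U j \<omega>)\<^sup>2)"
    "expectation (\<lambda>\<omega>. (\<Sum>j=1..p. U j \<omega>)\<^sup>2) = (\<Sum>j=1..p. expectation (\<lambda>\<omega>. (U j \<omega>)\<^sup>2))"
    using indep_sum_second_moment[OF finite_atLeastAtMost indU U(1,2)] by blast+
  have "prob {\<omega> \<in> space M. r < A1 p a (Z d \<omega>)} \<le> expectation (\<lambda>\<omega>. (\<Sum>j=1..p. U j \<omega>)\<^sup>2) / (r / 2)\<^sup>2"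
  proof (rule prob_le_markov_square[OF sm(1)])
    fix \<omega> assume less: "r < A1 p a (Z d \<omega>)"
    have "A1 p a (Z d \<omega>) = (\<Sum>j=1..p. W j \<omega>)"
      unfolding A1_def by (intro sum.cong) (use d in \<open>auto simp: W_def f_def Z_def\<close>)
    hence "(\<Sum>j=1..p. U j \<omega>) = A1 p a (Z d \<omega>) - (\<Sum>j=1..p. expectation (W j))"
      by (simp add: U_def sum_subtractf)
    moreover have "(\<Sum>j=1..p. expectation (W j)) \<le> (\<Sum>j=1..p. H * a powr (2 - \<alpha>))"
      by (intro sum_mono W)
    ultimately show "r / 2 \<le> \<bar>\<Sum>j=1..p. U j \<omega>\<bar>" using less r by simp
  qed (use r in simp)
  also have "\<dots> \<le> (\<Sum>j=1..p. H * a powr (4 - \<alpha>)) / (r / 2)\<^sup>2"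
    unfolding sm(2) by (intro divide_right_mono sum_mono U(3)) auto
  also have "\<dots> = 4 * (real p * (H * a powr (4 - \<alpha>))) / r\<^sup>2"
    by (simp add: power_divide)
  finally show ?thesis .
qed

text \<open>All summands are nonnegative because \<open>a > 1\<close>. On a clear coordinate
  \<open>|Z| >= |d| / 2\<close>, and \<open>d^2 >= 4 * a^2 >= 8\<close> gives
  \<open>Z^2 - 1 >= d^2 / 8\<close>. Clear energy of at least \<open>D / 2\<close> thus forces a
  value of at least \<open>D / 16\<close>.\<close>

lemma A1_alternative:
  assumes h: "h \<ge> 1" and a: "a > 1" "2 \<le> a\<^sup>2"
    and D: "D = (\<Sum>j=1..p. (d j)\<^sup>2)" "D > 0" and s: "norm0 p d \<le> s" and large: "16 * real s * a\<^sup>2 \<le> D"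
    and r: "r < D / 16"
  shows "prob {\<omega> \<in> space M. A1 p a (Z d \<omega>) \<le> r} \<le> 4 * (H1 * a powr - \<alpha>)"
proof -
  have T: "{1} \<subseteq> {1..h}" "{1::nat} \<noteq> {}" using h by auto
  have "prob {\<omega> \<in> space M. A1 p a (Z d \<omega>) \<le> r} \<le> prob {\<omega> \<in> space M. (\<Sum>j\<in>clear {1} a d \<omega>. (d j)\<^sup>2) < D / 2}"
  proof (rule finite_measure_mono[OF _ clear_signal_event[OF T]], intro subsetI, clarify)
    fix \<omega> assume le: "A1 p a (Z d \<omega>) \<le> r"
    have "(\<Sum>j\<in>clear {1} a d \<omega>. (d j)\<^sup>2 / 8) \<le> (\<Sum>j\<in>clear {1} a d \<omega>. ((Z d \<omega> 1 j)\<^sup>2 - 1) * of_bool (a \<le> \<bar>Z d \<omega> 1 j\<bar>))"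
    proof (rule sum_mono)
      fix j assume "j \<in> clear {1} a d \<omega>"
      hence j: "2 * a \<le> \<bar>d j\<bar>" "\<bar>\<xi> (j, 1) \<omega>\<bar> < a" by (auto simp: clear_def avg_def)
      have "\<bar>d j\<bar> \<le> \<bar>Z d \<omega> 1 j\<bar> + \<bar>\<xi> (j, 1) \<omega>\<bar>"
        using abs_triangle_ineq4[of "Z d \<omega> 1 j" "\<xi> (j, 1) \<omega>"] by (simp add: Z_def)
      hence z: "\<bar>d j\<bar> / 2 \<le> \<bar>Z d \<omega> 1 j\<bar>" "a \<le> \<bar>Z d \<omega> 1 j\<bar>" using j by linarith+
      have "(\<bar>d j\<bar> / 2)\<^sup>2 \<le> \<bar>Z d \<omega> 1 j\<bar>\<^sup>2" using z by (intro power_mono) auto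
      moreover have "(2 * a)\<^sup>2 \<le> \<bar>d j\<bar>\<^sup>2" using j a by (intro power_mono) auto
      ultimately show "(d j)\<^sup>2 / 8 \<le> ((Z d \<omega> 1 j)\<^sup>2 - 1) * of_bool (a \<le> \<bar>Z d \<omega> 1 j\<bar>)"
        using a z by (simp add: power_divide power_mult_distrib)
    qed
    also have "\<dots> \<le> A1 p a (Z d \<omega>)"
      unfolding A1_def
    proof (rule sum_mono2)
      fix j
      have "1 \<le> (Z d \<omega> 1 j)\<^sup>2" if "a \<le> \<bar>Z d \<omega> 1 j\<bar>"
        using one_le_power[of "\<bar>Z d \<omega> 1 j\<bar>" 2] that a by simp
      thus "0 \<le> ((Z d \<omega> 1 j)\<^sup>2 - 1) * of_bool (a \<le> \<bar>Z d \<omega> 1 j\<bar>)" by auto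
    qed (auto simp: clear_def)
    finally have "(\<Sum>j\<in>clear {1} a d \<omega>. (d j)\<^sup>2) / 8 \<le> r" using le by (simp add: sum_divide_distrib)
    thus "(\<Sum>j\<in>clear {1} a d \<omega>. (d j)\<^sup>2) < D / 2" using r by simp
  qed
  also have "\<dots> \<le> 4 * (H1 * a powr - \<alpha>)"
    by (rule clear_signal[OF T a(1) D s]) (use large in simp)
  finally show ?thesis .
qed

end

section \<open>A robust sparse mean estimator\<close>

text \<open>Integer vectors of small \<open>l1\<close>-norm, divided by \<open>2 * sqrt k\<close>, form a half-net of the \<open>k\<close>-sparse
  unit vectors; rounding towards zero preserves sparsity, so supports need not be enumerated.\<close>

definition net :: "nat \<Rightarrow> nat \<Rightarrow> (nat \<Rightarrow> int) set" where
  "net p k = {z \<in> PiE {1..p} (\<lambda>_. {- int (2 * k)..int (2 * k)}).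
     (\<Sum>j=1..p. nat \<bar>z j\<bar>) \<le> 2 * k \<and> (\<Sum>j=1..p. (real_of_int (z j))\<^sup>2) \<le> 4 * real k}"

definition dir :: "nat \<Rightarrow> (nat \<Rightarrow> int) \<Rightarrow> nat \<Rightarrow> real" where
  "dir k z j = real_of_int (z j) / (2 * sqrt k)"

definition proj :: "nat \<Rightarrow> nat \<Rightarrow> (nat \<Rightarrow> int) \<Rightarrow> (nat \<Rightarrow> real) \<Rightarrow> real" where
  "proj p k z u = (\<Sum>j=1..p. dir k z j * u j)"

lemma finite_net: "finite (net p k)"
  unfolding net_def by (rule finite_subset[of _ "PiE {1..p} (\<lambda>_. {- int (2 * k)..int (2 * k)})"]) (auto intro!: finite_PiE)

lemma two_sided_geometric_le:
  fixes x :: real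
  assumes "0 \<le> x" "x \<le> 1 / 2"
  shows "(\<Sum>a\<in>{- int K..int K}. x ^ nat \<bar>a\<bar>) \<le> 1 + 4 * x"
proof -
  have eq: "(1 - x) * (\<Sum>a\<in>{- int K..int K}. x ^ nat \<bar>a\<bar>) = 1 + x - 2 * x ^ Suc K"
  proof (induction K)
    case 0
    thus ?case by simp
  next
    case (Suc K)
    have "{- int (Suc K)..int (Suc K)} = insert (int (Suc K)) (insert (- int (Suc K)) {- int K..int K})"
      by auto
    hence "(\<Sum>a\<in>{- int (Suc K)..int (Suc K)}. x ^ nat \<bar>a\<bar>) = 2 * x ^ Suc K + (\<Sum>a\<in>{- int K..int K}. x ^ nat \<bar>a\<bar>)"
      by (simp add: nat_add_distrib del: of_nat_Suc)
    hence "(1 - x) * (\<Sum>a\<in>{- int (Suc K)..int (Suc K)}. x ^ nat \<bar>a\<bar>)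
        = 2 * x ^ Suc K * (1 - x) + (1 - x) * (\<Sum>a\<in>{- int K..int K}. x ^ nat \<bar>a\<bar>)"
      by (simp only:) (simp only: distrib_left mult.commute mult.left_commute)
    also have "\<dots> = 1 + x - 2 * x ^ Suc (Suc K)"
      unfolding Suc by (simp add: algebra_simps)
    finally show ?case .
  qed
  have "(1 - x) * (\<Sum>a\<in>{- int K..int K}. x ^ nat \<bar>a\<bar>) \<le> 1 + x"
    unfolding eq using assms by simp
  also have "\<dots> \<le> (1 - x) * (1 + 4 * x)"
    using mult_left_mono[OF assms(2), of x] assms(1) by (simp add: algebra_simps)
  finally show ?thesis using assms by simp
qed

text \<open>Counting by a generating function: an element of the net has weight \<open>x\<close> to
  the power of its l1-norm, at least \<open>x ^ (2 * k)\<close>, while the total weight of the whole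
  box factorizes over coordinates and is at most \<open>exp (4 * x * p)\<close>. The choice
  \<open>x = s / (2 * p)\<close> makes the latter \<open>exp (2 * s)\<close>.\<close>

lemma card_net_le:
  assumes s: "s \<in> {1..p}"
  shows "real (card (net p (4 * s))) \<le> exp (10 * (real s * ln (exp 1 * real p / real s)))"
proof -
  define k where "k = 4 * s"
  define x where "x = real s / (2 * real p)"
  have sp: "0 < real s" "real s \<le> real p" using s by auto
  have x: "0 < x" "x \<le> 1 / 2" using sp by (auto simp: x_def field_simps)
  have "real (card (net p k)) * x ^ (2 * k) = (\<Sum>z\<in>net p k. x ^ (2 * k))" by simp
  also have "\<dots> \<le> (\<Sum>z\<in>net p k. \<Prod>j=1..p. x ^ nat \<bar>z j\<bar>)"
  proof (rule sum_mono)
    fix z assume "z \<in> net p k"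
    hence "x ^ (2 * k) \<le> x ^ (\<Sum>j=1..p. nat \<bar>z j\<bar>)"
      using x by (intro power_decreasing) (auto simp: net_def)
    thus "x ^ (2 * k) \<le> (\<Prod>j=1..p. x ^ nat \<bar>z j\<bar>)" by (simp add: power_sum)
  qed
  also have "\<dots> \<le> (\<Sum>z\<in>PiE {1..p} (\<lambda>_. {- int (2 * k)..int (2 * k)}). \<Prod>j=1..p. x ^ nat \<bar>z j\<bar>)"
    using x by (intro sum_mono2 finite_PiE) (auto simp: net_def intro!: prod_nonneg)
  also have "\<dots> = (\<Prod>j=1..p. \<Sum>a\<in>{- int (2 * k)..int (2 * k)}. x ^ nat \<bar>a\<bar>)"
    by (rule prod_sum_PiE[symmetric]) auto
  also have "\<dots> \<le> (\<Prod>j=1..p. exp (4 * x))"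
  proof (intro prod_mono conjI)
    have "(\<Sum>a\<in>{- int (2 * k)..int (2 * k)}. x ^ nat \<bar>a\<bar>) \<le> 1 + 4 * x"
      using x by (intro two_sided_geometric_le) auto
    also have "\<dots> \<le> exp (4 * x)" by (rule exp_ge_add_one_self)
    finally show "(\<Sum>a\<in>{- int (2 * k)..int (2 * k)}. x ^ nat \<bar>a\<bar>) \<le> exp (4 * x)" .
    show "0 \<le> (\<Sum>a\<in>{- int (2 * k)..int (2 * k)}. x ^ nat \<bar>a\<bar>)" using x by (intro sum_nonneg) auto
  qed
  also have "\<dots> = exp (2 * real s)"
    using sp by (simp add: exp_of_nat_mult[symmetric] x_def)
  finally have "real (card (net p k)) \<le> exp (2 * real s) / x ^ (2 * k)"
    using x by (simp add: field_simps)
  also have "x ^ (2 * k) = exp (- (8 * real s * ln (2 * real p / real s)))"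
  proof -
    have "x = exp (- ln (2 * real p / real s))" using sp by (simp add: x_def exp_minus field_simps)
    hence "x ^ (2 * k) = exp (real (2 * k) * (- ln (2 * real p / real s)))"
      by (simp only: exp_of_nat_mult)
    thus ?thesis by (simp add: k_def)
  qed
  also have "exp (2 * real s) / exp (- (8 * real s * ln (2 * real p / real s))) = exp (2 * real s + 8 * real s * ln (2 * real p / real s))"
    by (simp add: exp_diff[symmetric])
  also have "\<dots> \<le> exp (10 * (real s * ln (exp 1 * real p / real s)))"
  proof -
    have "(2 :: real) \<le> exp 1" using exp_ge_add_one_self[of 1] by simp
    hence "2 * real p / real s \<le> exp 1 * real p / real s" using sp by (intro divide_right_mono mult_right_mono) auto
    hence a: "ln (2 * real p / real s) \<le> ln (exp 1 * real p / real s)" using sp by simp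
    have "ln (exp 1 * real p / real s) = 1 + ln (real p / real s)" using sp by (simp add: ln_mult ln_div)
    hence b: "1 \<le> ln (exp 1 * real p / real s)" using sp by simp
    have "8 * real s * ln (2 * real p / real s) \<le> 8 * real s * ln (exp 1 * real p / real s)"
      using a sp by (intro mult_left_mono) auto
    moreover have "2 * real s * 1 \<le> 2 * real s * ln (exp 1 * real p / real s)"
      using b sp by (intro mult_left_mono) auto
    ultimately have "2 * real s + 8 * real s * ln (2 * real p / real s) \<le> 10 * (real s * ln (exp 1 * real p / real s))"
      by linarith
    thus ?thesis by simp
  qed
  finally show ?thesis by (simp add: k_def)
qed

text \<open>The direction \<open>w = u / n\<close> is multiplied by \<open>c = 2 * sqrt k\<close>
  and rounded towards zero. By Cauchy-Schwarz its l1-norm is at most \<open>sqrt k\<close>, which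
  places the rounded vector in the net. Rounding errs by at most \<open>1 / c\<close> per
  coordinate, so it costs at most \<open>n * sqrt k / c = n / 2\<close> when paired with
  \<open>u\<close>.\<close>

lemma net_norming:
  assumes k: "k \<ge> 1" and u: "norm0 p u \<le> k" and le: "\<And>z. z \<in> net p k \<Longrightarrow> \<bar>proj p k z u\<bar> \<le> \<tau>"
  shows "sqrt (sqnorm p u) \<le> 2 * \<tau>"
proof (cases "sqnorm p u = 0")
  case True
  have "(\<lambda>j\<in>{1..p}. 0) \<in> net p k" by (auto simp: net_def)
  from le[OF this] have "0 \<le> \<tau>" by simp
  thus ?thesis using True by simp
next
  case False
  have "sqnorm p u \<ge> 0" by (simp add: sqnorm_def sum_nonneg)
  hence pos: "sqnorm p u > 0" using False by simp
  define n where "n = sqrt (sqnorm p u)"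
  have n: "n > 0" "n\<^sup>2 = sqnorm p u" using pos by (auto simp: n_def)
  define c where "c = 2 * sqrt (real k)"
  have c: "c > 0" "c\<^sup>2 = 4 * real k" using k by (auto simp: c_def power_mult_distrib)
  define w where "w = (\<lambda>j. u j / n)"
  have w2: "(\<Sum>j=1..p. (w j)\<^sup>2) = 1"
  proof -
    have "(\<Sum>j=1..p. (w j)\<^sup>2) = sqnorm p u / n\<^sup>2"
      by (simp add: w_def power_divide sum_divide_distrib sqnorm_def)
    thus ?thesis using n pos by simp
  qed
  define J where "J = {j \<in> {1..p}. u j \<noteq> 0}"
  have J: "finite J" "card J \<le> k" "J \<subseteq> {1..p}" using u by (auto simp: J_def norm0_def)
  have wJ: "(\<Sum>j=1..p. \<bar>w j\<bar>) = (\<Sum>j\<in>J. \<bar>w j\<bar>)"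
    using J(3) by (intro sum.mono_neutral_right) (auto simp: J_def w_def)
  have l1: "(\<Sum>j=1..p. \<bar>w j\<bar>) \<le> sqrt (real k)"
  proof (rule real_le_rsqrt)
    have "(\<Sum>j\<in>J. \<bar>w j\<bar> * 1)\<^sup>2 \<le> (\<Sum>j\<in>J. \<bar>w j\<bar>\<^sup>2) * (\<Sum>j\<in>J. 1\<^sup>2)" by (rule Cauchy_Schwarz_ineq_sum)
    also have "\<dots> \<le> 1 * real k"
    proof (rule mult_mono)
      show "(\<Sum>j\<in>J. \<bar>w j\<bar>\<^sup>2) \<le> 1" using w2 sum_mono2[OF finite_atLeastAtMost J(3), of "\<lambda>j. (w j)\<^sup>2"] by simp
    qed (use J in auto)
    finally show "(\<Sum>j=1..p. \<bar>w j\<bar>)\<^sup>2 \<le> real k" by (simp only: wJ mult_1_right mult_1_left)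
  qed
  define z where "z = (\<lambda>j\<in>{1..p}. if w j \<ge> 0 then \<lfloor>c * w j\<rfloor> else \<lceil>c * w j\<rceil>)"
  have z: "\<bar>real_of_int (z j)\<bar> \<le> c * \<bar>w j\<bar>" "\<bar>c * w j - real_of_int (z j)\<bar> \<le> 1" if "j \<in> {1..p}" for j
  proof -
    show "\<bar>c * w j - real_of_int (z j)\<bar> \<le> 1" 
    proof (cases "w j \<ge> 0")
      case True
      hence "z j = \<lfloor>c * w j\<rfloor>" using that by (simp add: z_def)
      thus ?thesis by linarith
    next
      case False
      hence "z j = \<lceil>c * w j\<rceil>" using that by (simp add: z_def)
      thus ?thesis by linarith
    qed
    show "\<bar>real_of_int (z j)\<bar> \<le> c * \<bar>w j\<bar>"
    proof (cases "w j \<ge> 0")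
      case True
      hence "0 \<le> c * w j" using c by simp
      thus ?thesis using True that by (simp add: z_def)
    next
      case False
      hence "c * w j \<le> 0" using c by (simp add: mult_nonneg_nonpos)
      hence "real_of_int \<lceil>c * w j\<rceil> \<le> 0" by simp
      moreover have "c * \<bar>w j\<bar> = - (c * w j)" using False by simp
      moreover have "z j = \<lceil>c * w j\<rceil>" using False that by (simp add: z_def)
      ultimately show ?thesis by linarith
    qed
  qed
  have "real (\<Sum>j=1..p. nat \<bar>z j\<bar>) = (\<Sum>j=1..p. \<bar>real_of_int (z j)\<bar>)" by simp
  also have "\<dots> \<le> (\<Sum>j=1..p. c * \<bar>w j\<bar>)" by (intro sum_mono z) auto
  also have "\<dots> \<le> c * sqrt (real k)" using l1 c by (simp add: sum_distrib_left[symmetric])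
  also have "\<dots> = real (2 * k)" by (simp add: c_def)
  finally have z1: "(\<Sum>j=1..p. nat \<bar>z j\<bar>) \<le> 2 * k" by (simp only: of_nat_le_iff)
  have "(\<Sum>j=1..p. (real_of_int (z j))\<^sup>2) \<le> (\<Sum>j=1..p. (c * \<bar>w j\<bar>)\<^sup>2)"
  proof (rule sum_mono)
    fix j assume "j \<in> {1..p}"
    from power_mono[OF z(1)[OF this], of 2] show "(real_of_int (z j))\<^sup>2 \<le> (c * \<bar>w j\<bar>)\<^sup>2" by simp
  qed
  also have "\<dots> = 4 * real k" using w2 c by (simp add: power_mult_distrib sum_distrib_left[symmetric])
  finally have z2: "(\<Sum>j=1..p. (real_of_int (z j))\<^sup>2) \<le> 4 * real k" .
  have zb: "z j \<in> {- int (2 * k)..int (2 * k)}" if "j \<in> {1..p}" for j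
  proof -
    have "nat \<bar>z j\<bar> \<le> (\<Sum>j=1..p. nat \<bar>z j\<bar>)" using that by (intro member_le_sum) auto
    hence "nat \<bar>z j\<bar> \<le> 2 * k" using z1 by linarith
    thus ?thesis by auto
  qed
  have "z \<in> net p k" using z1 z2 zb by (auto simp: net_def z_def)
  hence \<tau>: "\<bar>proj p k z u\<bar> \<le> \<tau>" by (rule le)
  have "n - proj p k z u = (\<Sum>j=1..p. (w j - real_of_int (z j) / c) * u j)"
  proof -
    have "n = (\<Sum>j=1..p. w j * u j)"
      using n by (simp add: w_def sqnorm_def power2_eq_square sum_divide_distrib[symmetric] field_simps)
    thus ?thesis by (simp add: proj_def dir_def c_def[symmetric] sum_subtractf[symmetric] left_diff_distrib)
  qed
  also have "\<dots> \<le> (\<Sum>j=1..p. 1 / c * (n * \<bar>w j\<bar>))"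
  proof (rule sum_mono)
    fix j assume j: "j \<in> {1..p}"
    have "(w j - real_of_int (z j) / c) * u j \<le> \<bar>w j - real_of_int (z j) / c\<bar> * \<bar>u j\<bar>"
      by (metis abs_ge_self abs_mult)
    also have "\<dots> \<le> 1 / c * \<bar>u j\<bar>"
    proof (rule mult_right_mono)
      have "w j - real_of_int (z j) / c = (c * w j - real_of_int (z j)) / c" using c by (simp add: field_simps)
      hence "\<bar>w j - real_of_int (z j) / c\<bar> = \<bar>c * w j - real_of_int (z j)\<bar> / c" using c by (simp add: abs_divide)
      also have "\<dots> \<le> 1 / c" using z(2)[OF j] c by (intro divide_right_mono) auto
      finally show "\<bar>w j - real_of_int (z j) / c\<bar> \<le> 1 / c" .
    qed simp
    also have "\<bar>u j\<bar> = n * \<bar>w j\<bar>" using n by (simp add: w_def abs_divide)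
    finally show "(w j - real_of_int (z j) / c) * u j \<le> 1 / c * (n * \<bar>w j\<bar>)" .
  qed
  also have "\<dots> = n / c * (\<Sum>j=1..p. \<bar>w j\<bar>)" by (simp add: sum_distrib_left)
  also have "\<dots> \<le> n / c * sqrt (real k)" using l1 n c by (intro mult_left_mono) auto
  also have "\<dots> = n / 2" using k by (simp add: c_def)
  finally show ?thesis using \<tau> by (simp add: n_def)
qed

text \<open>The first summand pays for the union over the net, whose logarithmic size is bounded by
  it, and \<open>ln (1 / \<eta>)\<close> for the confidence level; a direction fails with
  probability \<open>(1/3) ^ G \<le> exp (- G)\<close>.\<close>

definition rsm_groups :: "nat \<Rightarrow> nat \<Rightarrow> real \<Rightarrow> nat" where
  "rsm_groups p s \<eta> = nat \<lceil>10 * (real s * ln (exp 1 * real p / real s)) + ln (1 / \<eta>)\<rceil>"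

definition rsm_block :: "nat \<Rightarrow> nat \<Rightarrow> nat set" where
  "rsm_block N g = {(g - 1) * N + 1..g * N}"

definition block_proj :: "nat \<Rightarrow> nat \<Rightarrow> nat \<Rightarrow> (nat \<Rightarrow> int) \<Rightarrow> nat \<Rightarrow> mat \<Rightarrow> real" where
  "block_proj p k N z g W = (\<Sum>i\<in>rsm_block N g. proj p k z (col p W i)) / real N"

definition rsm_tau :: "nat \<Rightarrow> real" where "rsm_tau N = 6 / sqrt (real N)"

text \<open>The point \<open>q\<close> must agree with a strict majority of the block means in every
  direction of the net. Two strict majorities share a block, which is how the estimate and the true
  mean are compared. The tolerance is twice \<open>rsm_tau N\<close> to leave room for a rational
  approximation of the true mean, and \<open>k = 4 * s\<close> bounds the support of the difference
  of two \<open>2 * s\<close>-sparse vectors.\<close>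

definition rsm_feasible :: "nat \<Rightarrow> nat \<Rightarrow> nat \<Rightarrow> real \<Rightarrow> mat \<Rightarrow> (nat \<Rightarrow> real) \<Rightarrow> bool" where
  "rsm_feasible p m s \<eta> W q = (let G = rsm_groups p s \<eta>; N = m div G; k = 4 * s in
     \<forall>z\<in>net p k. G < 2 * card {g \<in> {1..G}. \<bar>block_proj p k N z g W - proj p k z q\<bar> \<le> 2 * rsm_tau N})"

text \<open>Sparsity \<open>2 * s\<close> rather than \<open>s\<close>, because the test of level
  \<open>s\<close> has to detect signals of up to \<open>2 * s\<close> entries. Rational entries
  make the set countable.\<close>

definition rsm_candidates :: "nat \<Rightarrow> nat \<Rightarrow> (nat \<Rightarrow> real) set" where
  "rsm_candidates p s = {q \<in> PiE {1..p} (\<lambda>_. \<rat>). norm0 p q \<le> 2 * s}"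

text \<open>Taking the first feasible point in a countable candidate set makes the estimator measurable; it
  is an arbitrary candidate if none is feasible.\<close>

definition rsm_estimator :: "nat \<Rightarrow> nat \<Rightarrow> nat \<Rightarrow> real \<Rightarrow> mat \<Rightarrow> nat \<Rightarrow> real" where
  "rsm_estimator p m s \<eta> W = from_nat_into (rsm_candidates p s)
     (LEAST i. rsm_feasible p m s \<eta> W (from_nat_into (rsm_candidates p s) i))"

section \<open>Selection of a feasible point and its measurability\<close>

lemma countable_candidates: "countable (rsm_candidates p s)"
  unfolding rsm_candidates_def
  by (rule countable_subset[of _ "PiE {1..p} (\<lambda>_. \<rat> :: real set)"]) (auto intro!: countable_PiE countable_rat)

lemma candidates_nonempty: "rsm_candidates p s \<noteq> {}"
proof -
  have "{j \<in> {1..p}. (\<lambda>j\<in>{1..p}. 0 :: real) j \<noteq> 0} = {}" by auto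
  hence "norm0 p (\<lambda>j\<in>{1..p}. 0) = 0" unfolding norm0_def by (simp only: card.empty)
  hence "(\<lambda>j\<in>{1..p}. 0) \<in> rsm_candidates p s" by (auto simp: rsm_candidates_def)
  thus ?thesis by blast
qed

lemma rsm_estimator_candidate: "rsm_estimator p m s \<eta> W \<in> rsm_candidates p s"
  unfolding rsm_estimator_def by (rule from_nat_into[OF candidates_nonempty])

lemma rsm_estimator_feasible:
  assumes "q \<in> rsm_candidates p s" "rsm_feasible p m s \<eta> W q"
  shows "rsm_feasible p m s \<eta> W (rsm_estimator p m s \<eta> W)"
  unfolding rsm_estimator_def
proof (rule LeastI_ex)
  from from_nat_into_surj[OF countable_candidates assms(1)] assms(2)
  show "\<exists>i. rsm_feasible p m s \<eta> W (from_nat_into (rsm_candidates p s) i)" by metis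
qed

lemma measurable_block_proj:
  assumes "\<And>i. i \<in> rsm_block N g \<Longrightarrow> i \<in> {1..m}"
  shows "block_proj p k N z g \<in> borel_measurable (mat_space p m)"
  unfolding block_proj_def[abs_def] proj_def col_def mat_space_def using assms
  by (intro borel_measurable_divide borel_measurable_sum borel_measurable_times borel_measurable_const)
    (auto simp: entries_def intro!: measurable_component_singleton)

lemma rsm_block_subset:
  assumes "N = m div G" "g \<in> {1..G}" "i \<in> rsm_block N g"
  shows "i \<in> {1..m}"
proof -
  have "g * N \<le> G * (m div G)" using assms by (intro mult_mono) auto
  also have "\<dots> \<le> m" by simp
  finally show ?thesis using assms by (auto simp: rsm_block_def)
qed

lemma disjoint_rsm_block: "disjoint_family_on (rsm_block N) {1..G}"
  unfolding disjoint_family_on_def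
proof (intro ballI impI)
  fix g g' assume g: "g \<in> {1..G}" "g' \<in> {1..G}" "g \<noteq> g'"
  have *: "rsm_block N g \<inter> rsm_block N g' = {}" if "g < g'" for g g'
  proof -
    have le: "g * N \<le> (g' - 1) * N" using that by (intro mult_right_mono) auto
    show ?thesis
    proof (rule equals0I)
      fix i assume "i \<in> rsm_block N g \<inter> rsm_block N g'"
      hence "i \<le> g * N" "(g' - 1) * N + 1 \<le> i" by (simp_all only: rsm_block_def Int_iff atLeastAtMost_iff)
      with le show False by linarith
    qed
  qed
  show "rsm_block N g \<inter> rsm_block N g' = {}"
    using *[of g g'] *[of g' g] g(3) by (cases "g < g'") auto
qed

lemma measurable_rsm_estimator: "rsm_estimator p m s \<eta> \<in> measurable (mat_space p m) (vec_space p)"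
proof -
  define G where "G = rsm_groups p s \<eta>"
  define N where "N = m div G"
  define k where "k = 4 * s"
  have "Measurable.pred (mat_space p m) (\<lambda>W. rsm_feasible p m s \<eta> W q)" for q
  proof -
    have "{W \<in> space (mat_space p m). rsm_feasible p m s \<eta> W q} = {W \<in> space (mat_space p m).
        \<forall>z\<in>net p k. real G < 2 * (\<Sum>g=1..G. of_bool (\<bar>block_proj p k N z g W - proj p k z q\<bar> \<le> 2 * rsm_tau N))}"
    proof -
      have "(G < 2 * card {g \<in> {1..G}. P g}) = (real G < 2 * (\<Sum>g=1..G. of_bool (P g)))" for P
      proof -
        have "(\<Sum>g=1..G. of_bool (P g)) = real (card {g \<in> {1..G}. P g})"
          by (simp add: sum_of_bool_eq Int_def)
        thus ?thesis by (simp del: of_nat_mult add: of_nat_mult[symmetric]) linarith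
      qed
      thus ?thesis by (simp only: rsm_feasible_def Let_def G_def[symmetric] N_def[symmetric] k_def[symmetric])
    qed
    also have "\<dots> \<in> sets (mat_space p m)"
    proof (rule sets.sets_Collect_finite_All[OF _ finite_net])
      fix z assume "z \<in> net p k"
      have "(\<lambda>W. of_bool (\<bar>block_proj p k N z g W - proj p k z q\<bar> \<le> 2 * rsm_tau N) :: real) \<in> borel_measurable (mat_space p m)"
        if "g \<in> {1..G}" for g
      proof -
        have [measurable]: "block_proj p k N z g \<in> borel_measurable (mat_space p m)"
          by (rule measurable_block_proj) (rule rsm_block_subset[OF N_def that])
        show ?thesis by measurable
      qed
      thus "{W \<in> space (mat_space p m). real G < 2 * (\<Sum>g=1..G. of_bool (\<bar>block_proj p k N z g W - proj p k z q\<bar> \<le> 2 * rsm_tau N))} \<in> sets (mat_space p m)"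
        by (intro borel_measurable_less borel_measurable_const borel_measurable_times borel_measurable_sum)
    qed
    finally show ?thesis by (simp add: pred_def)
  qed
  hence "(\<lambda>W. LEAST i. rsm_feasible p m s \<eta> W (from_nat_into (rsm_candidates p s) i))
      \<in> measurable (mat_space p m) (count_space UNIV)"
    by (intro measurable_Least)
  moreover have "from_nat_into (rsm_candidates p s) \<in> measurable (count_space UNIV) (vec_space p)"
    using from_nat_into[OF candidates_nonempty, of p s]
    by (auto simp: vec_space_def space_PiM rsm_candidates_def PiE_def)
  ultimately show ?thesis
    unfolding rsm_estimator_def[abs_def] by (rule measurable_compose)
qed

section \<open>Accuracy of the estimator\<close>

lemma rational_candidate:
  assumes \<mu>: "norm0 p \<mu> \<le> 2 * s" and e: "e > 0"
  obtains q where "q \<in> rsm_candidates p s" "\<And>j. j \<in> {1..p} \<Longrightarrow> \<bar>q j - \<mu> j\<bar> \<le> e"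
proof -
  have "\<exists>r\<in>\<rat>. \<bar>r - x\<bar> \<le> e" for x :: real
  proof -
    obtain r where "r \<in> \<rat>" "x - e < r" "r < x + e" using Rats_dense_in_real[of "x - e" "x + e"] e by auto
    thus ?thesis by (intro bexI[of _ r]) auto
  qed
  then obtain f where f: "\<And>x :: real. f x \<in> \<rat>" "\<And>x. \<bar>f x - x\<bar> \<le> e" by metis
  define q where "q = (\<lambda>j\<in>{1..p}. if \<mu> j = 0 then 0 else f (\<mu> j))"
  have "norm0 p q \<le> norm0 p \<mu>" unfolding norm0_def by (intro card_mono) (auto simp: q_def)
  hence "q \<in> rsm_candidates p s" using \<mu> f by (auto simp: rsm_candidates_def q_def)
  moreover have "\<bar>q j - \<mu> j\<bar> \<le> e" if "j \<in> {1..p}" for j using that f e by (auto simp: q_def)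
  ultimately show ?thesis by (rule that)
qed

lemma dir_le_one:
  assumes "z \<in> net p k" "j \<in> {1..p}" "k \<ge> 1"
  shows "\<bar>dir k z j\<bar> \<le> 1"
proof -
  have "(real_of_int (z j))\<^sup>2 \<le> (\<Sum>j=1..p. (real_of_int (z j))\<^sup>2)" using assms by (intro member_le_sum) auto
  also have "\<dots> \<le> 4 * real k" using assms by (simp add: net_def)
  also have "\<dots> = (2 * sqrt (real k))\<^sup>2" by (simp add: power_mult_distrib)
  finally have "\<bar>real_of_int (z j)\<bar> \<le> 2 * sqrt (real k)" by (rule abs_le_square_iff[THEN iffD2, THEN order_trans]) simp
  thus ?thesis using assms(3) by (simp add: dir_def abs_divide)
qed

lemma sum_dir_squares_le_one:
  assumes "z \<in> net p k" "k \<ge> 1"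
  shows "(\<Sum>j=1..p. (dir k z j)\<^sup>2) \<le> 1"
proof -
  have "(\<Sum>j=1..p. (dir k z j)\<^sup>2) = (\<Sum>j=1..p. (real_of_int (z j))\<^sup>2) / (4 * real k)"
    by (simp add: dir_def power_divide power_mult_distrib sum_divide_distrib)
  thus ?thesis using assms by (simp add: net_def)
qed

lemma proj_diff: "proj p k z (\<lambda>j. u j - v j) = proj p k z u - proj p k z v"
  by (simp add: proj_def right_diff_distrib sum_subtractf)

text \<open>A direction of the net has norm at most one, so identity covariance bounds the variance
  of a projected column by one. Averaging over \<open>N\<close> columns, Chebyshev's inequality at
  \<open>6 / sqrt N\<close> leaves \<open>(1/6)^2\<close> per block, and the majority bound gives
  \<open>(2/6) ^ G\<close>.\<close>

lemma block_proj_deviation: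
  assumes Q: "rsm_sample \<alpha> K p m s' \<mu> Q" and N: "N = m div G" "N \<ge> 1" and G: "G \<ge> 1"
    and z: "z \<in> net p k" and k: "k \<ge> 1"
  shows "measure Q {W \<in> space Q. G \<le> 2 * card {g \<in> {1..G}. rsm_tau N < \<bar>block_proj p k N z g W - proj p k z \<mu>\<bar>}} \<le> (1 / 3) ^ G"
proof -
  interpret prob_space Q using Q by (simp add: rsm_sample_def)
  define v where "v = dir k z"
  define Y where "Y = (\<lambda>i W. proj p k z (col p W i) - proj p k z \<mu>)"
  have ind: "indep_vars (\<lambda>_. vec_space p) (\<lambda>i W. col p W i) {1..m}" using Q by (simp add: rsm_sample_def)
  have mp: "(\<lambda>x. proj p k z x - c) \<in> borel_measurable (vec_space p)" for c
    unfolding proj_def vec_space_def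
    by (intro borel_measurable_diff borel_measurable_sum borel_measurable_times borel_measurable_const measurable_component_singleton)
  have indY: "indep_vars (\<lambda>_. borel) Y {1..m}"
    unfolding Y_def by (rule indep_vars_compose2[OF ind]) (rule mp)
  have Y: "has_bochner_integral Q (Y i) 0" "integrable Q (\<lambda>W. (Y i W)\<^sup>2)" "expectation (\<lambda>W. (Y i W)\<^sup>2) \<le> 1"
    if i: "i \<in> {1..m}" for i
  proof -
    have W1: "has_bochner_integral Q (\<lambda>W. W (j, i)) (\<mu> j)" if "j \<in> {1..p}" for j
      using Q i that by (auto simp: rsm_sample_def)
    have W2: "has_bochner_integral Q (\<lambda>W. (W (j, i) - \<mu> j) * (W (l, i) - \<mu> l)) (of_bool (j = l))"
      if "j \<in> {1..p}" "l \<in> {1..p}" for j l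
      using Q i that by (auto simp: rsm_sample_def)
    have Yeq: "Y i W = (\<Sum>j=1..p. v j * (W (j, i) - \<mu> j))" for W
      by (simp add: Y_def proj_def col_def v_def sum_subtractf right_diff_distrib)
    have "has_bochner_integral Q (\<lambda>W. W (j, i) - \<mu> j) 0" if "j \<in> {1..p}" for j
      using W1[OF that] by (simp add: has_bochner_integral_iff prob_space)
    hence "has_bochner_integral Q (\<lambda>W. \<Sum>j=1..p. v j * (W (j, i) - \<mu> j)) (\<Sum>j=1..p. v j * 0)"
      by (intro has_bochner_integral_sum has_bochner_integral_mult_right) auto
    thus "has_bochner_integral Q (Y i) 0" by (simp add: Yeq[abs_def])
    have sq: "(Y i W)\<^sup>2 = (\<Sum>j=1..p. \<Sum>l=1..p. v j * v l * ((W (j, i) - \<mu> j) * (W (l, i) - \<mu> l)))" for W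
      unfolding Yeq power2_eq_square sum_product by (simp add: mult_ac)
    have "has_bochner_integral Q (\<lambda>W. (Y i W)\<^sup>2) (\<Sum>j=1..p. \<Sum>l=1..p. v j * v l * of_bool (j = l))"
      unfolding sq by (intro has_bochner_integral_sum has_bochner_integral_mult_right W2)
    also have "(\<Sum>j=1..p. \<Sum>l=1..p. v j * v l * of_bool (j = l)) = (\<Sum>j=1..p. (v j)\<^sup>2)"
    proof (rule sum.cong[OF refl])
      fix j assume "j \<in> {1..p}"
      have "(\<Sum>l=1..p. v j * v l * of_bool (j = l)) = (\<Sum>l=1..p. if j = l then v j * v j else 0)"
        by (intro sum.cong) auto
      thus "(\<Sum>l=1..p. v j * v l * of_bool (j = l)) = (v j)\<^sup>2"
        using \<open>j \<in> {1..p}\<close> by (simp add: power2_eq_square)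
    qed
    finally show "integrable Q (\<lambda>W. (Y i W)\<^sup>2)" "expectation (\<lambda>W. (Y i W)\<^sup>2) \<le> 1"
      using sum_dir_squares_le_one[OF z k] by (auto simp: has_bochner_integral_iff v_def)
  qed
  have cardN: "card (rsm_block N g) = N" if "g \<in> {1..G}" for g
    using that by (cases g) (auto simp: rsm_block_def)
  have bp: "block_proj p k N z g W - proj p k z \<mu> = (\<Sum>i\<in>rsm_block N g. Y i W) / real N" if "g \<in> {1..G}" for g W
    using cardN[OF that] N by (simp add: block_proj_def Y_def sum_subtractf field_simps)
  have sub: "rsm_block N g \<subseteq> {1..m}" if "g \<in> {1..G}" for g using rsm_block_subset[OF N(1) that] by blast
  have indB: "indep_vars (\<lambda>_. borel) (\<lambda>g W. (\<Sum>i\<in>rsm_block N g. Y i W) / real N) {1..G}"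
  proof -
    have "indep_vars (\<lambda>_. borel) (\<lambda>g W. (\<lambda>y. (\<Sum>i\<in>rsm_block N g. y i) / real N) (restrict (\<lambda>i. Y i W) (rsm_block N g))) {1..G}"
    proof (rule indep_vars_compose2[OF indep_vars_restrict[OF indY sub disjoint_rsm_block]])
      show "(\<lambda>y. (\<Sum>i\<in>rsm_block N g. y i) / real N) \<in> borel_measurable (Pi\<^sub>M (rsm_block N g) (\<lambda>_. borel))" for g
        by (intro borel_measurable_divide borel_measurable_sum borel_measurable_const measurable_component_singleton)
    qed
    thus ?thesis by (simp cong: sum.cong)
  qed
  have tau: "rsm_tau N > 0" using N by (simp add: rsm_tau_def)
  have "prob {W \<in> space Q. G \<le> 2 * card {g \<in> {1..G}. rsm_tau N < \<bar>(\<Sum>i\<in>rsm_block N g. Y i W) / real N\<bar>}}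
      \<le> (2 * (1 / 6)) ^ G"
  proof (rule indep_events_majority[OF G])
    show "indep_events (\<lambda>g. {W \<in> space Q. rsm_tau N < \<bar>(\<Sum>i\<in>rsm_block N g. Y i W) / real N\<bar>}) {1..G}"
      using indep_eventsI_indep_vars[OF indB, of "\<lambda>_ v. rsm_tau N < \<bar>v\<bar>"] by simp
    fix g assume g: "g \<in> {1..G}"
    have sm: "integrable Q (\<lambda>W. (\<Sum>i\<in>rsm_block N g. Y i W)\<^sup>2)"
      "expectation (\<lambda>W. (\<Sum>i\<in>rsm_block N g. Y i W)\<^sup>2) = (\<Sum>i\<in>rsm_block N g. expectation (\<lambda>W. (Y i W)\<^sup>2))"
      using indep_sum_second_moment[OF _ indep_vars_subset[OF indY sub[OF g]] Y(2,1)[OF subsetD[OF sub[OF g]]]]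
      by (auto simp: rsm_block_def)
    have "prob {W \<in> space Q. rsm_tau N < \<bar>(\<Sum>i\<in>rsm_block N g. Y i W) / real N\<bar>}
        \<le> expectation (\<lambda>W. (\<Sum>i\<in>rsm_block N g. Y i W)\<^sup>2) / (rsm_tau N * real N)\<^sup>2"
      by (rule prob_le_markov_square[OF sm(1)]) (use tau N in \<open>auto simp: abs_divide field_simps\<close>)
    also have "\<dots> \<le> (\<Sum>i\<in>rsm_block N g. 1) / (rsm_tau N * real N)\<^sup>2"
      unfolding sm(2) by (intro divide_right_mono sum_mono Y(3)[OF subsetD[OF sub[OF g]]]) auto
    also have "\<dots> = (1 / 6)\<^sup>2"
      using N cardN[OF g] by (simp add: rsm_tau_def power_mult_distrib power_divide power2_eq_square)
    finally show "prob {W \<in> space Q. rsm_tau N < \<bar>(\<Sum>i\<in>rsm_block N g. Y i W) / real N\<bar>} \<le> (1 / 6)\<^sup>2" .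
  qed auto
  also have "{W \<in> space Q. G \<le> 2 * card {g \<in> {1..G}. rsm_tau N < \<bar>(\<Sum>i\<in>rsm_block N g. Y i W) / real N\<bar>}}
      = {W \<in> space Q. G \<le> 2 * card {g \<in> {1..G}. rsm_tau N < \<bar>block_proj p k N z g W - proj p k z \<mu>\<bar>}}"
    by (intro Collect_cong conj_cong refl arg_cong[where f = "\<lambda>n. G \<le> 2 * card n"]) (simp add: bp cong: conj_cong)
  finally show ?thesis by simp
qed

lemma ln_sparsity_ge_one:
  assumes "s \<in> {1..p}"
  shows "1 \<le> ln (exp 1 * real p / real s)"
proof -
  have "0 < real s" "real s \<le> real p" using assms by auto
  hence "ln (exp 1 * real p / real s) = 1 + ln (real p / real s)" by (simp add: ln_mult ln_div)
  thus ?thesis using \<open>0 < real s\<close> \<open>real s \<le> real p\<close> by simp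
qed

text \<open>Outside the union of bad events over the net, a rational point close to
  \<open>\<mu>\<close> is feasible, hence so is the estimate. In each direction it shares a block
  with \<open>\<mu>\<close>, so the projections differ by at most \<open>3 * \<tau>\<close> and
  \<open>net_norming\<close> yields \<open>6 * \<tau>\<close>. The mean may have
  \<open>2 * s\<close> nonzero entries although the estimator is tuned to \<open>s\<close>.\<close>

lemma rsm_estimator_bound:
  assumes Q: "rsm_sample \<alpha> K p m (2 * s) \<mu> Q" and s: "s \<in> {1..p}" and \<eta>: "0 < \<eta>" "\<eta> < 1"
    and m: "real m \<ge> 11 * (real s * ln (exp 1 * real p / real s) + ln (1 / \<eta>))"
  shows "measure Q {W \<in> space Q. sqrt (sqnorm p (\<lambda>j. rsm_estimator p m s \<eta> W j - \<mu> j))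
      \<le> sqrt 28512 * (sqrt (real s * ln (exp 1 * real p / real s) / real m) + sqrt (ln (1 / \<eta>) / real m))} \<ge> 1 - \<eta>"
proof -
  interpret prob_space Q using Q by (simp add: rsm_sample_def)
  have setsQ: "sets Q = sets (mat_space p m)" using Q by (simp add: rsm_sample_def)
  define l where "l = real s * ln (exp 1 * real p / real s)"
  define e where "e = ln (1 / \<eta>)"
  define G where "G = rsm_groups p s \<eta>"
  define N where "N = m div G"
  define k where "k = 4 * s"
  have s0: "real s \<ge> 1" "k \<ge> 1" "p \<ge> 1" using s by (auto simp: k_def)
  have "1 * 1 \<le> l" unfolding l_def using s0 ln_sparsity_ge_one[OF s] by (intro mult_mono) auto
  hence l: "l \<ge> 1" by simp
  have e: "e > 0" using \<eta> by (simp add: e_def)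
  have "G = nat \<lceil>10 * l + e\<rceil>" by (simp add: G_def rsm_groups_def l_def e_def)
  moreover have "0 \<le> 10 * l + e" using l e by simp
  ultimately have G: "10 * l + e \<le> real G" "real G \<le> 10 * l + e + 1" by linarith+
  have G1: "G \<ge> 1" using G(1) l e by (cases G) auto
  have m': "11 * (l + e) \<le> real m" using m by (simp add: l_def e_def)
  have "real G \<le> real m" using G(2) m' l e by simp
  hence Gm: "G \<le> m" by simp
  have N1: "N \<ge> 1" using Gm G1 by (simp add: N_def Suc_le_eq div_greater_zero_iff)
  have "m < G * (N + 1)" using G1 by (simp add: N_def dividend_less_times_div)
  also have "\<dots> \<le> G * (2 * N)" using N1 by (intro mult_left_mono) auto
  finally have mN: "real m \<le> 2 * real G * real N"
    by (metis (no_types, opaque_lifting) less_imp_le mult.assoc mult.left_commute of_nat_le_iff of_nat_mult of_nat_numeral)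
  define \<tau> where "\<tau> = rsm_tau N"
  have tau: "\<tau> > 0" using N1 by (simp add: \<tau>_def rsm_tau_def)
  define bad where "bad = (\<lambda>z. {W \<in> space Q. G \<le> 2 * card {g \<in> {1..G}. \<tau> < \<bar>block_proj p k N z g W - proj p k z \<mu>\<bar>}})"
  have bad_ev: "bad z \<in> events" for z
  proof -
    have "{W \<in> space Q. (G + 1) div 2 \<le> card {g \<in> {1..G}. \<tau> < \<bar>block_proj p k N z g W - proj p k z \<mu>\<bar>}} \<in> events"
    proof (rule count_event[OF finite_atLeastAtMost])
      fix g assume g: "g \<in> {1..G}"
      have "block_proj p k N z g \<in> borel_measurable (mat_space p m)"
        by (rule measurable_block_proj) (rule rsm_block_subset[OF N_def g])
      hence [measurable]: "random_variable borel (block_proj p k N z g)"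
        using measurable_cong_sets[OF setsQ refl] by blast
      show "{W \<in> space Q. \<tau> < \<bar>block_proj p k N z g W - proj p k z \<mu>\<bar>} \<in> events" by measurable
    qed
    moreover have "(G + 1) div 2 \<le> c \<longleftrightarrow> G \<le> 2 * c" for c by linarith
    ultimately show ?thesis by (simp only: bad_def)
  qed
  have bad_prob: "prob (bad z) \<le> (1 / 3) ^ G" if "z \<in> net p k" for z
    unfolding bad_def \<tau>_def by (rule block_proj_deviation[OF Q N_def N1 G1 that s0(2)])
  have "prob (\<Union>z\<in>net p k. bad z) \<le> (\<Sum>z\<in>net p k. prob (bad z))"
    using bad_ev by (intro finite_measure_subadditive_finite finite_net) auto
  also have "\<dots> \<le> (\<Sum>z\<in>net p k. (1 / 3) ^ G)" by (intro sum_mono bad_prob)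
  also have "\<dots> = real (card (net p k)) * (1 / 3) ^ G" by simp
  also have "\<dots> \<le> exp (10 * l) * exp (- real G)"
  proof (rule mult_mono)
    show "real (card (net p k)) \<le> exp (10 * l)" using card_net_le[OF s] by (simp add: k_def l_def)
    have "(1 / 3 :: real) \<le> exp (- 1)" using exp_le by (simp add: exp_minus field_simps)
    hence "(1 / 3 :: real) ^ G \<le> exp (- 1) ^ G" by (intro power_mono) auto
    also have "\<dots> = exp (- real G)" by (simp add: exp_of_nat_mult[symmetric])
    finally show "(1 / 3 :: real) ^ G \<le> exp (- real G)" .
  qed auto
  also have "\<dots> \<le> exp (- e)" using G(1) by (simp add: exp_add[symmetric])
  also have "exp (- e) = \<eta>" using \<eta> by (simp add: e_def ln_div)
  finally have bad: "prob (\<Union>z\<in>net p k. bad z) \<le> \<eta>" .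
  define good where "good = {W \<in> space Q. sqrt (sqnorm p (\<lambda>j. rsm_estimator p m s \<eta> W j - \<mu> j))
      \<le> sqrt 28512 * (sqrt (l / real m) + sqrt (e / real m))}"
  have mu: "norm0 p \<mu> \<le> 2 * s" using Q by (simp add: rsm_sample_def)
  have "W \<in> good" if W: "W \<in> space Q" "\<And>z. z \<in> net p k \<Longrightarrow> W \<notin> bad z" for W
  proof -
    have near: "G < 2 * card {g \<in> {1..G}. \<bar>block_proj p k N z g W - proj p k z \<mu>\<bar> \<le> \<tau>}" if z: "z \<in> net p k" for z
    proof -
      let ?A = "{g \<in> {1..G}. \<bar>block_proj p k N z g W - proj p k z \<mu>\<bar> \<le> \<tau>}"
      let ?B = "{g \<in> {1..G}. \<tau> < \<bar>block_proj p k N z g W - proj p k z \<mu>\<bar>}"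
      have un: "?A \<union> ?B = {1..G}" by auto
      have "card (?A \<union> ?B) \<le> card ?A + card ?B" by (rule card_Un_le)
      hence "card {1..G} \<le> card ?A + card ?B" by (simp only: un)
      moreover have "card {1..G} = G" by simp
      moreover have "\<not> G \<le> 2 * card {g \<in> {1..G}. \<tau> < \<bar>block_proj p k N z g W - proj p k z \<mu>\<bar>}"
        using W(1) W(2)[OF z] unfolding bad_def by blast
      ultimately show ?thesis by linarith
    qed
    obtain q where q: "q \<in> rsm_candidates p s" "\<And>j. j \<in> {1..p} \<Longrightarrow> \<bar>q j - \<mu> j\<bar> \<le> \<tau> / real p"
      using rational_candidate[OF mu, of "\<tau> / real p"] tau s0 by auto
    have pq: "\<bar>proj p k z q - proj p k z \<mu>\<bar> \<le> \<tau>" if z: "z \<in> net p k" for z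
    proof -
      have "\<bar>proj p k z q - proj p k z \<mu>\<bar> = \<bar>\<Sum>j=1..p. dir k z j * (q j - \<mu> j)\<bar>"
        by (simp add: proj_def sum_subtractf right_diff_distrib)
      also have "\<dots> \<le> (\<Sum>j=1..p. \<bar>dir k z j * (q j - \<mu> j)\<bar>)" by (rule sum_abs)
      also have "\<dots> \<le> (\<Sum>j=1..p. 1 * (\<tau> / real p))"
        unfolding abs_mult by (intro sum_mono mult_mono dir_le_one[OF z _ s0(2)] q(2)) auto
      also have "\<dots> = \<tau>" using s0 by simp
      finally show ?thesis .
    qed
    have "rsm_feasible p m s \<eta> W q"
      unfolding rsm_feasible_def Let_def G_def[symmetric] N_def[symmetric] k_def[symmetric] \<tau>_def[symmetric]
    proof
      fix z assume z: "z \<in> net p k"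
      have "\<bar>block_proj p k N z g W - proj p k z q\<bar> \<le> 2 * \<tau>"
        if "\<bar>block_proj p k N z g W - proj p k z \<mu>\<bar> \<le> \<tau>" for g
        using that pq[OF z] by linarith
      hence "card {g \<in> {1..G}. \<bar>block_proj p k N z g W - proj p k z \<mu>\<bar> \<le> \<tau>}
          \<le> card {g \<in> {1..G}. \<bar>block_proj p k N z g W - proj p k z q\<bar> \<le> 2 * \<tau>}"
        by (intro card_mono) auto
      thus "G < 2 * card {g \<in> {1..G}. \<bar>block_proj p k N z g W - proj p k z q\<bar> \<le> 2 * \<tau>}"
        using near[OF z] by linarith
    qed
    from rsm_estimator_feasible[OF q(1) this] have feas: "rsm_feasible p m s \<eta> W (rsm_estimator p m s \<eta> W)" .
    define u where "u = rsm_estimator p m s \<eta> W"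
    have "norm0 p u \<le> 2 * s" using rsm_estimator_candidate[of p m s \<eta> W] by (simp add: u_def rsm_candidates_def)
    moreover have "{j \<in> {1..p}. u j - \<mu> j \<noteq> 0} \<subseteq> {j \<in> {1..p}. u j \<noteq> 0} \<union> {j \<in> {1..p}. \<mu> j \<noteq> 0}" by auto
    hence "norm0 p (\<lambda>j. u j - \<mu> j) \<le> card ({j \<in> {1..p}. u j \<noteq> 0} \<union> {j \<in> {1..p}. \<mu> j \<noteq> 0})"
      unfolding norm0_def by (intro card_mono) auto
    hence "norm0 p (\<lambda>j. u j - \<mu> j) \<le> norm0 p u + norm0 p \<mu>"
      unfolding norm0_def using card_Un_le order_trans by blast
    ultimately have sp: "norm0 p (\<lambda>j. u j - \<mu> j) \<le> k" using mu by (simp add: k_def)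
    have "sqrt (sqnorm p (\<lambda>j. u j - \<mu> j)) \<le> 2 * (3 * \<tau>)"
    proof (rule net_norming[OF s0(2) sp])
      fix z assume z: "z \<in> net p k"
      let ?A = "{g \<in> {1..G}. \<bar>block_proj p k N z g W - proj p k z u\<bar> \<le> 2 * \<tau>}"
      let ?B = "{g \<in> {1..G}. \<bar>block_proj p k N z g W - proj p k z \<mu>\<bar> \<le> \<tau>}"
      have "G < 2 * card ?A"
        using feas z unfolding rsm_feasible_def Let_def G_def[symmetric] N_def[symmetric] k_def[symmetric] \<tau>_def[symmetric] u_def[symmetric]
        by blast
      moreover have "?A \<inter> ?B = {} \<Longrightarrow> card ?A + card ?B \<le> G"
      proof -
        assume "?A \<inter> ?B = {}"
        hence "card ?A + card ?B = card (?A \<union> ?B)" by (intro card_Un_disjoint[symmetric]) auto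
        also have "\<dots> \<le> card {1..G}" by (intro card_mono) auto
        finally show ?thesis by simp
      qed
      ultimately have "?A \<inter> ?B \<noteq> {}" using near[OF z] by linarith
      then obtain g where "\<bar>block_proj p k N z g W - proj p k z u\<bar> \<le> 2 * \<tau>" "\<bar>block_proj p k N z g W - proj p k z \<mu>\<bar> \<le> \<tau>"
        by blast
      thus "\<bar>proj p k z (\<lambda>j. u j - \<mu> j)\<bar> \<le> 3 * \<tau>" unfolding proj_diff by linarith
    qed
    also have "2 * (3 * \<tau>) = sqrt (1296 / real N)"
      by (simp add: \<tau>_def rsm_tau_def real_sqrt_divide)
    \<comment> \<open>\<open>28512 = 1296 * 2 * 11\<close>: the remainder of \<open>m div G\<close>
      costs at most a factor two, and
      \<open>G \<le> 10 * l + e + 1 \<le> 11 * (l + e)\<close>.\<close>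
    also have "\<dots> \<le> sqrt (28512 * (l / real m + e / real m))"
    proof -
      have m0: "real m > 0" using Gm G1 by simp
      have "1296 / real N \<le> 1296 * (2 * real G / real m)"
        using mN m0 N1 by (simp add: field_simps)
      also have "\<dots> \<le> 1296 * (2 * (11 * (l + e)) / real m)"
        using G(2) l e m0 by (intro mult_left_mono divide_right_mono) auto
      also have "\<dots> = 28512 * (l / real m + e / real m)" by (simp add: add_divide_distrib field_simps)
      finally show ?thesis by simp
    qed
    also have "\<dots> = sqrt 28512 * sqrt (l / real m + e / real m)" by (rule real_sqrt_mult)
    also have "\<dots> \<le> sqrt 28512 * (sqrt (l / real m) + sqrt (e / real m))"
      using l e by (intro mult_left_mono sqrt_add_le_add_sqrt) auto
    finally show ?thesis using W(1) by (simp add: good_def u_def)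
  qed
  hence sub: "space Q - (\<Union>z\<in>net p k. bad z) \<subseteq> good" by blast
  have good_ev: "good \<in> events"
  proof -
    have est: "rsm_estimator p m s \<eta> \<in> measurable Q (vec_space p)"
      using measurable_rsm_estimator measurable_cong_sets[OF setsQ refl] by blast
    have comp: "random_variable borel (\<lambda>W. rsm_estimator p m s \<eta> W j)" if "j \<in> {1..p}" for j
    proof (rule measurable_compose[OF est])
      show "(\<lambda>x. x j) \<in> borel_measurable (vec_space p)"
        unfolding vec_space_def by (rule measurable_component_singleton[OF that])
    qed
    have [measurable]: "random_variable borel (\<lambda>W. sqnorm p (\<lambda>j. rsm_estimator p m s \<eta> W j - \<mu> j))"
      unfolding sqnorm_def
      by (intro borel_measurable_sum borel_measurable_power borel_measurable_diff comp borel_measurable_const)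
    have "random_variable borel (\<lambda>W. sqrt (sqnorm p (\<lambda>j. rsm_estimator p m s \<eta> W j - \<mu> j)))" by measurable
    thus ?thesis unfolding good_def by (intro borel_measurable_le borel_measurable_const)
  qed
  have "1 - \<eta> \<le> 1 - prob (\<Union>z\<in>net p k. bad z)" using bad by simp
  also have "\<dots> = prob (space Q - (\<Union>z\<in>net p k. bad z))"
    using bad_ev finite_net by (intro prob_compl[symmetric] sets.finite_UN) auto
  also have "\<dots> \<le> prob good" by (rule finite_measure_mono[OF sub good_ev])
  finally show ?thesis by (simp add: good_def l_def e_def)
qed

lemma robust_sparse_mean_estimator: "robust_sparse_mean \<alpha> K rsm_estimator"
  unfolding robust_sparse_mean_def
proof (intro conjI allI impI ballI)
  show "rsm_estimator p m s \<eta> \<in> measurable (mat_space p m) (vec_space p)" for p m s \<eta>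
    by (rule measurable_rsm_estimator)
  show "\<exists>B1\<ge>1. \<exists>B2\<ge>1. \<forall>p\<ge>1. \<forall>m. \<forall>s\<in>{1..p}. \<forall>\<eta> \<mu> Q.
        0 < \<eta> \<and> \<eta> < 1 \<and> rsm_sample \<alpha> K p m s \<mu> Q \<and>
        real m \<ge> B1 * (real s * ln (exp 1 * real p / real s) + ln (1 / \<eta>)) \<longrightarrow>
        measure Q {W \<in> space Q. sqrt (sqnorm p (\<lambda>j. rsm_estimator p m s \<eta> W j - \<mu> j))
            \<le> sqrt B2 * (sqrt (real s * ln (exp 1 * real p / real s) / real m)
                        + sqrt (ln (1 / \<eta>) / real m))} \<ge> 1 - \<eta>"
  proof (rule exI[of _ 11], intro conjI, simp, rule exI[of _ 28512], intro conjI, simp, intro allI ballI impI)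
    fix p m s :: nat and \<eta> :: real and \<mu> Q
    assume s: "s \<in> {1..p}" and *: "0 < \<eta> \<and> \<eta> < 1 \<and> rsm_sample \<alpha> K p m s \<mu> Q \<and>
        real m \<ge> 11 * (real s * ln (exp 1 * real p / real s) + ln (1 / \<eta>))"
    hence "rsm_sample \<alpha> K p m (2 * s) \<mu> Q" by (auto simp: rsm_sample_def)
    thus "measure Q {W \<in> space Q. sqrt (sqnorm p (\<lambda>j. rsm_estimator p m s \<eta> W j - \<mu> j))
            \<le> sqrt 28512 * (sqrt (real s * ln (exp 1 * real p / real s) / real m)
                        + sqrt (ln (1 / \<eta>) / real m))} \<ge> 1 - \<eta>"
      using * by (intro rsm_estimator_bound[OF _ s]) auto
  qed
qed

section \<open>Tuning constants\<close>

lemma scales_iff: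
  assumes "n \<ge> 2"
  shows "t \<in> scales n \<longleftrightarrow> (\<exists>k. t = 2 ^ k) \<and> 2 * t \<le> n"
proof -
  have "int k \<le> \<lfloor>log 2 (real n / 2)\<rfloor> \<longleftrightarrow> 2 * 2 ^ k \<le> n" for k
  proof -
    have "int k \<le> \<lfloor>log 2 (real n / 2)\<rfloor> \<longleftrightarrow> real k \<le> log 2 (real n / 2)" by (simp add: le_floor_iff)
    also have "\<dots> \<longleftrightarrow> 2 powr real k \<le> real n / 2" using assms by (intro le_log_iff) auto
    also have "\<dots> \<longleftrightarrow> 2 * 2 ^ k \<le> real n" by (simp add: powr_realpow field_simps)
    also have "\<dots> \<longleftrightarrow> real (2 * 2 ^ k) \<le> real n" by simp
    finally show ?thesis by (simp only: of_nat_le_iff)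
  qed
  thus ?thesis by (auto simp: scales_def)
qed

lemma finite_powers_of_two: "finite S \<Longrightarrow> S \<subseteq> range (\<lambda>k. 2 ^ k) \<Longrightarrow> \<exists>K. finite K \<and> S = (\<lambda>k. 2 ^ k :: nat) ` K"
  using finite_subset_image[of S "\<lambda>k. 2 ^ k :: nat" UNIV] by blast

text \<open>A geometric series of ratio \<open>1 / sqrt 2 \<le> 3/4\<close>. It sums the errors
  twice: over the scales \<open>t\<close> and over the sparsity grid.\<close>

lemma sum_inverse_sqrt_powers_of_two:
  assumes "finite S" "S \<subseteq> range (\<lambda>k. 2 ^ k :: nat)"
  shows "(\<Sum>t\<in>S. 1 / sqrt (real t)) \<le> 4"
proof -
  obtain K where K: "finite K" "S = (\<lambda>k. 2 ^ k :: nat) ` K" using finite_powers_of_two[OF assms] by blast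
  define b where "b = 1 / sqrt (2 :: real)"
  have b: "0 \<le> b" "b \<le> 3 / 4"
  proof -
    have "(4 / 3 :: real) \<le> sqrt 2" by (rule real_le_rsqrt) (simp add: power2_eq_square)
    thus "b \<le> 3 / 4" by (simp add: b_def field_simps)
  qed (simp add: b_def)
  have sm: "summable (\<lambda>k. b ^ k)" using b by (intro summable_geometric) auto
  have "(\<Sum>t\<in>S. 1 / sqrt (real t)) = (\<Sum>k\<in>K. b ^ k)"
    unfolding K(2) by (subst sum.reindex) (auto simp: inj_on_def b_def real_sqrt_power power_divide)
  also have "\<dots> \<le> suminf (\<lambda>k. b ^ k)" using b by (intro sum_le_suminf sm K(1)) auto
  also have "\<dots> = 1 / (1 - b)" using b by (intro suminf_geometric) auto
  also have "\<dots> \<le> 4" using b by (simp add: field_simps)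
  finally show ?thesis .
qed

lemma card_powers_of_two_le:
  assumes "S \<subseteq> range (\<lambda>k. 2 ^ k :: nat)" and x: "x \<ge> 1" "\<And>t. t \<in> S \<Longrightarrow> real t \<le> x"
  shows "real (card S) \<le> log 2 x + 1"
proof -
  define m where "m = nat \<lfloor>log 2 x\<rfloor>"
  have l0: "0 \<le> log 2 x" using x(1) by simp
  have "S \<subseteq> (\<lambda>k. 2 ^ k) ` {..m}"
  proof
    fix t assume t: "t \<in> S"
    then obtain k where k: "t = 2 ^ k" using assms(1) by blast
    have "2 powr real k \<le> x" using x(2)[OF t] k by (simp add: powr_realpow)
    hence "real k \<le> log 2 x" using x(1) by (simp add: le_log_iff)
    hence "k \<le> m" using l0 by (simp add: m_def le_nat_iff le_floor_iff)
    thus "t \<in> (\<lambda>k. 2 ^ k) ` {..m}" using k by blast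
  qed
  hence "card S \<le> card ((\<lambda>k. 2 ^ k :: nat) ` {..m})" by (intro card_mono) auto
  also have "\<dots> \<le> card {..m}" by (rule card_image_le) simp
  also have "\<dots> = m + 1" by simp
  finally have "real (card S) \<le> real m + 1" by linarith
  also have "real m \<le> log 2 x" using l0 by (simp add: m_def)
  finally show ?thesis by simp
qed

lemma log2_le_ln:
  assumes "x \<ge> 1"
  shows "log 2 x \<le> 2 * ln x"
proof -
  have "ln x * 1 \<le> ln x * (2 * ln 2)" using ln2_ge_two_thirds assms by (intro mult_left_mono) auto
  thus ?thesis by (simp add: log_def divide_le_eq mult_ac)
qed

lemma ln_le_twice_sqrt:
  assumes "x > (0 :: real)"
  shows "ln x \<le> 2 * sqrt x"
  using ln_le_minus_one[of "sqrt x"] assms by (simp add: ln_sqrt)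

lemma binomial_le_exp_power:
  assumes "s \<in> {1..p}"
  shows "real (p choose s) \<le> (exp 1 * real p / real s) ^ s"
proof -
  have "real s ^ s / fact s \<le> (\<Sum>k. inverse (fact k) * real s ^ k)"
    using sum_le_suminf[OF summable_exp[of "real s"], of "{s}"] by (simp add: field_simps)
  also have "\<dots> = exp (real s)" by (simp add: exp_def scaleR_conv_of_real)
  finally have f: "real s ^ s \<le> exp (real s) * fact s" by (simp add: field_simps)
  have "real (p choose s) * fact s \<le> real p ^ s"
    using binomial_fact_pow[of p s] by (metis of_nat_fact of_nat_le_iff of_nat_mult of_nat_power)
  hence "real (p choose s) * real s ^ s \<le> exp (real s) * real p ^ s"
    using mult_left_mono[OF f, of "real (p choose s)"] by (smt (verit) exp_gt_zero mult.assoc mult.commute mult_left_mono of_nat_0_le_iff)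
  thus ?thesis using assms
    by (simp add: power_divide power_mult_distrib exp_of_nat_mult[symmetric] field_simps)
qed

lemma exp_minus_le_inverse:
  assumes "x > (0 :: real)"
  shows "exp (- x) \<le> 1 / x"
proof -
  have "x \<le> exp x" using exp_ge_add_one_self[of x] by linarith
  thus ?thesis using assms by (simp add: exp_minus inverse_eq_divide frac_le)
qed

text \<open>Numbers of groups are taken as powers of two so that they divide the dyadic sample
  sizes; the price is a factor two.\<close>

lemma power_of_two_between:
  assumes "x \<ge> (1 :: real)"
  obtains k where "x \<le> 2 ^ k" "2 ^ k \<le> 2 * x"
proof -
  define k where "k = nat \<lceil>log 2 x\<rceil>"
  have l0: "0 \<le> log 2 x" using assms by simp
  have "log 2 x \<le> real k" using l0 by (simp add: k_def)
  hence 1: "x \<le> 2 ^ k" using assms by (simp add: log_le_iff powr_realpow)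
  have "real k \<le> log 2 x + 1" using l0 by (simp add: k_def)
  also have "\<dots> = log 2 (2 * x)" using assms by (simp add: log_mult)
  finally have "2 ^ k \<le> 2 * x" using assms by (simp add: le_log_iff powr_realpow)
  thus ?thesis using 1 that by blast
qed

locale const_params =
  fixes \<alpha> H \<epsilon> :: real
  assumes \<alpha>: "\<alpha> \<ge> 4" and H1': "H \<ge> 1" and \<epsilon>: "0 < \<epsilon>" "\<epsilon> < 1"
begin

text \<open>\<open>kV\<close> and \<open>kH\<close> repeat \<open>V\<close> and \<open>H1\<close> of
  the array outside any probability space, since the final constant must be fixed before the noise
  law. The number of groups is at most \<open>2 * kG * (s * u)\<close>, \<open>kR\<close> bounds the
  complexity term of the estimator, \<open>a^2 = kc * u\<close>, \<open>kA\<close> belongs to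
  \<open>\<Delta>\<close>, \<open>kC\<close> and \<open>kT\<close> to the null thresholds and
  \<open>k0\<close> to the separation. In \<open>kc\<close>, the term
  \<open>64 * kH / \<epsilon>\<close> makes the power tail small and the last one outweighs the
  binomial coefficient.\<close>

definition kV where "kV = 2 * H + 8"
definition kH where "kH = H * \<alpha> powr \<alpha> + 2 * exp (2 * \<alpha>\<^sup>2)"
definition kG where "kG = 2 + 256 / \<epsilon>"
definition kR where "kR = \<alpha> / 2 + kG"
definition kc where "kc = 2 + 64 * kH / \<epsilon> + 32 * (4 + \<alpha> / 2 + 256 / \<epsilon>)"
definition kA0 where "kA0 = 4 * exp 1 * H * kc powr (\<alpha> / 2)"
definition kA where "kA = (512 * kA0 / \<epsilon>)\<^sup>2 + 4 * kG + 11 * kR"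
definition kC where "kC = 512 * kc / \<epsilon> + 128 * kV * (3 * kA + 8 * \<alpha>) / \<epsilon> + 16 * kG * kV"
definition kT where "kT = 114048 * kR"
definition k0 where "k0 = 64 * kc + 32 * kC + 3328 * kV / \<epsilon> + 12288 * kG * kV + 5 * kT"

lemma basic: "kV \<ge> 10" "kH \<ge> H" "kH > 0" "kG \<ge> 2" "kG \<ge> 256 / \<epsilon>" "kR \<ge> kG" "kR \<ge> 4" "kc \<ge> 2" "kc \<ge> 64 * kH / \<epsilon>"
  "kc \<ge> 32 * (4 + \<alpha> / 2 + 256 / \<epsilon>)" "kA0 > 0" "kA \<ge> (512 * kA0 / \<epsilon>)\<^sup>2" "kA \<ge> 4 * kG" "kA \<ge> 11 * kR" "kA \<ge> 44"
  "kC \<ge> 512 * kc / \<epsilon>" "kC \<ge> 128 * kV * (3 * kA + 8 * \<alpha>) / \<epsilon>" "kC \<ge> 16 * kG * kV" "kC \<ge> 2 * kc" "kC \<ge> 1" "kT > 0"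
  "k0 \<ge> 64 * kc" "k0 \<ge> 32 * kC" "k0 \<ge> 3328 * kV / \<epsilon>" "k0 \<ge> 12288 * kG * kV" "k0 \<ge> 5 * kT" "k0 \<ge> 1"
proof -
  show V: "kV \<ge> 10" using H1' by (simp add: kV_def)
  have "\<alpha> powr \<alpha> \<ge> 1 powr \<alpha>" using \<alpha> by (intro powr_mono2) auto
  hence "H * 1 \<le> H * \<alpha> powr \<alpha>" using H1' by (intro mult_left_mono) auto
  moreover have "exp (2 * \<alpha>\<^sup>2) > 0" by simp
  ultimately show kH: "kH \<ge> H" "kH > 0" using H1' unfolding kH_def by linarith+
  have e: "256 / \<epsilon> > 0" using \<epsilon> by simp
  show G: "kG \<ge> 2" "kG \<ge> 256 / \<epsilon>" using e by (auto simp: kG_def)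
  show R: "kR \<ge> kG" "kR \<ge> 4" using G \<alpha> by (auto simp: kR_def)
  have h: "64 * kH / \<epsilon> \<ge> 0" using kH \<epsilon> by simp
  have e4: "32 * (4 + \<alpha> / 2 + 256 / \<epsilon>) \<ge> 0" using e \<alpha> by simp
  show c: "kc \<ge> 2" "kc \<ge> 64 * kH / \<epsilon>" "kc \<ge> 32 * (4 + \<alpha> / 2 + 256 / \<epsilon>)" using h e4 unfolding kc_def by linarith+
  show A0: "kA0 > 0" using H1' c by (simp add: kA0_def)
  have sq: "(512 * kA0 / \<epsilon>)\<^sup>2 \<ge> 0" by simp
  show A: "kA \<ge> (512 * kA0 / \<epsilon>)\<^sup>2" "kA \<ge> 4 * kG" "kA \<ge> 11 * kR" "kA \<ge> 44" using G R sq unfolding kA_def by linarith+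
  have t1: "512 * kc / \<epsilon> \<ge> 512 * kc" using c \<epsilon> by (simp add: field_simps)
  have t2: "128 * kV * (3 * kA + 8 * \<alpha>) / \<epsilon> \<ge> 0" using V A \<alpha> \<epsilon> by simp
  have t3: "16 * kG * kV \<ge> 0" using V G by simp
  show C: "kC \<ge> 512 * kc / \<epsilon>" "kC \<ge> 128 * kV * (3 * kA + 8 * \<alpha>) / \<epsilon>" "kC \<ge> 16 * kG * kV" "kC \<ge> 2 * kc" "kC \<ge> 1"
    using t1 t2 t3 c unfolding kC_def by linarith+
  show T: "kT > 0" using R by (simp add: kT_def)
  have t4: "3328 * kV / \<epsilon> \<ge> 0" using V \<epsilon> by simp
  have t5: "12288 * kG * kV \<ge> 0" using V G by simp
  show "k0 \<ge> 64 * kc" "k0 \<ge> 32 * kC" "k0 \<ge> 3328 * kV / \<epsilon>" "k0 \<ge> 12288 * kG * kV" "k0 \<ge> 5 * kT" "k0 \<ge> 1"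
    using t4 t5 c C T unfolding k0_def by linarith+
qed

end

locale tuning = const_params +
  fixes L :: real and p s :: nat
  assumes L: "L \<ge> 1" and s: "s \<in> {1..p}"
begin

text \<open>\<open>s * u\<close> is the sparse rate. Up to the scale \<open>\<Delta>\<close>, which is polynomial in the rate, one group
  suffices because there are only logarithmically many such scales; beyond \<open>\<Delta>\<close> the heavy-tail term of
  the Fuk--Nagaev bound, of order \<open>1 / t\<close>, is negligible.\<close>

definition u where "u = (real p / real s) powr (2 / \<alpha>) + L / real s"
definition a where "a = sqrt (kc * u)"
definition r where "r = kC * (real s * u)"
definition \<Delta> where "\<Delta> = kA * (real s * u) powr (2 * \<alpha>)"
text \<open>The factor \<open>exp (- L)\<close> pays for the union over at most
  \<open>2 * exp L\<close> scales, the factor \<open>1 / sqrt s\<close> for the one over the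
  sparsity grid.\<close>

definition \<eta> where "\<eta> = exp (- L) * (\<epsilon> / (256 * sqrt (real s)))"
definition rT where "rT = kT * (real s * u)"

section \<open>Calibration of thresholds to the rate\<close>

lemma s1: "real s \<ge> 1" "real p \<ge> real s" "real p > 0" using s by auto

lemma u_ge: "u \<ge> (real p / real s) powr (2 / \<alpha>)" "u \<ge> 1" "real s * u \<ge> L" "real s * u \<ge> real s" "real s * u \<ge> 1"
proof -
  have Ls: "L / real s > 0" using L s1 by simp
  show 1: "u \<ge> (real p / real s) powr (2 / \<alpha>)" using Ls by (simp add: u_def)
  have "(real p / real s) powr (2 / \<alpha>) \<ge> 1" using s1 \<alpha> by (intro ge_one_powr_ge_zero) auto
  thus u: "u \<ge> 1" using 1 by linarith
  have "L / real s \<le> u" by (simp add: u_def)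
  thus "real s * u \<ge> L" using s1 by (simp add: field_simps)
  show su: "real s * u \<ge> real s" using u s1 by simp
  thus "real s * u \<ge> 1" using s1 by linarith
qed

lemma p_le: "real p / real s \<le> u powr (\<alpha> / 2)"
proof -
  have "real p / real s = ((real p / real s) powr (2 / \<alpha>)) powr (\<alpha> / 2)"
    using s1 \<alpha> by (simp add: powr_powr)
  also have "\<dots> \<le> u powr (\<alpha> / 2)" using u_ge \<alpha> by (intro powr_mono2) auto
  finally show ?thesis .
qed

lemma ln_sparsity_le: "ln (exp 1 * real p / real s) \<le> \<alpha> / 2 * u"
proof -
  have "ln (exp 1 * real p / real s) = 1 + ln (real p / real s)" using s1 by (simp add: ln_mult ln_div)
  also have "ln (real p / real s) \<le> ln (u powr (\<alpha> / 2))"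
    using p_le s1 u_ge by (subst ln_le_cancel_iff) auto
  also have "\<dots> = \<alpha> / 2 * ln u" using u_ge by (simp add: ln_powr)
  also have "\<dots> \<le> \<alpha> / 2 * (u - 1)" using ln_le_minus_one[of u] u_ge \<alpha> by (intro mult_left_mono) auto
  finally show ?thesis using \<alpha> by (simp add: algebra_simps)
qed

lemma a_gt: "a > 1" "a\<^sup>2 = kc * u" "a\<^sup>2 \<ge> 2"
proof -
  have "kc * u \<ge> 2 * 1" using basic u_ge by (intro mult_mono) auto
  thus "a\<^sup>2 = kc * u" "a\<^sup>2 \<ge> 2" by (auto simp: a_def)
  have "sqrt 2 \<le> a" using \<open>kc * u \<ge> 2 * 1\<close> by (simp add: a_def)
  moreover have "1 < sqrt (2 :: real)" by simp
  ultimately show "a > 1" by linarith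
qed

lemma a_powr: "a powr x = (kc * u) powr (x / 2)"
  using basic u_ge by (simp add: a_def powr_half_sqrt[symmetric] powr_powr)

lemma tail_le: "a powr - \<alpha> \<le> u powr (- \<alpha> / 2) / kc"
proof -
  have "a powr - \<alpha> = kc powr (- \<alpha> / 2) * u powr (- \<alpha> / 2)"
    using basic u_ge by (simp add: a_powr powr_mult)
  also have "kc powr (- \<alpha> / 2) \<le> kc powr - 1" using basic \<alpha> by (intro powr_mono) auto
  also have "kc powr - 1 = 1 / kc" using basic by (simp add: powr_minus_divide)
  finally show ?thesis by (simp add: mult_right_mono)
qed

text \<open>The first term of \<open>u\<close> is calibrated to this:
  \<open>p \<le> s * u powr (\<alpha> / 2)\<close> cancels against the tail
  \<open>u powr (- \<alpha> / 2) / kc\<close>, so the expected number of false selections is a small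
  multiple of \<open>s\<close>.\<close>

lemma q_le: "kH * a powr - \<alpha> \<le> \<epsilon> / 64" "real p * (kH * a powr - \<alpha>) \<le> real s * (\<epsilon> / 64)"
  "real p * (kH * a powr - \<alpha>) \<le> real s"
proof -
  have kk: "kH / kc \<le> \<epsilon> / 64" using basic \<epsilon> by (simp add: field_simps)
  have "kH * a powr - \<alpha> \<le> kH * (u powr (- \<alpha> / 2) / kc)" using tail_le basic by (intro mult_left_mono) auto
  also have "\<dots> = kH / kc * u powr (- \<alpha> / 2)" by simp
  finally have 1: "kH * a powr - \<alpha> \<le> kH / kc * u powr (- \<alpha> / 2)" .
  have "u powr (- \<alpha> / 2) \<le> u powr 0" using u_ge \<alpha> by (intro powr_mono) auto
  hence "kH / kc * u powr (- \<alpha> / 2) \<le> kH / kc * 1" using u_ge basic by (intro mult_left_mono) auto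
  thus "kH * a powr - \<alpha> \<le> \<epsilon> / 64" using 1 kk by linarith
  have "real p \<le> real s * u powr (\<alpha> / 2)" using p_le s1 by (simp add: field_simps)
  hence "real p * (kH * a powr - \<alpha>) \<le> (real s * u powr (\<alpha> / 2)) * (kH / kc * u powr (- \<alpha> / 2))"
    by (rule mult_mono[OF _ 1]) (use basic u_ge in auto)
  also have "\<dots> = real s * (kH / kc) * (u powr (\<alpha> / 2) * u powr (- \<alpha> / 2))" by simp
  also have "u powr (\<alpha> / 2) * u powr (- \<alpha> / 2) = 1" using u_ge by (simp add: powr_add[symmetric])
  also have "real s * (kH / kc) * 1 \<le> real s * (\<epsilon> / 64)"
    unfolding mult_1_right by (rule mult_left_mono[OF kk]) simp
  finally show 2: "real p * (kH * a powr - \<alpha>) \<le> real s * (\<epsilon> / 64)" .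
  also have "\<dots> \<le> real s * 1" using \<epsilon> s1 by (intro mult_left_mono) auto
  finally show "real p * (kH * a powr - \<alpha>) \<le> real s" by simp
qed

lemma r_pos: "r > 0" "rT > 0" using basic u_ge s1 by (auto simp: r_def rT_def intro!: mult_pos_pos)

text \<open>Inserting the expected number \<open>s\<close> of exceedances, the mean is of order
  \<open>s * u\<close> and the variance of order \<open>s * u^2\<close>, while \<open>r^2\<close> is
  of order \<open>s^2 * u^2\<close>. The surviving factor \<open>1 / s\<close> makes the error
  summable over the sparsity grid.\<close>

lemma first_scale: "2 * (real p * (H * a powr (2 - \<alpha>))) \<le> r"
  "4 * (real p * (H * a powr (4 - \<alpha>))) / r\<^sup>2 \<le> \<epsilon> / (128 * sqrt (real s))"
proof -
  have pH: "real p * (H * a powr - \<alpha>) \<le> real s"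
  proof -
    have "real p * (H * a powr - \<alpha>) \<le> real p * (kH * a powr - \<alpha>)"
      using basic by (intro mult_left_mono mult_right_mono) auto
    thus ?thesis using q_le(3) by linarith
  qed
  have ap: "a powr (x - \<alpha>) = a powr x * a powr - \<alpha>" for x by (simp add: powr_add[symmetric])
  have a2: "a powr 2 = kc * u" "a powr 4 = (kc * u)\<^sup>2" using basic u_ge by (simp_all add: a_powr powr_numeral)
  have "real p * (H * a powr (2 - \<alpha>)) = (real p * (H * a powr - \<alpha>)) * (kc * u)" by (simp add: ap a2)
  also have "\<dots> \<le> real s * (kc * u)" using pH basic u_ge by (intro mult_right_mono) auto
  also have "real s * (kc * u) = kc * (real s * u)" by simp
  finally have "2 * (real p * (H * a powr (2 - \<alpha>))) \<le> 2 * kc * (real s * u)" by simp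
  also have "\<dots> \<le> kC * (real s * u)" using basic u_ge by (intro mult_right_mono) auto
  finally show "2 * (real p * (H * a powr (2 - \<alpha>))) \<le> r" by (simp add: r_def)
  have "real p * (H * a powr (4 - \<alpha>)) = (real p * (H * a powr - \<alpha>)) * (kc * u)\<^sup>2" by (simp add: ap a2)
  also have "\<dots> \<le> real s * (kc * u)\<^sup>2" using pH by (intro mult_right_mono) auto
  finally have "4 * (real p * (H * a powr (4 - \<alpha>))) / r\<^sup>2 \<le> 4 * (real s * (kc * u)\<^sup>2) / r\<^sup>2"
    by (intro divide_right_mono) auto
  also have "\<dots> = 4 * kc\<^sup>2 / (kC\<^sup>2 * real s)"
    using s1 u_ge basic by (simp add: r_def power_mult_distrib power2_eq_square field_simps)
  also have "\<dots> \<le> 4 * kc\<^sup>2 / ((512 * kc / \<epsilon>)\<^sup>2 * real s)"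
    using basic s1 \<epsilon> by (intro divide_left_mono mult_right_mono power_mono mult_pos_pos) auto
  also have "\<dots> = \<epsilon> * \<epsilon> / (65536 * real s)"
    using basic \<epsilon> by (simp add: power_divide power_mult_distrib power2_eq_square field_simps)
  also have "\<dots> \<le> \<epsilon> * 1 / (128 * sqrt (real s))"
  proof (intro frac_le mult_left_mono)
    have "sqrt (real s) \<le> real s" using s1 by (intro real_le_lsqrt) (auto simp: power2_eq_square)
    thus "128 * sqrt (real s) \<le> 65536 * real s" using s1 by linarith
  qed (use \<epsilon> s1 in auto)
  finally show "4 * (real p * (H * a powr (4 - \<alpha>))) / r\<^sup>2 \<le> \<epsilon> / (128 * sqrt (real s))" by simp
qed

lemma \<Delta>_ge: "\<Delta> \<ge> kA * (real s * u)" "\<Delta> \<ge> 1" "\<Delta> \<ge> 44"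
proof -
  have "(real s * u) powr 1 \<le> (real s * u) powr (2 * \<alpha>)" using u_ge \<alpha> by (intro powr_mono) auto
  hence "kA * (real s * u) \<le> kA * (real s * u) powr (2 * \<alpha>)" using u_ge basic by (intro mult_left_mono) auto
  thus 1: "\<Delta> \<ge> kA * (real s * u)" by (simp add: \<Delta>_def)
  have "kA * (real s * u) \<ge> 44 * 1" using basic u_ge by (intro mult_mono) auto
  thus "\<Delta> \<ge> 1" "\<Delta> \<ge> 44" using 1 by linarith+
qed

definition small_bound where "small_bound = kV * real s / r\<^sup>2"

text \<open>With \<open>x = s * u\<close>, the number of dyadic scales up to \<open>\<Delta>\<close>
  is logarithmic in \<open>x\<close>, hence of order at most \<open>sqrt x\<close>. Multiplied by
  \<open>s / x^2\<close> this is at most \<open>1 / sqrt s\<close>, since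
  \<open>s \<le> x\<close>.\<close>

lemma count_small_bound:
  assumes "S \<subseteq> range (\<lambda>k. 2 ^ k :: nat)" "\<And>t. t \<in> S \<Longrightarrow> real t \<le> \<Delta>"
  shows "real (card S) * small_bound \<le> \<epsilon> / (128 * sqrt (real s))"
proof -
  define x where "x = real s * u"
  have x: "x \<ge> 1" using u_ge by (simp add: x_def)
  have "real (card S) \<le> log 2 \<Delta> + 1" by (rule card_powers_of_two_le[OF assms(1) \<Delta>_ge(2) assms(2)])
  also have "log 2 \<Delta> = log 2 kA + 2 * \<alpha> * log 2 x"
    using basic x by (simp add: \<Delta>_def x_def[symmetric] log_mult log_powr)
  also have "\<dots> + 1 \<le> (2 * kA + 1) * sqrt x + 2 * \<alpha> * (4 * sqrt x)"
  proof -
    have "log 2 kA \<le> 2 * ln kA" using basic by (intro log2_le_ln) auto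
    also have "ln kA \<le> kA" using ln_le_minus_one[of kA] basic by simp
    finally have l1: "log 2 kA + 1 \<le> 2 * kA + 1" by simp
    have "(2 * kA + 1) * 1 \<le> (2 * kA + 1) * sqrt x" using x basic by (intro mult_left_mono) auto
    moreover have "log 2 x \<le> 4 * sqrt x" using log2_le_ln[OF x] ln_le_twice_sqrt[of x] x by linarith
    hence "2 * \<alpha> * log 2 x \<le> 2 * \<alpha> * (4 * sqrt x)" using \<alpha> by (intro mult_left_mono) auto
    moreover have "log 2 kA + 1 \<le> (2 * kA + 1) * 1" using l1 by simp
    ultimately have "(log 2 kA + 1) + 2 * \<alpha> * log 2 x \<le> (2 * kA + 1) * sqrt x + 2 * \<alpha> * (4 * sqrt x)"
      by (intro add_mono) auto
    thus ?thesis by simp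
  qed
  also have "\<dots> \<le> (3 * kA + 8 * \<alpha>) * sqrt x"
  proof -
    have "1 * sqrt x \<le> kA * sqrt x" using basic x by (intro mult_right_mono) auto
    thus ?thesis by (simp add: algebra_simps)
  qed
  finally have card: "real (card S) \<le> (3 * kA + 8 * \<alpha>) * sqrt x" by simp
  have sb: "small_bound \<ge> 0" using basic by (simp add: small_bound_def)
  have "real (card S) * small_bound \<le> ((3 * kA + 8 * \<alpha>) * sqrt x) * small_bound"
    by (rule mult_right_mono[OF card sb])
  also have "\<dots> = ((3 * kA + 8 * \<alpha>) * kV / kC\<^sup>2) * (sqrt x * real s / x\<^sup>2)"
    using basic by (simp add: small_bound_def r_def x_def[symmetric] power_mult_distrib field_simps)
  also have "\<dots> \<le> (\<epsilon> / 128) * (1 / sqrt (real s))"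
  proof (rule mult_mono)
    have kC2: "kC \<le> kC\<^sup>2" using basic by (simp add: power2_eq_square)
    have "128 * kV * (3 * kA + 8 * \<alpha>) / \<epsilon> \<le> kC\<^sup>2" using kC2 basic by linarith
    thus "(3 * kA + 8 * \<alpha>) * kV / kC\<^sup>2 \<le> \<epsilon> / 128" using \<epsilon> basic by (simp add: field_simps)
    have "sqrt x * real s / x\<^sup>2 \<le> 1 / sqrt (real s)"
    proof -
      define b v where "b = sqrt (real s)" and "v = sqrt x"
      have b: "b > 0" "real s = b\<^sup>2" using s1 by (auto simp: b_def)
      have v: "v > 0" "x = v\<^sup>2" using x by (auto simp: v_def)
      have bv: "b \<le> v" using u_ge by (simp add: b_def v_def x_def)
      have "b ^ 3 \<le> v ^ 3" using bv b by (intro power_mono) auto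
      hence "b ^ 3 / v ^ 3 / b \<le> 1 / b" using v b by (intro divide_right_mono) (auto simp: divide_le_eq)
      moreover have "b\<^sup>2 / v ^ 3 = b ^ 3 / v ^ 3 / b" using b v by (simp add: power2_eq_square power3_eq_cube)
      moreover have "v * b\<^sup>2 / (v\<^sup>2)\<^sup>2 = b\<^sup>2 / v ^ 3" using v by (simp add: power2_eq_square power3_eq_cube)
      moreover have "sqrt x * real s / x\<^sup>2 = v * b\<^sup>2 / (v\<^sup>2)\<^sup>2"
        unfolding v_def[symmetric] b(2) by (simp only: v(2)[symmetric])
      ultimately show ?thesis unfolding b_def by linarith
    qed
    thus "sqrt x * real s / x\<^sup>2 \<le> 1 / sqrt (real s)" .
  qed (use basic \<epsilon> s1 x in auto)
  finally show ?thesis by simp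
qed

lemma exp_sqrt_s: "exp (- sqrt (real s)) \<le> 1 / sqrt (real s)" "exp (- real s) \<le> 1 / sqrt (real s)"
proof -
  show 1: "exp (- sqrt (real s)) \<le> 1 / sqrt (real s)" using s1 by (intro exp_minus_le_inverse) auto
  have "sqrt (real s) \<le> real s" using s1 by (intro real_le_lsqrt) (auto simp: power2_eq_square)
  hence "exp (- real s) \<le> exp (- sqrt (real s))" by simp
  thus "exp (- real s) \<le> 1 / sqrt (real s)" using 1 by linarith
qed

lemma exp_eps: "exp (- (256 / \<epsilon>)) \<le> \<epsilon> / 256"
  using exp_minus_le_inverse[of "256 / \<epsilon>"] \<epsilon> by simp

text \<open>Each summand yields one factor of \<open>\<eta>\<close>: \<open>exp (- L)\<close>,
  \<open>exp (- sqrt s) \<le> 1 / sqrt s\<close> and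
  \<open>exp (- 256 / \<epsilon>) \<le> \<epsilon> / 256\<close>. A summand of size
  \<open>sqrt s\<close> is affordable because \<open>G * sqrt s\<close> may be of order
  \<open>s * u\<close>.\<close>

definition large_G :: "nat \<Rightarrow> bool" where
  "large_G G \<longleftrightarrow> L + sqrt (real s) + 256 / \<epsilon> \<le> real G \<and> real G \<le> 2 * (L + sqrt (real s) + 256 / \<epsilon>)"

text \<open>\<open>2 * real G \<le> \<Delta>\<close> makes the groups of odd columns nonempty beyond
  \<open>\<Delta>\<close>. The last bound compares the separation \<open>G * sqrt s\<close> demanded
  by the median with the sparse rate; it is the one that depends on a large dimension
  \<open>p\<close>.\<close>

lemma large_G_bounds:
  assumes "large_G G"
  shows "(1 / 4) ^ G \<le> \<eta>" "real G \<le> 2 * (kG * (real s * u))" "2 * real G \<le> \<Delta>" "(1 / 4) ^ G \<le> \<epsilon> / 256"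
    and "L \<le> sqrt (real s) * u \<Longrightarrow> real G * sqrt (real s) \<le> 2 * (kG * (real s * u))"
proof -
  have "(1 / 4 :: real) \<le> exp (- 1)"
    using exp_le by (simp add: exp_minus field_simps)
  hence "(1 / 4 :: real) ^ G \<le> exp (- 1) ^ G" by (intro power_mono) auto
  also have "\<dots> = exp (- real G)" by (simp add: exp_of_nat_mult[symmetric])
  also have "\<dots> \<le> exp (- L + (- sqrt (real s)) + (- (256 / \<epsilon>)))" using assms by (simp add: large_G_def)
  also have "\<dots> = exp (- L) * exp (- sqrt (real s)) * exp (- (256 / \<epsilon>))" by (simp only: exp_add)
  finally have G: "(1 / 4) ^ G \<le> exp (- L) * exp (- sqrt (real s)) * exp (- (256 / \<epsilon>))" .
  also have "\<dots> \<le> exp (- L) * (1 / sqrt (real s)) * (\<epsilon> / 256)"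
    using exp_sqrt_s exp_eps \<epsilon> by (intro mult_mono) auto
  finally show "(1 / 4) ^ G \<le> \<eta>" by (simp add: \<eta>_def)
  have "exp (- L) * exp (- sqrt (real s)) * exp (- (256 / \<epsilon>)) \<le> 1 * 1 * (\<epsilon> / 256)"
    using exp_eps \<epsilon> L by (intro mult_mono) auto
  thus "(1 / 4) ^ G \<le> \<epsilon> / 256" using G by linarith
  have ss: "sqrt (real s) \<le> real s" using s1 by (intro real_le_lsqrt) (auto simp: power2_eq_square)
  have e: "256 / \<epsilon> * 1 \<le> 256 / \<epsilon> * (real s * u)" using u_ge \<epsilon> by (intro mult_left_mono) auto
  have "L + sqrt (real s) + 256 / \<epsilon> \<le> kG * (real s * u)"
    using u_ge ss e unfolding kG_def distrib_right by linarith
  hence "2 * (L + sqrt (real s) + 256 / \<epsilon>) \<le> 2 * (kG * (real s * u))" by (rule mult_left_mono) simp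
  thus 1: "real G \<le> 2 * (kG * (real s * u))" using assms order_trans unfolding large_G_def by blast
  have "2 * real G \<le> 2 * (2 * (kG * (real s * u)))" using 1 by (rule mult_left_mono) simp
  also have "\<dots> = 4 * kG * (real s * u)" by simp
  also have "\<dots> \<le> kA * (real s * u)" using basic u_ge by (intro mult_right_mono) auto
  finally show "2 * real G \<le> \<Delta>" using \<Delta>_ge by linarith
  assume Lu: "L \<le> sqrt (real s) * u"
  have sq: "sqrt (real s) * sqrt (real s) = real s" using s1 by simp
  have "L * sqrt (real s) \<le> (sqrt (real s) * u) * sqrt (real s)" using Lu by (intro mult_right_mono) auto
  also have "\<dots> = real s * u" using sq by (simp add: mult_ac)
  finally have l1: "L * sqrt (real s) \<le> real s * u" .
  have l2: "sqrt (real s) * sqrt (real s) \<le> real s * u" using u_ge sq by simp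
  have "256 / \<epsilon> * sqrt (real s) \<le> 256 / \<epsilon> * (real s * u)" using ss u_ge \<epsilon> by (intro mult_left_mono) auto
  hence "(L + sqrt (real s) + 256 / \<epsilon>) * sqrt (real s) \<le> kG * (real s * u)"
    using l1 l2 unfolding kG_def distrib_right by linarith
  moreover have "real G * sqrt (real s) \<le> 2 * (L + sqrt (real s) + 256 / \<epsilon>) * sqrt (real s)"
    using assms unfolding large_G_def by (intro mult_right_mono) auto
  hence "real G * sqrt (real s) \<le> 2 * ((L + sqrt (real s) + 256 / \<epsilon>) * sqrt (real s))" by (simp only: mult.assoc)
  ultimately show "real G * sqrt (real s) \<le> 2 * (kG * (real s * u))" by linarith
qed

text \<open>The binomial coefficient enters the \<open>s\<close>-th power as
  \<open>w = exp 1 * p / s\<close>. In the Gaussian part \<open>kc * u / 32\<close> outweighs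
  \<open>ln w\<close>, which grows at most linearly in \<open>u\<close>. In the heavy part
  \<open>2 * b1\<close> is small, so its \<open>s\<close>-th power is at most \<open>2 * b1\<close>
  itself.\<close>

lemma selection_bound:
  assumes t: "\<Delta> < real t"
  shows "real (p choose s) * (H * a powr \<alpha> / (real t / 2) + 2 * exp (- a\<^sup>2 / 32)) ^ s
    \<le> \<eta> + \<epsilon> / (512 * sqrt (real s)) * (1 / sqrt (real t))"
proof -
  define w where "w = exp 1 * real p / real s"
  have w: "w > 0" using s1 by (simp add: w_def)
  have tpos: "real t > 0" using t \<Delta>_ge by linarith
  define b1 b2 where "b1 = w * (2 * H * a powr \<alpha> / real t)" and "b2 = w * (2 * exp (- a\<^sup>2 / 32))"
  have b0: "b1 \<ge> 0" "b2 \<ge> 0" using w H1' tpos by (auto simp: b1_def b2_def)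
  have "real (p choose s) * (H * a powr \<alpha> / (real t / 2) + 2 * exp (- a\<^sup>2 / 32)) ^ s
      \<le> w ^ s * (2 * H * a powr \<alpha> / real t + 2 * exp (- a\<^sup>2 / 32)) ^ s"
    using binomial_le_exp_power[OF s] H1' tpos unfolding w_def[symmetric]
    by (intro mult_mono) (auto simp: mult_ac)
  also have "\<dots> = (b1 + b2) ^ s" by (simp add: b1_def b2_def power_mult_distrib[symmetric] distrib_left)
  also have "\<dots> \<le> (2 * b1) ^ s + (2 * b2) ^ s"
  proof (cases "b1 \<le> b2")
    case True
    have "(b1 + b2) ^ s \<le> (2 * b2) ^ s" using True b0 by (intro power_mono) auto
    thus ?thesis using b0 by (smt (verit) zero_le_power mult_nonneg_nonneg)
  next
    case False
    have "(b1 + b2) ^ s \<le> (2 * b1) ^ s" using False b0 by (intro power_mono) auto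
    thus ?thesis using b0 by (smt (verit) zero_le_power mult_nonneg_nonneg)
  qed
  also have "(2 * b2) ^ s \<le> \<eta>"
  proof -
    have lnw: "ln w \<le> \<alpha> / 2 * u" using ln_sparsity_le by (simp add: w_def)
    have "(4 :: real) \<le> exp 2" using exp_lower_Taylor_quadratic[of 2] by simp
    hence "2 * b2 \<le> exp 2 * (exp (ln w) * exp (- a\<^sup>2 / 32))"
      using w by (simp add: b2_def mult_right_mono)
    also have "\<dots> = exp (2 + ln w - kc * u / 32)" by (simp add: exp_add[symmetric] a_gt)
    finally have "(2 * b2) ^ s \<le> exp (2 + ln w - kc * u / 32) ^ s" using b0 by (intro power_mono) auto
    also have "\<dots> = exp (real s * (2 + ln w - kc * u / 32))" by (rule exp_of_nat_mult[symmetric])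
    also have "\<dots> \<le> exp (- L + (- real s) + (- (256 / \<epsilon>)))"
    proof -
      have "32 * (4 + \<alpha> / 2 + 256 / \<epsilon>) * u \<le> kc * u" using basic u_ge by (intro mult_right_mono) auto
      hence "2 + ln w - kc * u / 32 \<le> 2 + \<alpha> / 2 * u - (4 + \<alpha> / 2 + 256 / \<epsilon>) * u" using lnw by linarith
      also have "\<dots> = 2 - 4 * u - 256 / \<epsilon> * u" by (simp add: algebra_simps)
      finally have "real s * (2 + ln w - kc * u / 32) \<le> real s * (2 - 4 * u - 256 / \<epsilon> * u)"
        by (rule mult_left_mono) simp
      also have "\<dots> = 2 * real s - 4 * (real s * u) - 256 / \<epsilon> * (real s * u)" by (simp add: algebra_simps)
      also have "256 / \<epsilon> * (real s * u) \<ge> 256 / \<epsilon> * 1" using u_ge \<epsilon> by (intro mult_left_mono) auto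
      hence "2 * real s - 4 * (real s * u) - 256 / \<epsilon> * (real s * u) \<le> - L + (- real s) + (- (256 / \<epsilon>))"
        using u_ge by linarith
      finally show ?thesis by simp
    qed
    also have "\<dots> = exp (- L) * exp (- real s) * exp (- (256 / \<epsilon>))" by (simp only: exp_add)
    also have "\<dots> \<le> exp (- L) * (1 / sqrt (real s)) * (\<epsilon> / 256)"
      using exp_sqrt_s exp_eps \<epsilon> by (intro mult_mono) auto
    finally show ?thesis by (simp add: \<eta>_def)
  qed
  also have "(2 * b1) ^ s \<le> \<epsilon> / (512 * sqrt (real s)) * (1 / sqrt (real t))"
  proof -
    have aa: "a powr \<alpha> = kc powr (\<alpha> / 2) * u powr (\<alpha> / 2)" using basic u_ge by (simp add: a_powr powr_mult)
    have "2 * b1 = 4 * exp 1 * H * kc powr (\<alpha> / 2) * ((real p / real s) * u powr (\<alpha> / 2)) / real t"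
      by (simp add: b1_def w_def aa)
    also have "\<dots> \<le> kA0 * (u powr (\<alpha> / 2) * u powr (\<alpha> / 2)) / real t"
      unfolding kA0_def using p_le tpos H1' by (intro divide_right_mono mult_left_mono mult_right_mono) auto
    also have "u powr (\<alpha> / 2) * u powr (\<alpha> / 2) = u powr \<alpha>" by (simp add: powr_add[symmetric])
    finally have "2 * b1 \<le> kA0 * u powr \<alpha> / real t" .
    \<comment> \<open>One factor \<open>sqrt t\<close> exceeds \<open>sqrt \<Delta>\<close> and
      cancels \<open>u powr \<alpha>\<close>; the other is kept to make the bound summable over the
      scales.\<close>
    also have "\<dots> = kA0 * u powr \<alpha> / (sqrt (real t) * sqrt (real t))" using tpos by simp
    also have "\<dots> \<le> kA0 * u powr \<alpha> / ((512 * kA0 / \<epsilon> * (sqrt (real s) * u powr \<alpha>)) * sqrt (real t))"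
    proof (intro divide_left_mono mult_right_mono)
      have "(512 * kA0 / \<epsilon> * (sqrt (real s) * u powr \<alpha>))\<^sup>2 \<le> \<Delta>"
      proof -
        have "(512 * kA0 / \<epsilon> * (sqrt (real s) * u powr \<alpha>))\<^sup>2 = (512 * kA0 / \<epsilon>)\<^sup>2 * (real s * u powr (2 * \<alpha>))"
        proof -
          have "(u powr \<alpha>)\<^sup>2 = u powr (2 * \<alpha>)" by (simp add: power2_eq_square powr_add[symmetric])
          moreover have "(512 * kA0 / \<epsilon> * (sqrt (real s) * u powr \<alpha>))\<^sup>2
              = (512 * kA0 / \<epsilon>)\<^sup>2 * ((sqrt (real s))\<^sup>2 * (u powr \<alpha>)\<^sup>2)" by (simp only: power_mult_distrib)
          moreover have "(sqrt (real s))\<^sup>2 = real s" by simp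
          ultimately show ?thesis by (simp only:)
        qed
        also have "\<dots> \<le> kA * (real s powr (2 * \<alpha>) * u powr (2 * \<alpha>))"
        proof (intro mult_mono)
          have "real s powr 1 \<le> real s powr (2 * \<alpha>)" using s1 \<alpha> by (intro powr_mono) auto
          thus "real s \<le> real s powr (2 * \<alpha>)" using s1 by simp
        qed (use basic in auto)
        also have "\<dots> = \<Delta>" using u_ge by (simp add: \<Delta>_def powr_mult)
        finally show ?thesis .
      qed
      hence "512 * kA0 / \<epsilon> * (sqrt (real s) * u powr \<alpha>) \<le> sqrt \<Delta>" by (rule real_le_rsqrt)
      also have "\<dots> \<le> sqrt (real t)" using t by simp
      finally show "512 * kA0 / \<epsilon> * (sqrt (real s) * u powr \<alpha>) \<le> sqrt (real t)" .
    qed (use basic u_ge s1 \<epsilon> tpos in auto)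
    also have "\<dots> = \<epsilon> / (512 * sqrt (real s)) * (1 / sqrt (real t))"
      using basic u_ge s1 \<epsilon> tpos by (simp add: field_simps)
    finally have le: "2 * b1 \<le> \<epsilon> / (512 * sqrt (real s)) * (1 / sqrt (real t))" .
    also have "\<dots> \<le> 1 * 1"
    proof (intro mult_mono)
      have "1 \<le> sqrt (real s)" using s1 by simp
      hence "\<epsilon> \<le> 512 * sqrt (real s)" "0 < 512 * sqrt (real s)" using \<epsilon> by linarith+
      thus "\<epsilon> / (512 * sqrt (real s)) \<le> 1" by (simp only: divide_le_eq_1_pos)
      show "1 / sqrt (real t) \<le> 1" using t \<Delta>_ge by simp
    qed (use \<epsilon> in auto)
    finally have "2 * b1 \<le> 1" by simp
    hence "(2 * b1) ^ s \<le> (2 * b1) ^ 1" using b0 s by (intro power_decreasing) auto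
    thus ?thesis using le by simp
  qed
  finally show ?thesis by simp
qed

text \<open>A common budget for all regimes: scale one, a single group up to
  \<open>\<Delta>\<close>, and beyond it either the median, with \<open>\<eta>\<close> once for its
  failure and once for the Gaussian part of the selection, or the estimator.\<close>

definition pt_bound where
  "pt_bound t = (if t = (1 :: nat) then \<epsilon> / (128 * sqrt (real s)) else 0) + (if real t \<le> \<Delta> then small_bound else 0)
     + 2 * \<eta> + \<epsilon> / (512 * sqrt (real s)) * (1 / sqrt (real t))"

lemma sum_pt_bound:
  assumes S: "finite S" "S \<subseteq> range (\<lambda>k. 2 ^ k :: nat)" "real (card S) \<le> 2 * exp L"
  shows "(\<Sum>t\<in>S. pt_bound t) \<le> \<epsilon> / (16 * sqrt (real s))"
proof -
  define e where "e = \<epsilon> / sqrt (real s)"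
  have e: "e > 0" using \<epsilon> s1 by (simp add: e_def)
  have "(\<Sum>t\<in>S. if t = 1 then \<epsilon> / (128 * sqrt (real s)) else 0) \<le> e / 128"
    using S(1) e by (simp add: sum.delta e_def)
  moreover have "(\<Sum>t\<in>S. if real t \<le> \<Delta> then small_bound else 0) \<le> e / 128"
  proof -
    have "(\<Sum>t\<in>S. if real t \<le> \<Delta> then small_bound else 0) = real (card {t \<in> S. real t \<le> \<Delta>}) * small_bound"
      using S(1) by (simp add: sum.inter_filter[symmetric])
    also have "\<dots> \<le> \<epsilon> / (128 * sqrt (real s))" by (rule count_small_bound) (use S(2) in auto)
    finally show ?thesis by (simp add: e_def)
  qed
  moreover have "(\<Sum>t\<in>S. 2 * \<eta>) \<le> e / 64"
  proof -
    have "(\<Sum>t\<in>S. 2 * \<eta>) = real (card S) * (2 * \<eta>)" by simp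
    also have "\<dots> \<le> (2 * exp L) * (2 * \<eta>)" using S(3) \<epsilon> by (intro mult_right_mono) (auto simp: \<eta>_def)
    also have "\<dots> = (exp L * exp (- L)) * (e / 64)" by (simp add: \<eta>_def e_def mult_ac)
    also have "exp L * exp (- L) = 1" by (simp add: exp_minus)
    finally show ?thesis by simp
  qed
  moreover have "(\<Sum>t\<in>S. \<epsilon> / (512 * sqrt (real s)) * (1 / sqrt (real t))) \<le> e / 128"
  proof -
    have "(\<Sum>t\<in>S. \<epsilon> / (512 * sqrt (real s)) * (1 / sqrt (real t))) = e / 512 * (\<Sum>t\<in>S. 1 / sqrt (real t))"
      unfolding sum_distrib_left by (intro sum.cong refl) (simp add: e_def mult_ac)
    also have "\<dots> \<le> e / 512 * 4" using sum_inverse_sqrt_powers_of_two[OF S(1,2)] e by (intro mult_left_mono) auto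
    finally show ?thesis by simp
  qed
  ultimately have "(\<Sum>t\<in>S. pt_bound t) \<le> e / 128 + e / 128 + e / 64 + e / 128"
    unfolding pt_bound_def sum.distrib by linarith
  also have "\<dots> \<le> e / 16" using e by simp
  finally show ?thesis by (simp add: e_def)
qed

lemma pt_bound_parts:
  "t = 1 \<Longrightarrow> \<epsilon> / (128 * sqrt (real s)) \<le> pt_bound t" "real t \<le> \<Delta> \<Longrightarrow> small_bound \<le> pt_bound t" "\<eta> \<le> pt_bound t"
  "2 * \<eta> + \<epsilon> / (512 * sqrt (real s)) * (1 / sqrt (real t)) \<le> pt_bound t"
proof -
  have *: "\<epsilon> / (128 * sqrt (real s)) \<ge> 0" "small_bound \<ge> 0" "\<eta> \<ge> 0" "\<epsilon> / (512 * sqrt (real s)) * (1 / sqrt (real t)) \<ge> 0"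
    using \<epsilon> basic by (auto simp: small_bound_def \<eta>_def)
  show "t = 1 \<Longrightarrow> \<epsilon> / (128 * sqrt (real s)) \<le> pt_bound t" "real t \<le> \<Delta> \<Longrightarrow> small_bound \<le> pt_bound t" "\<eta> \<le> pt_bound t"
  "2 * \<eta> + \<epsilon> / (512 * sqrt (real s)) * (1 / sqrt (real t)) \<le> pt_bound t"
    using * unfolding pt_bound_def by (auto split: if_splits)
qed

lemma eta: "0 < \<eta>" "\<eta> < 1" "\<eta> \<le> \<epsilon> / 256"
  "real s * ln (exp 1 * real p / real s) + ln (1 / \<eta>) \<le> kR * (real s * u)" "ln (1 / \<eta>) \<ge> 0"
proof -
  show e0: "0 < \<eta>" using \<epsilon> s1 by (simp add: \<eta>_def)
  have "exp (- L) * (\<epsilon> / (256 * sqrt (real s))) \<le> 1 * (\<epsilon> / 256)"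
    using L \<epsilon> s1 by (intro mult_mono divide_left_mono) auto
  thus e1: "\<eta> \<le> \<epsilon> / 256" by (simp add: \<eta>_def)
  thus e2: "\<eta> < 1" using \<epsilon> by simp
  show "ln (1 / \<eta>) \<ge> 0" using e0 e2 by (simp add: ln_div)
  have "ln (1 / \<eta>) = L + ln (256 / \<epsilon>) + ln (sqrt (real s))"
    using \<epsilon> s1 by (simp add: \<eta>_def ln_div ln_mult)
  also have "ln (256 / \<epsilon>) \<le> 256 / \<epsilon> * (real s * u)"
  proof -
    have "ln (256 / \<epsilon>) \<le> 256 / \<epsilon> * 1" using ln_le_minus_one[of "256 / \<epsilon>"] \<epsilon> by simp
    also have "\<dots> \<le> 256 / \<epsilon> * (real s * u)" using u_ge \<epsilon> by (intro mult_left_mono) auto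
    finally show ?thesis .
  qed
  also have "ln (sqrt (real s)) \<le> real s * u"
  proof -
    have "ln (sqrt (real s)) \<le> sqrt (real s)" using ln_le_minus_one[of "sqrt (real s)"] s1 by simp
    also have "sqrt (real s) \<le> real s" using s1 by (intro real_le_lsqrt) (auto simp: power2_eq_square)
    finally show ?thesis using u_ge by linarith
  qed
  finally have l: "ln (1 / \<eta>) \<le> kG * (real s * u)" using u_ge unfolding kG_def distrib_right by linarith
  have "real s * ln (exp 1 * real p / real s) \<le> real s * (\<alpha> / 2 * u)"
    using ln_sparsity_le s1 by (intro mult_left_mono) auto
  thus "real s * ln (exp 1 * real p / real s) + ln (1 / \<eta>) \<le> kR * (real s * u)"
    using l by (simp add: kR_def algebra_simps)
qed

lemma sample_size:
  assumes "\<Delta> < real t"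
  shows "11 * (real s * ln (exp 1 * real p / real s) + ln (1 / \<eta>)) \<le> real t"
proof -
  have "11 * (real s * ln (exp 1 * real p / real s) + ln (1 / \<eta>)) \<le> 11 * (kR * (real s * u))"
    by (rule mult_left_mono[OF eta(4)]) simp
  also have "\<dots> = 11 * kR * (real s * u)" by simp
  also have "\<dots> \<le> kA * (real s * u)" using basic u_ge by (intro mult_right_mono) auto
  finally show ?thesis using \<Delta>_ge assms by linarith
qed

end

section \<open>Error bounds at a single scale\<close>

definition odds :: "nat \<Rightarrow> nat set" where "odds t = {i \<in> {1..t}. odd i}"
definition evens :: "nat \<Rightarrow> nat set" where "evens t = {i \<in> {1..t}. even i}"

lemma odds_evens:
  assumes "even t"
  shows "card (odds t) = t div 2" "card (evens t) = t div 2"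
    "odds t = (\<lambda>i. 2 * i - 1) ` {1..t div 2}" "evens t = (\<lambda>i. 2 * i) ` {1..t div 2}"
proof -
  show o: "odds t = (\<lambda>i. 2 * i - 1) ` {1..t div 2}"
  proof (intro set_eqI iffI)
    fix i assume "i \<in> odds t"
    hence i: "odd i" "1 \<le> i" "i \<le> t" by (auto simp: odds_def)
    have "(i + 1) div 2 \<le> t div 2" "1 \<le> (i + 1) div 2" "i = 2 * ((i + 1) div 2) - 1"
      using i assms by presburger+
    hence "i = 2 * ((i + 1) div 2) - 1" "(i + 1) div 2 \<in> {1..t div 2}" by auto
    thus "i \<in> (\<lambda>i. 2 * i - 1) ` {1..t div 2}" by blast
  next
    fix i assume "i \<in> (\<lambda>i. 2 * i - 1) ` {1..t div 2}"
    then obtain x where x: "i = 2 * x - 1" "1 \<le> x" "x \<le> t div 2" by auto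
    have "odd i" "1 \<le> i" "i \<le> t" using x assms by presburger+
    thus "i \<in> odds t" by (simp add: odds_def)
  qed
  show e: "evens t = (\<lambda>i. 2 * i) ` {1..t div 2}"
  proof (intro set_eqI iffI)
    fix i assume "i \<in> evens t"
    hence "i = 2 * (i div 2)" "i div 2 \<in> {1..t div 2}" by (auto simp: evens_def elim!: evenE)
    thus "i \<in> (\<lambda>i. 2 * i) ` {1..t div 2}" by blast
  qed (use assms in \<open>auto simp: evens_def elim!: evenE\<close>)
  show "card (odds t) = t div 2" unfolding o by (subst card_image) (auto simp: inj_on_def)
  show "card (evens t) = t div 2" unfolding e by (subst card_image) (auto simp: inj_on_def)
qed

lemma evens_nonempty: "t \<ge> 2 \<Longrightarrow> evens t \<noteq> {}"
  by (auto simp: evens_def intro!: exI[of _ 2])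

text \<open>Independence means that the joint law is the product law, and both laws are unchanged by
  passing to the image measure. It is needed because samples of the mean estimator live on the
  canonical matrix space.\<close>

lemma (in prob_space) indep_vars_distr:
  assumes f: "f \<in> measurable M N" and X: "\<And>i. i \<in> I \<Longrightarrow> X i \<in> measurable N (M' i)" and I: "I \<noteq> {}"
    and ind: "indep_vars M' (\<lambda>i x. X i (f x)) I"
  shows "prob_space.indep_vars (distr M N f) M' X I"
proof -
  interpret D: prob_space "distr M N f" by (rule prob_space_distr[OF f])
  have Xf: "(\<lambda>x. X i (f x)) \<in> measurable M (M' i)" if "i \<in> I" for i by (rule measurable_compose[OF f X[OF that]])
  have rest: "(\<lambda>x. \<lambda>i\<in>I. X i x) \<in> measurable N (PiM I M')" by (intro measurable_restrict X)
  have "distr (distr M N f) (PiM I M') (\<lambda>x. \<lambda>i\<in>I. X i x) = distr M (PiM I M') (\<lambda>x. \<lambda>i\<in>I. X i (f x))"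
    using distr_distr[OF rest f] by (simp add: comp_def)
  also have "\<dots> = PiM I (\<lambda>i. distr M (M' i) (\<lambda>x. X i (f x)))"
    using indep_vars_iff_distr_eq_PiM'[OF I Xf] ind by simp
  also have "\<dots> = PiM I (\<lambda>i. distr (distr M N f) (M' i) (X i))"
    using distr_distr[OF X f] by (intro PiM_cong refl) (simp add: comp_def)
  finally show ?thesis
    using D.indep_vars_iff_distr_eq_PiM'[OF I, of X M'] X by simp
qed

context noise_array
begin

lemma qform_event:
  assumes B: "B \<subseteq> {1..h}" and S: "S \<subseteq> {1..p}"
  shows "{\<omega> \<in> space M. qform S B (Z d \<omega>) \<le> x} \<in> events"
proof -
  have "(\<lambda>\<omega>. qform S B (Z d \<omega>)) \<in> borel_measurable M"
    unfolding qform_def Z_def using B S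
    by (intro borel_measurable_sum borel_measurable_diff borel_measurable_times borel_measurable_power
        borel_measurable_divide borel_measurable_add borel_measurable_const rv) auto
  from borel_measurable_le[OF this borel_measurable_const[of x]] show ?thesis .
qed

lemma mom_event:
  assumes gr: "groups G B N" and S: "S \<subseteq> {1..p}"
  shows "{\<omega> \<in> space M. mom G B S (Z d \<omega>) \<le> x} \<in> events"
proof -
  have "(\<lambda>\<omega>. mom G B S (Z d \<omega>)) \<in> borel_measurable M"
    unfolding mom_def
  proof (rule borel_measurable_median_on)
    fix g assume g: "g \<in> {1..G}"
    show "(\<lambda>\<omega>. qform S (B g) (Z d \<omega>)) \<in> borel_measurable M"
      unfolding qform_def Z_def using groupsD(1)[OF gr g] S
      by (intro borel_measurable_sum borel_measurable_diff borel_measurable_times borel_measurable_power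
          borel_measurable_divide borel_measurable_add borel_measurable_const rv) auto
  qed (use gr in \<open>simp add: groups_def\<close>)
  from borel_measurable_le[OF this borel_measurable_const[of x]] show ?thesis .
qed

end

locale tuned_array = noise_array M \<xi> p h \<alpha> H + tuning \<alpha> H \<epsilon> L p s
  for M :: "'a measure" and \<xi> :: "nat \<times> nat \<Rightarrow> 'a \<Rightarrow> real" and p h :: nat and \<alpha> H \<epsilon> L :: real and s :: nat
begin

lemma V_eq: "V = kV" and H1_eq: "H1 = kH"
  by (simp_all add: V_def kV_def H1_def kH_def)

lemma half_sets:
  assumes t: "even t" "2 \<le> t" "t \<le> h"
  shows "evens t \<subseteq> {1..h}" "evens t \<noteq> {}" "real (card (evens t)) = real t / 2" "odds t \<subseteq> {1..h}"
    "odds t \<inter> evens t = {}" "real (card (odds t)) = real t / 2" "card (odds t) \<ge> 1"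
  using t odds_evens[OF t(1)] evens_nonempty[OF t(2)] by (auto simp: evens_def odds_def elim!: evenE)

lemma groups_single:
  assumes t: "even t" "2 \<le> t" "t \<le> h" and B: "B 1 = odds t"
  shows "groups 1 B (card (odds t))"
  using half_sets[OF t] B by (auto simp: groups_def disjoint_family_on_def)

lemma null_first:
  assumes h: "h \<ge> 1" and d: "\<And>j. j \<in> {1..p} \<Longrightarrow> d j = 0"
  shows "prob {\<omega> \<in> space M. r < A1 p a (Z d \<omega>)} \<le> pt_bound 1"
proof -
  have "prob {\<omega> \<in> space M. r < A1 p a (Z d \<omega>)} \<le> 4 * (real p * (H * a powr (4 - \<alpha>))) / r\<^sup>2"
    by (rule A1_null[OF h a_gt(1) r_pos(1) first_scale(1) d])
  thus ?thesis using first_scale(2) pt_bound_parts(1)[of 1] by linarith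
qed

lemma null_small:
  assumes t: "even t" "2 \<le> t" "t \<le> h" "real t \<le> \<Delta>" and B: "B 1 = odds t" and d: "\<And>j. j \<in> {1..p} \<Longrightarrow> d j = 0"
  shows "prob {\<omega> \<in> space M. r < mom 1 B (sel (evens t) a d \<omega>) (Z d \<omega>)} \<le> pt_bound t"
proof -
  note hs = half_sets[OF t(1-3)]
  have "prob {\<omega> \<in> space M. r < mom 1 B (sel (evens t) a d \<omega>) (Z d \<omega>)} \<le> V * (real p * (H1 * a powr - \<alpha>)) / r\<^sup>2"
    by (rule sparse_null_single[OF hs(1,2) groups_single[where B = B, OF t(1-3) B] _ a_gt(1) r_pos(1) d]) (use hs B in auto)
  also have "\<dots> \<le> V * real s / r\<^sup>2"
    unfolding H1_eq using q_le(3) V_pos by (intro divide_right_mono mult_left_mono) auto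
  also have "\<dots> = small_bound" by (simp add: small_bound_def V_eq)
  finally show ?thesis using pt_bound_parts(2)[OF t(4)] by linarith
qed

text \<open>A group of the median fluctuates by about \<open>sqrt s\<close>, which is
  \<open>G * sqrt s\<close> on the scale of \<open>r\<close>. The assumption \<open>Lu\<close> keeps
  this below \<open>r\<close>, as \<open>mom_upper\<close> requires.\<close>

lemma null_large:
  assumes t: "even t" "2 \<le> t" "t \<le> h" "\<Delta> < real t" and G: "large_G G" and Lu: "L \<le> sqrt (real s) * u"
    and gr: "groups G B N" and disj: "\<And>g. g \<in> {1..G} \<Longrightarrow> B g \<subseteq> odds t" and d: "\<And>j. j \<in> {1..p} \<Longrightarrow> d j = 0"
  shows "prob {\<omega> \<in> space M. r / real G < mom G B (sel (evens t) a d \<omega>) (Z d \<omega>)} \<le> pt_bound t"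
proof -
  note hs = half_sets[OF t(1-3)]
  have G0: "real G > 0" using gr by (simp add: groups_def)
  have "prob {\<omega> \<in> space M. r / real G < mom G B (sel (evens t) a d \<omega>) (Z d \<omega>)}
    \<le> (1 / 4) ^ G + real (p choose s) * (H * a powr \<alpha> / real (card (evens t)) + 2 * exp (- a\<^sup>2 / 32)) ^ s"
  proof (rule sparse_null_groups[OF hs(1,2) gr _ a_gt(1) _ _ d])
    show "B g \<inter> evens t = {}" if "g \<in> {1..G}" for g using disj[OF that] hs(5) by blast
    show "0 < r / real G" using G0 r_pos by simp
    have "8 * V * (real G * sqrt (real s)) \<le> 8 * V * (2 * (kG * (real s * u)))"
      using large_G_bounds(5)[OF G Lu] V_pos by (intro mult_left_mono) auto
    also have "\<dots> = (16 * kG * kV) * (real s * u)" by (simp add: V_eq)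
    also have "\<dots> \<le> r" unfolding r_def using basic u_ge by (intro mult_right_mono) auto
    finally have le: "8 * V * sqrt (real s) \<le> r / real G" using G0 by (simp add: field_simps)
    have "V * 1 \<le> V * V" using basic by (intro mult_left_mono) (auto simp: V_eq)
    hence "64 * V \<le> 64 * (V * V)" by simp
    hence "64 * V * real s \<le> 64 * (V * V) * real s" by (rule mult_right_mono) simp
    also have "\<dots> = (8 * V * sqrt (real s))\<^sup>2"
      by (simp add: power_mult_distrib power2_eq_square[of V])
    finally have "64 * V * real s \<le> (8 * V * sqrt (real s))\<^sup>2" .
    also have "\<dots> \<le> (r / real G)\<^sup>2" using le V_pos by (intro power_mono) auto
    finally show "64 * V * real s \<le> (r / real G)\<^sup>2" .
  qed
  also have "\<dots> \<le> \<eta> + (\<eta> + \<epsilon> / (512 * sqrt (real s)) * (1 / sqrt (real t)))"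
    unfolding hs(3) by (intro add_mono large_G_bounds(1)[OF G] selection_bound[OF t(4)])
  finally show ?thesis using pt_bound_parts(4)[of t] by linarith
qed

lemma alt_first:
  assumes h: "h \<ge> 1" and d: "norm0 p d \<le> 2 * s" and D: "k0 * (real s * u) \<le> (\<Sum>j=1..p. (d j)\<^sup>2)"
  shows "prob {\<omega> \<in> space M. A1 p a (Z d \<omega>) \<le> r} \<le> \<epsilon> / 4"
proof -
  have su: "real s * u > 0" using u_ge by linarith
  have k: "k0 * (real s * u) > 0" using su basic by simp
  have "prob {\<omega> \<in> space M. A1 p a (Z d \<omega>) \<le> r} \<le> 4 * (H1 * a powr - \<alpha>)"
  proof (rule A1_alternative[OF h a_gt(1,3) refl _ d])
    show "0 < (\<Sum>j=1..p. (d j)\<^sup>2)" using k D by linarith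
    have "16 * real (2 * s) * a\<^sup>2 = 32 * kc * (real s * u)" by (simp add: a_gt)
    also have "\<dots> \<le> k0 * (real s * u)" using basic su by (intro mult_right_mono) auto
    finally show "16 * real (2 * s) * a\<^sup>2 \<le> (\<Sum>j=1..p. (d j)\<^sup>2)" using D by linarith
    have "16 * kC * (real s * u) < k0 * (real s * u)" using basic su by (intro mult_strict_right_mono) auto
    hence "16 * r < k0 * (real s * u)" by (simp add: r_def)
    thus "r < (\<Sum>j=1..p. (d j)\<^sup>2) / 16" using D by linarith
  qed
  thus ?thesis using q_le(1) \<epsilon> unfolding H1_eq by linarith
qed

text \<open>The slack \<open>k = s\<close> on top of \<open>2 * s\<close> nonzero entries gives the
  bound \<open>3 * s\<close> on the size of a good selection. The three sources of error add up to
  \<open>\<epsilon>/16 + \<epsilon>/16 + \<epsilon>/64\<close>.\<close>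

lemma alt_selection:
  assumes t: "even t" "2 \<le> t" "t \<le> h" and gr: "groups G B N" and disj: "\<And>g. g \<in> {1..G} \<Longrightarrow> B g \<subseteq> odds t"
    and d: "norm0 p d \<le> 2 * s" and D: "k0 * (real s * u) \<le> real t * (\<Sum>j=1..p. (d j)\<^sup>2)"
    and q: "\<And>S. S \<subseteq> {1..p} \<Longrightarrow> (\<Sum>j=1..p. (d j)\<^sup>2) / 2 \<le> (\<Sum>j\<in>S. (d j)\<^sup>2) \<Longrightarrow> real (card S) \<le> 3 * real s \<Longrightarrow>
      prob {\<omega> \<in> space M. mom G B S (Z d \<omega>) \<le> x} \<le> \<epsilon> / 16"
  shows "prob {\<omega> \<in> space M. mom G B (sel (evens t) a d \<omega>) (Z d \<omega>) \<le> x} \<le> \<epsilon> / 4"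
proof -
  note hs = half_sets[OF t]
  have su: "real s * u > 0" using u_ge by linarith
  have "k0 * (real s * u) > 0" using su basic by simp
  hence "0 < real t * (\<Sum>j=1..p. (d j)\<^sup>2)" using D by linarith
  hence D0: "0 < (\<Sum>j=1..p. (d j)\<^sup>2)" by (simp add: zero_less_mult_iff)
  have "prob {\<omega> \<in> space M. mom G B (sel (evens t) a d \<omega>) (Z d \<omega>) \<le> x}
      \<le> \<epsilon> / 16 + 4 * (H1 * a powr - \<alpha>) + real p * (H1 * a powr - \<alpha>) / real s"
  proof (rule sparse_alternative[OF hs(1,2) gr _ a_gt(1) refl D0 d])
    show "B g \<inter> evens t = {}" if "g \<in> {1..G}" for g using disj[OF that] hs(5) by blast
    have "16 * real (2 * s) * a\<^sup>2 = (64 * kc * (real s * u)) / 2" by (simp add: a_gt)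
    also have "\<dots> \<le> (k0 * (real s * u)) / 2" using basic su by (intro divide_right_mono mult_right_mono) auto
    also have "\<dots> \<le> (real t * (\<Sum>j=1..p. (d j)\<^sup>2)) / 2" using D by simp
    finally show "16 * real (2 * s) * a\<^sup>2 \<le> real (card (evens t)) * (\<Sum>j=1..p. (d j)\<^sup>2)" by (simp add: hs)
  qed (use q s1 \<epsilon> in auto)
  also have "real p * (H1 * a powr - \<alpha>) / real s \<le> \<epsilon> / 64"
    using q_le(2) s1 unfolding H1_eq by (simp add: divide_le_eq mult.commute)
  finally show ?thesis using q_le(1) \<epsilon> unfolding H1_eq by linarith
qed

lemma alt_small:
  assumes t: "even t" "2 \<le> t" "t \<le> h" and B: "B 1 = odds t"
    and d: "norm0 p d \<le> 2 * s" and D: "k0 * (real s * u) \<le> real t * (\<Sum>j=1..p. (d j)\<^sup>2)"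
  shows "prob {\<omega> \<in> space M. mom 1 B (sel (evens t) a d \<omega>) (Z d \<omega>) \<le> r} \<le> \<epsilon> / 4"
proof (rule alt_selection[OF t groups_single[where B = B, OF t B] _ d D])
  note hs = half_sets[OF t]
  show "B g \<subseteq> odds t" if "g \<in> {1..1}" for g using that B by simp
  fix S assume S: "S \<subseteq> {1..p}" "(\<Sum>j=1..p. (d j)\<^sup>2) / 2 \<le> (\<Sum>j\<in>S. (d j)\<^sup>2)" "real (card S) \<le> 3 * real s"
  define m where "m = real (card (B 1)) * (\<Sum>j\<in>S. (d j)\<^sup>2)"
  define x where "x = real s * u"
  have x: "x \<ge> 1" "real s \<le> x" using u_ge by (auto simp: x_def)
  \<comment> \<open>The statistic uses half of the columns and a good selection retains half of the
    energy, hence the factor \<open>1/4\<close>.\<close>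
  define m1 where "m1 = k0 * x / 4"
  have m1: "m1 > 0" using x basic by (simp add: m1_def)
  have "real t / 2 * ((\<Sum>j=1..p. (d j)\<^sup>2) / 2) \<le> real t / 2 * (\<Sum>j\<in>S. (d j)\<^sup>2)" using S by (intro mult_left_mono) auto
  moreover have "m = real t / 2 * (\<Sum>j\<in>S. (d j)\<^sup>2)" by (simp only: m_def B hs(6))
  ultimately have mm: "m1 \<le> m" using D by (simp add: m1_def x_def)
  hence m: "m > 0" using m1 by linarith
  have rm: "r \<le> m / 2"
  proof -
    have "32 * kC * x \<le> k0 * x" using basic x by (intro mult_right_mono) auto
    hence "32 * r \<le> 4 * m1" by (simp add: r_def x_def m1_def)
    thus ?thesis using mm m1 r_pos by linarith
  qed
  have "prob {\<omega> \<in> space M. mom 1 B S (Z d \<omega>) \<le> r} \<le> prob {\<omega> \<in> space M. qform S (B 1) (Z d \<omega>) \<le> m / 2}"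
  proof (rule finite_measure_mono[OF _ qform_event[OF _ S(1)]])
    have "mom 1 B S z = qform S (B 1) z" for z by (simp add: mom_one)
    thus "{\<omega> \<in> space M. mom 1 B S (Z d \<omega>) \<le> r} \<subseteq> {\<omega> \<in> space M. qform S (B 1) (Z d \<omega>) \<le> m / 2}"
      using order_trans[OF _ rm] by (simp only:) blast
    show "B 1 \<subseteq> {1..h}" by (simp only: B hs(4))
  qed
  also have "\<dots> \<le> 4 * V * (m + real (card S)) / m\<^sup>2"
    by (rule qform_lower[OF groupsD(1,2)[OF groups_single[where B = B, OF t B]] S(1) m_def m]) auto
  also have "\<dots> \<le> 4 * V * (m + 3 * real s) / m\<^sup>2"
    using S V_pos by (intro divide_right_mono mult_left_mono) auto
  also have "\<dots> = 4 * V * ((m + 3 * real s) / m\<^sup>2)" by simp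
  also have "\<dots> \<le> 4 * V * ((m1 + 3 * real s) / m1\<^sup>2)"
    using ratio_antimono[OF m1 mm, of "3 * real s"] V_pos by (intro mult_left_mono) auto
  also have "\<dots> \<le> 4 * V * (52 / k0)"
  proof (intro mult_left_mono)
    have "(m1 + 3 * real s) / m1\<^sup>2 = 1 / m1 + 3 * real s / m1\<^sup>2" using m1 by (simp add: add_divide_distrib power2_eq_square)
    also have "1 / m1 \<le> 4 / k0" using x basic by (simp add: m1_def frac_le)
    also have "3 * real s / m1\<^sup>2 \<le> 3 * x / m1\<^sup>2" using x by (intro divide_right_mono) auto
    also have "3 * x / m1\<^sup>2 = 48 / (k0 * (k0 * x))" using x basic by (simp add: m1_def power2_eq_square)
    also have "\<dots> \<le> 48 / (k0 * 1)"
    proof (intro divide_left_mono mult_left_mono)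
      show "1 \<le> k0 * x" using mult_mono[of 1 k0 1 x] basic x by simp
    qed (use basic x in auto)
    finally show "(m1 + 3 * real s) / m1\<^sup>2 \<le> 52 / k0" by simp
  qed (use V_pos in auto)
  also have "\<dots> \<le> \<epsilon> / 16"
  proof -
    have "3328 * V / \<epsilon> \<le> k0" using basic by (simp add: V_eq)
    hence "3328 * V \<le> k0 * \<epsilon>" using \<epsilon> by (simp add: field_simps)
    thus ?thesis using basic by (simp add: field_simps)
  qed
  finally show "prob {\<omega> \<in> space M. mom 1 B S (Z d \<omega>) \<le> r} \<le> \<epsilon> / 16" .
qed

lemma alt_large:
  assumes t: "even t" "2 \<le> t" "t \<le> h" and G: "large_G G" and Lu: "L \<le> sqrt (real s) * u"
    and gr: "groups G B N" and N: "real G * real N = real t / 2" and disj: "\<And>g. g \<in> {1..G} \<Longrightarrow> B g \<subseteq> odds t"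
    and d: "norm0 p d \<le> 2 * s" and D: "k0 * (real s * u) \<le> real t * (\<Sum>j=1..p. (d j)\<^sup>2)"
  shows "prob {\<omega> \<in> space M. mom G B (sel (evens t) a d \<omega>) (Z d \<omega>) \<le> r / real G} \<le> \<epsilon> / 4"
proof (rule alt_selection[OF t gr disj d D])
  fix S assume S: "S \<subseteq> {1..p}" "(\<Sum>j=1..p. (d j)\<^sup>2) / 2 \<le> (\<Sum>j\<in>S. (d j)\<^sup>2)" "real (card S) \<le> 3 * real s"
  have G0: "real G > 0" using gr by (simp add: groups_def)
  define m where "m = real N * (\<Sum>j\<in>S. (d j)\<^sup>2)"
  define x where "x = real s * u"
  have x: "x \<ge> 1" using u_ge by (auto simp: x_def)
  \<comment> \<open>As for a single group, but a group now has only a fraction \<open>1 / G\<close>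
    of the odd columns.\<close>
  define m1 where "m1 = k0 * x / (4 * real G)"
  have m1: "m1 > 0" using x basic G0 by (simp add: m1_def)
  have Neq: "real N = real t / (2 * real G)" using N G0 by (simp add: field_simps)
  have "k0 * x / (4 * real G) \<le> (real t * (\<Sum>j=1..p. (d j)\<^sup>2)) / (4 * real G)"
    using D G0 by (intro divide_right_mono) (auto simp: x_def)
  also have "\<dots> = real N * ((\<Sum>j=1..p. (d j)\<^sup>2) / 2)" by (simp add: Neq)
  also have "\<dots> \<le> m" unfolding m_def using S by (intro mult_left_mono) auto
  finally have mm: "m1 \<le> m" by (simp add: m1_def)
  hence m: "m > 0" using m1 by linarith
  have rG: "r / real G \<le> m / 2"
  proof -
    have "32 * kC * x \<le> k0 * x" using basic x by (intro mult_right_mono) auto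
    hence "32 * r / (4 * real G) \<le> m1" unfolding m1_def using G0 by (intro divide_right_mono) (auto simp: r_def x_def)
    moreover have "32 * r / (4 * real G) = 8 * (r / real G)" by simp
    moreover have "r / real G \<ge> 0" using r_pos G0 by simp
    ultimately show ?thesis using mm by linarith
  qed
  have m1s: "1536 * V * sqrt (real s) \<le> m1"
  proof -
    have "1536 * V * (4 * (real G * sqrt (real s))) \<le> 1536 * V * (4 * (2 * (kG * (real s * u))))"
      using large_G_bounds(5)[OF G Lu] V_pos by (intro mult_left_mono) auto
    also have "\<dots> = (12288 * kG * kV) * x" by (simp add: V_eq x_def)
    also have "\<dots> \<le> k0 * x" using basic x by (intro mult_right_mono) auto
    finally show ?thesis using G0 by (simp add: m1_def field_simps)
  qed
  have "256 * V * (m + real (card S)) \<le> m\<^sup>2"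
  proof -
    have sq: "sqrt (real s) \<ge> 1" using s1 by simp
    have "1536 * V * 1 \<le> 1536 * V * sqrt (real s)" using sq V_pos by (intro mult_left_mono) auto
    hence mV: "1536 * V \<le> m1" using m1s by linarith
    have "m1 * (512 * V) \<le> m1 * m1" using mV V_pos m1 by (intro mult_left_mono) auto
    moreover have "(1536 * V * sqrt (real s))\<^sup>2 \<le> m1\<^sup>2" using m1s V_pos by (intro power_mono) auto
    hence "2359296 * (V * V * real s) \<le> m1 * m1"
      by (simp add: power_mult_distrib power2_eq_square[of V] power2_eq_square[of m1])
    moreover have "V * real s \<le> V * V * real s"
      using mult_left_mono[of 1 V V] V_pos basic by (intro mult_right_mono) (auto simp: V_eq)
    moreover have "V * real s \<ge> 0" using V_pos by simp
    ultimately have "256 * V * (m1 + 3 * real s) \<le> m1 * m1"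
      unfolding distrib_left by (simp add: mult_ac)
    hence "(m1 + 3 * real s) / m1\<^sup>2 \<le> 1 / (256 * V)" using m1 V_pos by (simp add: power2_eq_square field_simps)
    hence "(m + 3 * real s) / m\<^sup>2 \<le> 1 / (256 * V)" using ratio_antimono[OF m1 mm, of "3 * real s"] by simp
    hence "256 * V * (m + 3 * real s) \<le> m\<^sup>2" using m V_pos by (simp add: field_simps)
    moreover have "256 * V * (m + real (card S)) \<le> 256 * V * (m + 3 * real s)" using S V_pos by (intro mult_left_mono) auto
    ultimately show ?thesis by linarith
  qed
  from mom_lower[OF gr S(1) m_def m this]
  have ml: "prob {\<omega> \<in> space M. mom G B S (Z d \<omega>) \<le> m / 2} \<le> (1 / 4) ^ G" .
  have "prob {\<omega> \<in> space M. mom G B S (Z d \<omega>) \<le> r / real G} \<le> prob {\<omega> \<in> space M. mom G B S (Z d \<omega>) \<le> m / 2}"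
    by (rule finite_measure_mono[OF _ mom_event[OF gr S(1)]]) (use order_trans[OF _ rG] in blast)
  also have "\<dots> \<le> (1 / 4) ^ G" by (rule ml)
  also have "\<dots> \<le> \<epsilon> / 256" by (rule large_G_bounds(4)[OF G])
  finally show "prob {\<omega> \<in> space M. mom G B S (Z d \<omega>) \<le> r / real G} \<le> \<epsilon> / 16" using \<epsilon> by linarith
qed

section \<open>Scales handled by the mean estimator\<close>

definition sample :: "(nat \<Rightarrow> real) \<Rightarrow> nat \<Rightarrow> 'a \<Rightarrow> mat" where
  "sample d t \<omega> = (\<lambda>(j, i)\<in>entries p t. Z d \<omega> i j)"

lemma measurable_sample:
  assumes "t \<le> h"
  shows "sample d t \<in> measurable M (mat_space p t)"
  unfolding sample_def[abs_def] mat_space_def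
proof (rule measurable_restrict)
  fix e assume "e \<in> entries p t"
  then obtain j i where e: "e = (j, i)" "j \<in> {1..p}" "i \<in> {1..h}" using assms by (auto simp: entries_def)
  have [measurable]: "random_variable borel (\<xi> (j, i))" using rv e by auto
  show "(\<lambda>\<omega>. case e of (j, i) \<Rightarrow> Z d \<omega> i j) \<in> borel_measurable M"
    unfolding e(1) Z_def prod.case by measurable
qed

text \<open>The estimator is built without reference to moments, so its error bound may be used with
  \<open>H\<close> in place of \<open>K\<close>. The moment condition then reads
  \<open>H \<le> (sqrt 2 * H) powr \<alpha>\<close>, which follows from
  \<open>H \<ge> 1\<close>.\<close>

lemma sample_rsm:
  assumes t: "1 \<le> t" "t \<le> h" and d: "norm0 p d \<le> 2 * s"
  shows "rsm_sample \<alpha> H p t (2 * s) d (distr M (mat_space p t) (sample d t))"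
proof -
  let ?Q = "distr M (mat_space p t) (sample d t)"
  note ms = measurable_sample[OF t(2), of d]
  have hb: "has_bochner_integral ?Q f x"
    if "f \<in> borel_measurable (mat_space p t)" "has_bochner_integral M (\<lambda>\<omega>. f (sample d t \<omega>)) x" for f :: "mat \<Rightarrow> real" and x
    using that ms by (simp add: has_bochner_integral_iff integrable_distr_eq integral_distr)
  have comp: "(\<lambda>W. W (j, i)) \<in> borel_measurable (mat_space p t)" if "j \<in> {1..p}" "i \<in> {1..t}" for j i
    unfolding mat_space_def using that by (intro measurable_component_singleton) (auto simp: entries_def)
  have val: "sample d t \<omega> (j, i) = d j + \<xi> (j, i) \<omega>" if "j \<in> {1..p}" "i \<in> {1..t}" for j i \<omega>
    using that by (simp add: sample_def entries_def Z_def)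
  have nz: "std_noise \<alpha> H (\<xi> (j, i))" if "j \<in> {1..p}" "i \<in> {1..t}" for j i using noise that t by auto
  have "indep_vars (\<lambda>_. vec_space p) (\<lambda>i \<omega>. col p (sample d t \<omega>) i) {1..t}"
  proof -
    have "indep_vars (\<lambda>_. vec_space p) (\<lambda>i \<omega>. (\<lambda>y. \<lambda>j\<in>{1..p}. d j + y (j, i)) (restrict (\<lambda>e. \<xi> e \<omega>) ({1..p} \<times> {i}))) {1..t}"
    proof (rule indep_vars_compose2[OF indep_vars_restrict[OF indep]])
      show "{1..p} \<times> {i} \<subseteq> {1..p} \<times> {1..h}" if "i \<in> {1..t}" for i using that t by auto
      show "disjoint_family_on (\<lambda>i. {1..p} \<times> {i}) {1..t}" by (auto simp: disjoint_family_on_def)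
      show "(\<lambda>y. \<lambda>j\<in>{1..p}. d j + y (j, i)) \<in> measurable (PiM ({1..p} \<times> {i}) (\<lambda>_. borel)) (vec_space p)" for i
        unfolding vec_space_def
        by (intro measurable_restrict borel_measurable_add borel_measurable_const measurable_component_singleton) auto
    qed
    also have "?this \<longleftrightarrow> ?thesis"
    proof (rule indep_vars_cong[OF refl])
      fix i assume i: "i \<in> {1..t}"
      show "(\<lambda>\<omega>. (\<lambda>y. \<lambda>j\<in>{1..p}. d j + y (j, i)) (restrict (\<lambda>e. \<xi> e \<omega>) ({1..p} \<times> {i}))) = (\<lambda>\<omega>. col p (sample d t \<omega>) i)"
        by (intro ext) (use i val in \<open>auto simp: col_def restrict_def\<close>)
    qed simp
    finally show ?thesis .
  qed
  hence "prob_space.indep_vars ?Q (\<lambda>_. vec_space p) (\<lambda>i W. col p W i) {1..t}"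
  proof (intro indep_vars_distr[OF ms])
    fix i assume i: "i \<in> {1..t}"
    show "(\<lambda>W. col p W i) \<in> measurable (mat_space p t) (vec_space p)"
      unfolding col_def vec_space_def using i by (intro measurable_restrict comp) auto
  qed (use t in auto)
  moreover have "has_bochner_integral ?Q (\<lambda>W. W (j, i)) (d j)" if ji: "j \<in> {1..p}" "i \<in> {1..t}" for j i
    using std_noiseD[OF nz[OF ji]]
    by (intro hb comp[OF ji]) (simp add: val[OF ji] has_bochner_integral_iff prob_space)
  moreover have "has_bochner_integral ?Q (\<lambda>W. (W (j, i) - d j) * (W (k, i) - d k)) (of_bool (j = k))"
    if ji: "j \<in> {1..p}" "i \<in> {1..t}" and k: "k \<in> {1..p}" for j i k
  proof (rule hb)
    show "(\<lambda>W. (W (j, i) - d j) * (W (k, i) - d k)) \<in> borel_measurable (mat_space p t)"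
      by (intro borel_measurable_times borel_measurable_diff comp ji k borel_measurable_const)
    have "has_bochner_integral M (\<lambda>\<omega>. \<xi> (j, i) \<omega> * \<xi> (k, i) \<omega>) (of_bool (j = k))"
    proof (cases "j = k")
      case True
      thus ?thesis using std_noiseD[OF nz[OF ji]] by (simp add: has_bochner_integral_iff power2_eq_square)
    next
      case False
      have "indep_vars (\<lambda>_. borel) \<xi> (insert (j, i) {(k, i)})"
        using ji k t by (intro indep_vars_subset[OF indep]) auto
      hence iv: "indep_var borel (\<xi> (j, i)) borel (\<lambda>\<omega>. \<Sum>e\<in>{(k, i)}. \<xi> e \<omega>)"
        using False by (intro indep_vars_sum) auto
      hence iv: "indep_var borel (\<xi> (j, i)) borel (\<xi> (k, i))" by simp
      show ?thesis
        using indep_var_integrable[OF iv] indep_var_lebesgue_integral[OF iv] std_noiseD[OF nz[OF ji]]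
          std_noiseD[OF nz[OF k ji(2)]] False by (simp add: has_bochner_integral_iff)
    qed
    thus "has_bochner_integral M (\<lambda>\<omega>. (sample d t \<omega> (j, i) - d j) * (sample d t \<omega> (k, i) - d k)) (of_bool (j = k))"
      by (simp only: val[OF ji] val[OF k ji(2)] add_diff_cancel_left')
  qed
  moreover have "integrable ?Q (\<lambda>W. \<bar>W (j, i) - d j\<bar> powr \<alpha>) \<and> (\<integral>W. \<bar>W (j, i) - d j\<bar> powr \<alpha> \<partial>?Q) \<le> (sqrt 2 * H) powr \<alpha>"
    if ji: "j \<in> {1..p}" "i \<in> {1..t}" for j i
  proof -
    note [measurable] = comp[OF ji]
    have m: "(\<lambda>W. \<bar>W (j, i) - d j\<bar> powr \<alpha>) \<in> borel_measurable (mat_space p t)" by measurable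
    have "H \<le> (sqrt 2 * H) powr \<alpha>"
    proof -
      have "1 * H \<le> sqrt 2 * H" using H by (intro mult_right_mono) auto
      hence "H powr 1 \<le> (sqrt 2 * H) powr 1" using H by simp
      also have "1 \<le> sqrt 2 * H" using \<open>1 * H \<le> sqrt 2 * H\<close> H by linarith
      hence "(sqrt 2 * H) powr 1 \<le> (sqrt 2 * H) powr \<alpha>" using alpha by (intro powr_mono) auto
      finally show ?thesis using H by simp
    qed
    thus ?thesis using std_noiseD(6,7)[OF nz[OF ji]] ms m
      by (simp add: integrable_distr_eq integral_distr val[OF ji])
  qed
  moreover have "prob_space ?Q" by (rule prob_space_distr[OF ms])
  ultimately show ?thesis using d by (simp add: rsm_sample_def)
qed

lemma rsm_deviation:
  assumes t: "1 \<le> t" "t \<le> h" "\<Delta> < real t" and d: "norm0 p d \<le> 2 * s"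
    and P: "\<And>\<omega>. \<omega> \<in> space M \<Longrightarrow> P \<omega> \<Longrightarrow>
      sqrt rT < sqrt (real t) * sqrt (sqnorm p (\<lambda>j. rsm_estimator p t s \<eta> (sample d t \<omega>) j - d j))"
  shows "prob {\<omega> \<in> space M. P \<omega>} \<le> \<eta>"
proof -
  let ?Q = "distr M (mat_space p t) (sample d t)"
  note ms = measurable_sample[OF t(2), of d]
  interpret Q: prob_space ?Q by (rule prob_space_distr[OF ms])
  define l where "l = real s * ln (exp 1 * real p / real s)"
  define e where "e = ln (1 / \<eta>)"
  define bound where "bound = sqrt 28512 * (sqrt (l / real t) + sqrt (e / real t))"
  define good where "good = {W \<in> space ?Q. sqrt (sqnorm p (\<lambda>j. rsm_estimator p t s \<eta> W j - d j)) \<le> bound}"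
  have "1 - \<eta> \<le> measure ?Q good"
    unfolding good_def bound_def l_def e_def
    by (rule rsm_estimator_bound[OF sample_rsm[OF t(1,2) d] s eta(1,2)]) (use sample_size[OF t(3)] in simp)
  \<comment> \<open>A non-measurable set would have \<open>measure\<close> zero, contradicting the
    positive lower bound \<open>1 - \<eta>\<close>.\<close>
  moreover have good_sets: "good \<in> sets (mat_space p t)"
  proof (rule ccontr)
    assume "good \<notin> sets (mat_space p t)"
    hence "measure ?Q good = 0" by (simp add: measure_notin_sets)
    thus False using \<open>1 - \<eta> \<le> measure ?Q good\<close> eta(2) by simp
  qed
  ultimately have pg: "1 - \<eta> \<le> prob (sample d t -` good \<inter> space M)"
    using measure_distr[OF ms good_sets] by simp
  have ev: "sample d t -` good \<inter> space M \<in> events" by (rule measurable_sets[OF ms good_sets])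
  \<comment> \<open>Here \<open>sqrt l + sqrt e \<le> 2 * sqrt (l + e)\<close>, which is why
    \<open>kT\<close> contains \<open>114048 = 4 * 28512\<close>.\<close>
  have "bound * sqrt (real t) \<le> sqrt rT"
  proof -
    have l0: "l \<ge> 0" using ln_sparsity_ge_one[OF s] by (simp add: l_def)
    have e0: "e \<ge> 0" using eta(5) by (simp add: e_def)
    have t0: "real t > 0" using t by simp
    have "bound * sqrt (real t) = sqrt 28512 * (sqrt l + sqrt e)"
      using t0 by (simp add: bound_def real_sqrt_divide field_simps)
    also have "\<dots> \<le> sqrt 28512 * (2 * sqrt (l + e))"
    proof (rule mult_left_mono)
      have "sqrt l \<le> sqrt (l + e)" "sqrt e \<le> sqrt (l + e)" using l0 e0 by auto
      thus "sqrt l + sqrt e \<le> 2 * sqrt (l + e)" by linarith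
    qed simp
    also have "\<dots> = sqrt (114048 * (l + e))"
    proof -
      have "sqrt (114048 * (l + e)) = sqrt (28512 * (4 * (l + e)))" by simp
      also have "\<dots> = sqrt 28512 * (sqrt 4 * sqrt (l + e))" by (simp only: real_sqrt_mult)
      finally show ?thesis by simp
    qed
    also have "\<dots> \<le> sqrt rT"
    proof -
      have "114048 * (l + e) \<le> 114048 * (kR * (real s * u))"
        using eta(4) by (intro mult_left_mono) (auto simp: l_def e_def)
      thus ?thesis by (simp add: rT_def kT_def mult_ac)
    qed
    finally show ?thesis .
  qed
  hence "{\<omega> \<in> space M. P \<omega>} \<subseteq> space M - (sample d t -` good \<inter> space M)"
  proof (intro subsetI DiffI)
    fix \<omega> assume w: "\<omega> \<in> {\<omega> \<in> space M. P \<omega>}"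
    show "\<omega> \<notin> sample d t -` good \<inter> space M"
    proof
      assume "\<omega> \<in> sample d t -` good \<inter> space M"
      hence "sqrt (sqnorm p (\<lambda>j. rsm_estimator p t s \<eta> (sample d t \<omega>) j - d j)) \<le> bound" by (simp add: good_def)
      hence "sqrt (real t) * sqrt (sqnorm p (\<lambda>j. rsm_estimator p t s \<eta> (sample d t \<omega>) j - d j)) \<le> sqrt (real t) * bound"
        by (rule mult_left_mono) simp
      thus False using P w \<open>bound * sqrt (real t) \<le> sqrt rT\<close> by (fastforce simp: mult.commute)
    qed
  qed auto
  hence "prob {\<omega> \<in> space M. P \<omega>} \<le> prob (space M - (sample d t -` good \<inter> space M))"
    using ev by (intro finite_measure_mono) auto
  also have "\<dots> = 1 - prob (sample d t -` good \<inter> space M)" by (rule prob_compl[OF ev])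
  finally show ?thesis using pg by linarith
qed

lemma null_rsm:
  assumes t: "1 \<le> t" "t \<le> h" "\<Delta> < real t" and d: "\<And>j. j \<in> {1..p} \<Longrightarrow> d j = 0"
  shows "prob {\<omega> \<in> space M. rT < real t * sqnorm p (rsm_estimator p t s \<eta> (sample d t \<omega>))} \<le> pt_bound t"
proof -
  have "{j \<in> {1..p}. d j \<noteq> 0} = {}" using d by auto
  hence d0: "norm0 p d \<le> 2 * s" unfolding norm0_def by (simp only: card.empty)
  have eq: "sqnorm p (\<lambda>j. v j - d j) = sqnorm p v" for v using d by (simp add: sqnorm_def)
  have "prob {\<omega> \<in> space M. rT < real t * sqnorm p (rsm_estimator p t s \<eta> (sample d t \<omega>))} \<le> \<eta>"
    by (rule rsm_deviation[OF t d0]) (simp only: eq real_sqrt_mult[symmetric] real_sqrt_less_iff)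
  thus ?thesis using pt_bound_parts(3)[of t] by linarith
qed

text \<open>A small estimate \<open>v\<close> of a large mean \<open>d\<close> is a large error:
  \<open>|d|^2 \<le> 2 * |v - d|^2 + 2 * |v|^2\<close>, and \<open>t * |d|^2 \<ge> 5 * rT\<close>
  together with \<open>t * |v|^2 \<le> rT\<close> leaves
  \<open>t * |v - d|^2 \<ge> 3/2 * rT\<close>.\<close>

lemma alt_rsm:
  assumes t: "1 \<le> t" "t \<le> h" "\<Delta> < real t"
    and d: "norm0 p d \<le> 2 * s" and D: "k0 * (real s * u) \<le> real t * (\<Sum>j=1..p. (d j)\<^sup>2)"
  shows "prob {\<omega> \<in> space M. real t * sqnorm p (rsm_estimator p t s \<eta> (sample d t \<omega>)) \<le> rT} \<le> \<epsilon> / 4"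
proof -
  have "prob {\<omega> \<in> space M. real t * sqnorm p (rsm_estimator p t s \<eta> (sample d t \<omega>)) \<le> rT} \<le> \<eta>"
  proof (rule rsm_deviation[OF t d])
    fix \<omega> assume le: "real t * sqnorm p (rsm_estimator p t s \<eta> (sample d t \<omega>)) \<le> rT"
    define v where "v = rsm_estimator p t s \<eta> (sample d t \<omega>)"
    have "sqnorm p d \<le> 2 * sqnorm p (\<lambda>j. v j - d j) + 2 * sqnorm p v"
    proof -
      have "(d j)\<^sup>2 \<le> 2 * (v j - d j)\<^sup>2 + 2 * (v j)\<^sup>2" for j
        using zero_le_power2[of "2 * v j - d j"] by (simp add: power2_eq_square algebra_simps)
      hence "sqnorm p d \<le> (\<Sum>j=1..p. 2 * (v j - d j)\<^sup>2 + 2 * (v j)\<^sup>2)" unfolding sqnorm_def by (intro sum_mono)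
      thus ?thesis by (simp add: sqnorm_def sum.distrib sum_distrib_left)
    qed
    hence "real t * sqnorm p d \<le> real t * (2 * sqnorm p (\<lambda>j. v j - d j) + 2 * sqnorm p v)" by (rule mult_left_mono) simp
    hence "real t * sqnorm p d \<le> 2 * (real t * sqnorm p (\<lambda>j. v j - d j)) + 2 * (real t * sqnorm p v)"
      by (simp add: algebra_simps)
    moreover have "5 * rT \<le> real t * sqnorm p d"
    proof -
      have "5 * kT * (real s * u) \<le> k0 * (real s * u)" using basic u_ge by (intro mult_right_mono) auto
      thus ?thesis using D by (simp add: rT_def sqnorm_def)
    qed
    ultimately have "rT < real t * sqnorm p (\<lambda>j. v j - d j)" using le r_pos(2) by (simp add: v_def)
    thus "sqrt rT < sqrt (real t) * sqrt (sqnorm p (\<lambda>j. rsm_estimator p t s \<eta> (sample d t \<omega>) j - d j))"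
      by (simp only: real_sqrt_mult[symmetric] real_sqrt_less_iff v_def)
  qed
  thus ?thesis using eta(3) \<epsilon> by linarith
qed

end

section \<open>The statistics as functions of the symmetrized array\<close>

lemma median_scale:
  fixes f :: "nat \<Rightarrow> real"
  assumes c: "c > 0" and G: "G \<ge> 1"
  shows "median G (\<lambda>g. c * f g) = c * median G f"
proof -
  have "sort (map ((*) c) xs) = map ((*) c) (sort xs)" for xs :: "real list"
  proof (rule properties_for_sort)
    show "mset (map ((*) c) (sort xs)) = mset (map ((*) c) xs)" by simp
    show "sorted (map ((*) c) (sort xs))"
      using c by (intro sorted_map_mono) (auto intro!: mono_onI mult_left_mono)
  qed
  from this[of "map f [1..<Suc G]"]
  have eq: "sort (map (\<lambda>g. c * f g) [1..<Suc G]) = map ((*) c) (sort (map f [1..<Suc G]))"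
    by (simp add: comp_def del: upt_Suc)
  have "G div 2 < G" "G div 2 - 1 < G" using G by auto
  thus ?thesis
    unfolding median_def Let_def eq by (simp add: distrib_left del: upt_Suc)
qed

definition zsel :: "nat \<Rightarrow> nat set \<Rightarrow> real \<Rightarrow> (nat \<Rightarrow> nat \<Rightarrow> real) \<Rightarrow> nat set" where
  "zsel p T a z = {j \<in> {1..p}. a \<le> \<bar>\<Sum>i\<in>T. z i j\<bar> / sqrt (card T)}"

lemma zsel_cong: "(\<And>i j. i \<in> T \<Longrightarrow> j \<in> {1..p} \<Longrightarrow> z i j = z' i j) \<Longrightarrow> zsel p T a z = zsel p T a z'"
  unfolding zsel_def by (intro Collect_cong conj_cong refl) (simp cong: sum.cong)

lemma qform_cong:
  "(\<And>i j. i \<in> B \<Longrightarrow> j \<in> S \<Longrightarrow> z i j = z' i j) \<Longrightarrow> qform S B z = qform S B z'"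
  unfolding qform_def by (intro sum.cong arg_cong2[where f = "(-)"] refl) (simp cong: sum.cong)

lemma (in noise_array) sel_eq_zsel: "sel T a d \<omega> = zsel p T a (Z d \<omega>)"
  by (simp add: sel_def zsel_def)

lemma equal_splitD:
  assumes "equal_split A G B"
  shows "G \<ge> 1" "\<And>g. g \<in> {1..G} \<Longrightarrow> real G * real (card (B g)) = real (card A)" "\<And>g. g \<in> {1..G} \<Longrightarrow> B g \<subseteq> A"
  using assms by (auto simp: equal_split_def of_nat_mult[symmetric] simp del: of_nat_mult)

lemma sum_group_mean_eq_qform:
  assumes "N > 0" "real (card B) = N" "finite S"
  shows "(\<Sum>j\<in>S. (group_mean n X B j)\<^sup>2 - 1 / N) = 1 / N * qform S B (Zst n X)"
  unfolding qform_def group_mean_def sum_distrib_left assms(2)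
  using assms(1) by (intro sum.cong refl) (simp add: right_diff_distrib)

lemma A_dense_eq:
  assumes sp: "equal_split {1..t} G B" and t: "t \<ge> 1"
  shows "A_dense p n G B t X = real G * median G (\<lambda>g. qform {1..p} (B g) (Zst n X))"
proof -
  note G = equal_splitD(1)[OF sp]
  define N where "N = real t / real G"
  have N: "N > 0" using t G by (simp add: N_def)
  have NG: "1 / N = real G / real t" by (simp add: N_def)
  have card: "real (card (B g)) = N" if "g \<in> {1..G}" for g
    using equal_splitD(2)[OF sp that] G by (simp add: N_def field_simps)
  have "median G (\<lambda>g. \<Sum>j = 1..p. ((group_mean n X (B g) j)\<^sup>2 - real G / real t))
      = median G (\<lambda>g. 1 / N * qform {1..p} (B g) (Zst n X))"
    unfolding NG[symmetric] by (intro median_cong sum_group_mean_eq_qform[OF N card]) auto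
  also have "\<dots> = 1 / N * median G (\<lambda>g. qform {1..p} (B g) (Zst n X))"
    by (rule median_scale) (use N G in auto)
  finally show ?thesis using t by (simp add: A_dense_def N_def)
qed

lemma sum_of_bool_filter:
  fixes f :: "nat \<Rightarrow> real"
  assumes "finite S"
  shows "(\<Sum>j\<in>S. f j * of_bool (P j)) = (\<Sum>j\<in>{j \<in> S. P j}. f j)"
proof -
  have "(\<Sum>j\<in>S. f j * of_bool (P j)) = (\<Sum>j\<in>S. if P j then f j else 0)" by (intro sum.cong) auto
  thus ?thesis by (simp only: sum.inter_filter[OF assms])
qed

lemma sum_evens:
  fixes f :: "nat \<Rightarrow> real"
  assumes "even t"
  shows "sum f (evens t) = (\<Sum>i=1..t div 2. f (2 * i))" "sum f (odds t) = (\<Sum>i=1..t div 2. f (2 * i - 1))"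
  unfolding odds_evens(3,4)[OF assms] by (subst sum.reindex; auto simp: inj_on_def)+

lemma sum_over_sqrt_half:
  assumes "t > 0"
  shows "(x / sqrt 2) / sqrt (real t / 2) = x / sqrt (real t)"
  using assms by (simp add: real_sqrt_divide)

lemma Y2_eq:
  assumes t: "even t" "2 \<le> t" "2 * t \<le> n"
  shows "Y2 n X t j = (\<Sum>i\<in>evens t. Zst n X i j) / sqrt (card (evens t))"
proof -
  have c: "real (card (evens t)) = real t / 2" using odds_evens(2)[OF t(1)] t by (auto elim!: evenE)
  have t0: "t > 0" using t by simp
  have "(\<Sum>i\<in>evens t. Zst n X i j) = (\<Sum>i=1..t div 2. (X (j, 2 * i) - X (j, n + 1 - 2 * i)) / sqrt 2)"
    unfolding sum_evens(1)[OF t(1)] Zst_def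
  proof (intro sum.cong refl)
    fix i assume "i \<in> {1..t div 2}"
    \<comment> \<open>Subtraction of naturals: the rearrangement relies on
      \<open>2 * i \<le> t \<le> n\<close>.\<close>
    hence "n - 2 * i + 1 = n + 1 - 2 * i" using t by auto
    thus "(X (j, 2 * i) - X (j, n - 2 * i + 1)) / sqrt 2 = (X (j, 2 * i) - X (j, n + 1 - 2 * i)) / sqrt 2" by simp
  qed
  also have "\<dots> = ((\<Sum>i=1..t div 2. X (j, 2 * i)) - (\<Sum>i=1..t div 2. X (j, n + 1 - 2 * i))) / sqrt 2"
    by (simp add: sum_subtractf sum_divide_distrib[symmetric])
  finally show ?thesis
    unfolding Y2_def c by (simp only: sum_over_sqrt_half[OF t0])
qed

lemma Y1_eq:
  assumes t: "even t" "2 \<le> t" "2 * t \<le> n"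
  shows "Y1 n X t j = (\<Sum>i\<in>odds t. Zst n X i j) / sqrt (card (odds t))"
proof -
  have c: "real (card (odds t)) = real t / 2" using odds_evens(1)[OF t(1)] t by (auto elim!: evenE)
  have t0: "t > 0" using t by simp
  have "(\<Sum>i\<in>odds t. Zst n X i j) = (\<Sum>i=1..t div 2. (X (j, 2 * i - 1) - X (j, n + 2 - 2 * i)) / sqrt 2)"
    unfolding sum_evens(2)[OF t(1)] Zst_def
  proof (intro sum.cong refl)
    fix i assume "i \<in> {1..t div 2}"
    hence "n - (2 * i - 1) + 1 = n + 2 - 2 * i" using t by auto
    thus "(X (j, 2 * i - 1) - X (j, n - (2 * i - 1) + 1)) / sqrt 2 = (X (j, 2 * i - 1) - X (j, n + 2 - 2 * i)) / sqrt 2" by (simp only:)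
  qed
  also have "\<dots> = ((\<Sum>i=1..t div 2. X (j, 2 * i - 1)) - (\<Sum>i=1..t div 2. X (j, n + 2 - 2 * i))) / sqrt 2"
    by (simp add: sum_subtractf sum_divide_distrib[symmetric])
  finally show ?thesis
    unfolding Y1_def c by (simp only: sum_over_sqrt_half[OF t0])
qed

lemma abs_Y2_eq:
  assumes t: "even t" "2 \<le> t" "2 * t \<le> n"
  shows "{j \<in> {1..p}. a \<le> \<bar>Y2 n X t j\<bar>} = zsel p (evens t) a (Zst n X)"
  unfolding zsel_def Y2_eq[OF t] by (simp add: abs_divide)

text \<open>A group has \<open>N = t / (2 * G)\<close> columns, so the centering
  \<open>2 * G / t\<close> is \<open>1 / N\<close>, and the prefactor \<open>t / 2\<close> turns
  this into \<open>G\<close>. A threshold \<open>r\<close> for the statistic is therefore the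
  threshold \<open>r / G\<close> for the median of normalized forms.\<close>

lemma A_mom_eq:
  assumes sp: "equal_split (odds t) G B" and t: "even t" "2 \<le> t" "2 * t \<le> n"
  shows "A_mom p n a G B t X = real G * median G (\<lambda>g. qform (zsel p (evens t) a (Zst n X)) (B g) (Zst n X))"
proof -
  note G = equal_splitD(1)[OF sp]
  have c: "real (card (odds t)) = real t / 2" using odds_evens(1)[OF t(1)] t by (auto elim!: evenE)
  define N where "N = real t / (2 * real G)"
  have N: "N > 0" using t G by (simp add: N_def)
  have NG: "1 / N = 2 * real G / real t" by (simp add: N_def)
  have card: "real (card (B g)) = N" if "g \<in> {1..G}" for g
    using equal_splitD(2)[OF sp that] G unfolding c by (simp add: N_def field_simps)
  define S where "S = zsel p (evens t) a (Zst n X)"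
  have finS: "finite S" by (simp add: S_def zsel_def)
  have "median G (\<lambda>g. \<Sum>j = 1..p. ((group_mean n X (B g) j)\<^sup>2 - 2 * real G / real t) * of_bool (\<bar>Y2 n X t j\<bar> \<ge> a))
      = median G (\<lambda>g. \<Sum>j\<in>S. ((group_mean n X (B g) j)\<^sup>2 - 1 / N))"
    unfolding NG[symmetric] sum_of_bool_filter[OF finite_atLeastAtMost] abs_Y2_eq[OF t] S_def ..
  also have "\<dots> = median G (\<lambda>g. 1 / N * qform S (B g) (Zst n X))"
    by (intro median_cong sum_group_mean_eq_qform[OF N card finS]) auto
  also have "\<dots> = 1 / N * median G (\<lambda>g. qform S (B g) (Zst n X))"
    by (rule median_scale) (use N G in auto)
  finally show ?thesis using t by (simp add: A_mom_def N_def S_def)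
qed

lemma A_split_eq:
  assumes t: "even t" "2 \<le> t" "2 * t \<le> n"
  shows "A_split p n a t X = qform (zsel p (evens t) a (Zst n X)) (odds t) (Zst n X)"
proof -
  define N where "N = real (card (odds t))"
  have N: "N > 0" using odds_evens(1)[OF t(1)] t by (auto simp: N_def)
  have sq: "((\<Sum>i\<in>odds t. Zst n X i j) / sqrt N)\<^sup>2 = N * ((\<Sum>i\<in>odds t. Zst n X i j) / N)\<^sup>2" for j
    using N by (simp add: power_divide power2_eq_square[of N])
  have "t \<noteq> 1" using t by simp
  hence "A_split p n a t X = (\<Sum>j = 1..p. ((Y1 n X t j)\<^sup>2 - 1) * of_bool (\<bar>Y2 n X t j\<bar> \<ge> a))"
    unfolding A_split_def by (rule if_not_P)
  also have "\<dots> = (\<Sum>j\<in>zsel p (evens t) a (Zst n X). (Y1 n X t j)\<^sup>2 - 1)"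
    by (simp only: sum_of_bool_filter[OF finite_atLeastAtMost] abs_Y2_eq[OF t])
  also have "\<dots> = qform (zsel p (evens t) a (Zst n X)) (odds t) (Zst n X)"
    by (simp only: qform_def Y1_eq[OF t] N_def[symmetric] sq)
  finally show ?thesis .
qed

lemma A_one_eq: "A_one p n a X = A1 p a (Zst n X)"
  by (simp add: A_one_def A1_def)

subsection \<open>Splits into blocks\<close>

lemma equal_split_blocks:
  assumes G: "G \<ge> 1" and N: "N \<ge> 1"
  shows "equal_split {1..G * N} G (rsm_block N)"
proof -
  have card: "card (rsm_block N g) = N" if "g \<in> {1..G}" for g
    using that by (cases g) (auto simp: rsm_block_def)
  have "(\<Union>g\<in>{1..G}. rsm_block N g) = {1..G * N}"
  proof (intro set_eqI iffI)
    fix i assume "i \<in> (\<Union>g\<in>{1..G}. rsm_block N g)"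
    then obtain g where g: "1 \<le> g" "g \<le> G" "(g - 1) * N + 1 \<le> i" "i \<le> g * N" by (auto simp: rsm_block_def)
    have "g * N \<le> G * N" using g by simp
    hence "i \<le> G * N" using g(4) by (rule order_trans[rotated])
    moreover have "1 \<le> i" using g(3) by linarith
    ultimately show "i \<in> {1..G * N}" by simp
  next
    fix i assume i: "i \<in> {1..G * N}"
    define g where "g = (i - 1) div N + 1"
    have "i - 1 < G * N" using i by auto
    hence "(i - 1) div N < G" using N by (simp add: div_less_iff_less_mult)
    hence g: "g \<in> {1..G}" by (simp add: g_def)
    have m: "(i - 1) div N * N \<le> i - 1" "i - 1 < (i - 1) div N * N + N"
      using div_times_less_eq_dividend[of "i - 1" N] dividend_less_div_times[of N "i - 1"] N by linarith+
    have "1 \<le> i" using i by simp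
    moreover have "g * N = (i - 1) div N * N + N" "(g - 1) * N = (i - 1) div N * N" by (simp_all add: g_def)
    ultimately have "(g - 1) * N + 1 \<le> i" "i \<le> g * N" using m by linarith+
    hence "i \<in> rsm_block N g" by (simp add: rsm_block_def)
    thus "i \<in> (\<Union>g\<in>{1..G}. rsm_block N g)" using g by blast
  qed
  thus ?thesis using G card disjoint_rsm_block by (simp add: equal_split_def)
qed

lemma equal_split_image:
  assumes sp: "equal_split A G B" and inj: "inj_on f A"
  shows "equal_split (f ` A) G (\<lambda>g. f ` B g)"
proof -
  have sub: "B g \<subseteq> A" if "g \<in> {1..G}" for g using sp that by (auto simp: equal_split_def)
  have "disjoint_family_on (\<lambda>g. f ` B g) {1..G}"
    unfolding disjoint_family_on_def
  proof (intro ballI impI)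
    fix g g' assume g: "g \<in> {1..G}" "g' \<in> {1..G}" "g \<noteq> g'"
    have "B g \<inter> B g' = {}" using sp g by (auto simp: equal_split_def disjoint_family_on_def)
    moreover have "f ` B g \<inter> f ` B g' = f ` (B g \<inter> B g')"
      using inj_on_image_Int[OF inj sub[OF g(1)] sub[OF g(2)]] by simp
    ultimately show "f ` B g \<inter> f ` B g' = {}" by simp
  qed
  moreover have "card (f ` B g) = card (B g)" if "g \<in> {1..G}" for g
    by (rule card_image[OF inj_on_subset[OF inj sub[OF that]]])
  moreover have "card (f ` A) = card A" by (rule card_image[OF inj])
  moreover have "(\<Union>g\<in>{1..G}. f ` B g) = f ` A" using sp by (auto simp: equal_split_def)
  ultimately show ?thesis using sp by (simp add: equal_split_def)
qed

definition odd_block :: "nat \<Rightarrow> nat \<Rightarrow> nat set" where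
  "odd_block N g = (\<lambda>i. 2 * i - 1) ` rsm_block N g"

lemma equal_split_odds:
  assumes t: "even t" and G: "G \<ge> 1" "N \<ge> 1" "G * N = t div 2"
  shows "equal_split (odds t) G (odd_block N)"
proof -
  have "inj_on (\<lambda>i. 2 * i - 1 :: nat) {1..G * N}" by (auto simp: inj_on_def)
  from equal_split_image[OF equal_split_blocks[OF G(1,2)] this] show ?thesis
    unfolding odds_evens(3)[OF t] odd_block_def G(3) .
qed

lemma (in noise_array) groups_of_split:
  assumes sp: "equal_split A G B" and A: "A \<subseteq> {1..h}" "card A = G * N" "N \<ge> 1"
  shows "groups G B N"
proof -
  have G: "G \<ge> 1" by (rule equal_splitD(1)[OF sp])
  have "card (B g) = N" if "g \<in> {1..G}" for g
    using sp that A G by (auto simp: equal_split_def)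
  thus ?thesis using sp A equal_splitD(3)[OF sp] G by (auto simp: groups_def equal_split_def)
qed

subsection \<open>Measurability\<close>

lemma measurable_Zst:
  assumes "j \<in> {1..p}" "i \<in> {1..n div 2}"
  shows "(\<lambda>X. Zst n X i j) \<in> borel_measurable (mat_space p n)"
  unfolding Zst_def mat_space_def using assms
  by (intro borel_measurable_divide borel_measurable_diff borel_measurable_const measurable_component_singleton)
    (auto simp: entries_def)

lemma measurable_group_mean:
  assumes "j \<in> {1..p}" "B \<subseteq> {1..n div 2}"
  shows "(\<lambda>X. group_mean n X B j) \<in> borel_measurable (mat_space p n)"
  unfolding group_mean_def using assms
  by (intro borel_measurable_divide borel_measurable_sum borel_measurable_const measurable_Zst) auto

lemma measurable_A_dense:
  assumes sp: "equal_split {1..t} G B" and t: "2 * t \<le> n"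
  shows "A_dense p n G B t \<in> borel_measurable (mat_space p n)"
  unfolding A_dense_def[abs_def]
proof (intro borel_measurable_times borel_measurable_const borel_measurable_median_on borel_measurable_sum
    borel_measurable_diff borel_measurable_power measurable_group_mean)
  have "{1..t} \<subseteq> {1..n div 2}" using t by auto
  thus "B g \<subseteq> {1..n div 2}" if "g \<in> {1..G}" for g using equal_splitD(3)[OF sp that] by (rule subset_trans[rotated])
  show "1 \<le> G" by (rule equal_splitD(1)[OF sp])
qed

lemma measurable_threshold:
  fixes f g :: "'a \<Rightarrow> real"
  assumes [measurable]: "f \<in> borel_measurable M" "g \<in> borel_measurable M"
  shows "(\<lambda>X. f X * of_bool (a \<le> \<bar>g X\<bar>)) \<in> borel_measurable M"
  by measurable

lemma measurable_A_one:
  assumes n: "n \<ge> 2"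
  shows "A_one p n a \<in> borel_measurable (mat_space p n)"
  unfolding A_one_def[abs_def] using n
  by (intro borel_measurable_sum measurable_threshold borel_measurable_diff borel_measurable_power
      borel_measurable_const measurable_Zst) auto

lemma measurable_Y:
  assumes t: "even t" "2 \<le> t" "2 * t \<le> n" and j: "j \<in> {1..p}"
  shows "(\<lambda>X. Y1 n X t j) \<in> borel_measurable (mat_space p n)" "(\<lambda>X. Y2 n X t j) \<in> borel_measurable (mat_space p n)"
  unfolding Y1_eq[OF t(1-3)] Y2_eq[OF t(1-3)] using t j
  by (intro borel_measurable_divide borel_measurable_sum borel_measurable_const measurable_Zst; force simp: odds_def evens_def)+

lemma measurable_A_mom:
  assumes n: "n \<ge> 2" and t: "t = 1 \<or> even t \<and> 2 \<le> t \<and> 2 * t \<le> n \<and> equal_split (odds t) G B"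
  shows "A_mom p n a G B t \<in> borel_measurable (mat_space p n)"
proof (cases "t = 1")
  case True
  hence "A_mom p n a G B t = A_one p n a" by (simp add: A_mom_def[abs_def])
  thus ?thesis using measurable_A_one[OF n] by simp
next
  case False
  hence t': "even t" "2 \<le> t" "2 * t \<le> n" and sp: "equal_split (odds t) G B" using t by auto
  have "A_mom p n a G B t = (\<lambda>X. real t / 2 * median G (\<lambda>g. \<Sum>j = 1..p.
       ((group_mean n X (B g) j)\<^sup>2 - 2 * real G / real t) * of_bool (\<bar>Y2 n X t j\<bar> \<ge> a)))"
    using False by (simp add: A_mom_def[abs_def])
  also have "\<dots> \<in> borel_measurable (mat_space p n)"
  proof (intro borel_measurable_times[OF borel_measurable_const] borel_measurable_median_on borel_measurable_sum measurable_threshold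
      borel_measurable_diff borel_measurable_power measurable_group_mean measurable_Y(2)[OF t'] borel_measurable_const)
    show "B g \<subseteq> {1..n div 2}" if "g \<in> {1..G}" for g
      using equal_splitD(3)[OF sp that] t' by (force simp: odds_def)
    show "1 \<le> G" by (rule equal_splitD(1)[OF sp])
  qed
  finally show ?thesis .
qed

lemma measurable_A_split:
  assumes n: "n \<ge> 2" and t: "t = 1 \<or> even t \<and> 2 \<le> t \<and> 2 * t \<le> n"
  shows "A_split p n a t \<in> borel_measurable (mat_space p n)"
proof (cases "t = 1")
  case True
  hence "A_split p n a t = A_one p n a" by (simp add: A_split_def[abs_def])
  thus ?thesis using measurable_A_one[OF n] by simp
next
  case False
  hence t': "even t" "2 \<le> t" "2 * t \<le> n" using t by auto
  have "A_split p n a t = (\<lambda>X. \<Sum>j = 1..p. ((Y1 n X t j)\<^sup>2 - 1) * of_bool (\<bar>Y2 n X t j\<bar> \<ge> a))"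
    using False by (simp add: A_split_def[abs_def])
  also have "\<dots> \<in> borel_measurable (mat_space p n)"
    by (intro borel_measurable_sum measurable_threshold borel_measurable_diff borel_measurable_power
        borel_measurable_const measurable_Y[OF t']) auto
  finally show ?thesis .
qed

lemma measurable_rsm_stat:
  assumes t: "2 * t \<le> n"
  shows "rsm_stat rsm_estimator p n s \<eta> t \<in> borel_measurable (mat_space p n)"
proof -
  have m: "(\<lambda>X. \<lambda>(j, i)\<in>entries p t. Zst n X i j) \<in> measurable (mat_space p n) (mat_space p t)"
    unfolding mat_space_def[of p t]
  proof (rule measurable_restrict)
    fix e assume "e \<in> entries p t"
    thus "(\<lambda>X. case e of (j, i) \<Rightarrow> Zst n X i j) \<in> borel_measurable (mat_space p n)"
      using t by (cases e) (auto simp: entries_def intro!: measurable_Zst)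
  qed
  have "(\<lambda>x. x j) \<in> borel_measurable (vec_space p)" if "j \<in> {1..p}" for j
    unfolding vec_space_def by (rule measurable_component_singleton[OF that])
  from measurable_compose[OF measurable_compose[OF m measurable_rsm_estimator] this]
  show ?thesis
    unfolding rsm_stat_def[abs_def] sqnorm_def
    by (intro borel_measurable_times borel_measurable_const borel_measurable_sum borel_measurable_power)
qed

subsection \<open>The noise of the symmetrized array\<close>

definition sym_noise :: "nat \<Rightarrow> nat \<times> nat \<Rightarrow> mat \<Rightarrow> real" where
  "sym_noise n e E = (E e - E (fst e, n - snd e + 1)) / sqrt 2"

text \<open>From \<open>|x - y| powr \<alpha> \<le> 2 powr \<alpha> * (|x| powr \<alpha> + |y| powr
  \<alpha>)\<close> with both moments at most \<open>K powr \<alpha>\<close>; the maximum with one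
  serves the assumption \<open>H \<ge> 1\<close> of \<open>noise_array\<close>.\<close>

definition sym_moment :: "real \<Rightarrow> real \<Rightarrow> real" where
  "sym_moment \<alpha> K = max 1 (2 * 2 powr \<alpha> * K powr \<alpha>)"

text \<open>For columns \<open>i \<le> n / 2\<close> the pairs of \<open>i\<close> and
  \<open>n - i + 1\<close> are disjoint, so independence passes to the differences, and division by
  \<open>sqrt 2\<close> restores unit variance.\<close>

lemma noise_array_sym_noise:
  assumes P: "P \<in> noise_laws \<alpha> K p n" and \<alpha>: "\<alpha> \<ge> 4" and K: "K > 0"
  shows "noise_array P (sym_noise n) p (n div 2) \<alpha> (sym_moment \<alpha> K)"
proof -
  interpret prob_space P using P by (simp add: noise_laws_def)
  have ind: "indep_vars (\<lambda>_. borel) (\<lambda>i E. E i) (entries p n)" using P by (simp add: noise_laws_def)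
  have rvE: "random_variable borel (\<lambda>E. E i)" if "i \<in> entries p n" for i using ind that by (simp add: indep_vars_def)
  have mom: "integrable P (\<lambda>E. E i)" "expectation (\<lambda>E. E i) = 0" "integrable P (\<lambda>E. (E i)\<^sup>2)" "expectation (\<lambda>E. (E i)\<^sup>2) = 1"
    "integrable P (\<lambda>E. \<bar>E i\<bar> powr \<alpha>)" "expectation (\<lambda>E. \<bar>E i\<bar> powr \<alpha>) \<le> K powr \<alpha>" if i: "i \<in> entries p n" for i
  proof -
    have D: "distr P borel (\<lambda>E. E i) \<in> noise_dist \<alpha> K" using P i by (simp add: noise_laws_def)
    note rv = rvE[OF i]
    have b: "has_bochner_integral (distr P borel (\<lambda>E. E i)) (\<lambda>w. w) 0" "has_bochner_integral (distr P borel (\<lambda>E. E i)) (\<lambda>w. w\<^sup>2) 1"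
      "integrable (distr P borel (\<lambda>E. E i)) (\<lambda>w. \<bar>w / K\<bar> powr \<alpha>)" "(\<integral>w. \<bar>w / K\<bar> powr \<alpha> \<partial>distr P borel (\<lambda>E. E i)) \<le> 1"
      using D by (auto simp: noise_dist_def)
    show "integrable P (\<lambda>E. E i)" "expectation (\<lambda>E. E i) = 0"
      using b(1) rv by (auto simp: has_bochner_integral_iff integrable_distr_eq integral_distr)
    show "integrable P (\<lambda>E. (E i)\<^sup>2)" "expectation (\<lambda>E. (E i)\<^sup>2) = 1"
      using b(2) rv by (auto simp: has_bochner_integral_iff integrable_distr_eq integral_distr)
    have c: "integrable P (\<lambda>E. \<bar>E i / K\<bar> powr \<alpha>)" "expectation (\<lambda>E. \<bar>E i / K\<bar> powr \<alpha>) \<le> 1"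
      using b(3,4) rv by (simp_all add: integrable_distr_eq integral_distr)
    have eq: "\<bar>x\<bar> powr \<alpha> = K powr \<alpha> * \<bar>x / K\<bar> powr \<alpha>" for x
      using K by (simp add: powr_mult[symmetric] abs_divide)
    show "integrable P (\<lambda>E. \<bar>E i\<bar> powr \<alpha>)" unfolding eq[of "_ i"] using c by simp
    show "expectation (\<lambda>E. \<bar>E i\<bar> powr \<alpha>) \<le> K powr \<alpha>"
      unfolding eq[of "_ i"] using c(2) by (simp add: mult_left_le)
  qed
  show ?thesis
  proof (intro_locales, unfold_locales)
    show "4 \<le> \<alpha>" by (rule \<alpha>)
    show "1 \<le> sym_moment \<alpha> K" by (simp add: sym_moment_def)
    define Kf where "Kf = (\<lambda>e :: nat \<times> nat. {e, (fst e, n - snd e + 1)})"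
    have sub: "Kf e \<subseteq> entries p n" if "e \<in> {1..p} \<times> {1..n div 2}" for e
      using that by (auto simp: Kf_def entries_def)
    have disj: "disjoint_family_on Kf ({1..p} \<times> {1..n div 2})"
      unfolding disjoint_family_on_def Kf_def by auto
    have "indep_vars (\<lambda>_. borel) (\<lambda>e E. (\<lambda>y. (y e - y (fst e, n - snd e + 1)) / sqrt 2) (restrict (\<lambda>i. E i) (Kf e))) ({1..p} \<times> {1..n div 2})"
    proof (rule indep_vars_compose2[OF indep_vars_restrict[OF ind sub disj]])
      show "(\<lambda>y. (y e - y (fst e, n - snd e + 1)) / sqrt 2) \<in> borel_measurable (PiM (Kf e) (\<lambda>_. borel))" for e
        by (intro borel_measurable_divide borel_measurable_diff borel_measurable_const measurable_component_singleton) (auto simp: Kf_def)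
    qed
    thus "indep_vars (\<lambda>_. borel) (sym_noise n) ({1..p} \<times> {1..n div 2})"
      by (simp add: Kf_def sym_noise_def[abs_def])
    fix e assume "e \<in> {1..p} \<times> {1..n div 2}"
    then obtain j i where e: "e = (j, i)" and ji: "j \<in> {1..p}" "i \<in> {1..n div 2}" by auto
    define e' where "e' = (j, n - i + 1)"
    have en: "e \<in> entries p n" "e' \<in> entries p n" and ne: "e \<noteq> e'" using ji by (auto simp: e e'_def entries_def)
    note m1 = mom[OF en(1)] and m2 = mom[OF en(2)]
    note [measurable] = rvE[OF en(1)] rvE[OF en(2)]
    have sn: "sym_noise n e = (\<lambda>E. (E e - E e') / sqrt 2)" by (simp add: sym_noise_def[abs_def] e e'_def)
    have "indep_vars (\<lambda>_. borel) (\<lambda>i E. E i) (insert e {e'})" using en by (intro indep_vars_subset[OF ind]) auto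
    hence "indep_var borel (\<lambda>E. E e) borel (\<lambda>E. \<Sum>i\<in>{e'}. E i)" using ne by (intro indep_vars_sum) auto
    hence iv: "indep_var borel (\<lambda>E. E e) borel (\<lambda>E. E e')" by simp
    have prod: "integrable P (\<lambda>E. E e * E e')" "expectation (\<lambda>E. E e * E e') = 0"
      using indep_var_integrable[OF iv] indep_var_lebesgue_integral[OF iv] m1 m2 by auto
    have sq: "((x - y) / sqrt 2)\<^sup>2 = (x\<^sup>2 - 2 * (x * y) + y\<^sup>2) / 2" for x y :: real
      by (simp add: power_divide power2_diff)
    have le: "\<bar>(x - y) / sqrt 2\<bar> powr \<alpha> \<le> 2 powr \<alpha> * (\<bar>x\<bar> powr \<alpha> + \<bar>y\<bar> powr \<alpha>)" for x y :: real
    proof -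
      have "\<bar>x - y\<bar> * 1 \<le> \<bar>x - y\<bar> * sqrt 2" by (intro mult_left_mono) auto
      hence "\<bar>(x - y) / sqrt 2\<bar> \<le> \<bar>x - y\<bar>" by (simp add: abs_divide divide_le_eq)
      also have "\<dots> \<le> 2 * max \<bar>x\<bar> \<bar>y\<bar>" by (simp add: abs_if max_def)
      finally have "\<bar>(x - y) / sqrt 2\<bar> powr \<alpha> \<le> (2 * max \<bar>x\<bar> \<bar>y\<bar>) powr \<alpha>" using \<alpha> by (intro powr_mono2) auto
      also have "\<dots> = 2 powr \<alpha> * (max \<bar>x\<bar> \<bar>y\<bar>) powr \<alpha>" by (simp add: powr_mult)
      also have "(max \<bar>x\<bar> \<bar>y\<bar>) powr \<alpha> \<le> \<bar>x\<bar> powr \<alpha> + \<bar>y\<bar> powr \<alpha>" by (simp add: max_def)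
      finally show ?thesis by simp
    qed
    have intb: "integrable P (\<lambda>E. 2 powr \<alpha> * (\<bar>E e\<bar> powr \<alpha> + \<bar>E e'\<bar> powr \<alpha>))" using m1 m2 by simp
    have int: "integrable P (\<lambda>E. \<bar>(E e - E e') / sqrt 2\<bar> powr \<alpha>)"
      by (rule Bochner_Integration.integrable_bound[OF intb]) (use order_trans[OF le abs_ge_self] in auto)
    have "expectation (\<lambda>E. \<bar>(E e - E e') / sqrt 2\<bar> powr \<alpha>) \<le> expectation (\<lambda>E. 2 powr \<alpha> * (\<bar>E e\<bar> powr \<alpha> + \<bar>E e'\<bar> powr \<alpha>))"
      by (rule integral_mono[OF int intb le])
    also have "\<dots> = 2 powr \<alpha> * (expectation (\<lambda>E. \<bar>E e\<bar> powr \<alpha>) + expectation (\<lambda>E. \<bar>E e'\<bar> powr \<alpha>))" using m1 m2 by simp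
    also have "\<dots> \<le> 2 powr \<alpha> * (K powr \<alpha> + K powr \<alpha>)" using m1 m2 by (intro mult_left_mono add_mono) auto
    also have "\<dots> \<le> sym_moment \<alpha> K" by (simp add: sym_moment_def)
    finally have "expectation (\<lambda>E. \<bar>(E e - E e') / sqrt 2\<bar> powr \<alpha>) \<le> sym_moment \<alpha> K" .
    thus "std_noise \<alpha> (sym_moment \<alpha> K) (sym_noise n e)"
      unfolding std_noise_def sn sq has_bochner_integral_iff using int prod m1 m2 by simp
  qed
qed

section \<open>The dense component\<close>

locale dense_array = noise_array M \<xi> p h \<alpha> H + const_params \<alpha> H \<epsilon>
  for M :: "'a measure" and \<xi> :: "nat \<times> nat \<Rightarrow> 'a \<Rightarrow> real" and p h :: nat and \<alpha> H \<epsilon> :: real +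
  fixes L :: real and G0 :: nat
  assumes L: "L \<ge> 1" and G0: "L + 64 / \<epsilon> \<le> real G0" and p1: "p \<ge> 1"
begin

text \<open>One threshold for both regimes: its square divided by \<open>G0^2\<close> is
  \<open>64 * kV * p\<close>, the requirement of \<open>mom_upper\<close>, and without the division
  it makes a single group fail with probability \<open>1 / (64 * G0^2)\<close>, small enough for the
  at most \<open>G0\<close> scales below \<open>G0\<close>.\<close>

definition RD where "RD = 8 * sqrt (kV * real p) * real G0"

lemma V_eq: "V = kV"
  by (simp add: V_def kV_def)

lemma G0_pos: "real G0 \<ge> 64" "real G0 > 0" "1 / real G0 \<le> \<epsilon> / 64"
proof -
  have e: "64 / \<epsilon> \<ge> 64" using \<epsilon> by (simp add: field_simps)
  thus g: "real G0 \<ge> 64" using G0 L by linarith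
  thus g0: "real G0 > 0" by linarith
  have "64 / \<epsilon> \<le> real G0" using G0 L by linarith
  thus "1 / real G0 \<le> \<epsilon> / 64" using g0 \<epsilon> by (simp add: field_simps)
qed

lemma quarter_power: "(1 / 4) ^ G0 \<le> exp (- L) * (\<epsilon> / 64)" "(1 / 4) ^ G0 \<le> \<epsilon> / 4"
proof -
  have "(1 / 4 :: real) \<le> exp (- 1)" using exp_le by (simp add: exp_minus field_simps)
  hence "(1 / 4 :: real) ^ G0 \<le> exp (- 1) ^ G0" by (intro power_mono) auto
  also have "\<dots> = exp (- real G0)" by (simp add: exp_of_nat_mult[symmetric])
  also have "\<dots> \<le> exp (- L + (- (64 / \<epsilon>)))" using G0 by simp
  also have "\<dots> = exp (- L) * exp (- (64 / \<epsilon>))" by (rule exp_add)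
  also have "\<dots> \<le> exp (- L) * (\<epsilon> / 64)"
    using exp_minus_le_inverse[of "64 / \<epsilon>"] \<epsilon> by (intro mult_left_mono) auto
  finally show 1: "(1 / 4) ^ G0 \<le> exp (- L) * (\<epsilon> / 64)" .
  also have "\<dots> \<le> 1 * (\<epsilon> / 64)" using L \<epsilon> by (intro mult_right_mono) auto
  finally show "(1 / 4) ^ G0 \<le> \<epsilon> / 4" using \<epsilon> by simp
qed

lemma RD_pos: "RD > 0"
  using basic p1 G0_pos by (simp add: RD_def)

lemma RD_sq: "RD\<^sup>2 = 64 * (kV * real p) * (real G0)\<^sup>2"
  using basic by (simp add: RD_def power_mult_distrib)

lemma dense_null_one:
  assumes gr: "groups 1 B N" and d: "\<And>j. j \<in> {1..p} \<Longrightarrow> d j = 0"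
  shows "prob {\<omega> \<in> space M. RD < mom 1 B {1..p} (Z d \<omega>)} \<le> 1 / (64 * (real G0)\<^sup>2)"
proof -
  have m: "mom 1 B S z = qform S (B 1) z" for S z by (simp add: mom_one)
  have "prob {\<omega> \<in> space M. RD < qform {1..p} (B 1) (Z d \<omega>)} \<le> V * real (card {1..p}) / RD\<^sup>2"
    by (rule qform_upper[OF groupsD(1,2)[OF gr]]) (use RD_pos d in auto)
  also have "\<dots> = 1 / (64 * (real G0)\<^sup>2)"
    unfolding RD_sq using basic p1 by (simp add: V_eq)
  finally show ?thesis unfolding m .
qed

lemma dense_null_many:
  assumes gr: "groups G0 B N" and d: "\<And>j. j \<in> {1..p} \<Longrightarrow> d j = 0"
  shows "prob {\<omega> \<in> space M. RD / real G0 < mom G0 B {1..p} (Z d \<omega>)} \<le> exp (- L) * (\<epsilon> / 64)"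
proof -
  have q: "RD / real G0 = 8 * sqrt (kV * real p)" using G0_pos by (simp add: RD_def)
  have "prob {\<omega> \<in> space M. RD / real G0 < mom G0 B {1..p} (Z d \<omega>)} \<le> (1 / 4) ^ G0"
  proof (rule mom_upper[OF gr order_refl _ d])
    show "0 < RD / real G0" using RD_pos G0_pos by simp
    show "64 * V * real (card {1..p}) \<le> (RD / real G0)\<^sup>2"
      unfolding q using basic by (simp add: V_eq power_mult_distrib)
  qed
  thus ?thesis using quarter_power(1) by linarith
qed

text \<open>A separation of order \<open>sqrt p * G0\<close> serves both regimes. A single group has
  mean \<open>G0\<close> times the noise level, so Chebyshev's inequality leaves
  \<open>1 / (64 * G0)\<close>; with \<open>G0\<close> groups each still has a mean of order
  \<open>sqrt p\<close>, and the median does the rest.\<close>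

lemma dense_alt:
  assumes gr: "groups G B N" and G: "G = 1 \<or> G = G0"
    and D: "512 * kV * sqrt (real p) * real G0 \<le> real G * real N * (\<Sum>j=1..p. (d j)\<^sup>2)"
  shows "prob {\<omega> \<in> space M. mom G B {1..p} (Z d \<omega>) \<le> RD / real G} \<le> \<epsilon> / 4"
proof -
  have G1: "real G > 0" using gr by (simp add: groups_def)
  define m where "m = real N * (\<Sum>j=1..p. (d j)\<^sup>2)"
  have V1: "V \<ge> 1" using basic by (simp add: V_eq)
  have sp: "sqrt (real p) \<ge> 1" using p1 by simp
  have sp2: "sqrt (real p) * sqrt (real p) = real p" by simp
  have mG: "512 * V * sqrt (real p) * real G0 \<le> m * real G" using D by (simp add: m_def V_eq mult_ac)
  have pos: "512 * V * sqrt (real p) * real G0 > 0" using V1 sp G0_pos by simp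
  have mpos: "m > 0"
  proof -
    have "0 < m * real G" using pos mG by linarith
    thus ?thesis using G1 by (simp add: zero_less_mult_iff)
  qed
  have half: "RD / real G \<le> m / 2"
  proof -
    have "sqrt V \<le> V" using V1 by (intro real_le_lsqrt) (auto simp: power2_eq_square)
    hence "16 * (sqrt V * (sqrt (real p) * real G0)) \<le> 512 * (V * (sqrt (real p) * real G0))"
      using G0_pos V1 sp by (intro mult_mono mult_right_mono) auto
    hence "2 * RD \<le> m * real G" using mG by (simp add: RD_def V_eq real_sqrt_mult mult_ac)
    thus ?thesis using G1 by (simp add: field_simps)
  qed
  have "prob {\<omega> \<in> space M. mom G B {1..p} (Z d \<omega>) \<le> m / 2} \<le> \<epsilon> / 4"
    using G
  proof
    assume g: "G = 1"
    have m': "mom G B S z = qform S (B 1) z" for S z using g by (simp add: mom_one)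
    have gr1: "groups 1 B N" using gr g by simp
    have "prob {\<omega> \<in> space M. qform {1..p} (B 1) (Z d \<omega>) \<le> m / 2} \<le> 4 * V * (m + real (card {1..p})) / m\<^sup>2"
      by (rule qform_lower[OF groupsD(1,2)[OF gr1]]) (use groupsD(3)[OF gr1] mpos in \<open>auto simp: m_def\<close>)
    also have "\<dots> = 4 * V * ((m + real p) / m\<^sup>2)" by simp
    also have "\<dots> \<le> 4 * V * ((512 * V * sqrt (real p) * real G0 + real p) / (512 * V * sqrt (real p) * real G0)\<^sup>2)"
      using ratio_antimono[OF pos, of m "real p"] mG g V1 by (intro mult_left_mono) auto
    also have "\<dots> \<le> 4 * V * (1 / (256 * V * real G0))"
    proof (intro mult_left_mono)
      define y where "y = 512 * V * sqrt (real p) * real G0"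
      have y: "y > 0" using pos by (simp add: y_def)
      have a1: "1 / y \<le> 1 / (512 * V * real G0)"
      proof (rule frac_le)
        have "512 * V * real G0 * 1 \<le> 512 * V * real G0 * sqrt (real p)" using sp V1 by (intro mult_left_mono) auto
        thus "512 * V * real G0 \<le> y" by (simp add: y_def mult_ac)
      qed (use V1 G0_pos in auto)
      have "real p / y\<^sup>2 = 1 / (512 * V * real G0) / (512 * V * real G0)"
        using V1 p1 G0_pos by (simp add: y_def power_mult_distrib power2_eq_square[of V] power2_eq_square[of "real G0"])
      also have "\<dots> \<le> 1 / (512 * V * real G0) / 1"
      proof (rule divide_left_mono)
        have "512 * 1 * 1 \<le> 512 * V * real G0" using V1 G0_pos by (intro mult_mono) auto
        thus "1 \<le> 512 * V * real G0" by simp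
      qed (use V1 G0_pos in auto)
      finally have a2: "real p / y\<^sup>2 \<le> 1 / (512 * V * real G0)" by simp
      have "(y + real p) / y\<^sup>2 = 1 / y + real p / y\<^sup>2" using y by (simp add: add_divide_distrib power2_eq_square)
      also have "\<dots> \<le> 1 / (512 * V * real G0) + 1 / (512 * V * real G0)" using a1 a2 by linarith
      also have "\<dots> = 1 / (256 * V * real G0)" by simp
      finally show "(512 * V * sqrt (real p) * real G0 + real p) / (512 * V * sqrt (real p) * real G0)\<^sup>2 \<le> 1 / (256 * V * real G0)"
        by (simp add: y_def)
    qed (use V1 in auto)
    also have "\<dots> = 1 / real G0 / 64" using V1 by simp
    also have "\<dots> \<le> \<epsilon> / 64 / 64" by (rule divide_right_mono[OF G0_pos(3)]) simp
    also have "\<dots> \<le> \<epsilon> / 4" using \<epsilon> by simp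
    finally show ?thesis unfolding m' .
  next
    assume g: "G = G0"
    have "512 * V * sqrt (real p) \<le> m" using mG g G0_pos by simp
    hence m1: "512 * V * sqrt (real p) \<le> m" .
    have "256 * V * (m + real (card {1..p})) \<le> m\<^sup>2"
    proof -
      have "512 * V * 1 \<le> 512 * V * sqrt (real p)" using sp V1 by (intro mult_left_mono) auto
      hence "512 * V \<le> m" using m1 by linarith
      hence a1: "512 * V * m \<le> m * m" using mpos by (intro mult_right_mono) auto
      have "(512 * V * sqrt (real p)) * (512 * V * sqrt (real p)) \<le> m * m" using m1 V1 mpos by (intro mult_mono) auto
      moreover have "(512 * V * sqrt (real p)) * (512 * V * sqrt (real p)) = 262144 * (V * V * (sqrt (real p) * sqrt (real p)))"
        by simp
      ultimately have a2: "262144 * (V * V * real p) \<le> m * m" unfolding sp2 by linarith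
      have "V * 1 * real p \<le> V * V * real p" using V1 by (intro mult_right_mono mult_left_mono) auto
      moreover have "0 \<le> V * V * real p" by simp
      ultimately have a3: "512 * (V * real p) \<le> m * m" using a2 by linarith
      have "256 * V * (m + real (card {1..p})) = (512 * V * m + 512 * (V * real p)) / 2" by (simp add: algebra_simps)
      also have "\<dots> \<le> m\<^sup>2" using a1 a3 by (simp add: power2_eq_square)
      finally show ?thesis .
    qed
    from mom_lower[OF gr order_refl m_def mpos this] show ?thesis using quarter_power(2) g by simp
  qed
  moreover have "prob {\<omega> \<in> space M. mom G B {1..p} (Z d \<omega>) \<le> RD / real G} \<le> prob {\<omega> \<in> space M. mom G B {1..p} (Z d \<omega>) \<le> m / 2}"
  proof (rule finite_measure_mono)
    show "{\<omega> \<in> space M. mom G B {1..p} (Z d \<omega>) \<le> RD / real G} \<subseteq> {\<omega> \<in> space M. mom G B {1..p} (Z d \<omega>) \<le> m / 2}"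
      using order_trans[OF _ half] by blast
    show "{\<omega> \<in> space M. mom G B {1..p} (Z d \<omega>) \<le> m / 2} \<in> events" by (rule mom_event[OF gr order_refl])
  qed
  ultimately show ?thesis by linarith
qed

end

section \<open>From the array to the data\<close>

definition shifted :: "nat \<Rightarrow> nat \<Rightarrow> mat \<Rightarrow> mat \<Rightarrow> mat" where
  "shifted p n \<theta> E = (\<lambda>i\<in>entries p n. \<theta> i + E i)"

text \<open>The only information about \<open>\<theta>\<close> that reaches the statistics at scale
  \<open>t\<close>: the symmetrized mean is the same vector \<open>d\<close> in the first
  \<open>t\<close> columns.\<close>

definition signal :: "nat \<Rightarrow> nat \<Rightarrow> mat \<Rightarrow> nat \<Rightarrow> (nat \<Rightarrow> real) \<Rightarrow> bool" where
  "signal p n \<theta> t d \<longleftrightarrow> (\<forall>i\<in>{1..t}. \<forall>j\<in>{1..p}. (\<theta> (j, i) - \<theta> (j, n - i + 1)) / sqrt 2 = d j)"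

lemma measurable_shifted:
  assumes "sets P = sets (mat_space p n)"
  shows "shifted p n \<theta> \<in> measurable P (mat_space p n)"
proof -
  have "shifted p n \<theta> \<in> measurable (mat_space p n) (mat_space p n)"
    unfolding shifted_def[abs_def] mat_space_def
    by (intro measurable_restrict borel_measurable_add borel_measurable_const measurable_component_singleton)
  thus ?thesis using measurable_cong_sets[OF assms refl] by blast
qed

lemma event_shifted:
  assumes P: "P \<in> noise_laws \<alpha> K p n" and R: "{X \<in> space (mat_space p n). R X} \<in> sets (mat_space p n)"
  shows "{E \<in> space P. R (shifted p n \<theta> E)} \<in> sets P"
proof -
  have m: "shifted p n \<theta> \<in> measurable P (mat_space p n)"
    by (rule measurable_shifted) (use P in \<open>simp add: noise_laws_def\<close>)
  have "shifted p n \<theta> -` {X \<in> space (mat_space p n). R X} \<inter> space P \<in> sets P"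
    by (rule measurable_sets[OF m R])
  also have "shifted p n \<theta> -` {X \<in> space (mat_space p n). R X} \<inter> space P = {E \<in> space P. R (shifted p n \<theta> E)}"
    using measurable_space[OF m] by auto
  finally show ?thesis .
qed

lemma Theta0_signal: "\<theta> \<in> Theta0 p n \<Longrightarrow> t \<le> n div 2 \<Longrightarrow> signal p n \<theta> t (\<lambda>_. 0)"
  by (force simp: Theta0_def signal_def)

lemma Zst_shifted:
  assumes sg: "signal p n \<theta> t d" and t: "2 * t \<le> n" and ij: "i \<in> {1..t}" "j \<in> {1..p}"
  shows "Zst n (shifted p n \<theta> E) i j = d j + (E (j, i) - E (j, n - i + 1)) / sqrt 2"
proof -
  have "(j, i) \<in> entries p n" "(j, n - i + 1) \<in> entries p n" using ij t by (auto simp: entries_def)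
  hence "Zst n (shifted p n \<theta> E) i j = ((\<theta> (j, i) - \<theta> (j, n - i + 1)) + (E (j, i) - E (j, n - i + 1))) / sqrt 2"
    by (simp add: Zst_def shifted_def)
  also have "\<dots> = (\<theta> (j, i) - \<theta> (j, n - i + 1)) / sqrt 2 + (E (j, i) - E (j, n - i + 1)) / sqrt 2"
    by (rule add_divide_distrib)
  finally show ?thesis using sg ij by (simp add: signal_def)
qed

locale sym_array = noise_array P "sym_noise n" p "n div 2" \<alpha> H for P n p \<alpha> H
begin

lemma Zst_eq_Z:
  assumes "signal p n \<theta> t d" "2 * t \<le> n" "i \<in> {1..t}" "j \<in> {1..p}"
  shows "Zst n (shifted p n \<theta> E) i j = Z d E i j"
  unfolding Zst_shifted[OF assms] by (simp add: Z_def sym_noise_def)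

lemma A1_shifted:
  assumes sg: "signal p n \<theta> 1 d" and n: "2 \<le> n"
  shows "A_one p n a (shifted p n \<theta> E) = A1 p a (Z d E)"
  unfolding A_one_eq A1_def using Zst_eq_Z[OF sg] n by (intro sum.cong refl) simp

lemma zsel_shifted:
  assumes sg: "signal p n \<theta> t d" and t: "2 * t \<le> n"
  shows "zsel p (evens t) a (Zst n (shifted p n \<theta> E)) = sel (evens t) a d E"
  unfolding sel_eq_zsel using Zst_eq_Z[OF sg t] by (intro zsel_cong) (auto simp: evens_def)

lemma A_mom_shifted:
  assumes sp: "equal_split (odds t) G B" and t: "even t" "2 \<le> t" "2 * t \<le> n" and sg: "signal p n \<theta> t d"
  shows "A_mom p n a G B t (shifted p n \<theta> E) = real G * mom G B (sel (evens t) a d E) (Z d E)"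
proof -
  have "median G (\<lambda>g. qform (sel (evens t) a d E) (B g) (Zst n (shifted p n \<theta> E))) = mom G B (sel (evens t) a d E) (Z d E)"
    unfolding mom_def
  proof (intro median_cong qform_cong Zst_eq_Z[OF sg t(3)])
    fix g i assume "g \<in> {1..G}" "i \<in> B g"
    thus "i \<in> {1..t}" using equal_splitD(3)[OF sp] by (fastforce simp: odds_def)
  next
    fix g i j assume "j \<in> sel (evens t) a d E"
    thus "j \<in> {1..p}" using sel_subset by blast
  qed
  thus ?thesis unfolding A_mom_eq[OF sp t] zsel_shifted[OF sg t(3)] by simp
qed

lemma A_split_shifted:
  assumes t: "even t" "2 \<le> t" "2 * t \<le> n" and sg: "signal p n \<theta> t d"
  shows "A_split p n a t (shifted p n \<theta> E) = mom 1 (\<lambda>_. odds t) (sel (evens t) a d E) (Z d E)"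
proof -
  have "mom 1 (\<lambda>_. odds t) S z = qform S (odds t) z" for S z by (simp add: mom_one)
  moreover have "qform (sel (evens t) a d E) (odds t) (Zst n (shifted p n \<theta> E)) = qform (sel (evens t) a d E) (odds t) (Z d E)"
  proof (intro qform_cong Zst_eq_Z[OF sg t(3)])
    fix i assume "i \<in> odds t" thus "i \<in> {1..t}" by (simp add: odds_def)
  next
    fix j assume "j \<in> sel (evens t) a d E" thus "j \<in> {1..p}" using sel_subset by blast
  qed
  ultimately show ?thesis unfolding A_split_eq[OF t] zsel_shifted[OF sg t(3)] by simp
qed

lemma A_dense_shifted:
  assumes sp: "equal_split {1..t} G B" and t: "1 \<le> t" "2 * t \<le> n" and sg: "signal p n \<theta> t d"
  shows "A_dense p n G B t (shifted p n \<theta> E) = real G * mom G B {1..p} (Z d E)"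
proof -
  have "median G (\<lambda>g. qform {1..p} (B g) (Zst n (shifted p n \<theta> E))) = mom G B {1..p} (Z d E)"
    unfolding mom_def
  proof (intro median_cong qform_cong Zst_eq_Z[OF sg t(2)])
    fix g i assume "g \<in> {1..G}" "i \<in> B g"
    thus "i \<in> {1..t}" using equal_splitD(3)[OF sp] by blast
  qed
  thus ?thesis unfolding A_dense_eq[OF sp t(1)] by simp
qed

end

lemma (in prob_space) prob_Ex_le:
  assumes S: "finite S" and ev: "\<And>t. t \<in> S \<Longrightarrow> {\<omega> \<in> space M. Q t \<omega>} \<in> events"
    and b: "\<And>t. t \<in> S \<Longrightarrow> prob {\<omega> \<in> space M. Q t \<omega>} \<le> b t"
  shows "prob {\<omega> \<in> space M. \<exists>t\<in>S. Q t \<omega>} \<le> (\<Sum>t\<in>S. b t)"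
proof -
  have "{\<omega> \<in> space M. \<exists>t\<in>S. Q t \<omega>} = (\<Union>t\<in>S. {\<omega> \<in> space M. Q t \<omega>})" by auto
  also have "prob \<dots> \<le> (\<Sum>t\<in>S. prob {\<omega> \<in> space M. Q t \<omega>})"
    using S ev by (intro finite_measure_subadditive_finite) auto
  also have "\<dots> \<le> (\<Sum>t\<in>S. b t)" by (intro sum_mono b)
  finally show ?thesis .
qed

lemma risk_le:
  assumes R: "{X \<in> space (mat_space p n). R X} \<in> sets (mat_space p n)" and e: "e \<ge> 0"
    and null: "\<And>P \<theta>. P \<in> noise_laws \<alpha> K p n \<Longrightarrow> \<theta> \<in> Theta0 p n \<Longrightarrow>
      measure P {E \<in> space P. R (shifted p n \<theta> E)} \<le> e / 2"
    and alt: "\<And>P \<theta>. P \<in> noise_laws \<alpha> K p n \<Longrightarrow> \<theta> \<in> Theta p n s \<rho> \<Longrightarrow>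
      measure P {E \<in> space P. \<not> R (shifted p n \<theta> E)} \<le> e / 2"
  shows "risk \<alpha> K p n s \<rho> (\<lambda>X. of_bool (R X)) \<le> ennreal e"
proof -
  have int: "(\<integral>\<^sup>+ X. ennreal (of_bool (Q X)) \<partial>data_law p n \<theta> P) = ennreal (measure P {E \<in> space P. Q (shifted p n \<theta> E)})"
    if P: "P \<in> noise_laws \<alpha> K p n" and Q: "{X \<in> space (mat_space p n). Q X} \<in> sets (mat_space p n)" for P \<theta> Q
  proof -
    interpret prob_space P using P by (simp add: noise_laws_def)
    have m: "shifted p n \<theta> \<in> measurable P (mat_space p n)"
      by (rule measurable_shifted) (use P in \<open>simp add: noise_laws_def\<close>)
    have "(\<integral>\<^sup>+ X. ennreal (of_bool (Q X)) \<partial>data_law p n \<theta> P)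
        = (\<integral>\<^sup>+ X. indicator {X \<in> space (mat_space p n). Q X} X \<partial>distr P (mat_space p n) (shifted p n \<theta>))"
      unfolding data_law_def shifted_def[abs_def] by (intro nn_integral_cong) auto
    also have "\<dots> = emeasure (distr P (mat_space p n) (shifted p n \<theta>)) {X \<in> space (mat_space p n). Q X}"
      using Q by (intro nn_integral_indicator) simp
    also have "\<dots> = emeasure P (shifted p n \<theta> -` {X \<in> space (mat_space p n). Q X} \<inter> space P)"
      by (rule emeasure_distr[OF m Q])
    also have "shifted p n \<theta> -` {X \<in> space (mat_space p n). Q X} \<inter> space P = {E \<in> space P. Q (shifted p n \<theta> E)}"
      using measurable_space[OF m] by auto
    finally show ?thesis by (simp add: emeasure_eq_measure)
  qed
  have nR: "{X \<in> space (mat_space p n). \<not> R X} \<in> sets (mat_space p n)"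
    using sets.sets_Collect_neg[OF R] .
  have one: "1 - of_bool (R X) = (of_bool (\<not> R X) :: real)" for X by simp
  have "risk \<alpha> K p n s \<rho> (\<lambda>X. of_bool (R X)) \<le> ennreal (e / 2) + ennreal (e / 2)"
    unfolding risk_def one
  proof (intro add_mono SUP_least)
    fix P \<theta> assume P: "P \<in> noise_laws \<alpha> K p n" and \<theta>: "\<theta> \<in> Theta0 p n"
    show "(\<integral>\<^sup>+ X. ennreal (of_bool (R X)) \<partial>data_law p n \<theta> P) \<le> ennreal (e / 2)"
      unfolding int[OF P R] by (rule ennreal_leI[OF null[OF P \<theta>]])
  next
    fix P \<theta> assume P: "P \<in> noise_laws \<alpha> K p n" and \<theta>: "\<theta> \<in> Theta p n s \<rho>"
    show "(\<integral>\<^sup>+ X. ennreal (of_bool (\<not> R X)) \<partial>data_law p n \<theta> P) \<le> ennreal (e / 2)"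
      unfolding int[OF P nR] by (rule ennreal_leI[OF alt[OF P \<theta>]])
  qed
  also have "\<dots> = ennreal e" using e by (simp add: ennreal_plus[symmetric] del: ennreal_plus)
  finally show ?thesis .
qed

section \<open>Existence of the component tests\<close>

text \<open>The reason for the \<open>8\<close> in the rate: \<open>n \<ge> 2\<close> makes the
  inner logarithm at least \<open>ln 16 = 4 * ln 2\<close>, which exceeds
  \<open>exp 1\<close>.\<close>

lemma iterated_log_ge_one:
  assumes "n \<ge> (2 :: nat)"
  shows "1 \<le> ln (ln (8 * real n))"
proof -
  have "272 / 100 \<le> 4 * ln (2 :: real)"
    using ln_approx_bounds[of 2 2, simplified, simplified eval_nat_numeral, simplified] by simp
  also have "4 * ln (2 :: real) = ln (16 :: real)"
  proof -
    have "ln (2 ^ 4 :: real) = real 4 * ln 2" by (rule ln_realpow)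
    thus ?thesis by simp
  qed
  also have "ln (16 :: real) \<le> ln (8 * real n)" using assms by simp
  finally have "exp 1 \<le> ln (8 * real n)" using e_less_272 by linarith
  hence "ln (exp 1) \<le> ln (ln (8 * real n))" by (subst ln_le_cancel_iff) (auto intro: less_le_trans[OF exp_gt_zero])
  thus ?thesis by simp
qed

lemma scales_subset: "scales n \<subseteq> range (\<lambda>k. 2 ^ k)"
  by (auto simp: scales_def)

lemma finite_scales: "n \<ge> 2 \<Longrightarrow> finite (scales n)"
  by (rule finite_subset[of _ "{..n}"]) (auto simp: scales_iff)

lemma card_scales_le:
  assumes n: "n \<ge> 2"
  shows "real (card (scales n)) \<le> 2 * exp (ln (ln (8 * real n)))"
proof -
  have "real (card (scales n)) \<le> log 2 (real n / 2) + 1"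
    by (rule card_powers_of_two_le[OF scales_subset]) (use n in \<open>auto simp: scales_iff\<close>)
  also have "\<dots> = log 2 (real n)" using n by (simp add: log_divide)
  also have "\<dots> \<le> 2 * ln (real n)" using n by (intro log2_le_ln) auto
  also have "ln (real n) \<le> ln (8 * real n)" using n by simp
  also have "ln (8 * real n) = exp (ln (ln (8 * real n)))" using n by simp
  finally show ?thesis by simp
qed

lemma scale_cases:
  assumes n: "n \<ge> 2" and t: "t \<in> scales n"
  obtains "t = 1" | k where "t = 2 ^ Suc k" "even t" "2 \<le> t" "2 * t \<le> n" "t \<noteq> 1"
proof -
  obtain k where k: "t = 2 ^ k" "2 * t \<le> n" using t n by (auto simp: scales_iff)
  show ?thesis
  proof (cases k)
    case 0
    thus ?thesis using k that(1) by simp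
  next
    case (Suc l)
    have "t = 2 * 2 ^ l" using k Suc by simp
    moreover have "(1 :: nat) \<le> 2 ^ l" by simp
    ultimately have "even t" "2 \<le> t" by auto
    thus ?thesis using k Suc that(2)[of l] by auto
  qed
qed

locale setting =
  fixes \<alpha> K \<epsilon> :: real and n p :: nat
  assumes params: "\<alpha> \<ge> 4" "K > 0" "0 < \<epsilon>" "\<epsilon> < 1" "n \<ge> 2" "p \<ge> 1"
begin

abbreviation H where "H \<equiv> sym_moment \<alpha> K"
definition L where "L = ln (ln (8 * real n))"

lemma H1: "H \<ge> 1" by (simp add: sym_moment_def)

sublocale const_params \<alpha> H \<epsilon>
  using params H1 by unfold_locales auto

lemma L1: "L \<ge> 1" using iterated_log_ge_one params by (simp add: L_def)

text \<open>The rejection rule is fixed before the noise law and the mean. The alternative is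
  phrased through one scale with constant symmetrized mean, and allowing \<open>2 * s\<close>
  nonzero entries makes the rule usable for every true sparsity between \<open>s\<close> and
  \<open>2 * s\<close>.\<close>

lemma sparse_test_exists:
  assumes s: "s \<in> {1..p}"
  shows "\<exists>R. (\<lambda>X. of_bool (R X)) \<in> sparse_tests \<alpha> rsm_estimator p n s \<and>
    {X \<in> space (mat_space p n). R X} \<in> sets (mat_space p n) \<and>
    (\<forall>P\<in>noise_laws \<alpha> K p n. \<forall>\<theta>\<in>Theta0 p n. measure P {E \<in> space P. R (shifted p n \<theta> E)} \<le> \<epsilon> / (16 * sqrt (real s))) \<and>
    (\<forall>P\<in>noise_laws \<alpha> K p n. \<forall>\<theta>. \<forall>t\<in>scales n. \<forall>d. signal p n \<theta> t d \<and> norm0 p d \<le> 2 * s \<and>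
      k0 * (real s * (real p / real s) powr (2 / \<alpha>) + L) \<le> real t * (\<Sum>j=1..p. (d j)\<^sup>2) \<longrightarrow>
      measure P {E \<in> space P. \<not> R (shifted p n \<theta> E)} \<le> \<epsilon> / 4)"
proof -
  interpret T: tuning \<alpha> H \<epsilon> L p s using L1 s by unfold_locales auto
  have su: "real s * (real p / real s) powr (2 / \<alpha>) + L = real s * T.u"
    using T.s1 by (simp add: T.u_def distrib_left)
  have n: "n \<ge> 2" using params by simp
  \<comment> \<open>Both constructions reduce to one rule \<open>W t\<close> per scale: null errors
    are summed over all scales, while under the alternative a single informative scale
    suffices.\<close>
  have "\<exists>W. (\<lambda>X. of_bool (\<exists>t\<in>scales n. W t X)) \<in> sparse_tests \<alpha> rsm_estimator p n s \<and>
    (\<forall>t\<in>scales n. {X \<in> space (mat_space p n). W t X} \<in> sets (mat_space p n)) \<and>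
    (\<forall>P\<in>noise_laws \<alpha> K p n. \<forall>\<theta>. \<forall>t\<in>scales n. signal p n \<theta> t (\<lambda>_. 0) \<longrightarrow>
      measure P {E \<in> space P. W t (shifted p n \<theta> E)} \<le> T.pt_bound t) \<and>
    (\<forall>P\<in>noise_laws \<alpha> K p n. \<forall>\<theta>. \<forall>t\<in>scales n. \<forall>d. signal p n \<theta> t d \<and> norm0 p d \<le> 2 * s \<and>
      k0 * (real s * T.u) \<le> real t * (\<Sum>j=1..p. (d j)\<^sup>2) \<longrightarrow>
      measure P {E \<in> space P. \<not> W t (shifted p n \<theta> E)} \<le> \<epsilon> / 4)"
  proof (cases "real p < L powr (\<alpha> - 2)")
    case False
    \<comment> \<open>makes the separation needed by \<open>G0 \<approx> L + sqrt s\<close> groups, of order \<open>G0 * sqrt s\<close>, at most the sparse rate\<close>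
    have Lu: "L \<le> sqrt (real s) * T.u"
    proof -
      have "L powr 1 \<le> L powr ((\<alpha> - 2) * (2 / \<alpha>))"
        using L1 params by (intro powr_mono) (auto simp: field_simps)
      also have "\<dots> = (L powr (\<alpha> - 2)) powr (2 / \<alpha>)" by (simp add: powr_powr)
      also have "\<dots> \<le> real p powr (2 / \<alpha>)" using False params by (intro powr_mono2) auto
      also have "\<dots> = real s powr (2 / \<alpha>) * (real p / real s) powr (2 / \<alpha>)"
        using T.s1 by (simp add: powr_mult[symmetric])
      also have "\<dots> \<le> sqrt (real s) * T.u"
      proof (rule mult_mono)
        have "real s powr (2 / \<alpha>) \<le> real s powr (1 / 2)" using T.s1 params by (intro powr_mono) (auto simp: field_simps)
        thus "real s powr (2 / \<alpha>) \<le> sqrt (real s)" by (simp add: powr_half_sqrt)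
      qed (use T.u_ge in auto)
      finally show ?thesis using L1 by simp
    qed
    have M1: "1 \<le> L + sqrt (real s) + 256 / \<epsilon>"
    proof -
      have "sqrt (real s) \<ge> 0" "256 / \<epsilon> \<ge> 0" using \<epsilon> by auto
      thus ?thesis using L1 by linarith
    qed
    obtain kk where kk: "L + sqrt (real s) + 256 / \<epsilon> \<le> 2 ^ kk" "2 ^ kk \<le> 2 * (L + sqrt (real s) + 256 / \<epsilon>)"
      using power_of_two_between[OF M1] by blast
    \<comment> \<open>A power of two, so that it divides \<open>t div 2\<close> exactly at every
      dyadic scale above \<open>\<Delta>\<close>.\<close>
    define G0 :: nat where "G0 = 2 ^ kk"
    have lG: "T.large_G G0" using kk by (simp add: T.large_G_def G0_def)
    define G where "G = (\<lambda>t. if real t \<le> T.\<Delta> then 1 else G0)"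
    define N where "N = (\<lambda>t. t div 2 div G t)"
    define B where "B = (\<lambda>t. odd_block (N t))"
    have GN: "G t \<ge> 1 \<and> N t \<ge> 1 \<and> G t * N t = t div 2" if t: "t = 2 ^ Suc k" for t k
    proof (cases "real t \<le> T.\<Delta>")
      case True
      have "(1 :: nat) \<le> 2 ^ k" by simp
      thus ?thesis using True t by (simp add: G_def N_def)
    next
      case False
      have "2 * real G0 < real t" using T.large_G_bounds(3)[OF lG] False by linarith
      hence "real (2 * G0) < real t" by simp
      hence "2 * G0 < t" by (simp only: of_nat_less_iff)
      hence "(2 :: nat) ^ kk < 2 ^ k" using t by (simp add: G0_def)
      hence "kk \<le> k" using power_less_imp_less_exp[of 2 kk k] by simp
      hence e: "(2 :: nat) ^ k = 2 ^ kk * 2 ^ (k - kk)" by (simp add: power_add[symmetric])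
      have g: "G t = 2 ^ kk" using False by (simp add: G_def G0_def)
      have th: "t div 2 = 2 ^ kk * 2 ^ (k - kk)" using e by (simp add: t)
      have "N t = t div 2 div 2 ^ kk" by (simp only: N_def g)
      also have "\<dots> = 2 ^ (k - kk)" unfolding th by simp
      finally have "N t = 2 ^ (k - kk)" .
      thus ?thesis unfolding th by (simp add: g)
    qed
    have sp: "equal_split (odds t) (G t) (B t)" if t: "t = 2 ^ Suc k" for t k
      unfolding B_def by (rule equal_split_odds) (use GN[OF t] t in auto)
    define W where "W = (\<lambda>t X. A_mom p n T.a (G t) (B t) t X / T.r > 1)"
    have Wr: "W t X \<longleftrightarrow> T.r < A_mom p n T.a (G t) (B t) t X" for t X
      using T.r_pos by (simp add: W_def)
    have test: "(\<lambda>X. of_bool (\<exists>t\<in>scales n. W t X)) \<in> sparse_tests \<alpha> rsm_estimator p n s"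
    proof -
      have "scan (scales n) (\<lambda>t. A_mom p n T.a (G t) (B t) t) (\<lambda>_. T.r) \<in> mom_tests p n"
        unfolding mom_tests_def
      proof (rule CollectI, rule exI[of _ T.a], rule exI[of _ G], rule exI[of _ B], rule exI[of _ "\<lambda>_. T.r"], intro conjI refl ballI impI)
        fix t assume t: "t \<in> scales n"
        show "0 < T.r" by (rule T.r_pos)
        assume "t \<noteq> 1"
        thus "equal_split {i \<in> {1..t}. odd i} (G t) (B t)"
          using scale_cases[OF n t] sp unfolding odds_def by metis
      qed
      moreover have "scan (scales n) (\<lambda>t. A_mom p n T.a (G t) (B t) t) (\<lambda>_. T.r) = (\<lambda>X. of_bool (\<exists>t\<in>scales n. W t X))"
        by (simp add: scan_def[abs_def] W_def)
      ultimately show ?thesis using False by (simp add: sparse_tests_def L_def)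
    qed
    have meas: "{X \<in> space (mat_space p n). W t X} \<in> sets (mat_space p n)" if t: "t \<in> scales n" for t
    proof -
      have "A_mom p n T.a (G t) (B t) t \<in> borel_measurable (mat_space p n)"
        by (rule measurable_A_mom[OF n]) (use scale_cases[OF n t] sp in metis)
      from borel_measurable_less[OF borel_measurable_const this] show ?thesis by (simp only: Wr)
    qed
    have core: "signal p n \<theta> t d \<Longrightarrow>
        ((\<forall>j\<in>{1..p}. d j = 0) \<longrightarrow> measure P {E \<in> space P. W t (shifted p n \<theta> E)} \<le> T.pt_bound t) \<and>
        (norm0 p d \<le> 2 * s \<and> k0 * (real s * T.u) \<le> real t * (\<Sum>j=1..p. (d j)\<^sup>2) \<longrightarrow>
          measure P {E \<in> space P. \<not> W t (shifted p n \<theta> E)} \<le> \<epsilon> / 4)"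
      if P: "P \<in> noise_laws \<alpha> K p n" and t: "t \<in> scales n" for P \<theta> t d
    proof -
      assume sg: "signal p n \<theta> t d"
      interpret A: noise_array P "sym_noise n" p "n div 2" \<alpha> H
        by (rule noise_array_sym_noise[OF P params(1,2)])
      interpret A: sym_array P n p \<alpha> H ..
      interpret A: tuned_array P "sym_noise n" p "n div 2" \<alpha> H \<epsilon> L s ..
      from n t show ?thesis
      proof (cases rule: scale_cases)
        case 1
        have W1: "W t (shifted p n \<theta> E) \<longleftrightarrow> T.r < A1 p T.a (A.Z d E)" for E
          unfolding Wr using A.A1_shifted[of \<theta> d T.a E] sg n 1 by (simp add: A_mom_def)
        have h1: "1 \<le> n div 2" using n by simp
        show ?thesis
          unfolding W1 not_less using A.null_first[OF h1] A.alt_first[OF h1] 1 by simp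
      next
        case (2 k)
        note t' = 2(2-4)
        have th: "t \<le> n div 2" using 2 by simp
        note spt = sp[OF 2(1)]
        have gn: "G t \<ge> 1" "N t \<ge> 1" "G t * N t = t div 2" using GN[OF 2(1)] by auto
        have Gp: "real (G t) > 0" using gn by simp
        have W2: "W t (shifted p n \<theta> E) \<longleftrightarrow> T.r / real (G t) < A.mom (G t) (B t) (A.sel (evens t) T.a d E) (A.Z d E)" for E
          unfolding Wr A.A_mom_shifted[OF spt t' sg] using Gp by (simp add: divide_less_eq mult.commute)
        have co: "card (odds t) = G t * N t" using odds_evens(1)[OF t'(1)] gn by simp
        have gr: "A.groups (G t) (B t) (N t)"
          by (rule A.groups_of_split[OF spt A.half_sets(4)[OF t'(1,2) th] co gn(2)])
        show ?thesis
        proof (cases "real t \<le> T.\<Delta>")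
          case True
          have G1: "G t = 1" using True by (simp add: G_def)
          have "(\<Union>g\<in>{1..1}. B t g) = odds t" using spt unfolding G1 equal_split_def by blast
          hence B1: "B t 1 = odds t" by simp
          have r1: "T.r / real (1 :: nat) = T.r" by simp
          show ?thesis
            unfolding W2 G1 r1 not_less
            using A.null_small[where B = "B t", OF t'(1,2) th True B1] A.alt_small[where B = "B t", OF t'(1,2) th B1] by blast
        next
          case False
          have G2: "G t = G0" using False by (simp add: G_def)
          have Bsub: "B t g \<subseteq> odds t" if "g \<in> {1..G0}" for g
            using equal_splitD(3)[OF spt, unfolded G2, OF that] .
          have rGN: "real G0 * real (N t) = real t / 2"
          proof -
            have "real G0 * real (N t) = real (t div 2)" using gn(3) unfolding G2 by (simp add: of_nat_mult[symmetric] del: of_nat_mult)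
            thus ?thesis using t'(1) by (auto elim!: evenE)
          qed
          have dl: "T.\<Delta> < real t" using False by simp
          show ?thesis
            unfolding W2 G2 not_less
            using A.null_large[OF t'(1,2) th dl lG Lu gr[unfolded G2] Bsub]
              A.alt_large[OF t'(1,2) th lG Lu gr[unfolded G2] rGN Bsub] by blast
        qed
      qed
    qed
    show ?thesis
      by (rule exI[of _ W]) (use test meas core in auto)
  next
    case True
    \<comment> \<open>Up to \<open>\<Delta>\<close> the split statistic is the one-group median over
      the odd columns, so the error bounds for a single group apply again; only larger scales need
      the estimator.\<close>
    define W where "W = (\<lambda>t X. if real t \<le> T.\<Delta> then A_split p n T.a t X / T.r > 1
      else rsm_stat rsm_estimator p n s T.\<eta> t X / T.rT > 1)"
    have W_small: "W t X \<longleftrightarrow> T.r < A_split p n T.a t X" if "real t \<le> T.\<Delta>" for t X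
      using T.r_pos that by (simp add: W_def)
    have W_large: "W t X \<longleftrightarrow> T.rT < rsm_stat rsm_estimator p n s T.\<eta> t X" if "\<not> real t \<le> T.\<Delta>" for t X
      using T.r_pos that by (simp add: W_def)
    have test: "(\<lambda>X. of_bool (\<exists>t\<in>scales n. W t X)) \<in> sparse_tests \<alpha> rsm_estimator p n s"
    proof -
      have "(\<lambda>X. max (scan {t \<in> scales n. real t \<le> T.\<Delta>} (A_split p n T.a) (\<lambda>_. T.r) X)
          (scan {t \<in> scales n. real t > T.\<Delta>} (\<lambda>t. rsm_stat rsm_estimator p n s T.\<eta> t) (\<lambda>_. T.rT) X)) \<in> rsm_tests rsm_estimator p n s"
        unfolding rsm_tests_def
        by (rule CollectI, rule exI[of _ T.\<Delta>], rule exI[of _ T.a], rule exI[of _ "\<lambda>_. T.r"], rule exI[of _ "\<lambda>_. T.\<eta>"],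
            rule exI[of _ "\<lambda>_. T.rT"]) (use T.r_pos T.eta in simp)
      moreover have "(\<lambda>X. max (scan {t \<in> scales n. real t \<le> T.\<Delta>} (A_split p n T.a) (\<lambda>_. T.r) X)
          (scan {t \<in> scales n. real t > T.\<Delta>} (\<lambda>t. rsm_stat rsm_estimator p n s T.\<eta> t) (\<lambda>_. T.rT) X))
          = (\<lambda>X. of_bool (\<exists>t\<in>scales n. W t X))"
      proof
        fix X
        have split: "(\<exists>t\<in>S. if b t then f t else g t) \<longleftrightarrow> (\<exists>t\<in>{t \<in> S. b t}. f t) \<or> (\<exists>t\<in>{t \<in> S. \<not> b t}. g t)"
          for S :: "nat set" and b f g
          unfolding if_bool_eq_disj by blast
        have "(\<exists>t\<in>scales n. W t X) \<longleftrightarrow> (\<exists>t\<in>{t \<in> scales n. real t \<le> T.\<Delta>}. A_split p n T.a t X / T.r > 1)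
            \<or> (\<exists>t\<in>{t \<in> scales n. real t > T.\<Delta>}. rsm_stat rsm_estimator p n s T.\<eta> t X / T.rT > 1)"
          unfolding W_def split not_le ..
        moreover have "max (of_bool A) (of_bool B) = (of_bool (A \<or> B) :: real)" for A B by simp
        ultimately show "max (scan {t \<in> scales n. real t \<le> T.\<Delta>} (A_split p n T.a) (\<lambda>_. T.r) X)
          (scan {t \<in> scales n. real t > T.\<Delta>} (\<lambda>t. rsm_stat rsm_estimator p n s T.\<eta> t) (\<lambda>_. T.rT) X)
          = of_bool (\<exists>t\<in>scales n. W t X)" by (simp only: scan_def)
      qed
      ultimately show ?thesis using True by (simp add: sparse_tests_def L_def)
    qed
    have meas: "{X \<in> space (mat_space p n). W t X} \<in> sets (mat_space p n)" if t: "t \<in> scales n" for t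
    proof (cases "real t \<le> T.\<Delta>")
      case True
      have "A_split p n T.a t \<in> borel_measurable (mat_space p n)"
        by (rule measurable_A_split[OF n]) (use scale_cases[OF n t] in metis)
      from borel_measurable_less[OF borel_measurable_const this] show ?thesis by (simp only: W_small[OF True])
    next
      case False
      have "2 * t \<le> n" using t n by (simp add: scales_iff)
      from borel_measurable_less[OF borel_measurable_const measurable_rsm_stat[OF this]]
      show ?thesis by (simp only: W_large[OF False])
    qed
    have core: "signal p n \<theta> t d \<Longrightarrow>
        ((\<forall>j\<in>{1..p}. d j = 0) \<longrightarrow> measure P {E \<in> space P. W t (shifted p n \<theta> E)} \<le> T.pt_bound t) \<and>
        (norm0 p d \<le> 2 * s \<and> k0 * (real s * T.u) \<le> real t * (\<Sum>j=1..p. (d j)\<^sup>2) \<longrightarrow>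
          measure P {E \<in> space P. \<not> W t (shifted p n \<theta> E)} \<le> \<epsilon> / 4)"
      if P: "P \<in> noise_laws \<alpha> K p n" and t: "t \<in> scales n" for P \<theta> t d
    proof -
      assume sg: "signal p n \<theta> t d"
      interpret A: noise_array P "sym_noise n" p "n div 2" \<alpha> H
        by (rule noise_array_sym_noise[OF P params(1,2)])
      interpret A: sym_array P n p \<alpha> H ..
      interpret A: tuned_array P "sym_noise n" p "n div 2" \<alpha> H \<epsilon> L s ..
      have t2: "2 * t \<le> n" "1 \<le> t" using t n by (auto simp: scales_iff)
      show ?thesis
      proof (cases "real t \<le> T.\<Delta>")
        case True
        note Ws = W_small[OF True]
        from n t show ?thesis
        proof (cases rule: scale_cases)
          case 1
          have W1: "W t (shifted p n \<theta> E) \<longleftrightarrow> T.r < A1 p T.a (A.Z d E)" for E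
            unfolding Ws using A.A1_shifted[of \<theta> d T.a E] sg n 1 by (simp add: A_split_def)
          have h1: "1 \<le> n div 2" using n by simp
          show ?thesis
            unfolding W1 not_less using A.null_first[OF h1] A.alt_first[OF h1] 1 by simp
        next
          case (2 k)
          note t' = 2(2-4)
          have th: "t \<le> n div 2" using 2 by simp
          show ?thesis
            unfolding Ws A.A_split_shifted[OF t' sg] not_less
            using A.null_small[OF t'(1,2) th True, of "\<lambda>_. odds t"] A.alt_small[OF t'(1,2) th, of "\<lambda>_. odds t"] by blast
        qed
      next
        case False
        have "(\<lambda>(j, i)\<in>entries p t. Zst n (shifted p n \<theta> E) i j) = A.sample d t E" for E
          unfolding A.sample_def by (intro restrict_ext) (auto simp: entries_def A.Zst_eq_Z[OF sg t2(1)])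
        hence W3: "W t (shifted p n \<theta> E) \<longleftrightarrow> T.rT < real t * sqnorm p (rsm_estimator p t s T.\<eta> (A.sample d t E))" for E
          unfolding W_large[OF False] rsm_stat_def by simp
        have th: "t \<le> n div 2" "T.\<Delta> < real t" using t2 False by auto
        show ?thesis
          unfolding W3 not_less using A.null_rsm[OF t2(2) th] A.alt_rsm[OF t2(2) th] by blast
      qed
    qed
    show ?thesis
      by (rule exI[of _ W]) (use test meas core in auto)
  qed
  then obtain W where W1: "(\<lambda>X. of_bool (\<exists>t\<in>scales n. W t X)) \<in> sparse_tests \<alpha> rsm_estimator p n s"
    and W2: "\<forall>t\<in>scales n. {X \<in> space (mat_space p n). W t X} \<in> sets (mat_space p n)"
    and W3: "\<forall>P\<in>noise_laws \<alpha> K p n. \<forall>\<theta>. \<forall>t\<in>scales n. signal p n \<theta> t (\<lambda>_. 0) \<longrightarrow>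
      measure P {E \<in> space P. W t (shifted p n \<theta> E)} \<le> T.pt_bound t"
    and W4: "\<forall>P\<in>noise_laws \<alpha> K p n. \<forall>\<theta>. \<forall>t\<in>scales n. \<forall>d. signal p n \<theta> t d \<and> norm0 p d \<le> 2 * s \<and>
      k0 * (real s * T.u) \<le> real t * (\<Sum>j=1..p. (d j)\<^sup>2) \<longrightarrow>
      measure P {E \<in> space P. \<not> W t (shifted p n \<theta> E)} \<le> \<epsilon> / 4"
    by (elim exE conjE) (rule that)
  have fin: "finite (scales n)" by (rule finite_scales[OF n])
  have evW: "{E \<in> space P. W t (shifted p n \<theta> E)} \<in> sets P" if P: "P \<in> noise_laws \<alpha> K p n" and t: "t \<in> scales n" for P \<theta> t
    by (rule event_shifted[OF P bspec[OF W2 t]])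
  show ?thesis
  proof (rule exI[of _ "\<lambda>X. \<exists>t\<in>scales n. W t X"], intro conjI ballI allI impI)
    show "(\<lambda>X. of_bool (\<exists>t\<in>scales n. W t X)) \<in> sparse_tests \<alpha> rsm_estimator p n s" by (rule W1)
    show "{X \<in> space (mat_space p n). \<exists>t\<in>scales n. W t X} \<in> sets (mat_space p n)"
      by (rule sets.sets_Collect_finite_Ex[OF _ fin]) (use W2 in blast)
  next
    fix P \<theta> assume P: "P \<in> noise_laws \<alpha> K p n" and \<theta>: "\<theta> \<in> Theta0 p n"
    interpret prob_space P using P by (simp add: noise_laws_def)
    have sg: "signal p n \<theta> t (\<lambda>_. 0)" if "t \<in> scales n" for t
      by (rule Theta0_signal[OF \<theta>]) (use that n in \<open>auto simp: scales_iff\<close>)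
    have "prob {E \<in> space P. \<exists>t\<in>scales n. W t (shifted p n \<theta> E)} \<le> (\<Sum>t\<in>scales n. T.pt_bound t)"
      by (rule prob_Ex_le[OF fin evW[OF P] W3[rule_format, OF P _ sg]])
    also have "\<dots> \<le> \<epsilon> / (16 * sqrt (real s))"
      by (rule T.sum_pt_bound[OF fin scales_subset]) (use card_scales_le[OF n] in \<open>simp add: L_def\<close>)
    finally show "prob {E \<in> space P. \<exists>t\<in>scales n. W t (shifted p n \<theta> E)} \<le> \<epsilon> / (16 * sqrt (real s))" .
  next
    fix P \<theta> t d
    assume P: "P \<in> noise_laws \<alpha> K p n" and t: "t \<in> scales n" and *: "signal p n \<theta> t d \<and> norm0 p d \<le> 2 * s \<and>
      k0 * (real s * (real p / real s) powr (2 / \<alpha>) + L) \<le> real t * (\<Sum>j=1..p. (d j)\<^sup>2)"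
    interpret prob_space P using P by (simp add: noise_laws_def)
    have ev: "{E \<in> space P. \<not> W t (shifted p n \<theta> E)} \<in> events" by (rule sets.sets_Collect_neg[OF evW[OF P t]])
    have "prob {E \<in> space P. \<not> (\<exists>t\<in>scales n. W t (shifted p n \<theta> E))} \<le> prob {E \<in> space P. \<not> W t (shifted p n \<theta> E)}"
      by (rule finite_measure_mono[OF _ ev]) (use t in blast)
    also have "\<dots> \<le> \<epsilon> / 4" using W4 P t * unfolding su by blast
    finally show "prob {E \<in> space P. \<not> (\<exists>t\<in>scales n. W t (shifted p n \<theta> E))} \<le> \<epsilon> / 4" .
  qed
qed

lemma dense_test_exists:
  "\<exists>R. (\<lambda>X. of_bool (R X)) \<in> dense_tests p n \<and>
    {X \<in> space (mat_space p n). R X} \<in> sets (mat_space p n) \<and>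
    (\<forall>P\<in>noise_laws \<alpha> K p n. \<forall>\<theta>\<in>Theta0 p n. measure P {E \<in> space P. R (shifted p n \<theta> E)} \<le> \<epsilon> / 4) \<and>
    (\<forall>P\<in>noise_laws \<alpha> K p n. \<forall>\<theta>. \<forall>t\<in>scales n. \<forall>d. signal p n \<theta> t d \<and>
      1024 * kV * (1 + 64 / \<epsilon>) * (sqrt (real p) * L) \<le> real t * (\<Sum>j=1..p. (d j)\<^sup>2) \<longrightarrow>
      measure P {E \<in> space P. \<not> R (shifted p n \<theta> E)} \<le> \<epsilon> / 4)"
proof -
  have n: "n \<ge> 2" using params by simp
  have e64: "64 / \<epsilon> \<ge> 0" using \<epsilon> by simp
  have M1: "1 \<le> L + 64 / \<epsilon>" using L1 e64 by linarith
  obtain kk where kk: "L + 64 / \<epsilon> \<le> 2 ^ kk" "2 ^ kk \<le> 2 * (L + 64 / \<epsilon>)"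
    using power_of_two_between[OF M1] by blast
  define G0 :: nat where "G0 = 2 ^ kk"
  have G0r: "real G0 = 2 ^ kk" by (simp add: G0_def)
  have G0_le: "real G0 \<le> 2 * (L * (1 + 64 / \<epsilon>))"
  proof -
    have "1 * (64 / \<epsilon>) \<le> L * (64 / \<epsilon>)" using L1 e64 by (intro mult_right_mono) auto
    hence "L + 64 / \<epsilon> \<le> L * (1 + 64 / \<epsilon>)" by (simp add: distrib_left)
    hence "2 * (L + 64 / \<epsilon>) \<le> 2 * (L * (1 + 64 / \<epsilon>))" by (rule mult_left_mono) simp
    with kk(2) show ?thesis unfolding G0r by (rule order_trans)
  qed
  have G0_ge: "L + 64 / \<epsilon> \<le> real G0" using kk(1) by (simp add: G0r)
  define G where "G = (\<lambda>t. if t < G0 then 1 else G0)"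
  define N where "N = (\<lambda>t. t div G t)"
  define B where "B = (\<lambda>t. rsm_block (N t))"
  have GN: "G t \<ge> 1 \<and> N t \<ge> 1 \<and> G t * N t = t" if t: "t \<in> scales n" for t
  proof -
    obtain k where k: "t = 2 ^ k" using t n by (auto simp: scales_iff)
    show ?thesis
    proof (cases "t < G0")
      case True
      thus ?thesis using k by (simp add: G_def N_def)
    next
      case False
      hence "(2 :: nat) ^ kk \<le> 2 ^ k" using k by (simp add: G0_def)
      hence "kk \<le> k" by simp
      hence e: "t = 2 ^ kk * 2 ^ (k - kk)" by (simp add: k power_add[symmetric])
      have g: "G t = 2 ^ kk" using False by (simp add: G_def G0_def)
      have "N t = t div 2 ^ kk" by (simp only: N_def g)
      also have "\<dots> = 2 ^ (k - kk)" by (subst e) simp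
      finally have nt: "N t = 2 ^ (k - kk)" .
      show ?thesis unfolding g nt using e by simp
    qed
  qed
  have sp: "equal_split {1..t} (G t) (B t)" if t: "t \<in> scales n" for t
    using equal_split_blocks[of "G t" "N t"] GN[OF t] by (simp add: B_def)
  define R0 where "R0 = 8 * sqrt (kV * real p) * real G0"
  have R0: "R0 > 0"
  proof -
    have "kV * real p > 0" using basic(1) params by simp
    thus ?thesis by (simp add: R0_def G0r)
  qed
  define W where "W = (\<lambda>t X. A_dense p n (G t) (B t) t X / R0 > 1)"
  have Wr: "W t X \<longleftrightarrow> R0 < A_dense p n (G t) (B t) t X" for t X using R0 by (simp add: W_def)
  have test: "(\<lambda>X. of_bool (\<exists>t\<in>scales n. W t X)) \<in> dense_tests p n"
  proof -
    have "scan (scales n) (\<lambda>t. A_dense p n (G t) (B t) t) (\<lambda>_. R0) \<in> dense_tests p n"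
      unfolding dense_tests_def
      by (rule CollectI, rule exI[of _ G], rule exI[of _ B], rule exI[of _ "\<lambda>_. R0"]) (use sp R0 in simp)
    thus ?thesis by (simp add: scan_def[abs_def] W_def)
  qed
  have measW: "{X \<in> space (mat_space p n). W t X} \<in> sets (mat_space p n)" if t: "t \<in> scales n" for t
  proof -
    have "2 * t \<le> n" using t n by (simp add: scales_iff)
    from borel_measurable_less[OF borel_measurable_const measurable_A_dense[OF sp[OF t] this]]
    show ?thesis by (simp only: Wr)
  qed
  \<comment> \<open>Null error per scale. The first value occurs at no more than \<open>G0\<close>
    scales and adds up to at most \<open>1 / (64 * G0)\<close>; the second is multiplied by at most
    \<open>2 * exp L\<close> scales.\<close>
  define b where "b = (\<lambda>t. if t < G0 then 1 / (64 * (real G0)\<^sup>2) else exp (- L) * (\<epsilon> / 64))"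
  have core: "((\<forall>j\<in>{1..p}. d j = 0) \<longrightarrow> measure P {E \<in> space P. W t (shifted p n \<theta> E)} \<le> b t) \<and>
      (1024 * kV * (1 + 64 / \<epsilon>) * (sqrt (real p) * L) \<le> real t * (\<Sum>j=1..p. (d j)\<^sup>2) \<longrightarrow>
        measure P {E \<in> space P. \<not> W t (shifted p n \<theta> E)} \<le> \<epsilon> / 4)"
    if P: "P \<in> noise_laws \<alpha> K p n" and t: "t \<in> scales n" and sg: "signal p n \<theta> t d" for P \<theta> t d
  proof -
    interpret A: noise_array P "sym_noise n" p "n div 2" \<alpha> H
      by (rule noise_array_sym_noise[OF P params(1,2)])
    interpret A: sym_array P n p \<alpha> H ..
    interpret A: dense_array P "sym_noise n" p "n div 2" \<alpha> H \<epsilon> L G0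
      using L1 G0_ge params by unfold_locales auto
    have RD: "A.RD = R0" by (simp add: A.RD_def R0_def)
    have t2: "1 \<le> t" "2 * t \<le> n" using t n by (auto simp: scales_iff)
    have gn: "G t \<ge> 1" "N t \<ge> 1" "G t * N t = t" using GN[OF t] by auto
    have Gp: "real (G t) > 0" using gn by simp
    have sub: "{1..t} \<subseteq> {1..n div 2}" "card {1..t} = G t * N t" using t2 gn(3) by auto
    have gr: "A.groups (G t) (B t) (N t)" by (rule A.groups_of_split[OF sp[OF t] sub gn(2)])
    have W2: "W t (shifted p n \<theta> E) \<longleftrightarrow> A.RD / real (G t) < A.mom (G t) (B t) {1..p} (A.Z d E)" for E
      unfolding Wr A.A_dense_shifted[OF sp[OF t] t2 sg] RD using Gp by (simp add: divide_less_eq mult.commute)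
    have GG: "G t = 1 \<or> G t = G0" by (simp add: G_def)
    have null: "measure P {E \<in> space P. A.RD / real (G t) < A.mom (G t) (B t) {1..p} (A.Z d E)} \<le> b t"
      if d: "\<forall>j\<in>{1..p}. d j = 0"
    proof (cases "t < G0")
      case True
      have G1: "G t = 1" using True by (simp add: G_def)
      have r1: "A.RD / real (1 :: nat) = A.RD" by simp
      show ?thesis
        using A.dense_null_one[OF gr[unfolded G1], of d] d True unfolding G1 r1 b_def by simp
    next
      case False
      have G2: "G t = G0" using False by (simp add: G_def)
      show ?thesis using A.dense_null_many[OF gr[unfolded G2], of d] d False unfolding G2 b_def by simp
    qed
    have alt: "measure P {E \<in> space P. A.mom (G t) (B t) {1..p} (A.Z d E) \<le> A.RD / real (G t)} \<le> \<epsilon> / 4"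
      if D: "1024 * kV * (1 + 64 / \<epsilon>) * (sqrt (real p) * L) \<le> real t * (\<Sum>j=1..p. (d j)\<^sup>2)"
    proof (rule A.dense_alt[OF gr GG])
      have "512 * kV * sqrt (real p) * real G0 \<le> 512 * kV * sqrt (real p) * (2 * (L * (1 + 64 / \<epsilon>)))"
        using G0_le basic(1) by (intro mult_left_mono) auto
      also have "\<dots> = 1024 * kV * (1 + 64 / \<epsilon>) * (sqrt (real p) * L)" by (simp only: mult_ac) simp
      also have "\<dots> \<le> real t * (\<Sum>j=1..p. (d j)\<^sup>2)" by (rule D)
      also have "real t = real (G t) * real (N t)" using gn(3) by (metis of_nat_mult)
      finally show "512 * kV * sqrt (real p) * real G0 \<le> real (G t) * real (N t) * (\<Sum>j=1..p. (d j)\<^sup>2)" .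
    qed
    show ?thesis unfolding W2 not_less using null alt by blast
  qed
  have fin: "finite (scales n)" by (rule finite_scales[OF n])
  have evW: "{E \<in> space P. W t (shifted p n \<theta> E)} \<in> sets P" if P: "P \<in> noise_laws \<alpha> K p n" and t: "t \<in> scales n" for P \<theta> t
    by (rule event_shifted[OF P measW[OF t]])
  have sum_b: "(\<Sum>t\<in>scales n. b t) \<le> \<epsilon> / 4"
  proof -
    let ?S = "{t \<in> scales n. t < G0}"
    have "real (card ?S) \<le> log 2 (real G0) + 1"
      proof (rule card_powers_of_two_le)
      show "?S \<subseteq> range (\<lambda>k. 2 ^ k)" using scales_subset by blast
      show "1 \<le> real G0" by (simp add: G0r)
      show "real t \<le> real G0" if "t \<in> ?S" for t using that by simp
    qed
    also have "log 2 (real G0) = real kk" by (simp add: G0r log_nat_power)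
    also have "real kk + 1 \<le> real G0"
    proof -
      have "kk < G0" by (simp add: G0_def)
      thus ?thesis by linarith
    qed
    finally have cS: "real (card ?S) \<le> real G0" .
    have G0p: "real G0 > 0" by (simp add: G0r)
    have "(\<Sum>t\<in>scales n. b t) \<le> (\<Sum>t\<in>scales n. (if t < G0 then 1 / (64 * (real G0)\<^sup>2) else 0) + exp (- L) * (\<epsilon> / 64))"
      using \<epsilon> by (intro sum_mono) (auto simp: b_def)
    also have "\<dots> = real (card ?S) * (1 / (64 * (real G0)\<^sup>2)) + real (card (scales n)) * (exp (- L) * (\<epsilon> / 64))"
      by (simp add: sum.distrib sum.inter_filter[symmetric] fin)
    also have "\<dots> \<le> real G0 * (1 / (64 * (real G0)\<^sup>2)) + (2 * exp L) * (exp (- L) * (\<epsilon> / 64))"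
      using cS card_scales_le[OF n] \<epsilon> by (intro add_mono mult_right_mono) (auto simp: L_def)
    also have "real G0 * (1 / (64 * (real G0)\<^sup>2)) = 1 / real G0 / 64" using G0p by (simp add: power2_eq_square)
    also have "(2 * exp L) * (exp (- L) * (\<epsilon> / 64)) = (exp L * exp (- L)) * (\<epsilon> / 32)" by simp
    also have "exp L * exp (- L) = 1" by (simp add: exp_minus)
    also have "1 / real G0 / 64 \<le> \<epsilon> / 64 / 64"
    proof (rule divide_right_mono)
      have "64 / \<epsilon> \<le> real G0" using G0_ge L1 by linarith
      thus "1 / real G0 \<le> \<epsilon> / 64" using G0p \<epsilon> by (simp add: field_simps)
    qed simp
    finally have "(\<Sum>t\<in>scales n. b t) \<le> \<epsilon> / 64 / 64 + 1 * (\<epsilon> / 32)" by linarith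
    thus ?thesis using \<epsilon> by simp
  qed
  show ?thesis
  proof (rule exI[of _ "\<lambda>X. \<exists>t\<in>scales n. W t X"], intro conjI ballI allI impI)
    show "(\<lambda>X. of_bool (\<exists>t\<in>scales n. W t X)) \<in> dense_tests p n" by (rule test)
    show "{X \<in> space (mat_space p n). \<exists>t\<in>scales n. W t X} \<in> sets (mat_space p n)"
      by (rule sets.sets_Collect_finite_Ex[OF measW fin])
  next
    fix P \<theta> assume P: "P \<in> noise_laws \<alpha> K p n" and \<theta>: "\<theta> \<in> Theta0 p n"
    interpret prob_space P using P by (simp add: noise_laws_def)
    have sg: "signal p n \<theta> t (\<lambda>_. 0)" if "t \<in> scales n" for t
      by (rule Theta0_signal[OF \<theta>]) (use that n in \<open>auto simp: scales_iff\<close>)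
    have "prob {E \<in> space P. \<exists>t\<in>scales n. W t (shifted p n \<theta> E)} \<le> (\<Sum>t\<in>scales n. b t)"
      by (rule prob_Ex_le[OF fin evW[OF P]]) (use core[OF P _ sg] in auto)
    thus "prob {E \<in> space P. \<exists>t\<in>scales n. W t (shifted p n \<theta> E)} \<le> \<epsilon> / 4" using sum_b by linarith
  next
    fix P \<theta> t d
    assume P: "P \<in> noise_laws \<alpha> K p n" and t: "t \<in> scales n" and *: "signal p n \<theta> t d \<and>
      1024 * kV * (1 + 64 / \<epsilon>) * (sqrt (real p) * L) \<le> real t * (\<Sum>j=1..p. (d j)\<^sup>2)"
    interpret prob_space P using P by (simp add: noise_laws_def)
    have ev: "{E \<in> space P. \<not> W t (shifted p n \<theta> E)} \<in> events" by (rule sets.sets_Collect_neg[OF evW[OF P t]])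
    have "prob {E \<in> space P. \<not> (\<exists>t\<in>scales n. W t (shifted p n \<theta> E))} \<le> prob {E \<in> space P. \<not> W t (shifted p n \<theta> E)}"
      by (rule finite_measure_mono[OF _ ev]) (use t in blast)
    also have "\<dots> \<le> \<epsilon> / 4" using core[OF P t] * by blast
    finally show "prob {E \<in> space P. \<not> (\<exists>t\<in>scales n. W t (shifted p n \<theta> E))} \<le> \<epsilon> / 4" .
  qed
qed

end

section \<open>The adaptive test\<close>

text \<open>The exponent \<open>\<lceil>log 2 p\<rceil> - 1\<close> is the largest one strictly
  below \<open>log 2 p\<close>, so \<open>p\<close> itself is never in the grid, not even when it is
  a power of two.\<close>

lemma grid_iff:
  assumes "p \<ge> 1"
  shows "m \<in> sparsity_grid p \<longleftrightarrow> (\<exists>k. m = 2 ^ k) \<and> m < p"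
proof -
  have "int k \<le> \<lceil>log 2 (real p)\<rceil> - 1 \<longleftrightarrow> 2 ^ k < p" for k
  proof -
    have "int k \<le> \<lceil>log 2 (real p)\<rceil> - 1 \<longleftrightarrow> int k < \<lceil>log 2 (real p)\<rceil>" by linarith
    also have "\<dots> \<longleftrightarrow> real k < log 2 (real p)" by (simp add: less_ceiling_iff)
    also have "\<dots> \<longleftrightarrow> 2 powr real k < real p" using assms by (intro less_log_iff) auto
    also have "\<dots> \<longleftrightarrow> real (2 ^ k) < real p" by (simp add: powr_realpow)
    finally show ?thesis by (simp only: of_nat_less_iff)
  qed
  thus ?thesis by (auto simp: sparsity_grid_def)
qed

lemma power_of_two_below:
  assumes "m \<ge> (1 :: nat)"
  obtains k where "2 ^ k \<le> m" "m < 2 * 2 ^ k"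
  using ex_power_ivl1[of 2 m] assms by auto

text \<open>Let \<open>m\<close> be the distance of the change point from the boundary and
  \<open>t\<close> the largest power of two up to \<open>m\<close>. Then
  \<open>t0 * (n - t0) / n \<le> m < 2 * t\<close>, which costs a factor two; the normalization by
  \<open>sqrt 2\<close> in \<open>d\<close> costs another.\<close>

lemma Theta_signal:
  assumes n: "n \<ge> 2" and \<theta>: "\<theta> \<in> Theta p n s \<rho>"
  obtains t d where "t \<in> scales n" "signal p n \<theta> t d" "norm0 p d \<le> s" "\<rho>\<^sup>2 / 4 \<le> real t * (\<Sum>j=1..p. (d j)\<^sup>2)"
proof -
  obtain t0 \<mu>1 \<mu>2 where t0: "1 \<le> t0" "t0 \<le> n - 1"
    and eq: "\<And>t j. t \<in> {1..n} \<Longrightarrow> j \<in> {1..p} \<Longrightarrow> \<theta> (j, t) = (if t \<le> t0 then \<mu>1 j else \<mu>2 j)"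
    and sp: "norm0 p (\<lambda>j. \<mu>1 j - \<mu>2 j) \<le> s"
    and sq: "\<rho>\<^sup>2 \<le> real t0 * (real n - real t0) / real n * sqnorm p (\<lambda>j. \<mu>1 j - \<mu>2 j)"
    using \<theta> by (auto simp: Theta_def Theta_at_def)
  define m where "m = min t0 (n - t0)"
  have m1: "m \<ge> 1" and m2: "2 * m \<le> n" using t0 n by (auto simp: m_def)
  obtain k where k: "2 ^ k \<le> m" "m < 2 * 2 ^ k" using power_of_two_below[OF m1] by blast
  define t :: nat where "t = 2 ^ k"
  define d where "d = (\<lambda>j. (\<mu>1 j - \<mu>2 j) / sqrt 2)"
  define q where "q = sqnorm p (\<lambda>j. \<mu>1 j - \<mu>2 j)"
  have q0: "q \<ge> 0" by (simp add: q_def sqnorm_def sum_nonneg)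
  have "t \<in> scales n" using k m2 n by (auto simp: scales_iff t_def)
  moreover have "signal p n \<theta> t d"
    unfolding signal_def
  proof (intro ballI)
    fix i j assume i: "i \<in> {1..t}" and j: "j \<in> {1..p}"
    have "i \<le> m" using i k by (simp add: t_def)
    hence "i \<le> t0" "t0 < n - i + 1" "i \<in> {1..n}" "n - i + 1 \<in> {1..n}" using i t0 by (auto simp: m_def)
    thus "(\<theta> (j, i) - \<theta> (j, n - i + 1)) / sqrt 2 = d j" using j by (simp add: eq d_def)
  qed
  moreover have "norm0 p d \<le> s" using sp by (simp add: norm0_def d_def)
  moreover have "\<rho>\<^sup>2 / 4 \<le> real t * (\<Sum>j=1..p. (d j)\<^sup>2)"
  proof -
    have n0: "real n > 0" and nt: "real (n - t0) = real n - real t0" using n t0 by auto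
    have "real t0 * (real n - real t0) \<le> real m * real n"
    proof (cases "t0 \<le> n - t0")
      case True
      thus ?thesis unfolding m_def using n0 by (simp add: mult_left_mono)
    next
      case False
      have "real t0 * (real n - real t0) \<le> real n * real (n - t0)"
        unfolding nt using t0 n by (intro mult_right_mono) auto
      thus ?thesis using False by (simp add: m_def mult.commute)
    qed
    hence "real t0 * (real n - real t0) / real n \<le> real m" using n0 by (simp add: divide_le_eq)
    hence "real t0 * (real n - real t0) / real n * q \<le> real m * q" using q0 by (intro mult_right_mono)
    hence "\<rho>\<^sup>2 \<le> real m * q" using sq by (simp add: q_def)
    also have "real m * q \<le> real (2 * t) * q"
    proof (intro mult_right_mono q0)
      have "m \<le> 2 * t" using k by (simp add: t_def)
      thus "real m \<le> real (2 * t)" by (simp only: of_nat_le_iff)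
    qed
    finally have \<rho>: "\<rho>\<^sup>2 \<le> 2 * (real t * q)" by simp
    have qs: "(\<Sum>j=1..p. (d j)\<^sup>2) = q / 2"
      by (simp add: d_def q_def sqnorm_def power_divide sum_divide_distrib)
    show ?thesis unfolding qs using \<rho> by simp
  qed
  ultimately show ?thesis by (rule that)
qed

text \<open>As a function of \<open>s\<close> the rate is
  \<open>p powr (2 / \<alpha>) * s powr (1 - 2 / \<alpha>)\<close>, with a nonnegative exponent. A
  smaller grid point thus never demands a stronger signal.\<close>

lemma sparse_rate_mono:
  assumes \<alpha>: "\<alpha> \<ge> (2 :: real)" and s: "0 < s'" "s' \<le> s" and p: "p > (0 :: real)"
  shows "s' * (p / s') powr (2 / \<alpha>) \<le> s * (p / s) powr (2 / \<alpha>)"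
proof -
  have *: "x * (p / x) powr (2 / \<alpha>) = p powr (2 / \<alpha>) * x powr (1 - 2 / \<alpha>)" if "x > 0" for x
    using that p by (simp add: powr_divide powr_diff)
  have "s' powr (1 - 2 / \<alpha>) \<le> s powr (1 - 2 / \<alpha>)" using s \<alpha> by (intro powr_mono2) auto
  thus ?thesis using s by (simp add: * mult_left_mono)
qed

text \<open>The largest power of two up to \<open>s\<close> works unless \<open>s = p\<close> is
  itself a power of two, which the grid omits; then half of it is taken.\<close>

lemma grid_approx:
  assumes s: "s \<in> {1..p}" and p: "p \<ge> 2"
  obtains s' where "s' \<in> sparsity_grid p" "1 \<le> s'" "s' \<le> s" "s \<le> 2 * s'"
proof -
  have s1: "s \<ge> 1" using s by simp
  obtain k where k: "2 ^ k \<le> s" "s < 2 * 2 ^ k" using power_of_two_below[OF s1] by blast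
  have grid: "\<And>m. m \<in> sparsity_grid p \<longleftrightarrow> (\<exists>k. m = 2 ^ k) \<and> m < p" using p by (intro grid_iff) simp
  show ?thesis
  proof (cases "2 ^ k < p")
    case True
    show ?thesis by (rule that[of "2 ^ k"]) (use True k grid in auto)
  next
    case False
    hence e: "p = 2 ^ k" "s = 2 ^ k" using k s by auto
    then obtain l where l: "k = Suc l" using p by (cases k) auto
    have "(2 :: nat) ^ l \<in> sparsity_grid p" using e l grid by auto
    thus ?thesis by (rule that) (use e l in auto)
  qed
qed

context setting
begin

text \<open>Whichever rate attains the minimum decides which component detects the change: the dense
  one, or the sparse one at a grid neighbour of \<open>s\<close>. Overall factors \<open>4\<close>
  in the constant make up for the loss in \<open>Theta_signal\<close>. Under the null the dense test
  and the whole sparsity grid cost \<open>\<epsilon> / 4\<close> each.\<close>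

lemma adaptive_test_exists:
  "\<exists>\<phi>\<in>adaptive_tests \<alpha> rsm_estimator p n. is_test p n \<phi> \<and>
    (\<forall>s\<in>{1..p}. \<forall>\<rho>::real.
      (4 * k0 + 4096 * kV * (1 + 64 / \<epsilon>)) * min (sqrt (real p) * L)
        (real s * (real p / real s) powr (2 / \<alpha>) + L) \<le> \<rho>\<^sup>2
      \<longrightarrow> risk \<alpha> K p n s \<rho> \<phi> \<le> ennreal \<epsilon>)"
proof -
  let ?g = "sparsity_grid p"
  let ?S = "\<lambda>s. real s * (real p / real s) powr (2 / \<alpha>) + L"
  let ?c = "1024 * kV * (1 + 64 / \<epsilon>)"
  have n: "n \<ge> 2" and p: "p \<ge> 1" using params by auto
  have grid: "m \<in> ?g \<longleftrightarrow> (\<exists>k. m = 2 ^ k) \<and> m < p" for m by (rule grid_iff[OF p])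
  have fin: "finite ?g" by (rule finite_subset[of _ "{..p}"]) (auto simp: grid)
  have g_sub: "m \<in> {1..p}" if "m \<in> ?g" for m using that by (auto simp: grid)
  obtain Rd where Rd1: "(\<lambda>X. of_bool (Rd X)) \<in> dense_tests p n"
    and Rd2: "{X \<in> space (mat_space p n). Rd X} \<in> sets (mat_space p n)"
    and Rd3: "\<forall>P\<in>noise_laws \<alpha> K p n. \<forall>\<theta>\<in>Theta0 p n. measure P {E \<in> space P. Rd (shifted p n \<theta> E)} \<le> \<epsilon> / 4"
    and Rd4: "\<forall>P\<in>noise_laws \<alpha> K p n. \<forall>\<theta>. \<forall>t\<in>scales n. \<forall>d. signal p n \<theta> t d \<and>
      ?c * (sqrt (real p) * L) \<le> real t * (\<Sum>j=1..p. (d j)\<^sup>2) \<longrightarrow>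
      measure P {E \<in> space P. \<not> Rd (shifted p n \<theta> E)} \<le> \<epsilon> / 4"
    using dense_test_exists by (elim exE conjE) (rule that)
  obtain Rs where Rs: "\<forall>s\<in>{1..p}. (\<lambda>X. of_bool (Rs s X)) \<in> sparse_tests \<alpha> rsm_estimator p n s \<and>
    {X \<in> space (mat_space p n). Rs s X} \<in> sets (mat_space p n) \<and>
    (\<forall>P\<in>noise_laws \<alpha> K p n. \<forall>\<theta>\<in>Theta0 p n. measure P {E \<in> space P. Rs s (shifted p n \<theta> E)} \<le> \<epsilon> / (16 * sqrt (real s))) \<and>
    (\<forall>P\<in>noise_laws \<alpha> K p n. \<forall>\<theta>. \<forall>t\<in>scales n. \<forall>d. signal p n \<theta> t d \<and> norm0 p d \<le> 2 * s \<and>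
      k0 * ?S s \<le> real t * (\<Sum>j=1..p. (d j)\<^sup>2) \<longrightarrow>
      measure P {E \<in> space P. \<not> Rs s (shifted p n \<theta> E)} \<le> \<epsilon> / 4)"
    by (rule exE[OF bchoice[OF ballI[OF sparse_test_exists]]], assumption) (rule that)
  define R where "R = (\<lambda>X. Rd X \<or> (\<exists>s\<in>?g. Rs s X))"
  have Rs2: "{X \<in> space (mat_space p n). Rs s X} \<in> sets (mat_space p n)" if "s \<in> ?g" for s
    using Rs g_sub[OF that] by blast
  have Rs3: "measure P {E \<in> space P. Rs s (shifted p n \<theta> E)} \<le> \<epsilon> / (16 * sqrt (real s))"
    if "s \<in> ?g" "P \<in> noise_laws \<alpha> K p n" "\<theta> \<in> Theta0 p n" for s P \<theta>
    using Rs g_sub[OF that(1)] that by blast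
  have Rs4: "measure P {E \<in> space P. \<not> Rs s (shifted p n \<theta> E)} \<le> \<epsilon> / 4"
    if "s \<in> ?g" "P \<in> noise_laws \<alpha> K p n" "t \<in> scales n" "signal p n \<theta> t d" "norm0 p d \<le> 2 * s"
      "k0 * ?S s \<le> real t * (\<Sum>j=1..p. (d j)\<^sup>2)" for s P \<theta> t d
    using Rs g_sub[OF that(1)] that by blast
  have measR: "{X \<in> space (mat_space p n). R X} \<in> sets (mat_space p n)"
    unfolding R_def by (intro sets.sets_Collect_disj Rd2 sets.sets_Collect_finite_Ex Rs2 fin)
  have adaptive: "(\<lambda>X. of_bool (R X)) \<in> adaptive_tests \<alpha> rsm_estimator p n"
  proof -
    have "Max (insert 0 ((\<lambda>s. of_bool (Rs s X) :: real) ` ?g)) = of_bool (\<exists>s\<in>?g. Rs s X)" for X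
    proof (rule Max_eqI)
      show "finite (insert 0 ((\<lambda>s. of_bool (Rs s X) :: real) ` ?g))" using fin by simp
      show "y \<le> of_bool (\<exists>s\<in>?g. Rs s X)" if "y \<in> insert 0 ((\<lambda>s. of_bool (Rs s X) :: real) ` ?g)" for y
        using that by auto
      show "of_bool (\<exists>s\<in>?g. Rs s X) \<in> insert 0 ((\<lambda>s. of_bool (Rs s X) :: real) ` ?g)"
        by (cases "\<exists>s\<in>?g. Rs s X") force+
    qed
    moreover have "max (of_bool A) (of_bool B) = (of_bool (A \<or> B) :: real)" for A B by simp
    ultimately have e: "(\<lambda>X. of_bool (R X)) = (\<lambda>X. max (of_bool (Rd X)) (Max (insert 0 ((\<lambda>s. of_bool (Rs s X) :: real) ` ?g))))"
      unfolding R_def by presburger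
    show ?thesis
      unfolding adaptive_tests_def e
      by (rule CollectI, rule exI[of _ "\<lambda>X. of_bool (Rd X)"], rule exI[of _ "\<lambda>s X. of_bool (Rs s X)"])
        (use Rd1 Rs g_sub in blast)
  qed
  have test: "is_test p n (\<lambda>X. of_bool (R X))"
    unfolding is_test_def
  proof (intro conjI ballI)
    have "(\<lambda>X. indicator {X \<in> space (mat_space p n). R X} X :: real) \<in> borel_measurable (mat_space p n)"
      using measR by simp
    thus "(\<lambda>X. of_bool (R X) :: real) \<in> borel_measurable (mat_space p n)"
      by (rule measurable_cong[THEN iffD1, rotated]) (auto simp: indicator_def)
    show "of_bool (R X) \<in> {0, 1 :: real}" for X by simp
  qed
  have risk: "risk \<alpha> K p n s \<rho> (\<lambda>X. of_bool (R X)) \<le> ennreal \<epsilon>"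
    if s: "s \<in> {1..p}" and \<rho>: "(4 * k0 + 4096 * kV * (1 + 64 / \<epsilon>)) * min (sqrt (real p) * L) (?S s) \<le> \<rho>\<^sup>2" for s \<rho>
  proof (rule risk_le[OF measR])
    show "0 \<le> \<epsilon>" using \<epsilon> by simp
  next
    fix P \<theta> assume P: "P \<in> noise_laws \<alpha> K p n" and \<theta>: "\<theta> \<in> Theta0 p n"
    interpret prob_space P using P by (simp add: noise_laws_def)
    have evs: "{E \<in> space P. Rs s (shifted p n \<theta> E)} \<in> events" if "s \<in> ?g" for s
      by (rule event_shifted[OF P Rs2[OF that]])
    have evd: "{E \<in> space P. Rd (shifted p n \<theta> E)} \<in> events" by (rule event_shifted[OF P Rd2])
    have evE: "{E \<in> space P. \<exists>s\<in>?g. Rs s (shifted p n \<theta> E)} \<in> events"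
      by (rule sets.sets_Collect_finite_Ex[OF evs fin])
    have "prob {E \<in> space P. \<exists>s\<in>?g. Rs s (shifted p n \<theta> E)} \<le> (\<Sum>s\<in>?g. \<epsilon> / (16 * sqrt (real s)))"
      by (rule prob_Ex_le[OF fin evs Rs3[OF _ P \<theta>]])
    also have "\<dots> = \<epsilon> / 16 * (\<Sum>s\<in>?g. 1 / sqrt (real s))" by (simp add: sum_distrib_left)
    also have "\<dots> \<le> \<epsilon> / 16 * 4"
      using \<epsilon> by (intro mult_left_mono sum_inverse_sqrt_powers_of_two fin) (auto simp: grid)
    finally have s_le: "prob {E \<in> space P. \<exists>s\<in>?g. Rs s (shifted p n \<theta> E)} \<le> \<epsilon> / 4" by simp
    have "{E \<in> space P. R (shifted p n \<theta> E)} = {E \<in> space P. Rd (shifted p n \<theta> E)} \<union> {E \<in> space P. \<exists>s\<in>?g. Rs s (shifted p n \<theta> E)}"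
      by (auto simp: R_def)
    hence "prob {E \<in> space P. R (shifted p n \<theta> E)}
        \<le> prob {E \<in> space P. Rd (shifted p n \<theta> E)} + prob {E \<in> space P. \<exists>s\<in>?g. Rs s (shifted p n \<theta> E)}"
      using measure_Un_le[OF evd evE] by simp
    also have "\<dots> \<le> \<epsilon> / 4 + \<epsilon> / 4" by (rule add_mono[OF Rd3[rule_format, OF P \<theta>] s_le])
    finally show "prob {E \<in> space P. R (shifted p n \<theta> E)} \<le> \<epsilon> / 2" by simp
  next
    fix P \<theta> assume P: "P \<in> noise_laws \<alpha> K p n" and \<theta>: "\<theta> \<in> Theta p n s \<rho>"
    interpret prob_space P using P by (simp add: noise_laws_def)
    obtain t d where td: "t \<in> scales n" "signal p n \<theta> t d" "norm0 p d \<le> s"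
      and D: "\<rho>\<^sup>2 / 4 \<le> real t * (\<Sum>j=1..p. (d j)\<^sup>2)"
      using Theta_signal[OF n \<theta>] by blast
    have kV0: "?c \<ge> 0" using basic(1) \<epsilon> by simp
    have k00: "k0 \<ge> 0" using basic(27) by simp
    have S0: "?S x \<ge> 0" for x using L1 by simp
    have pL0: "sqrt (real p) * L \<ge> 0" using L1 by simp
    have D': "(k0 + ?c) * min (sqrt (real p) * L) (?S s) \<le> real t * (\<Sum>j=1..p. (d j)\<^sup>2)"
    proof -
      have "4 * ((k0 + ?c) * min (sqrt (real p) * L) (?S s)) = (4 * k0 + 4096 * kV * (1 + 64 / \<epsilon>)) * min (sqrt (real p) * L) (?S s)"
        by (simp only: mult.assoc[symmetric] distrib_left) simp
      thus ?thesis using \<rho> D by linarith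
    qed
    have sub: "prob {E \<in> space P. \<not> R (shifted p n \<theta> E)} \<le> prob {E \<in> space P. \<not> Q (shifted p n \<theta> E)}"
      if Q: "{X \<in> space (mat_space p n). Q X} \<in> sets (mat_space p n)" "\<And>X. Q X \<Longrightarrow> R X" for Q
    proof (rule finite_measure_mono)
      show "{E \<in> space P. \<not> R (shifted p n \<theta> E)} \<subseteq> {E \<in> space P. \<not> Q (shifted p n \<theta> E)}" using Q(2) by blast
      show "{E \<in> space P. \<not> Q (shifted p n \<theta> E)} \<in> events"
        by (rule sets.sets_Collect_neg[OF event_shifted[OF P Q(1)]])
    qed
    have "prob {E \<in> space P. \<not> R (shifted p n \<theta> E)} \<le> \<epsilon> / 4"
    proof (cases "sqrt (real p) * L \<le> ?S s")
      case True
      have "?c * (sqrt (real p) * L) \<le> (k0 + ?c) * (sqrt (real p) * L)"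
        using k00 pL0 by (intro mult_right_mono) auto
      hence "?c * (sqrt (real p) * L) \<le> real t * (\<Sum>j=1..p. (d j)\<^sup>2)" using D' True by (simp add: min_def)
      with Rd4 P td have "prob {E \<in> space P. \<not> Rd (shifted p n \<theta> E)} \<le> \<epsilon> / 4" by blast
      moreover have "prob {E \<in> space P. \<not> R (shifted p n \<theta> E)} \<le> prob {E \<in> space P. \<not> Rd (shifted p n \<theta> E)}"
        by (rule sub[OF Rd2]) (simp add: R_def)
      ultimately show ?thesis by linarith
    next
      case False
      \<comment> \<open>For \<open>p = 1\<close> the grid is empty, but then the dense rate
        \<open>L\<close> lies below the sparse rate \<open>1 + L\<close>.\<close>
      have "p \<noteq> 1"
      proof
        assume "p = 1"
        hence "sqrt (real p) * L \<le> ?S s" using s L1 by simp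
        thus False using False by simp
      qed
      hence p2: "p \<ge> 2" using p by linarith
      obtain s' where s': "s' \<in> ?g" "1 \<le> s'" "s' \<le> s" "s \<le> 2 * s'" using grid_approx[OF s p2] by blast
      have "real s' * (real p / real s') powr (2 / \<alpha>) \<le> real s * (real p / real s) powr (2 / \<alpha>)"
        by (rule sparse_rate_mono) (use s' p params in auto)
      hence "k0 * ?S s' \<le> k0 * ?S s" using k00 by (intro mult_left_mono) auto
      also have "\<dots> \<le> (k0 + ?c) * ?S s" using kV0 S0 by (intro mult_right_mono) auto
      also have "\<dots> \<le> real t * (\<Sum>j=1..p. (d j)\<^sup>2)" using D' False by (simp add: min_def)
      finally have "prob {E \<in> space P. \<not> Rs s' (shifted p n \<theta> E)} \<le> \<epsilon> / 4"
        by (intro Rs4[OF s'(1) P td(1,2)]) (use td(3) s'(4) in auto)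
      moreover have "prob {E \<in> space P. \<not> R (shifted p n \<theta> E)} \<le> prob {E \<in> space P. \<not> Rs s' (shifted p n \<theta> E)}"
        by (rule sub[OF Rs2[OF s'(1)]]) (use s' in \<open>auto simp: R_def\<close>)
      ultimately show ?thesis by linarith
    qed
    thus "prob {E \<in> space P. \<not> R (shifted p n \<theta> E)} \<le> \<epsilon> / 2" using \<epsilon> by linarith
  qed
  show ?thesis using adaptive test risk by blast
qed

end

theorem theorem9:
  fixes \<alpha> K :: real
  assumes "\<alpha> \<ge> 4" and "K > 0"
  shows "\<exists>\<mu>h. robust_sparse_mean \<alpha> K \<mu>h \<and>
    (\<forall>\<epsilon>::real. 0 < \<epsilon> \<and> \<epsilon> < 1 \<longrightarrow>
      (\<exists>C::real. C > 0 \<and>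
        (\<forall>n p :: nat. n \<ge> 2 \<and> p \<ge> 1 \<longrightarrow>
          (\<exists>\<phi>\<in>adaptive_tests \<alpha> \<mu>h p n. is_test p n \<phi> \<and>
            (\<forall>s\<in>{1..p}. \<forall>\<rho>::real.
              \<rho>\<^sup>2 \<ge> C * min (real p powr (max (2 / \<alpha>) (1 / 2)) * ln (ln (8 * real n)))
                           (real s * (real p / real s) powr (2 / \<alpha>) + ln (ln (8 * real n)))
              \<longrightarrow> risk \<alpha> K p n s \<rho> \<phi> \<le> ennreal \<epsilon>)))))"
proof (intro exI[of _ rsm_estimator] conjI allI impI)
  show "robust_sparse_mean \<alpha> K rsm_estimator"
    by (rule robust_sparse_mean_estimator)
next
  fix \<epsilon> :: real assume e: "0 < \<epsilon> \<and> \<epsilon> < 1"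
  \<comment> \<open>The constants come from a locale that knows neither \<open>n\<close> nor
    \<open>p\<close>, which makes \<open>C\<close> uniform in both.\<close>
  interpret c: const_params \<alpha> "sym_moment \<alpha> K" \<epsilon>
    using assms e by unfold_locales (auto simp: sym_moment_def)
  define C where "C = 4 * c.k0 + 4096 * c.kV * (1 + 64 / \<epsilon>)"
  \<comment> \<open>Since \<open>\<alpha> \<ge> 4\<close>, the exponent of \<open>p\<close> is
    \<open>1/2\<close> and the dense rate becomes \<open>sqrt p * L\<close>.\<close>
  have mx: "max (2 / \<alpha>) (1 / 2) = 1 / 2" using assms by (simp add: max_def field_simps)
  show "\<exists>C::real. C > 0 \<and>
        (\<forall>n p :: nat. n \<ge> 2 \<and> p \<ge> 1 \<longrightarrow>
          (\<exists>\<phi>\<in>adaptive_tests \<alpha> rsm_estimator p n. is_test p n \<phi> \<and>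
            (\<forall>s\<in>{1..p}. \<forall>\<rho>::real.
              \<rho>\<^sup>2 \<ge> C * min (real p powr (max (2 / \<alpha>) (1 / 2)) * ln (ln (8 * real n)))
                           (real s * (real p / real s) powr (2 / \<alpha>) + ln (ln (8 * real n)))
              \<longrightarrow> risk \<alpha> K p n s \<rho> \<phi> \<le> ennreal \<epsilon>)))"
  proof (intro exI[of _ C] conjI allI impI)
    have "c.kV * (1 + 64 / \<epsilon>) \<ge> 0" using c.basic(1) e by simp
    thus "C > 0" using c.basic(27) by (simp add: C_def)
  next
    fix n p :: nat assume "n \<ge> 2 \<and> p \<ge> 1"
    then interpret s: setting \<alpha> K \<epsilon> n p using assms e by unfold_locales auto
    show "\<exists>\<phi>\<in>adaptive_tests \<alpha> rsm_estimator p n. is_test p n \<phi> \<and>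
            (\<forall>s\<in>{1..p}. \<forall>\<rho>::real.
              \<rho>\<^sup>2 \<ge> C * min (real p powr (max (2 / \<alpha>) (1 / 2)) * ln (ln (8 * real n)))
                           (real s * (real p / real s) powr (2 / \<alpha>) + ln (ln (8 * real n)))
              \<longrightarrow> risk \<alpha> K p n s \<rho> \<phi> \<le> ennreal \<epsilon>)"
      using s.adaptive_test_exists unfolding mx powr_half_sqrt[OF of_nat_0_le_iff] C_def s.L_def .
  qed
qed

end
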